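(* Let $F$ be a number field and $r\ge1$. For any convex polygon $p:[0,r]\to\mathbb R$ and every $g\in\mathrm{GL}_r(\mathbb A)$, $$\mathbf 1(\bar p^g\le p)=\sum_{P\supset P_0}(-1)^{|P|-1}\sum_{\delta\in P(F)\backslash \mathrm{GL}_r(F)}\mathbf 1(p_P^{\delta g}>_Pp),$$ where $P$ runs over all standard parabolic subgroups of $\mathrm{GL}_r$.
   Context: $\mathbb A$ is the adele ring of $F$, $\mathcal O_F$ the ring of integers, $v$ runs over finite and $\sigma$ over archimedean places, $N_\sigma=[F_\sigma:\mathbb R]$. For $g=(g_v;g_\sigma)\in\mathrm{GL}_r(\mathbb A)$ let $L_g=\{x\in F^r: x\in g_v\mathcal O_v^r\ \forall v\}$ (a projective $\mathcal O_F$-module of rank $r$), with norms $\|x\|_\sigma=|g_\sigma^{-1}x|$ at each $\sigma$ (standard Euclidean/Hermitian norm on $F_\sigma^r$). For a nonzero $F$-subspace $V\subset F^r$ of dimension $m$ let $$\deg_g(V)=\log\#\big((L_g\cap V)/(\mathcal O_Fx_1+\dots+\mathcal O_Fx_m)\big)-\sum_\sigma N_\sigma\log\|x_1\wedge\dots\wedge x_m\|_\sigma$$ for any $F$-basis $x_1,\dots,x_m$ of $V$ in $L_g$ (the Arakelov degree), and $\deg_g(0)=0$. A polygon is a continuous function $p:[0,r]\to\mathbb R$, affine on each interval $[i-1,i]$ ($1\le i\le r$), with $p(0)=p(r)=0$. It is called convex if its successive slopes are non-increasing (i.e. the region below its graph is convex, as for Harder–Narasimhan polygons). A parabolic subgroup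 $Q$ of $\mathrm{GL}_r$ over $F$ is the stabilizer of a flag $0=V_0\subsetneq V_1\subsetneq\dots\subsetneq V_s=F^r$, and $|Q|:=s$; the polygon $p_Q^g$ has $p_Q^g(0)=p_Q^g(r)=0$, is affine on each $[\dim V_{i-1},\dim V_i]$, and $p_Q^g(\dim V_i)=\deg_g(V_i)-\frac{\dim V_i}{r}\deg_g(F^r)$. $\bar p^g$ is the (existing) pointwise maximum of all $p_Q^g$ over all parabolic subgroups $Q$ of $\mathrm{GL}_r$ over $F$. $P_0$ is the upper triangular subgroup; standard parabolic subgroups are those containing $P_0$, and correspond to partitions $(r_1,\dots,r_{|P|})$ of $r$. For polygons $q,p$ and such $P$, $q>_Pp$ means $q(r_1+\dots+r_i)>p(r_1+\dots+r_i)$ for all $1\le i\le|P|-1$ (an empty condition if $P=\mathrm{GL}_r$). $\mathbf 1(\cdot)$ equals $1$ if the condition holds and $0$ otherwise. *)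

theory Defs
  imports "Jordan_Normal_Form.Determinant" "HOL-Computational_Algebra.Fundamental_Theorem_Algebra" "HOL-Algebra.QuotRing" "HOL-Analysis.Analysis"
begin

no_notation Matrix.vec_index (infixl "$" 100)

section \<open>Number fields and their archimedean embeddings\<close>

class number_field = field_char_0 +
  assumes finite_over_rat: "\<exists>B. finite B \<and> (\<forall>x. \<exists>c. x = (\<Sum>b\<in>B. of_rat (c b) * b))"

instance rat :: number_field
proof
  show "\<exists>B. finite B \<and> (\<forall>x::rat. \<exists>c. x = (\<Sum>b\<in>B. of_rat (c b) * b))"
  proof (intro exI conjI allI)
    show "finite {1::rat}" by simp
    show "x = (\<Sum>b\<in>{1}. of_rat ((\<lambda>_. x) b) * b)" for x :: rat
      by simp
  qed
qed

lemma algebraic_dep: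
  fixes b :: "'a::number_field"
  shows "\<exists>N (c::nat\<Rightarrow>rat). (\<exists>i\<le>N. c i \<noteq> 0) \<and> (\<Sum>i\<le>N. of_rat (c i) * b ^ i) = 0"
proof -
  interpret Q: vector_space "\<lambda>q (x::'a). of_rat q * x"
    by unfold_locales (auto simp: of_rat_add of_rat_mult algebra_simps)
  obtain B :: "'a set" where B: "finite B" "\<And>x. \<exists>c. x = (\<Sum>b\<in>B. of_rat (c b) * b)"
    using finite_over_rat by metis
  have sp: "x \<in> Q.span B" for x
  proof -
    obtain c where "x = (\<Sum>b\<in>B. of_rat (c b) * b)" using B(2) by blast
    then show ?thesis by (auto intro: Q.span_sum Q.span_scale Q.span_base)
  qed
  show ?thesis
  proof (cases "inj_on (\<lambda>i. b ^ i) {..card B}")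
    case True
    let ?S = "(\<lambda>i. b ^ i) ` {..card B}"
    have "card ?S = Suc (card B)" using True by (simp add: card_image)
    then have "Q.dependent ?S"
      using Q.independent_span_bound[OF B(1), of ?S] sp by auto
    then obtain u where u: "\<exists>v\<in>?S. u v \<noteq> 0" "(\<Sum>v\<in>?S. of_rat (u v) * v) = 0"
      using Q.dependent_finite[of ?S] by auto
    show ?thesis
      using u True by (intro exI[of _ "card B"] exI[of _ "\<lambda>i. u (b^i)"]) (auto simp: sum.reindex)
  next
    case False
    then obtain i j where ij: "i \<le> card B" "j \<le> card B" "i \<noteq> j" "b ^ i = b ^ j" by (auto simp: inj_on_def)
    define c where "c = (\<lambda>k. if k = i then 1 else if k = j then -1 else (0::rat))"
    have "(\<Sum>k\<le>card B. of_rat (c k) * b ^ k) = (\<Sum>k\<in>{i,j}. of_rat (c k) * b ^ k)"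
      using ij by (intro sum.mono_neutral_right) (auto simp: c_def)
    also have "\<dots> = 0" using ij by (simp add: c_def)
    finally show ?thesis using ij by (intro exI[of _ "card B"] exI[of _ c]) (auto simp: c_def)
  qed
qed

definition field_embeddings :: "('a::number_field \<Rightarrow> complex) set" where
  "field_embeddings = {\<sigma>. \<sigma> 1 = 1 \<and> (\<forall>x y. \<sigma> (x + y) = \<sigma> x + \<sigma> y) \<and> (\<forall>x y. \<sigma> (x * y) = \<sigma> x * \<sigma> y)}"

text \<open>A complex embedding exists: the rational-linear functionals \<open>F \<rightarrow> \<complex>\<close> contain a common
  eigenvector \<open>f\<close> of all multiplications by elements of \<open>F\<close>, and \<open>f / f 1\<close> is an embedding.
  This is what makes the adele ring nonzero below.\<close>

definition eigenfunctional :: "'a::number_field set \<Rightarrow> ('a \<Rightarrow> complex) \<Rightarrow> bool" where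
  "eigenfunctional S f \<longleftrightarrow> (\<forall>x y. f (x + y) = f x + f y) \<and> (\<forall>q x. f (of_rat q * x) = of_rat q * f x)
     \<and> (\<exists>x. f x \<noteq> 0) \<and> (\<forall>b\<in>S. \<exists>l. \<forall>x. f (b * x) = l * f x)"

lemma eigenfunctional_sum:
  "eigenfunctional S f \<Longrightarrow> f (\<Sum>i\<in>I. g i) = (\<Sum>i\<in>I. f (g i))"
proof -
  assume "eigenfunctional S f"
  then have add: "f (x + y) = f x + f y" for x y by (auto simp: eigenfunctional_def)
  have z: "f 0 = 0" using add[of 0 0] by simp
  show ?thesis by (induction I rule: infinite_finite_induct) (auto simp: add z)
qed

lemma eigenfunctional_insert:
  assumes f: "eigenfunctional S f"
  shows "\<exists>h. eigenfunctional (insert b S) h"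
proof -
  obtain N and c :: "nat \<Rightarrow> rat" where c: "\<exists>i\<le>N. c i \<noteq> 0" "(\<Sum>i\<le>N. of_rat (c i) * b ^ i) = 0"
    using algebraic_dep by blast
  define act where "act q x = (\<Sum>i\<le>N. coeff q i * f (b ^ i * x))" for q :: "complex poly" and x
  define good where "good q \<longleftrightarrow> q \<noteq> 0 \<and> degree q \<le> N \<and> (\<forall>x. act q x = 0)" for q
  define P where "P = (\<Sum>i\<le>N. monom (of_rat (c i) :: complex) i)"
  have cP: "coeff P i = (if i \<le> N then of_rat (c i) else 0)" for i
    by (auto simp: P_def coeff_sum)
  have "act P x = f ((\<Sum>i\<le>N. of_rat (c i) * b ^ i) * x)" for x
    using f unfolding sum_distrib_right eigenfunctional_sum[OF f] act_def
    by (intro sum.cong) (auto simp: cP mult.assoc eigenfunctional_def)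
  then have "act P x = 0" for x
    using c(2) eigenfunctional_sum[OF f, of "\<lambda>_. 0" "{}"] by simp
  moreover have "P \<noteq> 0" using c(1) cP by (metis coeff_0 of_rat_eq_0_iff)
  moreover have "degree P \<le> N" by (rule degree_le) (simp add: cP)
  ultimately have "good P" by (simp add: good_def)
  then obtain q where q: "good q" and qmin: "\<And>r. good r \<Longrightarrow> degree q \<le> degree r"
    using ex_has_least_nat[of good P degree] by blast
  obtain x0 where x0: "f x0 \<noteq> 0" using f by (auto simp: eigenfunctional_def)
  have dq: "degree q \<noteq> 0"
  proof
    assume "degree q = 0"
    then obtain a where a: "q = [:a:]" "a \<noteq> 0" using q unfolding good_def by (metis degree_eq_zeroE pCons_0_0)
    have "act q x0 = (\<Sum>i\<in>{0}. coeff q i * f (b ^ i * x0))"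
      unfolding act_def by (rule sum.mono_neutral_right) (auto simp: a coeff_pCons split: nat.splits)
    then show False using q a x0 by (auto simp: good_def)
  qed
  obtain a where "poly q a = 0"
    using fundamental_theorem_of_algebra[of q] dq constant_degree[of q] by auto
  then obtain r where r: "q = [:- a, 1:] * r" using poly_eq_0_iff_dvd by (metis dvdE)
  have r0: "r \<noteq> 0" using r q by (auto simp: good_def)
  have dr: "degree q = Suc (degree r)" using r r0 by (metis degree_mult_eq degree_pCons_eq_if one_neq_zero pCons_eq_0_iff plus_1_eq_Suc degree_0 One_nat_def)
  then have "\<not> good r" using qmin[of r] by auto
  then obtain x1 where x1: "act r x1 \<noteq> 0" using r0 dr q by (auto simp: good_def)
  have eig: "act r (b * x) = a * act r x" for x
  proof -
    have "act (pCons 0 r) x = (\<Sum>i\<le>N. coeff r i * f (b ^ i * (b * x)))"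
    proof -
      have N: "N = Suc (N - 1)" using dr q by (auto simp: good_def)
      have rN: "coeff r N = 0" using dr q by (intro coeff_eq_0) (auto simp: good_def)
      have "act (pCons 0 r) x = (\<Sum>i\<le>N - 1. coeff r i * f (b ^ Suc i * x))"
        unfolding act_def by (subst N, subst sum.atMost_Suc_shift) simp
      also have "\<dots> = (\<Sum>i\<le>N. coeff r i * f (b ^ Suc i * x))"
      proof -
        obtain M where M: "N = Suc M" by (rule that[OF N])
        show ?thesis using rN by (simp add: M)
      qed
      finally show ?thesis by (simp add: mult_ac)
    qed
    moreover have "act q x = act (pCons 0 r) x - a * act r x"
      unfolding r act_def by (simp add: sum_subtractf sum_distrib_left algebra_simps)
    ultimately show ?thesis using q by (simp add: good_def act_def)
  qed
  have "eigenfunctional (insert b S) (act r)"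
    unfolding eigenfunctional_def
  proof (intro conjI allI ballI)
    show "act r (x + y) = act r x + act r y" for x y
      using f unfolding eigenfunctional_def act_def by (simp add: algebra_simps sum.distrib)
    show "act r (of_rat s * x) = of_rat s * act r x" for s x
      using f unfolding eigenfunctional_def act_def by (simp add: mult.left_commute[of _ "of_rat s"] sum_distrib_left)
    show "\<exists>x. act r x \<noteq> 0" using x1 by blast
    fix b' assume "b' \<in> insert b S"
    then consider "b' = b" | "b' \<in> S" by blast
    then show "\<exists>l. \<forall>x. act r (b' * x) = l * act r x"
    proof cases
      case 1 then show ?thesis using eig by blast
    next
      case 2
      then obtain l where l: "\<And>x. f (b' * x) = l * f x" using f unfolding eigenfunctional_def by meson
      have "act r (b' * x) = l * act r x" for x
        unfolding act_def by (simp add: mult.left_commute[of _ b'] l sum_distrib_left mult_ac)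
      then show ?thesis by blast
    qed
  qed
  then show ?thesis by blast
qed

lemma field_embeddings_nonempty: "field_embeddings \<noteq> ({} :: ('a::number_field \<Rightarrow> complex) set)"
proof -
  interpret Q: vector_space "\<lambda>q (x::'a). of_rat q * x"
    by unfold_locales (auto simp: of_rat_add of_rat_mult algebra_simps)
  obtain B :: "'a set" where B: "finite B" "\<And>x. \<exists>c. x = (\<Sum>b\<in>B. of_rat (c b) * b)"
    using finite_over_rat by metis
  have i1: "Q.independent {1}" by (simp add: Q.dependent_single)
  define E where "E = Q.extend_basis {1}"
  have E: "Q.independent E" "Q.span E = UNIV" "1 \<in> E"
    using Q.independent_extend_basis[OF i1] Q.span_extend_basis[OF i1] Q.extend_basis_superset[OF i1] by (auto simp: E_def)
  define f0 where "f0 x = (of_rat (Q.representation E x 1) :: complex)" for x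
  have "eigenfunctional {} f0"
    unfolding eigenfunctional_def
    using E Q.representation_add[OF E(1)] Q.representation_scale[OF E(1)] Q.representation_basis[OF E(1) E(3)]
    by (auto simp: f0_def of_rat_add of_rat_mult intro!: exI[of _ 1])
  then have "\<exists>f. eigenfunctional {} (f :: 'a \<Rightarrow> complex)" by blast
  with B(1) have "\<exists>f. eigenfunctional B f"
  proof (induction B rule: finite_induct)
    case (insert x S)
    then obtain f where "eigenfunctional S f" by blast
    then show ?case by (rule eigenfunctional_insert)
  qed
  then obtain f where f: "eigenfunctional B f" using B(1) by blast
  have add: "f (x + y) = f x + f y" for x y using f by (simp add: eigenfunctional_def)
  have ex: "\<exists>m. \<forall>x. f (a * x) = m * f x" for a
  proof -
    obtain l where l: "\<And>b x. b \<in> B \<Longrightarrow> f (b * x) = l b * f x"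
      using f unfolding eigenfunctional_def by metis
    obtain c where c: "a = (\<Sum>b\<in>B. of_rat (c b) * b)" using B(2) by blast
    have "f (a * x) = (\<Sum>b\<in>B. of_rat (c b) * l b) * f x" for x
    proof -
      have "f (a * x) = (\<Sum>b\<in>B. f (of_rat (c b) * (b * x)))"
        unfolding c sum_distrib_right eigenfunctional_sum[OF f] by (simp add: mult.assoc)
      also have "\<dots> = (\<Sum>b\<in>B. of_rat (c b) * (l b * f x))"
        using f l by (intro sum.cong refl) (auto simp: eigenfunctional_def)
      finally show ?thesis by (simp add: sum_distrib_right mult.assoc)
    qed
    then show ?thesis by blast
  qed
  then obtain m where m: "\<And>a x. f (a * x) = m a * f x" by metis
  obtain x0 where "f x0 \<noteq> 0" using f by (auto simp: eigenfunctional_def)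
  then have f1: "f 1 \<noteq> 0" using m[of x0 1] by auto
  have "(\<lambda>x. f x / f 1) \<in> field_embeddings"
    unfolding field_embeddings_def mem_Collect_eq
  proof (intro conjI allI)
    show "f (x * y) / f 1 = f x / f 1 * (f y / f 1)" for x y
      using m[of x y] m[of x 1] f1 by simp
  qed (use f1 in \<open>simp_all add: add add_divide_distrib\<close>)
  then show ?thesis by blast
qed

section \<open>Finite places and completions\<close>

text \<open>A finite place (equivalence class of nontrivial non-archimedean absolute values) is represented
  by its unique normalized discrete valuation, i.e. the one with value group \<open>\<int>\<close>. The value at \<open>0\<close>
  is set to the dummy \<open>0\<close>; statements about valuations go through \<open>val_ge\<close>, which
  treats \<open>v 0\<close> as infinite.\<close>

definition finite_places :: "('a::number_field \<Rightarrow> int) set" where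
  "finite_places = {v. v 0 = 0 \<and> v ` (- {0}) = UNIV
     \<and> (\<forall>x y. x \<noteq> 0 \<longrightarrow> y \<noteq> 0 \<longrightarrow> v (x * y) = v x + v y)
     \<and> (\<forall>x y. x \<noteq> 0 \<longrightarrow> y \<noteq> 0 \<longrightarrow> x + y \<noteq> 0 \<longrightarrow> min (v x) (v y) \<le> v (x + y))}"

definition val_ge :: "('a::number_field \<Rightarrow> int) \<Rightarrow> int \<Rightarrow> 'a \<Rightarrow> bool" where
  "val_ge v k x \<longleftrightarrow> x = 0 \<or> k \<le> v x"

text \<open>\<open>F\<^sub>v\<close> is the ring of \<open>v\<close>-Cauchy sequences modulo the null sequences; \<open>\<O>\<^sub>v\<close> consists of the classes
  of Cauchy sequences of \<open>v\<close>-integral elements; the class of a constant sequence is the image of an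
  element of \<open>F\<close>.\<close>

definition cauchy_ring :: "('a::number_field \<Rightarrow> int) \<Rightarrow> (nat \<Rightarrow> 'a) ring" where
  "cauchy_ring v =
     \<lparr>carrier = {X. \<forall>k. \<exists>N. \<forall>m\<ge>N. \<forall>n\<ge>N. val_ge v k (X m - X n)},
      mult = (\<lambda>X Y n. X n * Y n), one = (\<lambda>_. 1), zero = (\<lambda>_. 0), add = (\<lambda>X Y n. X n + Y n)\<rparr>"

definition null_sequences :: "('a::number_field \<Rightarrow> int) \<Rightarrow> (nat \<Rightarrow> 'a) set" where
  "null_sequences v = {X. \<forall>k. \<exists>N. \<forall>n\<ge>N. val_ge v k (X n)}"

definition nonarch_completion :: "('a::number_field \<Rightarrow> int) \<Rightarrow> (nat \<Rightarrow> 'a) set ring" where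
  "nonarch_completion v = cauchy_ring v Quot null_sequences v"

definition cauchy_class :: "('a::number_field \<Rightarrow> int) \<Rightarrow> (nat \<Rightarrow> 'a) \<Rightarrow> (nat \<Rightarrow> 'a) set" where
  "cauchy_class v X = null_sequences v +>\<^bsub>cauchy_ring v\<^esub> X"

definition local_integers :: "('a::number_field \<Rightarrow> int) \<Rightarrow> (nat \<Rightarrow> 'a) set set" where
  "local_integers v = {cauchy_class v X | X. X \<in> carrier (cauchy_ring v) \<and> (\<forall>n. val_ge v 0 (X n))}"

lemma val_one: "v \<in> finite_places \<Longrightarrow> v 1 = 0"
  unfolding finite_places_def by (clarsimp) (metis add_cancel_left_left mult_1 one_neq_zero)

lemma val_minus: assumes "v \<in> finite_places" shows "v (- x) = v x"
proof (cases "x = 0")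
  case False
  have m: "v (x * y) = v x + v y" if "x \<noteq> 0" "y \<noteq> 0" for x y
    using assms that by (auto simp: finite_places_def)
  have "v (-1) + v (-1) = v 1" using m[of "-1" "-1"] by simp
  then have "v (-1) = 0" using val_one[OF assms] by simp
  then show ?thesis using m[of "-1" x] False by simp
qed simp

lemma val_ge_zero [simp]: "val_ge v k 0" by (simp add: val_ge_def)

lemma val_ge_minus: "v \<in> finite_places \<Longrightarrow> val_ge v k (- x) \<longleftrightarrow> val_ge v k x"
  by (simp add: val_ge_def val_minus)

lemma val_ge_add: "v \<in> finite_places \<Longrightarrow> val_ge v k x \<Longrightarrow> val_ge v k y \<Longrightarrow> val_ge v k (x + y)"
  unfolding val_ge_def finite_places_def mem_Collect_eq
  by (cases "x = 0"; cases "y = 0"; cases "x + y = 0") (auto, smt (verit))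

lemma val_ge_diff: "v \<in> finite_places \<Longrightarrow> val_ge v k x \<Longrightarrow> val_ge v k y \<Longrightarrow> val_ge v k (x - y)"
  using val_ge_add[of v k x "- y"] val_ge_minus[of v k y] by simp

lemma val_ge_mult: "v \<in> finite_places \<Longrightarrow> val_ge v k x \<Longrightarrow> val_ge v l y \<Longrightarrow> val_ge v (k + l) (x * y)"
  by (auto simp: val_ge_def finite_places_def)

lemma val_ge_mono: "val_ge v k x \<Longrightarrow> l \<le> k \<Longrightarrow> val_ge v l x"
  by (auto simp: val_ge_def)

lemma cauchy_bounded:
  assumes v: "v \<in> finite_places" and X: "X \<in> carrier (cauchy_ring v)"
  shows "\<exists>k\<le>0. \<forall>n. val_ge v k (X n)"
proof -
  obtain N where N: "\<And>m n. m \<ge> N \<Longrightarrow> n \<ge> N \<Longrightarrow> val_ge v 0 (X m - X n)"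
    using X unfolding cauchy_ring_def by (simp) metis
  define k where "k = Min (insert 0 ((\<lambda>n. v (X n)) ` {..N}))"
  have "k \<le> l" if "l \<in> insert 0 ((\<lambda>n. v (X n)) ` {..N})" for l
    unfolding k_def by (rule Min_le) (use that in auto)
  then have le: "k \<le> 0" "\<And>n. n \<le> N \<Longrightarrow> k \<le> v (X n)" by auto
  have "val_ge v k (X n)" for n
  proof (cases "n \<le> N")
    case True then show ?thesis using le by (simp add: val_ge_def)
  next
    case False
    then have "val_ge v k (X n - X N)" using N[of n N] val_ge_mono le by fastforce
    moreover have "val_ge v k (X N)" using le by (simp add: val_ge_def)
    ultimately show ?thesis using val_ge_add[OF v] by fastforce
  qed
  then show ?thesis using le by blast
qed

lemma cauchy_add_closed:
  assumes v: "v \<in> finite_places" and X: "X \<in> carrier (cauchy_ring v)" and Y: "Y \<in> carrier (cauchy_ring v)"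
  shows "(\<lambda>n. X n + Y n) \<in> carrier (cauchy_ring v)"
  unfolding cauchy_ring_def partial_object.simps mem_Collect_eq
proof
  fix k
  obtain M where M: "\<And>m n. m \<ge> M \<Longrightarrow> n \<ge> M \<Longrightarrow> val_ge v k (X m - X n)"
    using X unfolding cauchy_ring_def by (simp) metis
  obtain N where N: "\<And>m n. m \<ge> N \<Longrightarrow> n \<ge> N \<Longrightarrow> val_ge v k (Y m - Y n)"
    using Y unfolding cauchy_ring_def by (simp) metis
  have "val_ge v k ((X m + Y m) - (X n + Y n))" if "m \<ge> max M N" "n \<ge> max M N" for m n
    using val_ge_add[OF v M[of m n] N[of m n]] that by (simp add: algebra_simps)
  then show "\<exists>N. \<forall>m\<ge>N. \<forall>n\<ge>N. val_ge v k ((X m + Y m) - (X n + Y n))" by blast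
qed

lemma cauchy_minus_closed:
  assumes v: "v \<in> finite_places" and X: "X \<in> carrier (cauchy_ring v)"
  shows "(\<lambda>n. - X n) \<in> carrier (cauchy_ring v)"
proof -
  have "val_ge v k (- X m - - X n) \<longleftrightarrow> val_ge v k (X m - X n)" for k m n
    using val_ge_minus[OF v, of k "X m - X n"] by (simp add: algebra_simps)
  then show ?thesis using X unfolding cauchy_ring_def by (simp del: diff_minus_eq_add)
qed

lemma cauchy_mult_closed:
  assumes v: "v \<in> finite_places" and X: "X \<in> carrier (cauchy_ring v)" and Y: "Y \<in> carrier (cauchy_ring v)"
  shows "(\<lambda>n. X n * Y n) \<in> carrier (cauchy_ring v)"
  unfolding cauchy_ring_def partial_object.simps mem_Collect_eq
proof
  fix k
  obtain a b where ab: "\<And>n. val_ge v a (X n)" "\<And>n. val_ge v b (Y n)"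
    using cauchy_bounded[OF v X] cauchy_bounded[OF v Y] by blast
  obtain M where M: "\<And>m n. m \<ge> M \<Longrightarrow> n \<ge> M \<Longrightarrow> val_ge v (k - b) (X m - X n)"
    using X unfolding cauchy_ring_def by (simp) metis
  obtain N where N: "\<And>m n. m \<ge> N \<Longrightarrow> n \<ge> N \<Longrightarrow> val_ge v (k - a) (Y m - Y n)"
    using Y unfolding cauchy_ring_def by (simp) metis
  have "val_ge v k (X m * Y m - X n * Y n)" if "m \<ge> max M N" "n \<ge> max M N" for m n
  proof -
    have "X m * Y m - X n * Y n = (X m - X n) * Y m + X n * (Y m - Y n)" by (simp add: algebra_simps)
    moreover have "val_ge v k ((X m - X n) * Y m)" using val_ge_mult[OF v M[of m n] ab(2)[of m]] that by simp
    moreover have "val_ge v k (X n * (Y m - Y n))" using val_ge_mult[OF v ab(1)[of n] N[of m n]] that by simp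
    ultimately show ?thesis using val_ge_add[OF v] by simp
  qed
  then show "\<exists>N. \<forall>m\<ge>N. \<forall>n\<ge>N. val_ge v k (X m * Y m - X n * Y n)" by blast
qed

lemma cauchy_const: "(\<lambda>_. x) \<in> carrier (cauchy_ring v)"
  by (simp add: cauchy_ring_def)

lemma cring_cauchy_ring:
  assumes v: "v \<in> finite_places"
  shows "cring (cauchy_ring v)"
proof (rule cringI)
  show "abelian_group (cauchy_ring v)"
  proof (rule abelian_groupI)
    fix X assume X: "X \<in> carrier (cauchy_ring v)"
    show "\<exists>Y\<in>carrier (cauchy_ring v). Y \<oplus>\<^bsub>cauchy_ring v\<^esub> X = \<zero>\<^bsub>cauchy_ring v\<^esub>"
      by (rule bexI[OF _ cauchy_minus_closed[OF v X]]) (simp add: cauchy_ring_def)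
  qed (use cauchy_add_closed[OF v] cauchy_const[of 0 v] in \<open>auto simp: cauchy_ring_def add_ac\<close>)
  show "Group.comm_monoid (cauchy_ring v)"
    by (rule comm_monoidI) (use cauchy_mult_closed[OF v] cauchy_const[of 1 v] in \<open>auto simp: cauchy_ring_def mult_ac\<close>)
qed (auto simp: cauchy_ring_def algebra_simps)

lemma ideal_null_sequences:
  assumes v: "v \<in> finite_places"
  shows "ideal (null_sequences v) (cauchy_ring v)"
proof (rule idealI)
  interpret R: cring "cauchy_ring v" by (rule cring_cauchy_ring[OF v])
  show "ring (cauchy_ring v)" by (rule R.ring_axioms)
  have sub: "null_sequences v \<subseteq> carrier (cauchy_ring v)"
  proof
    fix X assume X: "X \<in> null_sequences v"
    have "\<exists>N. \<forall>m\<ge>N. \<forall>n\<ge>N. val_ge v k (X m - X n)" for k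
    proof -
      obtain N where "\<And>n. n \<ge> N \<Longrightarrow> val_ge v k (X n)" using X unfolding null_sequences_def by blast
      then show ?thesis using val_ge_diff[OF v] by blast
    qed
    then show "X \<in> carrier (cauchy_ring v)" by (simp add: cauchy_ring_def)
  qed
  have add: "(\<lambda>n. X n + Y n) \<in> null_sequences v" if X: "X \<in> null_sequences v" and Y: "Y \<in> null_sequences v" for X Y
    unfolding null_sequences_def mem_Collect_eq
  proof
    fix k
    obtain M where M: "\<And>n. n \<ge> M \<Longrightarrow> val_ge v k (X n)" using X unfolding null_sequences_def by blast
    obtain N where N: "\<And>n. n \<ge> N \<Longrightarrow> val_ge v k (Y n)" using Y unfolding null_sequences_def by blast
    show "\<exists>N. \<forall>n\<ge>N. val_ge v k (X n + Y n)"
      by (intro exI[of _ "max M N"]) (auto intro!: val_ge_add[OF v] M N)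
  qed
  have mult: "(\<lambda>n. X n * Y n) \<in> null_sequences v" if X: "X \<in> null_sequences v" and Y: "Y \<in> carrier (cauchy_ring v)" for X Y
    unfolding null_sequences_def mem_Collect_eq
  proof
    fix k
    obtain b where b: "\<And>n. val_ge v b (Y n)" using cauchy_bounded[OF v Y] by blast
    obtain M where M: "\<And>n. n \<ge> M \<Longrightarrow> val_ge v (k - b) (X n)" using X unfolding null_sequences_def by blast
    show "\<exists>N. \<forall>n\<ge>N. val_ge v k (X n * Y n)"
      using val_ge_mult[OF v M b] by (intro exI[of _ M]) simp
  qed
  show "subgroup (null_sequences v) (add_monoid (cauchy_ring v))"
  proof (rule group.subgroupI)
    show "group (add_monoid (cauchy_ring v))" by (rule R.a_group)
    show "null_sequences v \<subseteq> carrier (add_monoid (cauchy_ring v))" using sub by simp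
    have "(\<lambda>_. 0) \<in> null_sequences v" by (simp add: null_sequences_def)
    then show "null_sequences v \<noteq> {}" by blast
    fix X assume X: "X \<in> null_sequences v"
    have "\<ominus>\<^bsub>cauchy_ring v\<^esub> X = (\<lambda>n. - X n)"
      by (rule R.minus_equality) (use sub X cauchy_minus_closed[OF v] in \<open>auto simp: cauchy_ring_def\<close>)
    moreover have "(\<lambda>n. - X n) \<in> null_sequences v"
      using X val_ge_minus[OF v] by (simp add: null_sequences_def)
    ultimately show "inv\<^bsub>add_monoid (cauchy_ring v)\<^esub> X \<in> null_sequences v"
      by (simp add: a_inv_def)
    fix Y assume Y: "Y \<in> null_sequences v"
    show "X \<otimes>\<^bsub>add_monoid (cauchy_ring v)\<^esub> Y \<in> null_sequences v"
      using add[OF X Y] by (simp add: cauchy_ring_def)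
  qed
  fix X Y assume XY: "X \<in> null_sequences v" "Y \<in> carrier (cauchy_ring v)"
  show "Y \<otimes>\<^bsub>cauchy_ring v\<^esub> X \<in> null_sequences v" "X \<otimes>\<^bsub>cauchy_ring v\<^esub> Y \<in> null_sequences v"
    using mult[OF XY] by (simp_all add: cauchy_ring_def mult.commute)
qed

lemma cring_nonarch_completion: "v \<in> finite_places \<Longrightarrow> cring (nonarch_completion v)"
  unfolding nonarch_completion_def by (intro ideal.quotient_is_cring ideal_null_sequences cring_cauchy_ring)

lemma cauchy_class_ring_hom:
  "v \<in> finite_places \<Longrightarrow> cauchy_class v \<in> Ring.ring_hom (cauchy_ring v) (nonarch_completion v)"
  unfolding nonarch_completion_def cauchy_class_def[abs_def] by (rule ideal.rcos_ring_hom[OF ideal_null_sequences])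

lemma local_integers_closed:
  assumes v: "v \<in> finite_places"
  shows "local_integers v \<subseteq> carrier (nonarch_completion v)"
    and "\<zero>\<^bsub>nonarch_completion v\<^esub> \<in> local_integers v" and "\<one>\<^bsub>nonarch_completion v\<^esub> \<in> local_integers v"
    and "a \<in> local_integers v \<Longrightarrow> b \<in> local_integers v \<Longrightarrow> a \<oplus>\<^bsub>nonarch_completion v\<^esub> b \<in> local_integers v"
    and "a \<in> local_integers v \<Longrightarrow> b \<in> local_integers v \<Longrightarrow> a \<otimes>\<^bsub>nonarch_completion v\<^esub> b \<in> local_integers v"
    and "a \<in> local_integers v \<Longrightarrow> \<ominus>\<^bsub>nonarch_completion v\<^esub> a \<in> local_integers v"
proof -
  interpret R: cring "cauchy_ring v" by (rule cring_cauchy_ring[OF v])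
  interpret K: cring "nonarch_completion v" by (rule cring_nonarch_completion[OF v])
  interpret h: ring_hom_cring "cauchy_ring v" "nonarch_completion v" "cauchy_class v"
    by unfold_locales (rule cauchy_class_ring_hom[OF v])
  have R0: "\<zero>\<^bsub>cauchy_ring v\<^esub> = (\<lambda>_. 0)" "\<one>\<^bsub>cauchy_ring v\<^esub> = (\<lambda>_. 1)"
    "\<And>X Y. X \<oplus>\<^bsub>cauchy_ring v\<^esub> Y = (\<lambda>n. X n + Y n)" "\<And>X Y. X \<otimes>\<^bsub>cauchy_ring v\<^esub> Y = (\<lambda>n. X n * Y n)"
    by (simp_all add: cauchy_ring_def)
  have Rm: "\<ominus>\<^bsub>cauchy_ring v\<^esub> X = (\<lambda>n. - X n)" if "X \<in> carrier (cauchy_ring v)" for X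
    by (rule R.minus_equality) (use that cauchy_minus_closed[OF v] in \<open>auto simp: cauchy_ring_def\<close>)
  have I: "cauchy_class v X \<in> local_integers v" if "X \<in> carrier (cauchy_ring v)" "\<And>n. val_ge v 0 (X n)" for X
    using that by (auto simp: local_integers_def)
  show "local_integers v \<subseteq> carrier (nonarch_completion v)" by (auto simp: local_integers_def)
  show "\<zero>\<^bsub>nonarch_completion v\<^esub> \<in> local_integers v"
    unfolding h.hom_zero[symmetric] by (rule I) (auto simp: R0(1) cauchy_const)
  show "\<one>\<^bsub>nonarch_completion v\<^esub> \<in> local_integers v"
    unfolding h.hom_one[symmetric] by (rule I) (auto simp: R0(2) cauchy_const val_ge_def val_one[OF v])
  assume "a \<in> local_integers v"
  then obtain X where X: "a = cauchy_class v X" "X \<in> carrier (cauchy_ring v)" "\<And>n. val_ge v 0 (X n)"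
    by (auto simp: local_integers_def)
  show "\<ominus>\<^bsub>nonarch_completion v\<^esub> a \<in> local_integers v"
    unfolding X(1) h.hom_a_inv[OF X(2), symmetric] by (rule I) (use X cauchy_minus_closed[OF v] in \<open>auto simp: Rm val_ge_minus[OF v]\<close>)
  assume "b \<in> local_integers v"
  then obtain Y where Y: "b = cauchy_class v Y" "Y \<in> carrier (cauchy_ring v)" "\<And>n. val_ge v 0 (Y n)"
    by (auto simp: local_integers_def)
  show "a \<oplus>\<^bsub>nonarch_completion v\<^esub> b \<in> local_integers v"
    unfolding X(1) Y(1) h.hom_add[OF X(2) Y(2), symmetric]
R0(3)
    by (rule I) (use X Y cauchy_add_closed[OF v] val_ge_add[OF v] in auto)
  show "a \<otimes>\<^bsub>nonarch_completion v\<^esub> b \<in> local_integers v"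
    unfolding X(1) Y(1) h.hom_mult[OF X(2) Y(2), symmetric]
R0(4)
    by (rule I) (use X Y cauchy_mult_closed[OF v] val_ge_mult[OF v, of 0 _ 0] in auto)
qed

section \<open>Archimedean places\<close>

text \<open>An archimedean place is a complex embedding up to complex conjugation. Its completion is identified
  with \<open>\<real>\<close> or \<open>\<complex>\<close> through an arbitrarily chosen embedding of the pair.\<close>

definition arch_places :: "('a::number_field \<Rightarrow> complex) set set" where
  "arch_places = {{\<sigma>, cnj \<circ> \<sigma>} | \<sigma>. \<sigma> \<in> field_embeddings}"

definition arch_embedding :: "('a::number_field \<Rightarrow> complex) set \<Rightarrow> 'a \<Rightarrow> complex" where
  "arch_embedding w = (SOME \<sigma>. \<sigma> \<in> w)"

definition arch_completion :: "('a::number_field \<Rightarrow> complex) set \<Rightarrow> complex set" where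
  "arch_completion w = (if range (arch_embedding w) \<subseteq> \<real> then \<real> else UNIV)"

lemma arch_completion_closed:
  "0 \<in> arch_completion w" "1 \<in> arch_completion w"
  "a \<in> arch_completion w \<Longrightarrow> b \<in> arch_completion w \<Longrightarrow> a + b \<in> arch_completion w"
  "a \<in> arch_completion w \<Longrightarrow> b \<in> arch_completion w \<Longrightarrow> a * b \<in> arch_completion w"
  "a \<in> arch_completion w \<Longrightarrow> - a \<in> arch_completion w"
  by (auto simp: arch_completion_def)

section \<open>The adele ring\<close>

text \<open>The restricted product of the \<open>F\<^sub>v\<close> with respect to the \<open>\<O>\<^sub>v\<close>, times the archimedean completions.\<close>

lemma adele_mem:
  fixes x :: "('a::number_field \<Rightarrow> int) \<Rightarrow> (nat \<Rightarrow> 'a) set" and z :: "('a \<Rightarrow> complex) set \<Rightarrow> complex"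
  assumes "\<And>v. v \<in> finite_places \<Longrightarrow> x v \<in> carrier (nonarch_completion v)"
    and "finite S" "\<And>v. v \<in> finite_places \<Longrightarrow> v \<notin> S \<Longrightarrow> x v \<in> local_integers v"
    and "\<And>w. w \<in> arch_places \<Longrightarrow> z w \<in> arch_completion w"
  shows "(\<lambda>v\<in>finite_places. x v, \<lambda>w\<in>arch_places. z w) \<in>
    {(x, z). x \<in> (\<Pi>\<^sub>E v\<in>finite_places. carrier (nonarch_completion v))
     \<and> finite {v\<in>finite_places. x v \<notin> local_integers v}
     \<and> z \<in> (\<Pi>\<^sub>E w\<in>arch_places. arch_completion w)}"
proof -
  have "{v\<in>finite_places. (\<lambda>v\<in>finite_places. x v) v \<notin> local_integers v} \<subseteq> S"
    using assms(3) by auto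
  then have "finite {v\<in>finite_places. (\<lambda>v\<in>finite_places. x v) v \<notin> local_integers v}"
    using assms(2) by (rule finite_subset)
  then show ?thesis using assms(1,4) by simp
qed

typedef (overloaded) 'a adele =
  "{(x, z). x \<in> (\<Pi>\<^sub>E v\<in>(finite_places :: ('a::number_field \<Rightarrow> int) set). carrier (nonarch_completion v))
     \<and> finite {v\<in>finite_places. x v \<notin> local_integers v}
     \<and> z \<in> (\<Pi>\<^sub>E w\<in>(arch_places :: ('a \<Rightarrow> complex) set set). arch_completion w)}"
proof (rule exI, rule adele_mem)
  fix v :: "'a \<Rightarrow> int" assume v: "v \<in> finite_places"
  show "\<zero>\<^bsub>nonarch_completion v\<^esub> \<in> local_integers v" by (rule local_integers_closed(2)[OF v])
  then show "\<zero>\<^bsub>nonarch_completion v\<^esub> \<in> carrier (nonarch_completion v)"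
    using local_integers_closed(1)[OF v] by blast
next
  show "finite {}" by simp
  show "0 \<in> arch_completion w" for w :: "('a \<Rightarrow> complex) set" by (rule arch_completion_closed(1))
qed

setup_lifting type_definition_adele

lift_definition fin_comp :: "'a::number_field adele \<Rightarrow> ('a \<Rightarrow> int) \<Rightarrow> (nat \<Rightarrow> 'a) set" is fst .

lift_definition arch_comp :: "'a::number_field adele \<Rightarrow> ('a \<Rightarrow> complex) set \<Rightarrow> complex" is snd .

lemma fin_comp_closed: "v \<in> finite_places \<Longrightarrow> fin_comp a v \<in> carrier (nonarch_completion v)"
  by transfer auto

lemma adele_eqI:
  assumes "\<And>v. v \<in> finite_places \<Longrightarrow> fin_comp a v = fin_comp b v"
    and "\<And>w. w \<in> arch_places \<Longrightarrow> arch_comp a w = arch_comp b w"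
  shows "a = b"
proof -
  have "fst (Rep_adele a) = fst (Rep_adele b)"
    using Rep_adele[of a] Rep_adele[of b] assms(1)
    by (intro PiE_ext[of _ finite_places "\<lambda>v. carrier (nonarch_completion v)"]) (auto simp: fin_comp.rep_eq)
  moreover have "snd (Rep_adele a) = snd (Rep_adele b)"
    using Rep_adele[of a] Rep_adele[of b] assms(2)
    by (intro PiE_ext[of _ arch_places arch_completion]) (auto simp: arch_comp.rep_eq)
  ultimately show ?thesis by (metis Rep_adele_inject prod_eq_iff)
qed

instantiation adele :: (number_field) comm_ring_1
begin

lift_definition zero_adele :: "'a adele" is
  "(\<lambda>v\<in>finite_places. \<zero>\<^bsub>nonarch_completion v\<^esub>, \<lambda>w\<in>arch_places. 0)"
  by (rule adele_mem[where S = "{}"]) (auto intro: local_integers_closed(2) subsetD[OF local_integers_closed(1)] arch_completion_closed(1))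

lift_definition one_adele :: "'a adele" is
  "(\<lambda>v\<in>finite_places. \<one>\<^bsub>nonarch_completion v\<^esub>, \<lambda>w\<in>arch_places. 1)"
  by (rule adele_mem[where S = "{}"]) (auto intro: local_integers_closed(3) subsetD[OF local_integers_closed(1)] arch_completion_closed(2))

lift_definition plus_adele :: "'a adele \<Rightarrow> 'a adele \<Rightarrow> 'a adele" is
  "\<lambda>a b. (\<lambda>v\<in>finite_places. fst a v \<oplus>\<^bsub>nonarch_completion v\<^esub> fst b v, \<lambda>w\<in>arch_places. snd a w + snd b w)"
  subgoal for a b
    by (rule adele_mem[where S = "{v\<in>finite_places. fst a v \<notin> local_integers v} \<union> {v\<in>finite_places. fst b v \<notin> local_integers v}"])
       (auto intro!: local_integers_closed(4) arch_completion_closed(3) cring.cring_simprules(1)[OF cring_nonarch_completion])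
  done

lift_definition times_adele :: "'a adele \<Rightarrow> 'a adele \<Rightarrow> 'a adele" is
  "\<lambda>a b. (\<lambda>v\<in>finite_places. fst a v \<otimes>\<^bsub>nonarch_completion v\<^esub> fst b v, \<lambda>w\<in>arch_places. snd a w * snd b w)"
  subgoal for a b
    by (rule adele_mem[where S = "{v\<in>finite_places. fst a v \<notin> local_integers v} \<union> {v\<in>finite_places. fst b v \<notin> local_integers v}"])
       (auto intro!: local_integers_closed(5) arch_completion_closed(4) cring.cring_simprules(5)[OF cring_nonarch_completion])
  done

lift_definition uminus_adele :: "'a adele \<Rightarrow> 'a adele" is
  "\<lambda>a. (\<lambda>v\<in>finite_places. \<ominus>\<^bsub>nonarch_completion v\<^esub> fst a v, \<lambda>w\<in>arch_places. - snd a w)"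
  subgoal for a
    by (rule adele_mem[where S = "{v\<in>finite_places. fst a v \<notin> local_integers v}"])
       (auto intro!: local_integers_closed(6) arch_completion_closed(5) cring.cring_simprules(3)[OF cring_nonarch_completion])
  done

definition minus_adele :: "'a adele \<Rightarrow> 'a adele \<Rightarrow> 'a adele" where
  "minus_adele a b = a + - b"

lemma fin_comp_simps:
  assumes "v \<in> finite_places"
  shows "fin_comp (0 :: 'a adele) v = \<zero>\<^bsub>nonarch_completion v\<^esub>" "fin_comp (1 :: 'a adele) v = \<one>\<^bsub>nonarch_completion v\<^esub>"
    "fin_comp (a + b) v = fin_comp a v \<oplus>\<^bsub>nonarch_completion v\<^esub> fin_comp b v"
    "fin_comp (a * b) v = fin_comp a v \<otimes>\<^bsub>nonarch_completion v\<^esub> fin_comp b v"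
    "fin_comp (- a) v = \<ominus>\<^bsub>nonarch_completion v\<^esub> fin_comp a v"
  using assms by (transfer; simp)+

lemma arch_comp_simps:
  assumes "w \<in> arch_places"
  shows "arch_comp (0 :: 'a adele) w = 0" "arch_comp (1 :: 'a adele) w = 1"
    "arch_comp (a + b) w = arch_comp a w + arch_comp b w"
    "arch_comp (a * b) w = arch_comp a w * arch_comp b w"
    "arch_comp (- a) w = - arch_comp a w"
  using assms by (transfer; simp)+

instance
proof
  fix a b c :: "'a adele"
  note cr = cring_nonarch_completion and cl = fin_comp_closed and simps = fin_comp_simps arch_comp_simps
  show "a + b + c = a + (b + c)"
    by (rule adele_eqI) (simp_all only: simps cring.cring_simprules(7)[OF cr cl cl cl] add.assoc)
  show "a * b * c = a * (b * c)"
    by (rule adele_eqI) (simp_all only: simps cring.cring_simprules(11)[OF cr cl cl cl] mult.assoc)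
  show "(a + b) * c = a * c + b * c"
    by (rule adele_eqI) (simp_all only: simps cring.cring_simprules(13)[OF cr cl cl cl] distrib_right)
  show "a + b = b + a"
    by (rule adele_eqI) (simp_all only: simps cring.cring_simprules(10)[OF cr cl cl] add.commute)
  show "a * b = b * a"
    by (rule adele_eqI) (simp_all only: simps cring.cring_simprules(14)[OF cr cl cl] mult.commute)
  show "0 + a = a"
    by (rule adele_eqI) (simp_all only: simps cring.cring_simprules(8)[OF cr cl] add_0)
  show "1 * a = a"
    by (rule adele_eqI) (simp_all only: simps cring.cring_simprules(12)[OF cr cl] mult_1)
  show "- a + a = 0"
    by (rule adele_eqI) (simp_all only: simps cring.cring_simprules(9)[OF cr cl] left_minus)
  show "a - b = a + - b" by (simp add: minus_adele_def)
  obtain w :: "('a \<Rightarrow> complex) set" where "w \<in> arch_places"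
    using field_embeddings_nonempty unfolding arch_places_def by blast
  then show "(0 :: 'a adele) \<noteq> 1" using arch_comp_simps(1,2) by (metis zero_neq_one)
qed

end

text \<open>Elements of \<open>F\<close> are integral at almost all finite places, so \<open>Abs_adele\<close> is applied to a genuine
  restricted family.\<close>

definition diag_adele :: "'a::number_field \<Rightarrow> 'a adele" where
  "diag_adele x =
     Abs_adele (\<lambda>v\<in>finite_places. cauchy_class v (\<lambda>_. x), \<lambda>w\<in>arch_places. arch_embedding w x)"

definition adelic_matrix :: "'a::number_field^'n^'n \<Rightarrow> 'a adele^'n^'n" where
  "adelic_matrix \<delta> = (\<chi> i j. diag_adele (\<delta> $ i $ j))"

section \<open>The lattice, its metrics and the Arakelov degree\<close>

definition lattice_of :: "'a::number_field adele^'n^'n \<Rightarrow> ('a^'n) set" where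
  "lattice_of g = {x. \<forall>v\<in>finite_places. \<exists>y. (\<forall>j. y j \<in> local_integers v) \<and>
     (\<forall>i. cauchy_class v (\<lambda>_. x $ i)
        = (\<Oplus>\<^bsub>nonarch_completion v\<^esub>j\<in>UNIV. fin_comp (g $ i $ j) v \<otimes>\<^bsub>nonarch_completion v\<^esub> y j))}"

text \<open>The vector \<open>g\<^sub>\<sigma>\<^sup>-\<^sup>1 x\<close> at an archimedean place.\<close>

definition arch_vector :: "'a::number_field adele^'n^'n \<Rightarrow> ('a \<Rightarrow> complex) set \<Rightarrow> 'a^'n \<Rightarrow> complex^'n" where
  "arch_vector g w x =
     matrix_inv (\<chi> i j. arch_comp (g $ i $ j) w) *v (\<chi> i. arch_embedding w (x $ i))"

definition hermitian :: "complex^'n \<Rightarrow> complex^'n \<Rightarrow> complex" where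
  "hermitian x y = (\<Sum>i\<in>UNIV. x $ i * cnj (y $ i))"

text \<open>The norm of \<open>x\<^sub>1 \<and> \<dots> \<and> x\<^sub>m\<close> for the metric induced on the exterior power, whose Hermitian form is
  \<open>\<langle>x\<^sub>1 \<and> \<dots> \<and> x\<^sub>m, y\<^sub>1 \<and> \<dots> \<and> y\<^sub>m\<rangle> = det (\<langle>x\<^sub>i, y\<^sub>j\<rangle>)\<close>. At a real place all entries are real.\<close>

definition wedge_norm :: "'a::number_field adele^'n^'n \<Rightarrow> ('a \<Rightarrow> complex) set \<Rightarrow> ('a^'n) list \<Rightarrow> real" where
  "wedge_norm g w xs =
     sqrt (Re (Determinant.det (Matrix.mat (length xs) (length xs)
       (\<lambda>(i, j). hermitian (arch_vector g w (xs ! i)) (arch_vector g w (xs ! j))))))"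

definition is_basis :: "('a::number_field^'n) list \<Rightarrow> ('a^'n) set \<Rightarrow> bool" where
  "is_basis xs V \<longleftrightarrow> distinct xs \<and> vec.independent (set xs) \<and> vec.span (set xs) = V"

definition integral_span :: "('a::number_field^'n) list \<Rightarrow> ('a^'n) set" where
  "integral_span xs = {\<Sum>i<length xs. c i *s xs ! i | c. \<forall>i<length xs. algebraic_int (c i)}"

definition lattice_index :: "'a::number_field adele^'n^'n \<Rightarrow> ('a^'n) set \<Rightarrow> ('a^'n) list \<Rightarrow> nat" where
  "lattice_index g V xs =
     card ((lattice_of g \<inter> V) //
       {(x, y). x \<in> lattice_of g \<inter> V \<and> y \<in> lattice_of g \<inter> V \<and> x - y \<in> integral_span xs})"

text \<open>\<open>N\<^sub>\<sigma> = [F\<^sub>\<sigma> : \<real>]\<close> is the real dimension of the completion. The description operator expresses that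
  the value does not depend on the basis.\<close>

definition arakelov_degree :: "'a::number_field adele^'n^'n \<Rightarrow> ('a^'n) set \<Rightarrow> real" where
  "arakelov_degree g V = (if V = {0} then 0 else
     (THE d. \<forall>xs. is_basis xs V \<and> set xs \<subseteq> lattice_of g \<longrightarrow>
        d = ln (real (lattice_index g V xs))
          - (\<Sum>w\<in>arch_places. real (dim (arch_completion w)) * ln (wedge_norm g w xs))))"

section \<open>Parabolic subgroups\<close>

definition GL_group :: "('a::field^'n^'n) monoid" where
  "GL_group = \<lparr>carrier = {A. invertible A}, mult = (**), one = Finite_Cartesian_Product.mat 1\<rparr>"

definition is_flag :: "('a::field^'n) set list \<Rightarrow> bool" where
  "is_flag Vs \<longleftrightarrow> Vs \<noteq> [] \<and> hd Vs = {0} \<and> last Vs = UNIV \<and> sorted_wrt (\<subset>) Vs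
     \<and> (\<forall>V\<in>set Vs. vec.subspace V)"

definition flag_stabilizer :: "('a::field^'n) set list \<Rightarrow> ('a^'n^'n) set" where
  "flag_stabilizer Vs = {A. invertible A \<and> (\<forall>V\<in>set Vs. (*v) A ` V = V)}"

text \<open>A parabolic subgroup is represented by its group of \<open>F\<close>-points; since \<open>F\<close> is infinite, these
  points determine the flag.\<close>

definition is_parabolic :: "('a::field^'n^'n) set \<Rightarrow> bool" where
  "is_parabolic Q \<longleftrightarrow> (\<exists>Vs. is_flag Vs \<and> Q = flag_stabilizer Vs)"

definition flag_of :: "('a::field^'n^'n) set \<Rightarrow> ('a^'n) set list" where
  "flag_of Q = (THE Vs. is_flag Vs \<and> Q = flag_stabilizer Vs)"

definition parabolic_rank :: "('a::field^'n^'n) set \<Rightarrow> nat" where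
  "parabolic_rank Q = length (flag_of Q) - 1"

definition upper_triangular_group :: "('a::field^'n::{finite,linorder}^'n::{finite,linorder}) set" where
  "upper_triangular_group = {A. invertible A \<and> (\<forall>i j. j < i \<longrightarrow> A $ i $ j = 0)}"

definition standard_parabolics :: "('a::field^'n::{finite,linorder}^'n::{finite,linorder}) set set" where
  "standard_parabolics = {P. is_parabolic P \<and> upper_triangular_group \<subseteq> P}"

section \<open>Polygons\<close>

definition polygon :: "nat \<Rightarrow> (real \<Rightarrow> real) \<Rightarrow> bool" where
  "polygon r p \<longleftrightarrow> continuous_on {0..real r} p \<and> p 0 = 0 \<and> p (real r) = 0
     \<and> (\<forall>i\<in>{1..r}. \<exists>a b. \<forall>t\<in>{real i - 1..real i}. p t = a * t + b)"

definition convex_polygon :: "nat \<Rightarrow> (real \<Rightarrow> real) \<Rightarrow> bool" where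
  "convex_polygon r p \<longleftrightarrow> polygon r p
     \<and> (\<forall>i\<in>{1..<r}. p (real i + 1) - p (real i) \<le> p (real i) - p (real i - 1))"

text \<open>Linear interpolation of the values \<open>y i\<close> at the abscissae \<open>d 0 < d 1 < \<dots>\<close>.\<close>

definition interpolate :: "(nat \<Rightarrow> real) \<Rightarrow> (nat \<Rightarrow> real) \<Rightarrow> real \<Rightarrow> real" where
  "interpolate d y t =
     (let i = (LEAST i. t \<le> d (Suc i))
      in y i + (t - d i) / (d (Suc i) - d i) * (y (Suc i) - y i))"

definition parabolic_polygon :: "'a::number_field adele^'n^'n \<Rightarrow> ('a^'n^'n) set \<Rightarrow> real \<Rightarrow> real" where
  "parabolic_polygon g Q =
     interpolate (\<lambda>i. real (vec.dim (flag_of Q ! i)))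
       (\<lambda>i. arakelov_degree g (flag_of Q ! i)
          - real (vec.dim (flag_of Q ! i)) / real CARD('n) * arakelov_degree g UNIV)"

definition max_polygon :: "'a::number_field adele^'n^'n \<Rightarrow> real \<Rightarrow> real" where
  "max_polygon g t = (GREATEST y. \<exists>Q. is_parabolic Q \<and> y = parabolic_polygon g Q t)"

text \<open>For a standard parabolic with blocks \<open>r\<^sub>1, \<dots>, r\<^sub>s\<close>, the \<open>i\<close>-th step of its flag is spanned by the
  first \<open>r\<^sub>1 + \<dots> + r\<^sub>i\<close> basis vectors, so \<open>r\<^sub>1 + \<dots> + r\<^sub>i\<close> is the dimension of that step.\<close>

definition polygon_exceeds :: "('a::field^'n^'n) set \<Rightarrow> (real \<Rightarrow> real) \<Rightarrow> (real \<Rightarrow> real) \<Rightarrow> bool" where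
  "polygon_exceeds P q p \<longleftrightarrow>
     (\<forall>i\<in>{1..<parabolic_rank P}. q (real (vec.dim (flag_of P ! i))) > p (real (vec.dim (flag_of P ! i))))"

text \<open>The condition \<open>p\<^sub>P\<^sup>\<delta>\<^sup>g >\<^sub>P p\<close> for a coset \<open>D = P(F) \<delta>\<close>, evaluated at a representative; it does not
  depend on the representative.\<close>

definition coset_exceeds ::
  "'a::number_field adele^'n^'n \<Rightarrow> (real \<Rightarrow> real) \<Rightarrow> ('a^'n^'n) set \<Rightarrow> ('a^'n^'n) set \<Rightarrow> bool" where
  "coset_exceeds g p P D \<longleftrightarrow>
     (let \<delta> = (SOME \<delta>. \<delta> \<in> D)
      in polygon_exceeds P (parabolic_polygon (adelic_matrix \<delta> ** g) P) p)"

end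

theory Submission
  imports Defs "HOL-Library.Function_Algebras" "Jordan_Normal_Form.Char_Poly" "HOL-Computational_Algebra.Field_as_Ring"
begin

no_notation Matrix.vec_index (infixl "$" 100)

text \<open>The degree \<open>V \<mapsto> deg\<^sub>g(V)\<close> is supermodular, and only finitely many subspaces have degree above a given
  bound. Since \<open>p\<close> is concave, \<open>f(V) = deg\<^sub>g(V) - (dim V / r) deg\<^sub>g(F\<^sup>r) - p(dim V)\<close> is supermodular as well, and
  \<open>f(0) = f(F\<^sup>r) = 0\<close>. A flag is determined by its stabilizer, so the pairs \<open>(P, P(F) \<delta>)\<close> correspond to the flags
  \<open>\<delta>\<^sup>-\<^sup>1 V\<^sub>i\<close> of \<open>F\<^sup>r\<close>, i.e. to the chains of nonzero proper subspaces, and the right-hand side of the theorem is the sum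
  of \<open>(-1)\<^sup>|\<^sup>C\<^sup>|\<close> over the chains \<open>C\<close> in the finite set \<open>S\<close> of nonzero proper subspaces with \<open>f > 0\<close>; the left-hand
  side is \<open>1\<close> iff \<open>S\<close> is empty. If \<open>S\<close> is nonempty and \<open>V\<^sub>0 \<in> S\<close> maximizes \<open>f\<close>, then supermodularity gives
  \<open>f(W + V\<^sub>0) \<ge> f(W) > 0\<close> for \<open>W \<in> S\<close>, so \<open>S\<close> is conically contractible via \<open>W \<subseteq> W + V\<^sub>0 \<supseteq> V\<^sub>0\<close> and the
  alternating sum vanishes.

  The arithmetic input is elementary: Minkowski's theorem by the pigeonhole principle gives
  \<open>[\<O> : a \<O>] = |N(a)|\<close>, whence the degree does not depend on the basis; elements outside \<open>\<O>\<close> are detected by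
  a finite place constructed from a maximal ideal; and lines whose degree is bounded below contain short lattice vectors.\<close>

section \<open>Algebraic integers\<close>

text \<open>Two obstacles shape the arithmetic part. The intersection of \<open>lattice_of g\<close>
  with a subspace need not be free over the integers of \<open>F\<close>, so the degree cannot be
  read off from a good basis. Instead, both terms of the defining formula are split off one vector
  at a time: the index along an exact sequence, the wedge norm as a product of distances. Exchanging
  one vector changes the two terms by the same norm, and supermodularity compares the same factors
  over two nested spans. The second obstacle is the exact equality of index and norm: pigeonhole
  arguments give it only up to a constant. Both sides are multiplicative, so a bound with a constant
  that holds for all powers of an element holds without the constant. In the same spirit, chain
  conditions on ideals are replaced throughout by counting in the finite residue ring of a nonzero
  element.\<close>

definition zscale :: "int \<Rightarrow> 'a::comm_ring_1 \<Rightarrow> 'a" where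
  "zscale k x = of_int k * x"

interpretation Zmod: Modules.module zscale
  by unfold_locales (auto simp: zscale_def algebra_simps)

lemma mult_zscale: "x * zscale k y = zscale k (x * y)"
  and zscale_mult: "zscale k x * y = zscale k (x * y)"
  by (simp_all add: zscale_def mult_ac)

text \<open>The relations make \<open>x\<close> an eigenvalue of an integer matrix, hence a root of
  its characteristic polynomial, which is monic with integer coefficients.\<close>

lemma algebraic_int_if_int_matrix:
  fixes x :: "'a::field_char_0" and v :: "nat \<Rightarrow> 'a" and A :: "nat \<Rightarrow> nat \<Rightarrow> int"
  assumes nz: "\<exists>i<n. v i \<noteq> 0"
    and eq: "\<And>i. i < n \<Longrightarrow> x * v i = (\<Sum>j<n. of_int (A i j) * v j)"
  shows "algebraic_int x"
proof -
  define M where "M = Matrix.mat n n (\<lambda>(i, j). A i j)"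
  define M' where "M' = (map_mat of_int M :: 'a mat)"
  have M: "M \<in> carrier_mat n n" "M' \<in> carrier_mat n n" by (auto simp: M_def M'_def)
  have "eigenvector M' (Matrix.vec n v) x"
    unfolding eigenvector_def
  proof (intro conjI)
    show "Matrix.vec n v \<in> carrier_vec (dim_row M')" using M by auto
    show "Matrix.vec n v \<noteq> 0\<^sub>v (dim_row M')" using nz M
      by (metis carrier_matD(1) index_vec index_zero_vec(1))
    show "M' *\<^sub>v Matrix.vec n v = x \<cdot>\<^sub>v Matrix.vec n v"
    proof (rule eq_vecI)
      fix i assume "i < dim_vec (x \<cdot>\<^sub>v Matrix.vec n v)"
      then have i: "i < n" by simp
      show "vec_index (M' *\<^sub>v Matrix.vec n v) i = vec_index (x \<cdot>\<^sub>v Matrix.vec n v) i"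
        using i eq[OF i] by (simp add: M'_def M_def scalar_prod_def atLeast0LessThan)
    qed (use M in auto)
  qed
  then have "eigenvalue M' x" unfolding eigenvalue_def by blast
  then have r: "poly (char_poly M') x = 0" using eigenvalue_root_char_poly[OF M(2)] by blast
  have c: "char_poly M' = map_poly of_int (char_poly M)"
    unfolding M'_def by (rule of_int_hom.char_poly_hom[OF M(1)])
  show ?thesis
    by (rule algebraic_int.intros[OF _ _ r])
       (use degree_monic_char_poly[OF M(2)] in \<open>auto simp: c coeff_map_poly\<close>)
qed

text \<open>For finite \<open>G\<close> containing \<open>1\<close> this certifies that
  \<open>z\<close> is integral (\<open>algebraic_int_if_Zstab\<close>). For a fixed \<open>G\<close>
  the certified elements form a ring, so closure properties reduce to finding a common
  \<open>G\<close>.\<close>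

definition Zstab :: "'a::comm_ring_1 set \<Rightarrow> 'a \<Rightarrow> bool" where
  "Zstab G z \<longleftrightarrow> (\<forall>g\<in>G. z * g \<in> Zmod.span G)"

lemma Zstab_span: assumes "Zstab G z" "s \<in> Zmod.span G" shows "z * s \<in> Zmod.span G"
proof -
  have "Zmod.subspace {s. z * s \<in> Zmod.span G}"
    by (rule Zmod.subspaceI)
(auto simp: distrib_left distrib_right mult_zscale zscale_mult intro: Zmod.span_zero Zmod.span_add Zmod.span_scale)
  moreover have "G \<subseteq> {s. z * s \<in> Zmod.span G}" using assms(1) by (auto simp: Zstab_def)
  ultimately have "Zmod.span G \<subseteq> {s. z * s \<in> Zmod.span G}" by (rule Zmod.span_minimal[rotated])
  then show ?thesis using assms(2) by blast
qed

lemma Zstab_add: "Zstab G x \<Longrightarrow> Zstab G y \<Longrightarrow> Zstab G (x + y)"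
  by (auto simp: Zstab_def distrib_right intro: Zmod.span_add)

lemma Zstab_mult: "Zstab G x \<Longrightarrow> Zstab G y \<Longrightarrow> Zstab G (x * y)"
  by (metis Zstab_def Zstab_span mult.assoc)

lemma Zstab_of_int: "Zstab G (of_int k)"
  unfolding Zstab_def using Zmod.span_scale[OF Zmod.span_base, of _ G k] by (simp add: zscale_def)

lemma algebraic_int_if_Zstab:
  fixes x :: "'a::field_char_0"
  assumes G: "finite G" "1 \<in> G" "Zstab G x"
  shows "algebraic_int x"
proof -
  obtain n :: nat and v where v: "bij_betw v {..<n} G"
    using ex_bij_betw_nat_finite[OF G(1)] by (metis atLeast0LessThan)
  have "\<exists>a. x * v i = (\<Sum>j<n. of_int (a j) * v j)" if "i < n" for i
  proof -
    have "x * v i \<in> Zmod.span G" using G(3) v that by (auto simp: Zstab_def bij_betw_def)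
    then obtain u where "x * v i = (\<Sum>g\<in>G. of_int (u g) * g)"
      unfolding Zmod.span_finite[OF G(1)] by (auto simp: zscale_def)
    also have "\<dots> = (\<Sum>j<n. of_int (u (v j)) * v j)"
      using sum.reindex_bij_betw[OF v, of "\<lambda>g. of_int (u g) * g"] by simp
    finally show ?thesis by (intro exI[of _ "\<lambda>j. u (v j)"])
  qed
  then obtain A where A: "\<And>i. i < n \<Longrightarrow> x * v i = (\<Sum>j<n. of_int (A i j) * v j)" by metis
  have "\<exists>i<n. v i \<noteq> 0" using v G(2) unfolding bij_betw_def by (metis imageE lessThan_iff zero_neq_one)
  then show ?thesis using algebraic_int_if_int_matrix A by blast
qed

text \<open>\<open>H\<close> consists of the products \<open>g * y ^ b\<close> with
  \<open>b < k\<close>; the relation rewrites the overflow \<open>y ^ k\<close>. Whatever stabilizes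
  the span of \<open>G\<close> also stabilizes that of \<open>H\<close>, so certificates are merged
  by adjoining one element at a time. As the \<open>e b\<close> only have to stabilize
  \<open>G\<close>, relations over the algebraic integers are covered too.\<close>

lemma Zstab_extend:
  fixes y :: "'a::field_char_0"
  assumes G: "finite G" "1 \<in> G" and k: "k > 0"
    and y: "y ^ k = (\<Sum>b<k. e b * y ^ b)" and e: "\<And>b. b < k \<Longrightarrow> Zstab G (e b)"
  shows "\<exists>H. finite H \<and> 1 \<in> H \<and> Zstab H y \<and> (\<forall>z. Zstab G z \<longrightarrow> Zstab H z)"
proof -
  define H where "H = (\<lambda>(g, b). g * y ^ b) ` (G \<times> {..<k})"
  have sp: "s * y ^ b \<in> Zmod.span H" if "s \<in> Zmod.span G" "b < k" for s b
  proof -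
    have "Zmod.subspace {s. s * y ^ b \<in> Zmod.span H}"
      by (rule Zmod.subspaceI)
(auto simp: distrib_left distrib_right mult_zscale zscale_mult intro: Zmod.span_zero Zmod.span_add Zmod.span_scale)
    moreover have "G \<subseteq> {s. s * y ^ b \<in> Zmod.span H}"
      using that(2) by (auto simp: H_def intro!: Zmod.span_base)
    ultimately have "Zmod.span G \<subseteq> {s. s * y ^ b \<in> Zmod.span H}" by (rule Zmod.span_minimal[rotated])
    then show ?thesis using that(1) by blast
  qed
  show ?thesis
  proof (intro exI[of _ H] conjI allI impI)
    show "finite H" using G by (simp add: H_def)
    have "1 = 1 * y ^ 0" by simp
    then show "1 \<in> H" using G k unfolding H_def by (auto intro!: image_eqI[of _ _ "(1, 0)"])
    show "Zstab H z" if z: "Zstab G z" for z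
      unfolding Zstab_def
    proof
      fix h assume "h \<in> H"
      then obtain g b where h: "h = g * y ^ b" "g \<in> G" "b < k" by (auto simp: H_def)
      have "(z * g) * y ^ b \<in> Zmod.span H" using sp z h by (auto simp: Zstab_def)
      then show "z * h \<in> Zmod.span H" by (simp add: h mult.assoc)
    qed
    show "Zstab H y"
      unfolding Zstab_def
    proof
      fix h assume "h \<in> H"
      then obtain g b where h: "h = g * y ^ b" "g \<in> G" "b < k" by (auto simp: H_def)
      show "y * h \<in> Zmod.span H"
      proof (cases "Suc b < k")
        case True
        have "g * y ^ Suc b \<in> Zmod.span H" using sp[OF Zmod.span_base True] h by blast
        then show ?thesis by (simp add: h mult_ac)
      next
        case False
        then have "Suc b = k" using h by simp
        then have "y * h = g * y ^ k" by (auto simp: h mult_ac)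
        also have "\<dots> = (\<Sum>b<k. (e b * g) * y ^ b)" by (simp add: y sum_distrib_left mult_ac)
        also have "\<dots> \<in> Zmod.span H"
          by (intro Zmod.span_sum sp) (use e h in \<open>auto simp: Zstab_def\<close>)
        finally show ?thesis .
      qed
    qed
  qed
qed

lemma algebraic_int_power_eq:
  fixes x :: "'a::field_char_0"
  assumes "algebraic_int x"
  obtains k and c :: "nat \<Rightarrow> int" where "k > 0" "x ^ k = (\<Sum>b<k. of_int (c b) * x ^ b)"
proof -
  obtain p :: "int poly" where p: "poly (map_poly of_int p) x = 0" "lead_coeff p = 1"
    using assms unfolding algebraic_int_altdef_ipoly by blast
  have "0 = (\<Sum>i\<le>degree p. of_int (coeff p i) * x ^ i)"
    using p(1) by (simp add: poly_altdef degree_map_poly coeff_map_poly)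
  also have "\<dots> = x ^ degree p + (\<Sum>i<degree p. of_int (coeff p i) * x ^ i)"
    using p(2) by (subst lessThan_Suc_atMost[symmetric]) simp
  finally have *: "x ^ degree p = (\<Sum>i<degree p. of_int (- coeff p i) * x ^ i)"
    by (simp add: sum_negf add_eq_0_iff2)
  moreover have "degree p > 0" using * by (cases "degree p = 0") auto
  ultimately show ?thesis using that[of "degree p" "\<lambda>i. - coeff p i"] by blast
qed

lemma algebraic_int_Zstab:
  fixes x :: "'a::field_char_0"
  assumes "algebraic_int x" "finite G" "1 \<in> G"
  shows "\<exists>H. finite H \<and> 1 \<in> H \<and> Zstab H x \<and> (\<forall>z. Zstab G z \<longrightarrow> Zstab H z)"
proof -
  obtain k and c :: "nat \<Rightarrow> int" where k: "k > 0" "x ^ k = (\<Sum>b<k. of_int (c b) * x ^ b)"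
    using algebraic_int_power_eq[OF assms(1)] by blast
  show ?thesis by (rule Zstab_extend[OF assms(2,3) k Zstab_of_int])
qed

section \<open>The ring of algebraic integers\<close>

lemma algebraic_int_common:
  fixes x y :: "'a::field_char_0"
  assumes "algebraic_int x" "algebraic_int y"
  obtains H where "finite H" "1 \<in> H" "Zstab H x" "Zstab H y"
proof -
  obtain G where G: "finite G" "1 \<in> G" "Zstab G x"
    using algebraic_int_Zstab[OF assms(1), of "{1}"] by blast
  show ?thesis using algebraic_int_Zstab[OF assms(2) G(1,2)] G that by blast
qed

lemma algebraic_int_add [intro]:
  fixes x y :: "'a::field_char_0"
  shows "algebraic_int x \<Longrightarrow> algebraic_int y \<Longrightarrow> algebraic_int (x + y)"
  by (metis algebraic_int_common Zstab_add algebraic_int_if_Zstab)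

lemma algebraic_int_mult [intro]:
  fixes x y :: "'a::field_char_0"
  shows "algebraic_int x \<Longrightarrow> algebraic_int y \<Longrightarrow> algebraic_int (x * y)"
  by (metis algebraic_int_common Zstab_mult algebraic_int_if_Zstab)

lemma algebraic_int_diff [intro]:
  fixes x y :: "'a::field_char_0"
  shows "algebraic_int x \<Longrightarrow> algebraic_int y \<Longrightarrow> algebraic_int (x - y)"
  using algebraic_int_add[of x "- y"] algebraic_int_minus by auto

lemma algebraic_int_sum [intro]:
  fixes f :: "'b \<Rightarrow> 'a::field_char_0"
  shows "(\<And>i. i \<in> I \<Longrightarrow> algebraic_int (f i)) \<Longrightarrow> algebraic_int (sum f I)"
  by (induction I rule: infinite_finite_induct) auto

lemma algebraic_int_power [intro]:
  fixes x :: "'a::field_char_0"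
  shows "algebraic_int x \<Longrightarrow> algebraic_int (x ^ k)"
  by (induction k) auto

text \<open>Divide an annihilating relation by its highest nonzero coefficient, at index
  \<open>d\<close>, and let \<open>k\<close> be the product of the denominators of the quotients
  \<open>c' i\<close>. Multiplying by \<open>k ^ d\<close> gives a monic relation for
  \<open>y = k * x\<close> whose coefficients \<open>- z i * k ^ (d - 1 - i)\<close> are integers,
  where \<open>z i = k * c' i\<close>.\<close>

lemma exists_int_multiple_algebraic_int:
  fixes x :: "'a::number_field"
  obtains k :: nat where "k > 0" "algebraic_int (of_nat k * x)"
proof -
  obtain N and c :: "nat \<Rightarrow> rat" where c: "\<exists>i\<le>N. c i \<noteq> 0" "(\<Sum>i\<le>N. of_rat (c i) * x ^ i) = 0"
    using algebraic_dep by blast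
  define d where "d = Max {i. i \<le> N \<and> c i \<noteq> 0}"
  have "d \<in> {i. i \<le> N \<and> c i \<noteq> 0}" unfolding d_def by (rule Max_in) (use c(1) in auto)
  then have d: "d \<le> N" "c d \<noteq> 0" by auto
  have dmax: "i \<le> d" if "i \<le> N" "c i \<noteq> 0" for i
    unfolding d_def by (rule Max_ge) (use that in auto)
  define c' where "c' i = c i / c d" for i
  have "0 = (\<Sum>i\<le>N. of_rat (c i) * x ^ i) / of_rat (c d)" using c by simp
  also have "\<dots> = (\<Sum>i\<le>N. of_rat (c' i) * x ^ i)"
    by (simp add: c'_def sum_divide_distrib of_rat_divide)
  also have "\<dots> = (\<Sum>i\<le>d. of_rat (c' i) * x ^ i)"
    by (rule sum.mono_neutral_right) (use d dmax in \<open>force simp: c'_def\<close>)+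
  also have "\<dots> = x ^ d + (\<Sum>i<d. of_rat (c' i) * x ^ i)"
    using d by (subst lessThan_Suc_atMost[symmetric]) (simp add: c'_def)
  finally have rel: "x ^ d = (\<Sum>i<d. - of_rat (c' i) * x ^ i)" by (simp add: sum_negf add_eq_0_iff2)
  define k where "k = (\<Prod>i<d. nat (snd (quotient_of (c' i))))"
  have den: "snd (quotient_of q) > 0" for q using quotient_of_denom_pos' by blast
  have k0: "k > 0" unfolding k_def using den by (auto intro!: prod_pos)
  have int: "\<exists>z. of_nat k * c' i = of_int z" if "i < d" for i
  proof -
    obtain a b where ab: "quotient_of (c' i) = (a, b)" by force
    then have b: "b > 0" "c' i = of_int a / of_int b" using den[of "c' i"] quotient_of_div by auto
    have "nat b dvd k" unfolding k_def using ab that by (metis dvd_prodI finite_lessThan lessThan_iff snd_conv)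
    then obtain m where "k = nat b * m" by blast
    then have "of_nat k * c' i = of_int (int m * a)" using b by simp
    then show ?thesis by blast
  qed
  then obtain z where z: "\<And>i. i < d \<Longrightarrow> of_nat k * c' i = of_int (z i)" by metis
  define y where "y = of_nat k * x"
  have d0: "d > 0" using rel by (cases "d = 0") auto
  have "y ^ d = (\<Sum>i<d. of_int (- z i * int k ^ (d - 1 - i)) * y ^ i)"
  proof -
    have "y ^ d = of_nat k ^ d * x ^ d" by (simp add: y_def power_mult_distrib)
    also have "\<dots> = (\<Sum>i<d. of_nat k ^ d * (- of_rat (c' i) * x ^ i))" by (simp only: rel sum_distrib_left)
    also have "\<dots> = (\<Sum>i<d. of_int (- z i * int k ^ (d - 1 - i)) * y ^ i)"
    proof (rule sum.cong[OF refl])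
      fix i assume "i \<in> {..<d}"
      then have i: "i < d" by simp
      have k1: "(of_nat k :: 'a) ^ d = of_nat k * of_nat k ^ (d - 1 - i) * of_nat k ^ i"
        using i d0 by (simp flip: power_add power_Suc)
      have k2: "of_nat k * (of_rat (c' i) :: 'a) = of_int (z i)"
        using arg_cong[OF z[OF i], of "of_rat :: rat \<Rightarrow> 'a"] by (simp add: of_rat_mult)
      have "(of_nat k :: 'a) ^ d * (- of_rat (c' i) * x ^ i)
          = - ((of_nat k * of_rat (c' i)) * of_nat k ^ (d - 1 - i)) * (of_nat k ^ i * x ^ i)"
        by (simp add: k1)
      also have "\<dots> = - (of_int (z i) * of_nat k ^ (d - 1 - i)) * (of_nat k ^ i * x ^ i)"
        by (simp only: k2)
      finally show "(of_nat k :: 'a) ^ d * (- of_rat (c' i) * x ^ i) = of_int (- z i * int k ^ (d - 1 - i)) * y ^ i"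
        by (simp add: y_def power_mult_distrib)
    qed
    finally show ?thesis .
  qed
  then have "\<exists>H. finite H \<and> 1 \<in> H \<and> Zstab H y \<and> (\<forall>z. Zstab {1} z \<longrightarrow> Zstab H z)"
    by (intro Zstab_extend[OF _ _ d0, where e = "\<lambda>i. of_int (- z i * int k ^ (d - 1 - i))"] Zstab_of_int) simp_all
  then obtain H where H: "finite H" "1 \<in> H" "Zstab H y" by blast
  then have "algebraic_int y" using algebraic_int_if_Zstab[OF H(1-3)] by simp
  then show ?thesis using that k0 by (auto simp: y_def)
qed

section \<open>Complex embeddings\<close>

definition qscale :: "rat \<Rightarrow> 'a::field_char_0 \<Rightarrow> 'a" where
  "qscale q x = of_rat q * x"

interpretation qvec: vector_space qscale
  by unfold_locales (auto simp: qscale_def of_rat_add of_rat_mult algebra_simps)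

definition cscale :: "complex \<Rightarrow> ('a \<Rightarrow> complex) \<Rightarrow> 'a \<Rightarrow> complex" where
  "cscale c f = (\<lambda>x. c * f x)"

interpretation cfun: vector_space cscale
  by unfold_locales (auto simp: cscale_def algebra_simps plus_fun_def)

lemma fun_sum_apply: "(\<Sum>i\<in>I. g i) x = (\<Sum>i\<in>I. (g i x :: complex))"
  by (induction I rule: infinite_finite_induct) (auto simp: zero_fun_def)

definition rat_linear :: "('a::number_field \<Rightarrow> complex) \<Rightarrow> bool" where
  "rat_linear f \<longleftrightarrow> (\<forall>x y. f (x + y) = f x + f y) \<and> (\<forall>q x. f (of_rat q * x) = of_rat q * f x)"

lemma rat_linear_sum: "rat_linear f \<Longrightarrow> f (\<Sum>i\<in>I. g i) = (\<Sum>i\<in>I. f (g i))"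
proof -
  assume "rat_linear f"
  then have add: "f (x + y) = f x + f y" for x y by (auto simp: rat_linear_def)
  have z: "f 0 = 0" using add[of 0 0] by simp
  show ?thesis by (induction I rule: infinite_finite_induct) (auto simp: add z)
qed

lemma embedding_hom:
  assumes "\<sigma> \<in> field_embeddings"
  shows embedding_add: "\<sigma> (x + y) = \<sigma> x + \<sigma> y" and embedding_mult: "\<sigma> (x * y) = \<sigma> x * \<sigma> y"
    and embedding_1: "\<sigma> 1 = 1" and embedding_0: "\<sigma> 0 = 0" and embedding_minus: "\<sigma> (- x) = - \<sigma> x"
    and embedding_diff: "\<sigma> (x - y) = \<sigma> x - \<sigma> y"
    and embedding_of_nat: "\<sigma> (of_nat n) = of_nat n" and embedding_of_int: "\<sigma> (of_int k) = of_int k"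
    and embedding_of_rat: "\<sigma> (of_rat q) = of_rat q"
    and embedding_eq_0_iff: "\<sigma> x = 0 \<longleftrightarrow> x = 0"
    and embedding_power: "\<sigma> (x ^ n) = \<sigma> x ^ n"
    and embedding_sum: "\<sigma> (sum g I) = (\<Sum>i\<in>I. \<sigma> (g i))"
proof -
  have add: "\<sigma> (x + y) = \<sigma> x + \<sigma> y" and mult: "\<sigma> (x * y) = \<sigma> x * \<sigma> y" and one: "\<sigma> 1 = 1" for x y
    using assms by (auto simp: field_embeddings_def)
  have z: "\<sigma> 0 = 0" using add[of 0 0] by simp
  have m: "\<sigma> (- x) = - \<sigma> x" for x using add[of x "- x"] z by (simp add: add_eq_0_iff)
  have nat: "\<sigma> (of_nat n) = of_nat n" for n by (induction n) (auto simp: z add one)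
  have int: "\<sigma> (of_int k) = of_int k" for k by (cases k rule: int_cases2) (auto simp: m nat)
  have "\<sigma> x * \<sigma> (inverse x) = 1" if "x \<noteq> 0" for x using mult[of x "inverse x"] one that by simp
  then have eq0: "\<sigma> x = 0 \<longleftrightarrow> x = 0" for x using z by (metis mult_zero_left zero_neq_one)
  obtain a b where ab: "q = of_int a / of_int b" "b \<noteq> 0"
    by (metis Rat_cases Fract_of_int_quotient less_irrefl)
  have "of_rat q * of_int b = (of_int a :: 'a)" using ab by (simp add: of_rat_divide)
  then have "\<sigma> (of_rat q) * of_int b = of_int a" by (metis int mult)
  moreover have "of_rat q * of_int b = (of_int a :: complex)" using ab by (simp add: of_rat_divide)
  ultimately show "\<sigma> (of_rat q) = of_rat q" by (metis ab(2) mult_cancel_right of_int_eq_0_iff)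
  show "\<sigma> (x + y) = \<sigma> x + \<sigma> y" "\<sigma> (x * y) = \<sigma> x * \<sigma> y" "\<sigma> 1 = 1" "\<sigma> 0 = 0" "\<sigma> (- x) = - \<sigma> x"
    "\<sigma> (of_nat n) = of_nat n" "\<sigma> (of_int k) = of_int k" "\<sigma> x = 0 \<longleftrightarrow> x = 0"
    by (fact add mult one z m nat int eq0)+
  show "\<sigma> (x - y) = \<sigma> x - \<sigma> y" using add[of x "- y"] m by simp
  show "\<sigma> (x ^ n) = \<sigma> x ^ n" by (induction n) (auto simp: mult one)
  show "\<sigma> (sum g I) = (\<Sum>i\<in>I. \<sigma> (g i))"
    by (induction I rule: infinite_finite_induct) (auto simp: add z)
qed

lemma embedding_rat_linear: "\<sigma> \<in> field_embeddings \<Longrightarrow> rat_linear \<sigma>"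
  by (simp add: rat_linear_def embedding_hom)

lemma embedding_divide: "\<sigma> \<in> field_embeddings \<Longrightarrow> \<sigma> (x / y) = \<sigma> x / \<sigma> y"
  by (cases "y = 0") (auto simp: embedding_0 nonzero_eq_divide_eq embedding_eq_0_iff simp flip: embedding_mult)

lemma embedding_algebraic_int:
  assumes "\<sigma> \<in> field_embeddings" "algebraic_int x"
  shows "algebraic_int (\<sigma> x)"
proof -
  obtain p :: "int poly" where p: "poly (map_poly of_int p) x = 0" "lead_coeff p = 1"
    using assms(2) unfolding algebraic_int_altdef_ipoly by blast
  have "poly (map_poly of_int p) (\<sigma> x) = \<sigma> (poly (map_poly of_int p) x)"
    by (simp add: poly_altdef degree_map_poly coeff_map_poly embedding_hom[OF assms(1)])
  then show ?thesis using p embedding_0[OF assms(1)] unfolding algebraic_int_altdef_ipoly by metis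
qed

interpretation of_rat_poly: map_poly_inj_idom_hom "of_rat :: rat \<Rightarrow> 'a::field_char_0" ..

subsection \<open>Every rational-linear functional is a combination of embeddings\<close>

text \<open>An annihilator of least degree works. If \<open>P = d * e\<close> with \<open>d\<close>
  the gcd of \<open>P\<close> and its derivative, then \<open>d\<close> or \<open>e\<close> kills
  \<open>b\<close>, and minimality forces \<open>d\<close> to be constant. A Bezout relation then
  excludes common complex roots of \<open>P\<close> and its derivative.\<close>

lemma separable_annihilator:
  fixes b :: "'a::number_field"
  obtains P :: "rat poly" where "P \<noteq> 0" "poly (map_poly of_rat P) b = 0"
    "rsquarefree (map_poly of_rat P :: complex poly)"
proof -
  define ann where "ann P \<longleftrightarrow> P \<noteq> 0 \<and> poly (map_poly of_rat P) b = 0" for P :: "rat poly"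
  obtain N and c :: "nat \<Rightarrow> rat" where c: "\<exists>i\<le>N. c i \<noteq> 0" "(\<Sum>i\<le>N. of_rat (c i) * b ^ i) = 0"
    using algebraic_dep by blast
  define P0 where "P0 = (\<Sum>i\<le>N. monom (c i) i)"
  have cP: "coeff P0 i = (if i \<le> N then c i else 0)" for i
    by (auto simp: P0_def coeff_sum)
  have "poly (map_poly of_rat P0) b = (\<Sum>i\<le>N. of_rat (c i) * b ^ i)"
    unfolding P0_def of_rat_poly.hom_sum poly_sum by (simp add: of_rat_hom.map_poly_hom_monom poly_monom)
  then have "ann P0" using c cP unfolding ann_def by (metis coeff_0)
  then obtain P where P: "ann P" and Pmin: "\<And>R. ann R \<Longrightarrow> degree P \<le> degree R"
    using ex_has_least_nat[of ann P0 degree] by blast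
  have dP: "degree P > 0"
  proof (rule ccontr)
    assume "\<not> degree P > 0"
    then obtain a where "P = [:a:]" by (metis degree_eq_zeroE gr0I)
    then show False using P by (auto simp: ann_def of_rat_hom.map_poly_pCons_hom)
  qed
  define d where "d = gcd P (pderiv P)"
  have pd: "pderiv P \<noteq> 0" using dP by (simp add: pderiv_eq_0_iff)
  have "degree (pderiv P) < degree P" using dP by (simp add: degree_pderiv)
  moreover have "degree d \<le> degree (pderiv P)" unfolding d_def using pd by (intro dvd_imp_degree_le) auto
  ultimately have dd: "degree d < degree P" by simp
  have d0: "d \<noteq> 0" using pd by (simp add: d_def)
  obtain e where e: "P = d * e" unfolding d_def by (metis gcd_dvd1 dvdE)
  have e0: "e \<noteq> 0" using P e by (auto simp: ann_def)
  have "poly (map_poly of_rat d) b * poly (map_poly of_rat e) b = 0"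
    using P unfolding ann_def e by (simp add: of_rat_poly.hom_mult)
  then have "ann d \<or> ann e" using d0 e0 by (auto simp: ann_def)
  then have "ann e" using Pmin dd by fastforce
  then have "degree e \<ge> degree P" by (rule Pmin)
  then have "degree d = 0" using e d0 e0 by (simp add: degree_mult_eq)
  then obtain k where k: "d = [:k:]" "k \<noteq> 0" using d0 by (metis degree_eq_zeroE pCons_0_0)
  obtain u v where uv: "u * P + v * pderiv P = [:k:]"
    using bezout_coefficients_fst_snd[of P "pderiv P"] k by (auto simp: d_def)
  have "\<not> (poly (map_poly of_rat P) a = 0 \<and> poly (pderiv (map_poly of_rat P)) a = 0)" for a :: complex
  proof
    assume a: "poly (map_poly of_rat P) a = 0 \<and> poly (pderiv (map_poly of_rat P)) a = 0"
    have "poly (map_poly of_rat (u * P + v * pderiv P)) a = 0"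
      using a by (simp add: of_rat_poly.hom_add of_rat_poly.hom_mult of_rat_hom.map_poly_pderiv)
    then show False using k unfolding uv by (simp add: of_rat_hom.map_poly_pCons_hom)
  qed
  then have "rsquarefree (map_poly of_rat P :: complex poly)" by (simp add: rsquarefree_roots)
  then show ?thesis using that P by (auto simp: ann_def)
qed

text \<open>The functional \<open>p(T) f\<close>, where \<open>T f\<close> is
  \<open>\<lambda>x. f (b * x)\<close>.\<close>

definition poly_act :: "'a \<Rightarrow> complex poly \<Rightarrow> ('a::number_field \<Rightarrow> complex) \<Rightarrow> 'a \<Rightarrow> complex" where
  "poly_act b p f x = (\<Sum>i\<le>degree p. coeff p i * f (b ^ i * x))"

lemma poly_act_bound: "degree p \<le> N \<Longrightarrow> poly_act b p f x = (\<Sum>i\<le>N. coeff p i * f (b ^ i * x))"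
  unfolding poly_act_def by (rule sum.mono_neutral_left) (auto intro: coeff_eq_0)

lemma poly_act_linear_factor:
  "poly_act b ([:- a, 1:] * q) f x = poly_act b q (\<lambda>x. f (b * x) - a * f x) x"
proof -
  define N where "N = degree q"
  have "degree ([:- a, 1:] * q) \<le> degree [:- a, 1:] + degree q" by (rule degree_mult_le)
  then have "degree ([:- a, 1:] * q) \<le> Suc N" by (simp add: N_def)
  then have "poly_act b ([:- a, 1:] * q) f x = (\<Sum>i\<le>Suc N. coeff ([:- a, 1:] * q) i * f (b ^ i * x))"
    by (rule poly_act_bound)
  also have "\<dots> = (\<Sum>i\<le>Suc N. coeff (pCons 0 q) i * f (b ^ i * x)) - a * (\<Sum>i\<le>Suc N. coeff q i * f (b ^ i * x))"
    by (simp add: sum_subtractf sum_distrib_left algebra_simps del: sum.atMost_Suc)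
  also have "(\<Sum>i\<le>Suc N. coeff (pCons 0 q) i * f (b ^ i * x)) = (\<Sum>i\<le>N. coeff q i * f (b ^ i * (b * x)))"
    by (subst sum.atMost_Suc_shift) (simp add: mult_ac)
  also have "(\<Sum>i\<le>Suc N. coeff q i * f (b ^ i * x)) = (\<Sum>i\<le>N. coeff q i * f (b ^ i * x))"
    using coeff_eq_0[of q "Suc N"] by (simp add: N_def)
  finally show ?thesis
    by (simp add: poly_act_def N_def sum_subtractf sum_distrib_left algebra_simps)
qed

lemma rat_linear_cmult: "rat_linear f \<Longrightarrow> rat_linear (\<lambda>x. c * f x)"
  by (auto simp: rat_linear_def algebra_simps)

lemma rat_linear_diff: "rat_linear f \<Longrightarrow> rat_linear g \<Longrightarrow> rat_linear (\<lambda>x. f x - g x)"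
  by (auto simp: rat_linear_def algebra_simps)

lemma rat_linear_sum_fun: "(\<And>i. i \<in> I \<Longrightarrow> rat_linear (g i)) \<Longrightarrow> rat_linear (\<lambda>x. \<Sum>i\<in>I. g i x)"
  by (auto simp: rat_linear_def sum.distrib sum_distrib_left)

lemma rat_linear_mult_arg: "rat_linear f \<Longrightarrow> rat_linear (\<lambda>x. f (b * x))"
  by (auto simp: rat_linear_def distrib_left mult.left_commute[of b])

text \<open>Let \<open>T f\<close> be \<open>\<lambda>x. f (b * x)\<close>. For a new root
  \<open>a\<close>, the functional \<open>g = (T - a) f\<close> is killed by the other factors and
  splits by induction. Dividing its \<open>z\<close>-component by \<open>z - a\<close> gives the
  \<open>z\<close>-component of \<open>f\<close>, and the remainder \<open>h\<close> of
  \<open>f\<close> satisfies \<open>(T - a) h = 0\<close>. Multiplications commute, so the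
  eigenvalues \<open>l s\<close> survive.\<close>

lemma eigen_decomposition:
  assumes "finite Z" "rat_linear f" "\<And>s x. s \<in> S \<Longrightarrow> f (s * x) = l s * f x"
    and "\<And>x. poly_act b (\<Prod>z\<in>Z. [:- z, 1:]) f x = 0"
  shows "\<exists>G. (\<forall>x. f x = (\<Sum>z\<in>Z. G z x)) \<and>
    (\<forall>z\<in>Z. rat_linear (G z) \<and> (\<forall>s\<in>S. \<forall>x. G z (s * x) = l s * G z x) \<and> (\<forall>x. G z (b * x) = z * G z x))"
  using assms
proof (induction Z arbitrary: f rule: finite_induct)
  case empty
  then have "f x = 0" for x by (simp add: poly_act_def)
  then show ?case by simp
next
  case (insert a Z)
  define g where "g x = f (b * x) - a * f x" for x
  have g1: "rat_linear g" unfolding g_def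
    by (intro rat_linear_diff rat_linear_cmult rat_linear_mult_arg insert.prems)
  have g2: "g (s * x) = l s * g x" if "s \<in> S" for s x
  proof -
    have "b * (s * x) = s * (b * x)" by (rule mult.left_commute)
    then have "f (b * (s * x)) = f (s * (b * x))" by (rule arg_cong)
    then have "f (b * (s * x)) = l s * f (b * x)" unfolding insert.prems(2)[OF that] .
    then show ?thesis by (simp only: g_def insert.prems(2)[OF that] right_diff_distrib mult.left_commute[of a])
  qed
  have g3: "poly_act b (\<Prod>z\<in>Z. [:- z, 1:]) g x = 0" for x
    using insert.prems(3)[of x] insert.hyps unfolding g_def
    by (simp only: prod.insert poly_act_linear_factor not_False_eq_True)
  obtain G where G: "\<And>x. g x = (\<Sum>z\<in>Z. G z x)"
    "\<And>z. z \<in> Z \<Longrightarrow> rat_linear (G z)" "\<And>z s x. z \<in> Z \<Longrightarrow> s \<in> S \<Longrightarrow> G z (s * x) = l s * G z x"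
    "\<And>z x. z \<in> Z \<Longrightarrow> G z (b * x) = z * G z x"
    using insert.IH[OF g1 g2 g3] by blast
  define H where "H z x = inverse (z - a) * G z x" for z x
  define h where "h x = f x - (\<Sum>z\<in>Z. H z x)" for x
  have H: "rat_linear (H z)" "s \<in> S \<Longrightarrow> H z (s * x) = l s * H z x" "H z (b * x) = z * H z x" if "z \<in> Z" for z s x
    unfolding H_def using G(2-4)[OF that] by (auto intro: rat_linear_cmult)
  have h: "rat_linear h" unfolding h_def by (intro rat_linear_diff rat_linear_sum_fun insert.prems H)
  have hS: "h (s * x) = l s * h x" if "s \<in> S" for s x
  proof -
    have "(\<Sum>z\<in>Z. H z (s * x)) = (\<Sum>z\<in>Z. l s * H z x)" using H(2) that by (intro sum.cong) auto
    then show ?thesis by (simp add: h_def insert.prems(2)[OF that] right_diff_distrib sum_distrib_left)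
  qed
  have hb: "h (b * x) = a * h x" for x
  proof -
    have "h (b * x) - a * h x = g x - (\<Sum>z\<in>Z. (z - a) * H z x)"
    proof -
      have "(\<Sum>z\<in>Z. H z (b * x)) = (\<Sum>z\<in>Z. z * H z x)" using H(3) by (intro sum.cong) auto
      then show ?thesis by (simp add: h_def g_def right_diff_distrib left_diff_distrib sum_distrib_left sum_subtractf)
    qed
    also have "(\<Sum>z\<in>Z. (z - a) * H z x) = (\<Sum>z\<in>Z. G z x)"
    proof (rule sum.cong[OF refl])
      fix z assume "z \<in> Z"
      then have "z - a \<noteq> 0" using insert.hyps by auto
      then show "(z - a) * H z x = G z x" by (simp add: H_def flip: mult.assoc)
    qed
    finally show ?thesis using G(1) by simp
  qed
  have *: "f x = (\<Sum>z\<in>insert a Z. (if z = a then h else H z) x)" for x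
  proof -
    have "(\<Sum>z\<in>Z. (if z = a then h else H z) x) = (\<Sum>z\<in>Z. H z x)"
      using insert.hyps by (intro sum.cong) auto
    then show ?thesis using insert.hyps by (simp add: h_def)
  qed
  show ?case
    by (rule exI[of _ "\<lambda>z. if z = a then h else H z"]) (use * h hS hb H in \<open>auto split: if_splits\<close>)
qed

text \<open>Simultaneous diagonalization: multiplication by each element satisfies a separable
  polynomial, so it splits every functional into eigenfunctionals without disturbing the eigenvalues
  for the elements treated before.\<close>

lemma in_cfun_span_eigen:
  fixes f :: "'a::number_field \<Rightarrow> complex"
  assumes "finite S" "rat_linear f"
  shows "f \<in> cfun.span {h. rat_linear h \<and> (\<exists>l. \<forall>s\<in>S. \<forall>x. h (s * x) = l s * h x)}"
  using assms(1)
proof (induction S rule: finite_induct)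
  case empty
  show ?case using assms(2) by (intro cfun.span_base) auto
next
  case (insert b S)
  let ?E = "\<lambda>S. {h. rat_linear h \<and> (\<exists>l. \<forall>s\<in>S. \<forall>x. h (s * x) = l s * h x)}"
  have "?E S \<subseteq> cfun.span (?E (insert b S))"
  proof
    fix h assume "h \<in> ?E S"
    then obtain l where h: "rat_linear h" "\<And>s x. s \<in> S \<Longrightarrow> h (s * x) = l s * h x" by auto
    obtain P :: "rat poly" where P: "P \<noteq> 0" "poly (map_poly of_rat P) b = 0"
      "rsquarefree (map_poly of_rat P :: complex poly)"
      using separable_annihilator by blast
    let ?P = "map_poly of_rat P :: complex poly"
    define Z where "Z = {z. poly ?P z = 0}"
    have P0: "?P \<noteq> 0" using P(1) by simp
    then have Z: "finite Z" unfolding Z_def by (rule poly_roots_finite)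
    have dec: "?P = smult (lead_coeff ?P) (\<Prod>z\<in>Z. [:- z, 1:])"
      using complex_poly_decompose_rsquarefree[OF P(3)] by (simp add: Z_def)
    define R where "R = (\<Prod>z\<in>Z. [:- z, 1:])"
    have lc: "lead_coeff ?P \<noteq> 0" using P0 by simp
    have "lead_coeff ?P * poly_act b R h x = 0" for x
    proof -
      have "h 0 = 0" using h(1) unfolding rat_linear_def by (metis add_cancel_right_right)
      then have "0 = h (poly (map_poly of_rat P) b * x)" using P(2) by simp
      also have "\<dots> = poly_act b ?P h x"
        using h(1) unfolding poly_act_def poly_altdef sum_distrib_right rat_linear_sum[OF h(1)]
        by (auto simp: degree_map_poly coeff_map_poly rat_linear_def mult.assoc intro!: sum.cong)
      also have "\<dots> = lead_coeff ?P * poly_act b R h x"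
        using lc by (subst (1) dec) (simp add: poly_act_def R_def sum_distrib_left mult.assoc)
      finally show ?thesis by simp
    qed
    then have act0: "poly_act b (\<Prod>z\<in>Z. [:- z, 1:]) h x = 0" for x using lc by (simp add: R_def)
    have "\<exists>G. (\<forall>x. h x = (\<Sum>z\<in>Z. G z x)) \<and>
        (\<forall>z\<in>Z. rat_linear (G z) \<and> (\<forall>s\<in>S. \<forall>x. G z (s * x) = l s * G z x) \<and> (\<forall>x. G z (b * x) = z * G z x))"
      by (rule eigen_decomposition[where b = b and S = S and l = l, OF Z h(1)]) (use h(2) act0 in simp_all)
    then obtain G where G0: "\<forall>x. h x = (\<Sum>z\<in>Z. G z x)"
      "\<forall>z\<in>Z. rat_linear (G z) \<and> (\<forall>s\<in>S. \<forall>x. G z (s * x) = l s * G z x) \<and> (\<forall>x. G z (b * x) = z * G z x)"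
      by (elim exE conjE)
    then have G: "\<And>x. h x = (\<Sum>z\<in>Z. G z x)"
      "\<And>z. z \<in> Z \<Longrightarrow> rat_linear (G z)" "\<And>z s x. z \<in> Z \<Longrightarrow> s \<in> S \<Longrightarrow> G z (s * x) = l s * G z x"
      "\<And>z x. z \<in> Z \<Longrightarrow> G z (b * x) = z * G z x"
      by simp_all
    have "h = (\<Sum>z\<in>Z. G z)" by (rule ext) (simp add: G(1) fun_sum_apply)
    moreover have GE: "G z \<in> ?E (insert b S)" if "z \<in> Z" for z
    proof -
      have "\<forall>s\<in>insert b S. \<forall>x. G z (s * x) = (if s = b then z else l s) * G z x"
        using G(3,4)[OF \<open>z \<in> Z\<close>] by auto
      then have "\<exists>l. \<forall>s\<in>insert b S. \<forall>x. G z (s * x) = l s * G z x"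
        by (rule exI[of _ "\<lambda>s. if s = b then z else l s"])
      then show ?thesis using G(2)[OF that] by simp
    qed
    moreover have "(\<Sum>z\<in>Z. G z) \<in> cfun.span (?E (insert b S))"
      by (intro cfun.span_sum cfun.span_base GE)
    ultimately show "h \<in> cfun.span (?E (insert b S))" by simp
  qed
  then have "cfun.span (?E S) \<subseteq> cfun.span (?E (insert b S))"
    by (rule cfun.span_minimal) simp
  then show ?case using insert.IH by blast
qed

text \<open>Since \<open>B\<close> spans \<open>F\<close> over the rationals, a common
  eigenfunctional \<open>h\<close> of the multiplications by \<open>B\<close> is one for all of
  \<open>F\<close>. Evaluation at \<open>1\<close> shows that \<open>h\<close> is \<open>h 1\<close>
  times its eigenvalue function \<open>m\<close>, and \<open>m\<close> is an embedding unless
  \<open>h\<close> vanishes.\<close>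

theorem rat_linear_in_span_embeddings:
  fixes f :: "'a::number_field \<Rightarrow> complex"
  assumes "rat_linear f"
  shows "f \<in> cfun.span field_embeddings"
proof -
  obtain B :: "'a set" where B: "finite B" "\<And>x. \<exists>c. x = (\<Sum>b\<in>B. of_rat (c b) * b)"
    using finite_over_rat by metis
  let ?E = "{h. rat_linear h \<and> (\<exists>l. \<forall>s\<in>B. \<forall>x. h (s * x) = l s * h x)}"
  have "?E \<subseteq> cfun.span field_embeddings"
  proof
    fix h assume "h \<in> ?E"
    then obtain l where h: "rat_linear h" "\<And>s x. s \<in> B \<Longrightarrow> h (s * x) = l s * h x" by auto
    have "\<exists>m. \<forall>x. h (a * x) = m * h x" for a
    proof -
      obtain c where c: "a = (\<Sum>b\<in>B. of_rat (c b) * b)" using B(2) by blast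
      have "h (a * x) = (\<Sum>b\<in>B. of_rat (c b) * l b) * h x" for x
      proof -
        have "h (a * x) = (\<Sum>b\<in>B. h (of_rat (c b) * (b * x)))"
          unfolding c sum_distrib_right rat_linear_sum[OF h(1)] by (simp add: mult.assoc)
        also have "\<dots> = (\<Sum>b\<in>B. of_rat (c b) * (l b * h x))"
          using h by (intro sum.cong refl) (auto simp: rat_linear_def)
        finally show ?thesis by (simp add: sum_distrib_right mult.assoc)
      qed
      then show ?thesis by blast
    qed
    then obtain m where m: "\<And>a x. h (a * x) = m a * h x" by metis
    show "h \<in> cfun.span field_embeddings"
    proof (cases "h 1 = 0")
      case True
      have "h = 0"
      proof
        fix x show "h x = 0 x" using m[of x 1] True by simp
      qed
      then show ?thesis by (simp add: cfun.span_zero)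
    next
      case False
      have "m \<in> field_embeddings"
        unfolding field_embeddings_def mem_Collect_eq
      proof (intro conjI allI)
        show "m 1 = 1" using m[of 1 1] False by simp
        show "m (x + y) = m x + m y" for x y
        proof -
          have "m (x + y) * h 1 = (m x + m y) * h 1"
            using m[of "x + y" 1] m[of x 1] m[of y 1] h(1) by (simp add: rat_linear_def distrib_right)
          then show ?thesis using False by simp
        qed
        show "m (x * y) = m x * m y" for x y
          using m[of "x * y" 1] m[of x y] m[of y 1] False by simp
      qed
      then have "cscale (h 1) m \<in> cfun.span field_embeddings"
        by (intro cfun.span_scale cfun.span_base)
      moreover have "h = cscale (h 1) m"
      proof
        fix x show "h x = cscale (h 1) m x" using m[of x 1] by (simp add: cscale_def)
      qed
      ultimately show ?thesis by simp
    qed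
  qed
  then have "cfun.span ?E \<subseteq> cfun.span field_embeddings" by (rule cfun.span_minimal) simp
  then show ?thesis using in_cfun_span_eigen[OF B(1) assms] by blast
qed

text \<open>Dedekind's argument: subtracting \<open>\<tau> y\<close> times the relation at
  \<open>x\<close> from the relation at \<open>x * y\<close> removes \<open>\<tau>\<close>, so
  \<open>c \<sigma> * (\<sigma> y - \<tau> y) = 0\<close> for all \<open>y\<close>, and an embedding
  other than \<open>\<tau>\<close> differs from it at some \<open>y\<close>.\<close>

lemma embeddings_independent_aux:
  assumes "finite T" "T \<subseteq> field_embeddings" "\<And>x. (\<Sum>\<sigma>\<in>T. c \<sigma> * \<sigma> x) = 0"
  shows "\<forall>\<sigma>\<in>T. c \<sigma> = 0"
  using assms
proof (induction T arbitrary: c rule: finite_induct)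
  case (insert \<tau> T)
  have e: "\<sigma> (x * y) = \<sigma> x * \<sigma> y" if "\<sigma> \<in> insert \<tau> T" for \<sigma> x y
    using that insert.prems(1) embedding_mult by blast
  have rel: "c \<tau> * \<tau> x + (\<Sum>\<sigma>\<in>T. c \<sigma> * \<sigma> x) = 0" for x
    using insert.prems(2)[of x] insert.hyps by simp
  have "c \<sigma> * (\<sigma> y - \<tau> y) = 0" if "\<sigma> \<in> T" for \<sigma> y
  proof -
    have "(\<Sum>\<sigma>\<in>T. c \<sigma> * (\<sigma> y - \<tau> y) * \<sigma> x) = 0" for x
    proof -
      have "(\<Sum>\<sigma>\<in>T. c \<sigma> * (\<sigma> y - \<tau> y) * \<sigma> x) = (\<Sum>\<sigma>\<in>T. c \<sigma> * \<sigma> (x * y)) - \<tau> y * (\<Sum>\<sigma>\<in>T. c \<sigma> * \<sigma> x)"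
      proof -
        have "(\<Sum>\<sigma>\<in>T. c \<sigma> * \<sigma> (x * y)) = (\<Sum>\<sigma>\<in>T. c \<sigma> * (\<sigma> x * \<sigma> y))"
          using e by (intro sum.cong) auto
        then show ?thesis by (simp add: sum_subtractf sum_distrib_left algebra_simps)
      qed
      also have "\<dots> = - (c \<tau> * \<tau> (x * y)) + \<tau> y * (c \<tau> * \<tau> x)"
        using rel[of "x * y"] rel[of x] by (simp add: add_eq_0_iff)
      also have "\<dots> = 0" using e[of \<tau> x y] by simp
      finally show ?thesis .
    qed
    then show ?thesis using insert.IH[of "\<lambda>\<sigma>. c \<sigma> * (\<sigma> y - \<tau> y)"] insert.prems(1) that by blast
  qed
  then have T0: "c \<sigma> = 0" if "\<sigma> \<in> T" for \<sigma>
    using that insert.hyps(2) by (metis ext mult_eq_0_iff right_minus_eq)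
  moreover have "c \<tau> = 0" using rel[of 1] T0 embedding_1[of \<tau>] insert.prems(1) by simp
  ultimately show ?case by blast
qed simp

lemma embeddings_independent: "cfun.independent (field_embeddings :: ('a::number_field \<Rightarrow> complex) set)"
proof (rule ccontr)
  assume "\<not> cfun.independent (field_embeddings :: ('a \<Rightarrow> complex) set)"
  then obtain T u v where T: "finite T" "T \<subseteq> (field_embeddings :: ('a \<Rightarrow> complex) set)"
    "(\<Sum>\<sigma>\<in>T. cscale (u \<sigma>) \<sigma>) = 0" "v \<in> T" "u v \<noteq> 0"
    unfolding cfun.dependent_explicit by blast
  have "(\<Sum>\<sigma>\<in>T. u \<sigma> * \<sigma> x) = 0" for x
    using fun_cong[OF T(3), of x] by (simp add: fun_sum_apply cscale_def)
  then show False using embeddings_independent_aux[OF T(1,2), of u] T(4,5) by blast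
qed

subsection \<open>A rational basis of integers and the trace form\<close>

lemma ex_integral_basis:
  "\<exists>E. finite E \<and> qvec.independent E \<and> qvec.span E = (UNIV :: 'a::number_field set) \<and> (\<forall>e\<in>E. algebraic_int e)"
proof -
  obtain B :: "'a set" where B: "finite B" "\<And>x. \<exists>c. x = (\<Sum>b\<in>B. of_rat (c b) * b)"
    using finite_over_rat by metis
  have "\<forall>b. \<exists>k::nat. k > 0 \<and> algebraic_int (of_nat k * b :: 'a)"
    using exists_int_multiple_algebraic_int by metis
  then obtain k :: "'a \<Rightarrow> nat" where k: "\<And>b. k b > 0" "\<And>b. algebraic_int (of_nat (k b) * b)" by metis
  define B' where "B' = (\<lambda>b. of_nat (k b) * b) ` B"
  have k0: "k b \<noteq> 0" for b using k(1)[of b] by simp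
  have "x \<in> qvec.span B'" for x
  proof -
    obtain c where "x = (\<Sum>b\<in>B. of_rat (c b) * b)" using B(2) by blast
    also have "\<dots> = (\<Sum>b\<in>B. qscale (c b / of_nat (k b)) (of_nat (k b) * b))"
      by (intro sum.cong) (auto simp: qscale_def of_rat_divide k0)
    also have "\<dots> \<in> qvec.span B'" by (intro qvec.span_sum qvec.span_scale qvec.span_base) (auto simp: B'_def)
    finally show ?thesis .
  qed
  then have sp: "qvec.span B' = UNIV" by blast
  obtain E where E: "E \<subseteq> B'" "qvec.independent E" "B' \<subseteq> qvec.span E"
    using qvec.maximal_independent_subset by metis
  have "qvec.span B' \<subseteq> qvec.span E" using E(3) by (rule qvec.span_minimal) simp
  then have "qvec.span E = UNIV" using sp by blast
  then show ?thesis using E B(1) k(2) finite_subset[OF E(1)] by (intro exI[of _ E]) (auto simp: B'_def)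
qed

text \<open>A rational basis of \<open>F\<close> made of integers. It need not generate the integers
  as a group, which is why later counts carry constants.\<close>

definition integral_basis :: "'a::number_field set" where
  "integral_basis = (SOME E. finite E \<and> qvec.independent E \<and> qvec.span E = UNIV \<and> (\<forall>e\<in>E. algebraic_int e))"

lemma integral_basis:
  shows finite_integral_basis: "finite (integral_basis :: 'a::number_field set)"
    and independent_integral_basis: "qvec.independent (integral_basis :: 'a set)"
    and span_integral_basis: "qvec.span integral_basis = (UNIV :: 'a set)"
    and integral_basis_algebraic_int: "\<And>e. e \<in> integral_basis \<Longrightarrow> algebraic_int (e :: 'a)"
  using someI_ex[OF ex_integral_basis, folded integral_basis_def] by auto

definition coord :: "'a::number_field \<Rightarrow> 'a \<Rightarrow> rat" where
  "coord x e = qvec.representation integral_basis x e"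

lemma coord_add: "coord (x + y) e = coord x e + coord y e"
  unfolding coord_def by (rule qvec.representation_add[OF independent_integral_basis, THEN fun_cong]) (auto simp: span_integral_basis)

lemma coord_scale: "coord (of_rat q * x) e = q * coord x e"
  unfolding coord_def using qvec.representation_scale[OF independent_integral_basis, of x q, THEN fun_cong, of e]
  by (auto simp: span_integral_basis qscale_def)

lemma coord_basis: "e \<in> integral_basis \<Longrightarrow> e' \<in> integral_basis \<Longrightarrow> coord e e' = (if e' = e then 1 else 0)"
  unfolding coord_def by (simp add: qvec.representation_basis[OF independent_integral_basis])

lemma coord_expand: "x = (\<Sum>e\<in>integral_basis. of_rat (coord x e) * e)"
  unfolding coord_def
  using qvec.sum_representation_eq[OF independent_integral_basis _ finite_integral_basis subset_refl, of x]
  by (simp add: span_integral_basis qscale_def)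

lemma rat_linear_coord: "rat_linear (\<lambda>x. of_rat (coord x e))"
  by (simp add: rat_linear_def coord_add coord_scale of_rat_add of_rat_mult)

lemma rat_linear_expand:
  assumes "rat_linear f" shows "f x = (\<Sum>e\<in>integral_basis. f e * of_rat (coord x e))"
proof -
  have "f x = f (\<Sum>e\<in>integral_basis. of_rat (coord x e) * e)" using coord_expand[of x] by simp
  also have "\<dots> = (\<Sum>e\<in>integral_basis. of_rat (coord x e) * f e)"
    using assms unfolding rat_linear_sum[OF assms] by (simp add: rat_linear_def)
  finally show ?thesis by (simp add: mult.commute)
qed

text \<open>Coordinate functionals and embeddings are two linearly independent families with the
  same complex span, so they are equally many.\<close>

lemma finite_embeddings: "finite (field_embeddings :: ('a::number_field \<Rightarrow> complex) set)"
  and card_integral_basis: "card (integral_basis :: 'a set) = card (field_embeddings :: ('a \<Rightarrow> complex) set)"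
proof -
  let ?f = "\<lambda>e x::'a. of_rat (coord x e) :: complex"
  let ?D = "?f ` integral_basis"
  have inj: "inj_on ?f integral_basis"
  proof (rule inj_onI)
    fix d e :: 'a assume de: "d \<in> integral_basis" "e \<in> integral_basis" "?f d = ?f e"
    have "coord d d = coord d e" using fun_cong[OF de(3), of d] by simp
    then show "d = e" using coord_basis[OF de(1) de(1)] coord_basis[OF de(1) de(2)] by (simp split: if_splits)
  qed
  have fin: "finite ?D" by (simp add: finite_integral_basis)
  have "field_embeddings \<subseteq> cfun.span ?D"
  proof
    fix \<sigma> :: "'a \<Rightarrow> complex" assume "\<sigma> \<in> field_embeddings"
    then have "\<sigma> = (\<Sum>e\<in>integral_basis. cscale (\<sigma> e) (?f e))"
      using rat_linear_expand[OF embedding_rat_linear] by (intro ext) (simp add: fun_sum_apply cscale_def)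
    also have "\<dots> \<in> cfun.span ?D" by (intro cfun.span_sum cfun.span_scale cfun.span_base) auto
    finally show "\<sigma> \<in> cfun.span ?D" .
  qed
  from cfun.independent_span_bound[OF fin embeddings_independent this]
  have 1: "finite (field_embeddings :: ('a \<Rightarrow> complex) set)" "card (field_embeddings :: ('a \<Rightarrow> complex) set) \<le> card ?D"
    by auto
  then show "finite (field_embeddings :: ('a \<Rightarrow> complex) set)" by blast
  have "cfun.independent ?D"
  proof (rule ccontr)
    assume "\<not> cfun.independent ?D"
    then obtain u where u: "\<exists>v\<in>?D. u v \<noteq> 0" "(\<Sum>v\<in>?D. cscale (u v) v) = 0"
      using cfun.dependent_finite[OF fin] by auto
    then obtain d where d: "d \<in> integral_basis" "u (?f d) \<noteq> 0" by blast
    have "0 = (\<Sum>v\<in>?D. cscale (u v) v) d" using u by simp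
    also have "\<dots> = (\<Sum>e\<in>integral_basis. u (?f e) * ?f e d)"
      unfolding sum.reindex[OF inj] by (simp add: fun_sum_apply cscale_def)
    also have "\<dots> = (\<Sum>e\<in>integral_basis. if e = d then u (?f e) else 0)"
      by (intro sum.cong) (auto simp: coord_basis[OF d(1)])
    also have "\<dots> = u (?f d)" using d by (simp add: sum.delta[OF finite_integral_basis])
    finally show False using d by simp
  qed
  moreover have "?D \<subseteq> cfun.span field_embeddings"
    using rat_linear_in_span_embeddings rat_linear_coord by blast
  ultimately have "card ?D \<le> card (field_embeddings :: ('a \<Rightarrow> complex) set)"
    using cfun.independent_span_bound[OF 1(1)] by blast
  with 1 show "card (integral_basis :: 'a set) = card (field_embeddings :: ('a \<Rightarrow> complex) set)"
    by (simp add: card_image[OF inj])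
qed

text \<open>As a function of \<open>e\<close> and the embedding, this is the inverse of the matrix
  with entries \<open>\<sigma> e\<close>.\<close>

definition dual_coeff :: "'a::number_field \<Rightarrow> ('a \<Rightarrow> complex) \<Rightarrow> complex" where
  "dual_coeff e = (SOME u. \<forall>x. of_rat (coord x e) = (\<Sum>\<sigma>\<in>field_embeddings. u \<sigma> * \<sigma> x))"

lemma coord_eq: "of_rat (coord x e) = (\<Sum>\<sigma>\<in>field_embeddings. dual_coeff e \<sigma> * \<sigma> x)"
proof -
  have "(\<lambda>x. of_rat (coord x e) :: complex) \<in> cfun.span field_embeddings"
    by (rule rat_linear_in_span_embeddings[OF rat_linear_coord])
  then obtain u where "(\<lambda>x. of_rat (coord x e) :: complex) = (\<Sum>\<sigma>\<in>field_embeddings. cscale (u \<sigma>) \<sigma>)"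
    unfolding cfun.span_finite[OF finite_embeddings] by auto
  then have "\<exists>u. \<forall>x. of_rat (coord x e) = (\<Sum>\<sigma>\<in>field_embeddings. u \<sigma> * \<sigma> x)"
    by (auto simp: fun_eq_iff fun_sum_apply cscale_def)
  from someI_ex[OF this] show ?thesis unfolding dual_coeff_def by blast
qed

text \<open>The sum equals the trace \<open>\<Sum>e. coord (x * e) e\<close> of multiplication by
  \<open>x\<close> in the rational basis. The fact \<open>1\<close> says that
  \<open>\<sigma> e\<close> and \<open>dual_coeff e \<tau>\<close> are inverse matrices, which
  converts one expression into the other.\<close>

lemma trace_rational: "(\<Sum>\<sigma>\<in>field_embeddings. \<sigma> x) \<in> \<rat>"
proof -
  have 1: "(\<Sum>e\<in>integral_basis. \<sigma> e * dual_coeff e \<tau>) = (if \<tau> = \<sigma> then 1 else 0)"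
    if "\<sigma> \<in> field_embeddings" "\<tau> \<in> field_embeddings" for \<sigma> \<tau> :: "'a \<Rightarrow> complex"
  proof -
    let ?c = "\<lambda>\<tau>. (\<Sum>e\<in>integral_basis. \<sigma> e * dual_coeff e \<tau>) - (if \<tau> = \<sigma> then 1 else 0)"
    have "(\<Sum>\<tau>\<in>field_embeddings. ?c \<tau> * \<tau> y) = 0" for y
    proof -
      have "\<sigma> y = (\<Sum>e\<in>integral_basis. \<sigma> e * (\<Sum>\<tau>\<in>field_embeddings. dual_coeff e \<tau> * \<tau> y))"
        using rat_linear_expand[OF embedding_rat_linear[OF that(1)], of y] by (simp add: coord_eq)
      also have "\<dots> = (\<Sum>\<tau>\<in>field_embeddings. (\<Sum>e\<in>integral_basis. \<sigma> e * dual_coeff e \<tau>) * \<tau> y)"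
        by (simp add: sum_distrib_left sum_distrib_right mult.assoc) (rule sum.swap)
      moreover have "(\<Sum>\<tau>\<in>field_embeddings. (if \<tau> = \<sigma> then 1 else 0) * \<tau> y) = \<sigma> y"
        using that(1) by (simp add: if_distrib[of "\<lambda>z. z * _"] finite_embeddings cong: if_cong)
      ultimately show ?thesis by (simp add: left_diff_distrib sum_subtractf)
    qed
    from embeddings_independent_aux[OF finite_embeddings subset_refl this] that(2) show ?thesis by simp
  qed
  have "of_rat (\<Sum>e\<in>integral_basis. coord (x * e) e) = (\<Sum>e\<in>integral_basis. \<Sum>\<sigma>\<in>field_embeddings. dual_coeff e \<sigma> * (\<sigma> x * \<sigma> e))"
    by (simp add: of_rat_sum coord_eq embedding_mult)
  also have "\<dots> = (\<Sum>\<sigma>\<in>field_embeddings. \<sigma> x * (\<Sum>e\<in>integral_basis. \<sigma> e * dual_coeff e \<sigma>))"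
    by (subst sum.swap) (simp add: sum_distrib_left mult_ac)
  also have "\<dots> = (\<Sum>\<sigma>\<in>field_embeddings. \<sigma> x)" using 1 by simp
  finally show ?thesis by (metis Rats_of_rat)
qed

lemma trace_int:
  assumes "algebraic_int x" shows "(\<Sum>\<sigma>\<in>field_embeddings. \<sigma> x) \<in> \<int>"
  using assms by (intro rational_algebraic_int_is_int trace_rational algebraic_int_sum embedding_algebraic_int)

text \<open>The traces of \<open>x * e\<close>, for \<open>e\<close> in the rational basis, are
  integers of bounded size and so take finitely many values. They determine \<open>x\<close>,
  because independence of the embeddings makes the trace form nondegenerate.\<close>

theorem finite_bounded_algebraic_ints:
  "finite {x :: 'a::number_field. algebraic_int x \<and> (\<forall>\<sigma>\<in>field_embeddings. norm (\<sigma> x) \<le> R)}"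
  (is "finite ?S")
proof -
  let ?E = "integral_basis :: 'a set" and ?emb = "field_embeddings :: ('a \<Rightarrow> complex) set"
  let ?T = "\<lambda>x::'a. restrict (\<lambda>e. \<Sum>\<sigma>\<in>?emb. \<sigma> (x * e)) ?E"
  define K where "K e = (\<Sum>\<sigma>\<in>?emb. R * norm (\<sigma> e))" for e
  let ?I = "\<lambda>e. of_int ` {- \<lceil>K e\<rceil>..\<lceil>K e\<rceil>} :: complex set"
  have "?T ` ?S \<subseteq> (\<Pi>\<^sub>E e\<in>?E. ?I e)"
  proof (rule image_subsetI, rule PiE_I)
    fix x e assume x: "x \<in> ?S" and e: "e \<in> ?E"
    have "algebraic_int (x * e)" using x e integral_basis_algebraic_int by auto
    then obtain z where z: "(\<Sum>\<sigma>\<in>?emb. \<sigma> (x * e)) = of_int z" using trace_int by (metis Ints_cases)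
    have "norm (\<Sum>\<sigma>\<in>?emb. \<sigma> (x * e)) \<le> K e"
      unfolding K_def using x by (intro sum_norm_le) (auto simp: embedding_mult norm_mult intro: mult_right_mono)
    then have "\<bar>of_int z\<bar> \<le> K e" unfolding z by simp
    then have "z \<in> {- \<lceil>K e\<rceil>..\<lceil>K e\<rceil>}" by (simp add: abs_le_iff) linarith
    then show "?T x e \<in> ?I e" using e z by auto
  qed auto
  moreover have "finite (\<Pi>\<^sub>E e\<in>?E. ?I e)" by (intro finite_PiE finite_integral_basis) simp
  ultimately have "finite (?T ` ?S)" by (rule finite_subset)
  moreover have "inj_on ?T ?S"
  proof (rule inj_onI)
    fix x y assume xy: "?T x = ?T y"
    have *: "(\<Sum>\<sigma>\<in>?emb. \<sigma> (x * e)) = (\<Sum>\<sigma>\<in>?emb. \<sigma> (y * e))" if "e \<in> ?E" for e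
      using fun_cong[OF xy, of e] that by simp
    let ?f = "\<lambda>z. \<Sum>\<sigma>\<in>?emb. (\<sigma> x - \<sigma> y) * \<sigma> z"
    have lin: "rat_linear ?f" by (intro rat_linear_sum_fun rat_linear_cmult embedding_rat_linear)
    have "?f e = 0" if "e \<in> ?E" for e
      using *[OF that] by (simp add: embedding_mult left_diff_distrib sum_subtractf)
    then have "?f z = 0" for z using rat_linear_expand[OF lin, of z] by simp
    then have "\<forall>\<sigma>\<in>?emb. \<sigma> x - \<sigma> y = 0"
      by (intro embeddings_independent_aux[OF finite_embeddings subset_refl])
    moreover obtain \<sigma> where \<sigma>: "\<sigma> \<in> ?emb" using field_embeddings_nonempty by blast
    ultimately have "\<sigma> (x - y) = 0" by (simp add: embedding_diff)
    then show "x = y" using embedding_eq_0_iff[OF \<sigma>] by simp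
  qed
  ultimately show ?thesis by (rule finite_imageD)
qed

section \<open>Indices of additive subgroups\<close>

definition add_subgroup :: "'b::ab_group_add set \<Rightarrow> bool" where
  "add_subgroup M \<longleftrightarrow> 0 \<in> M \<and> (\<forall>x\<in>M. \<forall>y\<in>M. x - y \<in> M)"

lemma add_subgroupD:
  assumes "add_subgroup M"
  shows "0 \<in> M" "x \<in> M \<Longrightarrow> y \<in> M \<Longrightarrow> x - y \<in> M" "x \<in> M \<Longrightarrow> - x \<in> M" "x \<in> M \<Longrightarrow> y \<in> M \<Longrightarrow> x + y \<in> M"
proof -
  show z: "0 \<in> M" and d: "\<And>x y. x \<in> M \<Longrightarrow> y \<in> M \<Longrightarrow> x - y \<in> M"
    using assms by (auto simp: add_subgroup_def)
  show m: "- x \<in> M" if "x \<in> M" for x using d[OF z that] by simp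
  show "x + y \<in> M" if "x \<in> M" "y \<in> M" for x y using d[OF that(1) m[OF that(2)]] by simp
qed

lemma add_subgroup_Int: "add_subgroup M \<Longrightarrow> add_subgroup N \<Longrightarrow> add_subgroup (M \<inter> N)"
  by (auto simp: add_subgroup_def)

lemma add_subgroup_sum: "add_subgroup M \<Longrightarrow> (\<And>i. i \<in> I \<Longrightarrow> f i \<in> M) \<Longrightarrow> sum f I \<in> M"
  by (induction I rule: infinite_finite_induct) (auto simp: add_subgroupD)

lemma add_subgroup_image:
  assumes "Modules.additive f" "add_subgroup M" shows "add_subgroup (f ` M)"
  using assms(2) Modules.additive.diff[OF assms(1)] Modules.additive.zero[OF assms(1)]
  unfolding add_subgroup_def by (auto simp flip: Modules.additive.diff[OF assms(1)])

lemma add_subgroup_kernel: "Modules.additive f \<Longrightarrow> add_subgroup {x. f x = 0}"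
  by (auto simp: add_subgroup_def Modules.additive.zero Modules.additive.diff)

text \<open>Phrased exactly like \<open>lattice_index\<close>, so that one unfolds to the other. As
  \<open>card\<close> is \<open>0\<close> on infinite sets, \<open>fin_index\<close> has to be
  carried along.\<close>

definition quot_index :: "'b::ab_group_add set \<Rightarrow> 'b set \<Rightarrow> nat" where
  "quot_index M N = card (M // {(x, y). x \<in> M \<and> y \<in> M \<and> x - y \<in> N})"

definition transversal :: "'b::ab_group_add set \<Rightarrow> 'b set \<Rightarrow> 'b set \<Rightarrow> bool" where
  "transversal M N R \<longleftrightarrow> R \<subseteq> M \<and> (\<forall>x\<in>M. \<exists>!r. r \<in> R \<and> x - r \<in> N)"

definition fin_index :: "'b::ab_group_add set \<Rightarrow> 'b set \<Rightarrow> bool" where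
  "fin_index M N \<longleftrightarrow> (\<exists>R. finite R \<and> transversal M N R)"

text \<open>\<open>f\<close> chooses a representative through a predicate that is the same for
  congruent elements, so the choice is constant on cosets.\<close>

lemma ex_transversal:
  assumes "add_subgroup N"
  shows "\<exists>R. transversal M N R"
proof -
  define f where "f x = (SOME y. y \<in> M \<and> x - y \<in> N)" for x
  have f: "f x \<in> M \<and> x - f x \<in> N" if "x \<in> M" for x
    unfolding f_def by (rule someI[of _ x]) (use that add_subgroupD[OF assms] in auto)
  have "r = f x" if h: "x \<in> M" "r \<in> f ` M" "x - r \<in> N" for x r
  proof -
    obtain x' where x': "x' \<in> M" "r = f x'" using h(2) by blast
    have "x - x' \<in> N"
      using add_subgroupD(2)[OF assms h(3), of "x' - r"] f[OF x'(1)] x'(2) by simp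
    then have "x - y \<in> N \<longleftrightarrow> x' - y \<in> N" for y
      using add_subgroupD(2)[OF assms, of "x - y" "x - x'"] add_subgroupD(4)[OF assms, of "x' - y" "x - x'"] by auto
    then show ?thesis unfolding x'(2) f_def by simp
  qed
  then have "transversal M N (f ` M)"
    unfolding transversal_def using f by (metis image_eqI image_subset_iff)
  then show ?thesis by blast
qed

lemma transversal_eq:
  assumes "add_subgroup N" "transversal M N R" "r \<in> R" "s \<in> R" "r - s \<in> N"
  shows "r = s"
  using assms add_subgroupD(1)[OF assms(1)] unfolding transversal_def
  by (metis cancel_comm_monoid_add_class.diff_cancel subsetD)

lemma quot_index_transversal:
  assumes N: "add_subgroup N" and R: "transversal M N R"
  shows "quot_index M N = card R"
proof -
  let ?E = "{(x, y). x \<in> M \<and> y \<in> M \<and> x - y \<in> N}"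
  have RM: "R \<subseteq> M" using R by (simp add: transversal_def)
  have "bij_betw (\<lambda>r. ?E `` {r}) R (M // ?E)"
    unfolding bij_betw_def
  proof
    show "inj_on (\<lambda>r. ?E `` {r}) R"
    proof (rule inj_onI)
      fix r s assume rs: "r \<in> R" "s \<in> R" "?E `` {r} = ?E `` {s}"
      have "r \<in> ?E `` {r}" using rs RM add_subgroupD(1)[OF N] by auto
      then have "s - r \<in> N" unfolding rs(3) by simp
      then show "r = s" using transversal_eq[OF N R rs(2,1)] by simp
    qed
    show "(\<lambda>r. ?E `` {r}) ` R = M // ?E"
    proof
      show "(\<lambda>r. ?E `` {r}) ` R \<subseteq> M // ?E" using RM by (intro image_subsetI quotientI) auto
      show "M // ?E \<subseteq> (\<lambda>r. ?E `` {r}) ` R"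
      proof
        fix X assume "X \<in> M // ?E"
        then obtain x where x: "x \<in> M" "X = ?E `` {x}" by (rule quotientE)
        then obtain r where r: "r \<in> R" "x - r \<in> N" using R unfolding transversal_def by blast
        have "x - y \<in> N \<longleftrightarrow> r - y \<in> N" for y
          using add_subgroupD(2)[OF N, of "x - y" "x - r"] add_subgroupD(4)[OF N, of "r - y" "x - r"] r(2) by auto
        then have "X = ?E `` {r}" using x r(1) RM by auto
        then show "X \<in> (\<lambda>r. ?E `` {r}) ` R" using r by blast
      qed
    qed
  qed
  from bij_betw_same_card[OF this] show ?thesis unfolding quot_index_def by (rule sym)
qed

text \<open>A transversal of \<open>M'\<close> modulo \<open>N'\<close> injects into one of
  \<open>M\<close> modulo \<open>N\<close>, because elements of \<open>M'\<close> that are congruent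
  modulo \<open>N\<close> are congruent modulo \<open>N'\<close>. This covers shrinking
  \<open>M\<close> and enlarging \<open>N\<close> at once.\<close>

lemma fin_index_le:
  assumes N: "add_subgroup N" and N': "add_subgroup N'" and fi: "fin_index M N"
    and sep: "\<And>x y. x \<in> M' \<Longrightarrow> y \<in> M' \<Longrightarrow> x - y \<in> N' \<Longrightarrow> x - y \<in> N' " and M': "M' \<subseteq> M"
    and NN': "\<And>x y. x \<in> M' \<Longrightarrow> y \<in> M' \<Longrightarrow> x - y \<in> N \<Longrightarrow> x - y \<in> N'"
  shows "fin_index M' N'" "quot_index M' N' \<le> quot_index M N"
proof -
  obtain R where R: "finite R" "transversal M N R" using fi unfolding fin_index_def by blast
  obtain R' where R': "transversal M' N' R'" using ex_transversal[OF N'] by blast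
  have "\<forall>x\<in>M'. \<exists>r\<in>R. x - r \<in> N" using R(2) M' unfolding transversal_def by blast
  then obtain f where f: "\<And>x. x \<in> M' \<Longrightarrow> f x \<in> R \<and> x - f x \<in> N" by metis
  have R'M: "R' \<subseteq> M'" using R' by (simp add: transversal_def)
  have inj: "inj_on f R'"
  proof (rule inj_onI)
    fix r s assume rs: "r \<in> R'" "s \<in> R'" "f r = f s"
    have "r - s \<in> N" using add_subgroupD(2)[OF N, of "r - f r" "s - f s"] f rs R'M by force
    then have "r - s \<in> N'" using NN' rs R'M by blast
    then show "r = s" by (rule transversal_eq[OF N' R' rs(1,2)])
  qed
  have sub: "f ` R' \<subseteq> R" using f R'M by blast
  show "fin_index M' N'" using inj_on_finite[OF inj sub R(1)] R' unfolding fin_index_def by blast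
  show "quot_index M' N' \<le> quot_index M N"
    unfolding quot_index_transversal[OF N R(2)] quot_index_transversal[OF N' R']
    by (rule card_inj_on_le[OF inj sub R(1)])
qed

lemma fin_indexI:
  assumes N: "add_subgroup N" and R: "finite R" "\<And>x. x \<in> M \<Longrightarrow> \<exists>r\<in>R. x - r \<in> N"
  shows "fin_index M N"
proof -
  obtain T where T: "transversal M N T" using ex_transversal[OF N] by blast
  obtain f where f: "\<And>x. x \<in> M \<Longrightarrow> f x \<in> R \<and> x - f x \<in> N" using R(2) by metis
  have TM: "T \<subseteq> M" using T by (simp add: transversal_def)
  have inj: "inj_on f T"
  proof (rule inj_onI)
    fix r s assume rs: "r \<in> T" "s \<in> T" "f r = f s"
    have "r - s \<in> N" using add_subgroupD(2)[OF N, of "r - f r" "s - f s"] f rs TM by force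
    then show "r = s" by (rule transversal_eq[OF N T rs(1,2)])
  qed
  have "finite T" using inj f TM R(1) by (intro inj_on_finite[OF inj _ R(1)]) blast
  then show ?thesis using T unfolding fin_index_def by blast
qed

lemma quot_index_pos:
  assumes "add_subgroup N" "fin_index M N" "M \<noteq> {}"
  shows "quot_index M N > 0"
proof -
  obtain R where R: "finite R" "transversal M N R" using assms(2) unfolding fin_index_def by blast
  then have "R \<noteq> {}" using assms(3) unfolding transversal_def by blast
  then show ?thesis using quot_index_transversal[OF assms(1) R(2)] R(1) by (simp add: card_gt_0_iff)
qed

lemma quot_index_tower:
  assumes N: "add_subgroup N" and M': "add_subgroup M'" and M: "add_subgroup M"
    and sub: "N \<subseteq> M'" "M' \<subseteq> M" and fi: "fin_index M M'" "fin_index M' N"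
  shows "fin_index M N" "quot_index M N = quot_index M M' * quot_index M' N"
proof -
  obtain R where R: "finite R" "transversal M M' R" using fi(1) unfolding fin_index_def by blast
  obtain S where S: "finite S" "transversal M' N S" using fi(2) unfolding fin_index_def by blast
  let ?f = "\<lambda>(r, s). r + s"
  have RM: "R \<subseteq> M" and SM: "S \<subseteq> M'" using R S by (simp_all add: transversal_def)
  have eq: "r = r' \<and> s = s'" if "r \<in> R" "r' \<in> R" "s \<in> S" "s' \<in> S" "(r + s) - (r' + s') \<in> N" for r r' s s'
  proof -
    have "r + s - (r' + s') \<in> M'" "s - s' \<in> M'" using that(3-5) sub SM add_subgroupD(2)[OF M'] by blast+
    then have "(r + s - (r' + s')) - (s - s') \<in> M'" by (rule add_subgroupD(2)[OF M'])
    then have "r - r' \<in> M'" by simp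
    then have r: "r = r'" using transversal_eq[OF M' R(2) that(1,2)] by blast
    then have "s - s' \<in> N" using that(5) by simp
    then show ?thesis using transversal_eq[OF N S(2) that(3,4)] r by blast
  qed
  have inj: "inj_on ?f (R \<times> S)"
  proof (rule inj_onI, goal_cases)
    case (1 x y)
    then show ?case
      using eq[of "fst x" "fst y" "snd x" "snd y"] add_subgroupD(1)[OF N] by (auto simp: case_prod_beta prod_eq_iff)
  qed
  have T: "transversal M N (?f ` (R \<times> S))"
    unfolding transversal_def
  proof (intro conjI ballI)
    show "?f ` (R \<times> S) \<subseteq> M" by (rule image_subsetI) (use RM SM sub in \<open>auto intro!: add_subgroupD(4)[OF M]\<close>)
    fix x assume x: "x \<in> M"
    obtain r where r: "r \<in> R" "x - r \<in> M'" using x R(2) unfolding transversal_def by blast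
    obtain s where s: "s \<in> S" "x - r - s \<in> N" using r S(2) unfolding transversal_def by blast
    show "\<exists>!t. t \<in> ?f ` (R \<times> S) \<and> x - t \<in> N"
    proof (rule ex1I[of _ "r + s"])
      show "r + s \<in> ?f ` (R \<times> S) \<and> x - (r + s) \<in> N" using r s by (auto simp: algebra_simps)
      fix t assume "t \<in> ?f ` (R \<times> S) \<and> x - t \<in> N"
      then obtain r' s' where t: "t = r' + s'" "r' \<in> R" "s' \<in> S" "x - (r' + s') \<in> N" by auto
      have "(x - (r' + s')) - (x - r - s) \<in> N" by (rule add_subgroupD(2)[OF N t(4) s(2)])
      then have "(r + s) - (r' + s') \<in> N" by (simp add: algebra_simps)
      then show "t = r + s" using eq[OF r(1) t(2) s(1) t(3)] t(1) by simp
    qed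
  qed
  have fin: "finite (?f ` (R \<times> S))" using R S by simp
  show "fin_index M N" using T fin unfolding fin_index_def by blast
  show "quot_index M N = quot_index M M' * quot_index M' N"
    unfolding quot_index_transversal[OF N T] quot_index_transversal[OF M' R(2)] quot_index_transversal[OF N S(2)]
    by (simp add: card_image[OF inj] card_cartesian_product)
qed

text \<open>A transversal consists of the sums of a lifted representative of the image and a
  representative of the kernel: once the lift is subtracted, a correction by some
  \<open>n \<in> N\<close> brings the rest into the kernel.\<close>

lemma quot_index_exact:
  assumes N: "add_subgroup N" and M: "add_subgroup M" and sub: "N \<subseteq> M"
    and fi: "fin_index M N" and f: "Modules.additive f"
  shows "quot_index M N = quot_index (M \<inter> {x. f x = 0}) (N \<inter> {x. f x = 0}) * quot_index (f ` M) (f ` N)"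
    and "fin_index (M \<inter> {x. f x = 0}) (N \<inter> {x. f x = 0})" and "fin_index (f ` M) (f ` N)"
proof -
  let ?K = "{x. f x = 0}"
  note fd = Modules.additive.diff[OF f] and fa = Modules.additive.add[OF f] and f0 = Modules.additive.zero[OF f]
  have NK: "add_subgroup (N \<inter> ?K)" using N add_subgroup_kernel[OF f] by (rule add_subgroup_Int)
  have fN: "add_subgroup (f ` N)" by (rule add_subgroup_image[OF f N])
  show fi1: "fin_index (M \<inter> ?K) (N \<inter> ?K)"
    by (rule fin_index_le(1)[OF N NK fi]) (auto simp: fd)
  obtain R where R: "finite R" "transversal M N R" using fi unfolding fin_index_def by blast
  show fi2: "fin_index (f ` M) (f ` N)"
  proof (rule fin_indexI[OF fN, of "f ` R"])
    show "finite (f ` R)" using R by simp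
    fix y assume "y \<in> f ` M"
    then obtain x where x: "x \<in> M" "y = f x" by blast
    then obtain r where "r \<in> R" "x - r \<in> N" using R(2) unfolding transversal_def by blast
    then have "f r \<in> f ` R" "y - f r \<in> f ` N" using x by (auto simp flip: fd)
    then show "\<exists>r\<in>f ` R. y - r \<in> f ` N" by blast
  qed
  obtain S where S: "finite S" "transversal (M \<inter> ?K) (N \<inter> ?K) S" using fi1 unfolding fin_index_def by blast
  obtain Q where Q: "finite Q" "transversal (f ` M) (f ` N) Q" using fi2 unfolding fin_index_def by blast
  have QM: "Q \<subseteq> f ` M" and SM: "S \<subseteq> M \<inter> ?K" using Q S by (simp_all add: transversal_def)
  then have "\<forall>q\<in>Q. \<exists>x\<in>M. f x = q" by (auto simp: image_iff)
  then obtain h where h: "\<And>q. q \<in> Q \<Longrightarrow> h q \<in> M \<and> f (h q) = q" by metis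
  let ?g = "\<lambda>(q, s). h q + s"
  have eq: "q = q' \<and> s = s'" if "q \<in> Q" "q' \<in> Q" "s \<in> S" "s' \<in> S" "(h q + s) - (h q' + s') \<in> N" for q q' s s'
  proof -
    have fs: "f s = 0" "f s' = 0" using that(3,4) SM by blast+
    then have "f ((h q + s) - (h q' + s')) = q - q'" using that(1,2) h by (simp add: fd fa)
    then have "q - q' \<in> f ` N" using that(5) by (metis imageI)
    then have q: "q = q'" using transversal_eq[OF fN Q(2) that(1,2)] by blast
    then have "s - s' \<in> N" using that(5) by simp
    moreover have "s - s' \<in> ?K" using fs by (simp add: fd)
    ultimately have "s - s' \<in> N \<inter> ?K" by blast
    then show ?thesis using transversal_eq[OF NK S(2) that(3,4)] q by blast
  qed
  have inj: "inj_on ?g (Q \<times> S)"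
  proof (rule inj_onI, goal_cases)
    case (1 x y)
    then show ?case
      using eq[of "fst x" "fst y" "snd x" "snd y"] add_subgroupD(1)[OF N] by (auto simp: case_prod_beta prod_eq_iff)
  qed
  have T: "transversal M N (?g ` (Q \<times> S))"
    unfolding transversal_def
  proof (intro conjI ballI)
    show "?g ` (Q \<times> S) \<subseteq> M" by (rule image_subsetI) (use h SM in \<open>auto intro!: add_subgroupD(4)[OF M]\<close>)
    fix x assume x: "x \<in> M"
    obtain q where q: "q \<in> Q" "f x - q \<in> f ` N" using x Q(2) unfolding transversal_def by blast
    then obtain n where n: "n \<in> N" "f x - q = f n" by blast
    have "x - h q - n \<in> M \<inter> ?K"
      using x h[OF q(1)] n sub by (auto simp: fd intro!: add_subgroupD(2)[OF M])
    then obtain s where s: "s \<in> S" "x - h q - n - s \<in> N \<inter> ?K" using S(2) unfolding transversal_def by blast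
    have "(x - h q - n - s) + n \<in> N" using s n by (intro add_subgroupD(4)[OF N]) auto
    then have xs: "x - (h q + s) \<in> N" by (simp add: algebra_simps)
    show "\<exists>!t. t \<in> ?g ` (Q \<times> S) \<and> x - t \<in> N"
    proof (rule ex1I[of _ "h q + s"])
      show "h q + s \<in> ?g ` (Q \<times> S) \<and> x - (h q + s) \<in> N" using q(1) s(1) xs by auto
      fix t assume "t \<in> ?g ` (Q \<times> S) \<and> x - t \<in> N"
      then obtain q' s' where t: "t = h q' + s'" "q' \<in> Q" "s' \<in> S" "x - (h q' + s') \<in> N" by auto
      have "(x - (h q' + s')) - (x - (h q + s)) \<in> N" by (rule add_subgroupD(2)[OF N t(4) xs])
      then have "(h q + s) - (h q' + s') \<in> N" by (simp add: algebra_simps)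
      then show "t = h q + s" using eq[OF q(1) t(2) s(1) t(3)] t(1) by simp
    qed
  qed
  show "quot_index M N = quot_index (M \<inter> ?K) (N \<inter> ?K) * quot_index (f ` M) (f ` N)"
    unfolding quot_index_transversal[OF N T] quot_index_transversal[OF fN Q(2)] quot_index_transversal[OF NK S(2)]
    by (simp add: card_image[OF inj] card_cartesian_product)
qed

lemma quot_index_inj_image:
  assumes N: "add_subgroup N" and f: "Modules.additive f" "inj f"
  shows "quot_index (f ` M) (f ` N) = quot_index M N" "fin_index M N \<Longrightarrow> fin_index (f ` M) (f ` N)"
proof -
  have fN: "add_subgroup (f ` N)" by (rule add_subgroup_image[OF f(1) N])
  have tr: "transversal (f ` M) (f ` N) (f ` R)" if R: "transversal M N R" for R
    unfolding transversal_def
  proof (intro conjI ballI)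
    show "f ` R \<subseteq> f ` M" using R by (auto simp: transversal_def)
    fix y assume "y \<in> f ` M"
    then obtain x where x: "x \<in> M" "y = f x" by blast
    have mem: "f x - f r \<in> f ` N \<longleftrightarrow> x - r \<in> N" for r
      using inj_image_mem_iff[OF f(2)] by (simp flip: Modules.additive.diff[OF f(1)])
    obtain r where r: "r \<in> R" "x - r \<in> N" "\<And>s. s \<in> R \<Longrightarrow> x - s \<in> N \<Longrightarrow> s = r"
      using R x unfolding transversal_def by (metis (no_types))
    show "\<exists>!t. t \<in> f ` R \<and> y - t \<in> f ` N"
    proof (rule ex1I[of _ "f r"])
      show "f r \<in> f ` R \<and> y - f r \<in> f ` N" using r(1,2) by (simp add: x(2) mem)
      fix t assume t: "t \<in> f ` R \<and> y - t \<in> f ` N"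
      then obtain s where s: "s \<in> R" "t = f s" by blast
      then have "x - s \<in> N" using t by (simp add: x(2) mem)
      then show "t = f r" using r(3) s by blast
    qed
  qed
  obtain R where R: "transversal M N R" using ex_transversal[OF N] by blast
  show "quot_index (f ` M) (f ` N) = quot_index M N"
    unfolding quot_index_transversal[OF N R] quot_index_transversal[OF fN tr[OF R]]
    by (rule card_image) (use f(2) in \<open>auto intro: inj_on_subset\<close>)
  show "fin_index M N \<Longrightarrow> fin_index (f ` M) (f ` N)"
    unfolding fin_index_def using tr by blast
qed

section \<open>Norms\<close>

abbreviation int_ring :: "'a::number_field set" where
  "int_ring \<equiv> {x. algebraic_int x}"

abbreviation mult_ideal :: "'a::number_field \<Rightarrow> 'a set" where
  "mult_ideal a \<equiv> (\<lambda>x. a * x) ` int_ring"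

definition abs_norm :: "'a::number_field \<Rightarrow> real" where
  "abs_norm a = (\<Prod>\<sigma>\<in>field_embeddings. norm (\<sigma> a))"

lemma abs_norm_mult: "abs_norm (a * b) = abs_norm a * abs_norm b"
  by (simp add: abs_norm_def embedding_mult norm_mult prod.distrib)

lemma abs_norm_pos: "a \<noteq> 0 \<Longrightarrow> abs_norm a > 0"
  unfolding abs_norm_def by (intro prod_pos) (auto simp: embedding_eq_0_iff)

lemma abs_norm_of_nat:
  "abs_norm (of_nat k :: 'a::number_field) = real k ^ card (field_embeddings :: ('a \<Rightarrow> complex) set)"
  by (simp add: abs_norm_def embedding_of_nat)

lemma additive_mult: "Modules.additive (\<lambda>x. a * x :: 'a::ring)"
  by unfold_locales (rule distrib_left)

lemma add_subgroup_int_ring: "add_subgroup int_ring"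
  by (auto simp: add_subgroup_def)

lemma add_subgroup_mult_ideal: "add_subgroup (mult_ideal a)"
  by (rule add_subgroup_image[OF additive_mult add_subgroup_int_ring])

lemma mult_ideal_subset: "algebraic_int a \<Longrightarrow> mult_ideal a \<subseteq> int_ring"
  by auto

lemma mult_ideal_mult: "mult_ideal (a * b) = (\<lambda>x. a * x) ` mult_ideal b"
  by (auto simp: image_image mult.assoc)

lemma inj_mult: "a \<noteq> 0 \<Longrightarrow> inj (\<lambda>x::'a::field. a * x)"
  by (simp add: inj_def)

text \<open>Bounds \<open>\<sigma>\<close> on combinations of the rational basis with coefficients
  of absolute value at most \<open>1\<close>; this is the error made by rounding
  coordinates.\<close>

definition basis_bound :: "('a::number_field \<Rightarrow> complex) \<Rightarrow> real" where
  "basis_bound \<sigma> = (\<Sum>e\<in>integral_basis. norm (\<sigma> e))"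

lemma embedding_sum_bound:
  assumes "\<sigma> \<in> field_embeddings" "\<And>e. e \<in> integral_basis \<Longrightarrow> norm (\<sigma> (q e)) \<le> K"
  shows "norm (\<sigma> (\<Sum>e\<in>integral_basis. q e * e)) \<le> K * basis_bound \<sigma>"
  unfolding embedding_sum[OF assms(1)] basis_bound_def sum_distrib_left
  by (rule sum_norm_le) (use assms in \<open>auto simp: embedding_mult norm_mult intro: mult_right_mono\<close>)

lemma round_to_integral:
  fixes x :: "'a::number_field"
  obtains y where "algebraic_int y" "\<And>\<sigma>. \<sigma> \<in> field_embeddings \<Longrightarrow> norm (\<sigma> (x - y)) \<le> basis_bound \<sigma>"
proof -
  define y where "y = (\<Sum>e\<in>integral_basis. of_int \<lfloor>coord x e\<rfloor> * e)"
  have "x - y = (\<Sum>e\<in>integral_basis. of_rat (frac (coord x e)) * e)"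
    by (subst coord_expand[of x]) (simp add: y_def frac_def of_rat_diff left_diff_distrib sum_subtractf)
  moreover have "norm (\<sigma> (of_rat (frac (coord x e)))) \<le> 1" if "\<sigma> \<in> field_embeddings" for \<sigma> :: "'a \<Rightarrow> complex" and e
  proof -
    have "norm (of_rat q :: complex) \<le> 1" if "0 \<le> q" "q < 1" for q
    proof -
      have "(of_rat q :: complex) = of_real (of_rat q)" by (cases q) (simp add: of_rat_rat)
      then have "norm (of_rat q :: complex) = \<bar>of_rat q\<bar>" by (metis norm_of_real)
      also have "\<dots> = of_rat q" using that by simp
      also have "\<dots> \<le> of_rat 1" using that by (simp only: of_rat_less_eq less_imp_le)
      finally show ?thesis by simp
    qed
    then show ?thesis using that by (simp add: embedding_of_rat frac_lt_1)
  qed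
  ultimately have "norm (\<sigma> (x - y)) \<le> 1 * basis_bound \<sigma>" if "\<sigma> \<in> field_embeddings" for \<sigma>
    using embedding_sum_bound[OF that, of "\<lambda>e. of_rat (frac (coord x e))" 1] that by simp
  moreover have "algebraic_int y"
    unfolding y_def using integral_basis_algebraic_int by auto
  ultimately show ?thesis using that by simp
qed

text \<open>Rounding \<open>x / b\<close> to an integer \<open>y\<close> leaves a remainder
  \<open>x - b * y\<close> with bounded conjugates, and only finitely many integers have such
  conjugates. Passing from \<open>a\<close> to an integral multiple \<open>b = k * a\<close> keeps
  the remainder integral when \<open>a\<close> is not.\<close>

lemma fin_index_mult_ideal:
  fixes a :: "'a::number_field"
  assumes "a \<noteq> 0"
  shows "fin_index int_ring (mult_ideal a)"
proof -
  define K where "K = (\<Sum>\<sigma>\<in>(field_embeddings :: ('a \<Rightarrow> complex) set). norm (\<sigma> a) * basis_bound \<sigma>)"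
  let ?R = "{x :: 'a. algebraic_int x \<and> (\<forall>\<sigma>\<in>field_embeddings. norm (\<sigma> x) \<le> K + norm (\<sigma> 0))}"
  obtain k :: nat where k: "k > 0" "algebraic_int (of_nat k * a)" using exists_int_multiple_algebraic_int by metis
  define b where "b = of_nat k * a"
  have b: "b \<noteq> 0" "algebraic_int b" using assms k by (auto simp: b_def)
  define L where "L = (\<Sum>\<sigma>\<in>(field_embeddings :: ('a \<Rightarrow> complex) set). norm (\<sigma> b) * basis_bound \<sigma>)"
  show ?thesis
  proof (rule fin_indexI[OF add_subgroup_mult_ideal])
    show "finite {x :: 'a. algebraic_int x \<and> (\<forall>\<sigma>\<in>field_embeddings. norm (\<sigma> x) \<le> L)}"
      by (rule finite_bounded_algebraic_ints)
    fix x :: 'a assume x: "x \<in> int_ring"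
    obtain y where y: "algebraic_int y" "\<And>\<sigma>. \<sigma> \<in> field_embeddings \<Longrightarrow> norm (\<sigma> (x / b - y)) \<le> basis_bound \<sigma>"
      using round_to_integral by blast
    let ?r = "x - b * y"
    have "norm (\<sigma> ?r) \<le> L" if \<sigma>: "\<sigma> \<in> field_embeddings" for \<sigma>
    proof -
      have "?r = b * (x / b - y)" using b by (simp add: field_simps)
      then have "norm (\<sigma> ?r) = norm (\<sigma> b) * norm (\<sigma> (x / b - y))" using \<sigma> by (simp only: embedding_mult norm_mult)
      also have "\<dots> \<le> norm (\<sigma> b) * basis_bound \<sigma>" by (intro mult_left_mono y \<sigma>) simp
      also have "\<dots> \<le> L" unfolding L_def
        by (rule member_le_sum[OF \<sigma> _ finite_embeddings]) (simp add: basis_bound_def sum_nonneg)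
      finally show ?thesis .
    qed
    moreover have "algebraic_int ?r" using x b y by auto
    moreover have "x - ?r = a * (of_nat k * y)" by (simp add: b_def)
    moreover have "algebraic_int (of_nat k * y)" using y by auto
    ultimately show "\<exists>r\<in>{x :: 'a. algebraic_int x \<and> (\<forall>\<sigma>\<in>field_embeddings. norm (\<sigma> x) \<le> L)}. x - r \<in> mult_ideal a"
      by (intro bexI[of _ ?r]) auto
  qed
qed

lemma cnj_embedding: "\<sigma> \<in> field_embeddings \<Longrightarrow> cnj \<circ> \<sigma> \<in> field_embeddings"
  by (auto simp: field_embeddings_def)

text \<open>Minkowski's theorem by the pigeonhole principle. The real linear forms \<open>Re \<sigma> + Im \<sigma>\<close>, one for
  every embedding, treat real and complex places uniformly: at a conjugate pair they are
  \<open>Re \<sigma> \<plusminus> Im \<sigma>\<close>, and these two bound \<open>\<bar>\<sigma>\<bar>\<close>.\<close>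

lemma norm_le_max_forms: "norm z \<le> max \<bar>Re z + Im z\<bar> \<bar>Re z - Im z\<bar>"
  using cmod_le[of z] by (simp add: max_def abs_if split: if_splits)

theorem minkowski_pigeonhole:
  "\<exists>C>0. \<forall>(R :: 'a::number_field set) T. finite R \<longrightarrow> (\<forall>r\<in>R. \<forall>s\<in>R. algebraic_int (r - s) \<longrightarrow> r = s) \<longrightarrow>
     (\<forall>\<sigma>\<in>field_embeddings. T \<sigma> > 0 \<and> T (cnj \<circ> \<sigma>) = T \<sigma>) \<longrightarrow>
     real (card R) * (\<Prod>\<sigma>\<in>field_embeddings. T \<sigma>) > C \<longrightarrow>
     (\<exists>r\<in>R. \<exists>s\<in>R. \<exists>\<beta>. algebraic_int \<beta> \<and> r - s + \<beta> \<noteq> 0 \<and> (\<forall>\<sigma>\<in>field_embeddings. norm (\<sigma> (r - s + \<beta>)) \<le> T \<sigma>))"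
proof -
  let ?emb = "field_embeddings :: ('a \<Rightarrow> complex) set" and ?E = "integral_basis :: 'a set"
  define n where "n = card ?emb"
  define K where "K = 1 + (\<Sum>\<sigma>\<in>?emb. basis_bound \<sigma>)"
  have bb0: "basis_bound \<sigma> \<ge> 0" for \<sigma> :: "'a \<Rightarrow> complex" by (simp add: basis_bound_def sum_nonneg)
  have K1: "K \<ge> 1" unfolding K_def using bb0 by (simp add: sum_nonneg)
  have bbK: "1 + basis_bound \<sigma> \<le> K" if "\<sigma> \<in> ?emb" for \<sigma>
    unfolding K_def using member_le_sum[OF that _ finite_embeddings, of basis_bound] bb0 by simp
  \<comment> \<open>The values of one form lie in \<open>[- 2 * B * K, 2 * B * K]\<close>. Cut into
    pieces of length \<open>T \<sigma>\<close>, this gives at most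
    \<open>4 * (B * K / T \<sigma>) + 3\<close> cells, and \<open>1 \<le> B * K / T \<sigma>\<close>
    absorbs the \<open>3\<close> into the factor \<open>10\<close>.\<close>
  define C where "C = (10 * K) ^ n"
  have C0: "C > 0" using K1 by (simp add: C_def)
  have main: "\<exists>r\<in>R. \<exists>s\<in>R. \<exists>\<beta>. algebraic_int \<beta> \<and> r - s + \<beta> \<noteq> 0 \<and> (\<forall>\<sigma>\<in>?emb. norm (\<sigma> (r - s + \<beta>)) \<le> T \<sigma>)"
    if R: "finite R" "\<And>r s. r \<in> R \<Longrightarrow> s \<in> R \<Longrightarrow> algebraic_int (r - s) \<Longrightarrow> r = s"
    and T: "\<And>\<sigma>. \<sigma> \<in> ?emb \<Longrightarrow> T \<sigma> > 0" "\<And>\<sigma>. \<sigma> \<in> ?emb \<Longrightarrow> T (cnj \<circ> \<sigma>) = T \<sigma>"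
    and big: "real (card R) * (\<Prod>\<sigma>\<in>?emb. T \<sigma>) > C" for R :: "'a set" and T
  proof -
    \<comment> \<open>Large enough that the bound \<open>2 * B * K\<close> on the forms holds at
      every point whatever \<open>R\<close> is, and that \<open>T \<sigma> \<le> B\<close>.\<close>
    define B0 where "B0 = (\<Sum>r\<in>R. \<Sum>\<sigma>\<in>?emb. norm (\<sigma> r)) + (\<Sum>\<sigma>\<in>?emb. T \<sigma>) + 1"
    define B where "B = nat \<lceil>B0\<rceil>"
    have T0: "0 \<le> (\<Sum>\<sigma>\<in>?emb. T \<sigma>)" using T(1) by (intro sum_nonneg) (auto intro: less_imp_le)
    have nn: "0 \<le> (\<Sum>r\<in>R. \<Sum>\<sigma>\<in>?emb. norm (\<sigma> r))" by (intro sum_nonneg) auto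
    have B0: "B0 \<ge> 1" using T0 nn by (simp add: B0_def)
    then have BB0: "real B \<ge> B0" unfolding B_def by linarith
    then have B1: "real B \<ge> 1" using B0 by linarith
    have Br: "norm (\<sigma> r) \<le> real B" if "r \<in> R" "\<sigma> \<in> ?emb" for r \<sigma>
    proof -
      have "norm (\<sigma> r) \<le> (\<Sum>\<sigma>\<in>?emb. norm (\<sigma> r))" by (rule member_le_sum[OF that(2) _ finite_embeddings]) simp
      also have "\<dots> \<le> (\<Sum>r\<in>R. \<Sum>\<sigma>\<in>?emb. norm (\<sigma> r))"
        by (rule member_le_sum[OF that(1) _ R(1)]) (simp add: sum_nonneg)
      finally show ?thesis using BB0 T0 by (simp add: B0_def)
    qed
    have BT: "T \<sigma> \<le> real B" if "\<sigma> \<in> ?emb" for \<sigma>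
    proof -
      have "T \<sigma> \<le> (\<Sum>\<sigma>\<in>?emb. T \<sigma>)"
        by (rule member_le_sum[OF that _ finite_embeddings]) (use T(1) in \<open>auto intro: less_imp_le\<close>)
      then show ?thesis using BB0 nn by (simp add: B0_def)
    qed
    define form where "form \<sigma> x = Re (\<sigma> x) + Im (\<sigma> x)" for \<sigma> :: "'a \<Rightarrow> complex" and x
    \<comment> \<open>There are \<open>card R * (B + 1) ^ n\<close> index pairs and at most
      \<open>C * B ^ n\<close> divided by the product of the \<open>T \<sigma>\<close> cells. The
      powers of \<open>B\<close> cancel, so \<open>C\<close> depends neither on \<open>R\<close> nor
      on \<open>T\<close>.\<close>
    define pt where "pt = (\<lambda>(r, c). r + (\<Sum>e\<in>?E. of_nat (c e) * e))"
    define D where "D = R \<times> (?E \<rightarrow>\<^sub>E {..B})"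
    define cell where "cell d = (\<lambda>\<sigma>\<in>?emb. \<lfloor>form \<sigma> (pt d) / T \<sigma>\<rfloor>)" for d
    have form_bound: "\<bar>form \<sigma> (pt d)\<bar> \<le> 2 * (real B * K)" if that: "\<sigma> \<in> ?emb" "d \<in> D" for \<sigma> d
    proof -
      have "\<exists>r c. d = (r, c) \<and> r \<in> R \<and> c \<in> ?E \<rightarrow>\<^sub>E {..B}" using that(2) by (auto simp: D_def)
      then obtain r c where d: "d = (r, c)" "r \<in> R" "c \<in> ?E \<rightarrow>\<^sub>E {..B}" by blast
      have "norm (\<sigma> (\<Sum>e\<in>?E. of_nat (c e) * e)) \<le> real B * basis_bound \<sigma>"
        by (rule embedding_sum_bound[OF that(1)]) (use d(3) in \<open>auto simp: embedding_of_nat[OF that(1)]\<close>)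
      then have "norm (\<sigma> (pt d)) \<le> real B + real B * basis_bound \<sigma>"
        using Br[OF d(2) that(1)] unfolding d pt_def
        by (simp add: embedding_add[OF that(1)]) (metis add_mono norm_triangle_le)
      also have "\<dots> = real B * (1 + basis_bound \<sigma>)" by (simp add: distrib_left)
      also have "\<dots> \<le> real B * K" by (intro mult_left_mono bbK that) simp
      finally have "norm (\<sigma> (pt d)) \<le> real B * K" .
      then show ?thesis unfolding form_def
        using abs_Re_le_cmod[of "\<sigma> (pt d)"] abs_Im_le_cmod[of "\<sigma> (pt d)"] by linarith
    qed
    define m where "m \<sigma> = \<lfloor>2 * (real B * K) / T \<sigma>\<rfloor> + 1" for \<sigma>
    have "cell ` D \<subseteq> (\<Pi>\<^sub>E \<sigma>\<in>?emb. {- m \<sigma>..m \<sigma>})"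
    proof (rule image_subsetI, rule PiE_I)
      fix d \<sigma> assume d: "d \<in> D" and \<sigma>: "\<sigma> \<in> ?emb"
      have "form \<sigma> (pt d) \<le> 2 * (real B * K)" "- (2 * (real B * K)) \<le> form \<sigma> (pt d)"
        using form_bound[OF \<sigma> d] by linarith+
      then have "form \<sigma> (pt d) / T \<sigma> \<le> 2 * (real B * K) / T \<sigma>" "- (2 * (real B * K)) / T \<sigma> \<le> form \<sigma> (pt d) / T \<sigma>"
        using T(1)[OF \<sigma>] by (intro divide_right_mono; simp)+
      then have "\<lfloor>form \<sigma> (pt d) / T \<sigma>\<rfloor> \<in> {- m \<sigma>..m \<sigma>}"
        unfolding m_def using floor_correct[of "form \<sigma> (pt d) / T \<sigma>"] floor_correct[of "2 * (real B * K) / T \<sigma>"]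
        unfolding minus_divide_left[symmetric] atLeastAtMost_iff by linarith
      then show "cell d \<sigma> \<in> {- m \<sigma>..m \<sigma>}" using \<sigma> by (simp add: cell_def)
    qed (auto simp: cell_def)
    then have "card (cell ` D) \<le> card (\<Pi>\<^sub>E \<sigma>\<in>?emb. {- m \<sigma>..m \<sigma>})"
      by (intro card_mono finite_PiE finite_embeddings) auto
    also have "\<dots> = (\<Prod>\<sigma>\<in>?emb. card {- m \<sigma>..m \<sigma>})" by (rule card_PiE[OF finite_embeddings])
    finally have "real (card (cell ` D)) \<le> (\<Prod>\<sigma>\<in>?emb. real (card {- m \<sigma>..m \<sigma>}))" by (simp flip: of_nat_prod)
    also have "\<dots> \<le> (\<Prod>\<sigma>\<in>?emb. 10 * K * real B / T \<sigma>)"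
    proof (rule prod_mono)
      fix \<sigma> assume \<sigma>: "\<sigma> \<in> ?emb"
      have BK: "1 \<le> real B * K / T \<sigma>"
      proof -
        have "T \<sigma> * 1 \<le> real B * K" using BT[OF \<sigma>] K1 T(1)[OF \<sigma>] by (intro mult_mono) auto
        then show ?thesis using T(1)[OF \<sigma>] by (simp add: field_simps)
      qed
      have "0 \<le> 2 * (real B * K) / T \<sigma>" using BK by simp
      then have m0: "m \<sigma> \<ge> 0" unfolding m_def by linarith
      have "real (card {- m \<sigma>..m \<sigma>}) = 2 * real_of_int (m \<sigma>) + 1" using m0 by simp
      also have "\<dots> \<le> 2 * (2 * (real B * K) / T \<sigma> + 1) + 1"
      proof -
        have "real_of_int (m \<sigma>) \<le> 2 * (real B * K) / T \<sigma> + 1"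
          unfolding m_def of_int_add by (intro add_mono of_int_floor_le) simp
        then show ?thesis by (intro add_right_mono mult_left_mono) simp_all
      qed
      also have "\<dots> = 4 * (real B * K / T \<sigma>) + 3" by simp
      also have "\<dots> \<le> 10 * (real B * K / T \<sigma>)"
      proof -
        have "4 * x + 3 \<le> 10 * x" if "1 \<le> x" for x :: real using that by linarith
        from this[OF BK] show ?thesis .
      qed
      finally show "0 \<le> real (card {- m \<sigma>..m \<sigma>}) \<and> real (card {- m \<sigma>..m \<sigma>}) \<le> 10 * K * real B / T \<sigma>"
        by (simp add: mult_ac)
    qed
    also have "\<dots> = C * real B ^ n / (\<Prod>\<sigma>\<in>?emb. T \<sigma>)"
      by (simp add: prod_dividef C_def n_def power_mult_distrib)
    also have "\<dots> < real (card R) * real B ^ n"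
    proof -
      have "(\<Prod>\<sigma>\<in>?emb. T \<sigma>) > 0" using T(1) by (intro prod_pos) auto
      then show ?thesis using big B1 by (simp add: divide_simps mult_ac)
    qed
    also have "\<dots> \<le> real (card D)"
    proof -
      have "card D = card R * Suc B ^ n"
        unfolding D_def n_def card_cartesian_product card_PiE[OF finite_integral_basis]
        by (simp add: card_integral_basis)
      moreover have "real B ^ n \<le> real (Suc B ^ n)" by (simp add: power_mono)
      ultimately show ?thesis by (simp add: mult_left_mono)
    qed
    finally have "card (cell ` D) < card D" by simp
    then have "\<not> inj_on cell D" by (metis card_image less_irrefl)
    then obtain d d' where dd: "d \<in> D" "d' \<in> D" "cell d = cell d'" "d \<noteq> d'" by (auto simp: inj_on_def)
    obtain r c s c' where rc: "d = (r, c)" "d' = (s, c')" by force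
    then have mem: "r \<in> R" "s \<in> R" "c \<in> ?E \<rightarrow>\<^sub>E {..B}" "c' \<in> ?E \<rightarrow>\<^sub>E {..B}" using dd by (auto simp: D_def)
    define \<beta> where "\<beta> = (\<Sum>e\<in>?E. of_int (int (c e) - int (c' e)) * e)"
    have \<beta>: "algebraic_int \<beta>" unfolding \<beta>_def using integral_basis_algebraic_int by blast
    have diff: "pt d - pt d' = r - s + \<beta>"
      by (simp add: rc pt_def \<beta>_def left_diff_distrib sum_subtractf)
    have "r - s + \<beta> \<noteq> 0"
    proof
      assume 0: "r - s + \<beta> = 0"
      then have "r - s = - \<beta>" by (simp add: add_eq_0_iff2)
      then have "algebraic_int (r - s)" using \<beta> by simp
      then have rs: "r = s" using R(2) mem by blast
      then have "(\<Sum>e\<in>?E. qscale (of_int (int (c e) - int (c' e))) e) = 0"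
        using 0 by (simp add: \<beta>_def qscale_def of_rat_diff)
      from qvec.independentD[OF independent_integral_basis finite_integral_basis subset_refl this]
      have "of_int (int (c e) - int (c' e)) = (0 :: rat)" if "e \<in> ?E" for e using that .
      then have "c e = c' e" if "e \<in> ?E" for e using that by fastforce
      then have "c = c'" using mem(3,4) by (intro PiE_ext) auto
      then show False using dd(4) rs rc by simp
    qed
    moreover have "norm (\<sigma> (r - s + \<beta>)) \<le> T \<sigma>" if \<sigma>: "\<sigma> \<in> ?emb" for \<sigma>
    proof -
      have fb: "\<bar>form \<tau> (r - s + \<beta>)\<bar> \<le> T \<tau>" if \<tau>: "\<tau> \<in> ?emb" for \<tau>
      proof -
        have "\<lfloor>form \<tau> (pt d) / T \<tau>\<rfloor> = \<lfloor>form \<tau> (pt d') / T \<tau>\<rfloor>"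
          using fun_cong[OF dd(3), of \<tau>] \<tau> by (simp add: cell_def)
        then have "\<bar>form \<tau> (pt d) / T \<tau> - form \<tau> (pt d') / T \<tau>\<bar> \<le> 1" by linarith
        moreover have "form \<tau> (pt d) / T \<tau> - form \<tau> (pt d') / T \<tau> = form \<tau> (r - s + \<beta>) / T \<tau>"
          unfolding diff[symmetric] form_def embedding_diff[OF \<tau>] by (simp add: diff_divide_distrib add_divide_distrib)
        ultimately show ?thesis using T(1)[OF \<tau>] by (simp add: divide_simps split: if_splits)
      qed
      have "\<bar>Re (\<sigma> (r - s + \<beta>)) - Im (\<sigma> (r - s + \<beta>))\<bar> \<le> T \<sigma>"
        using fb[OF cnj_embedding[OF \<sigma>]] T(2)[OF \<sigma>] by (simp add: form_def)
      then show ?thesis using fb[OF \<sigma>] norm_le_max_forms[of "\<sigma> (r - s + \<beta>)"] by (simp add: form_def max_def split: if_splits)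
    qed
    ultimately show ?thesis using mem \<beta> by blast
  qed
  show ?thesis
  proof (intro exI[of _ C] conjI allI impI C0)
    fix R :: "'a set" and T
    assume "finite R" "\<forall>r\<in>R. \<forall>s\<in>R. algebraic_int (r - s) \<longrightarrow> r = s"
      "\<forall>\<sigma>\<in>?emb. T \<sigma> > 0 \<and> T (cnj \<circ> \<sigma>) = T \<sigma>" "real (card R) * (\<Prod>\<sigma>\<in>?emb. T \<sigma>) > C"
    then show "\<exists>r\<in>R. \<exists>s\<in>R. \<exists>\<beta>. algebraic_int \<beta> \<and> r - s + \<beta> \<noteq> 0 \<and> (\<forall>\<sigma>\<in>?emb. norm (\<sigma> (r - s + \<beta>)) \<le> T \<sigma>)"
      by (intro main) simp_all
  qed
qed


text \<open>Apply the pigeonhole theorem to the fractions \<open>r / a\<close>: an index above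
  \<open>C / t ^ n\<close> times the norm would yield a nonzero integer all of whose conjugates are
  at most \<open>t\<close>, and \<open>t\<close> is chosen so small that there is none.\<close>

theorem quot_index_le_abs_norm_const:
  "\<exists>C. \<forall>a::'a::number_field. algebraic_int a \<longrightarrow> a \<noteq> 0 \<longrightarrow> real (quot_index int_ring (mult_ideal a)) \<le> C * abs_norm a"
proof -
  let ?emb = "field_embeddings :: ('a \<Rightarrow> complex) set"
  obtain C where C: "C > 0" "\<And>(R :: 'a set) T. finite R \<Longrightarrow> (\<forall>r\<in>R. \<forall>s\<in>R. algebraic_int (r - s) \<longrightarrow> r = s) \<Longrightarrow>
     (\<forall>\<sigma>\<in>?emb. T \<sigma> > 0 \<and> T (cnj \<circ> \<sigma>) = T \<sigma>) \<Longrightarrow> real (card R) * (\<Prod>\<sigma>\<in>?emb. T \<sigma>) > C \<Longrightarrow>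
     (\<exists>r\<in>R. \<exists>s\<in>R. \<exists>\<beta>. algebraic_int \<beta> \<and> r - s + \<beta> \<noteq> 0 \<and> (\<forall>\<sigma>\<in>?emb. norm (\<sigma> (r - s + \<beta>)) \<le> T \<sigma>))"
    using minkowski_pigeonhole[where 'a = 'a] by (elim exE conjE) simp
  obtain \<sigma>0 where \<sigma>0: "\<sigma>0 \<in> ?emb" using field_embeddings_nonempty by blast
  define S where "S = {x :: 'a. algebraic_int x \<and> (\<forall>\<sigma>\<in>?emb. norm (\<sigma> x) \<le> 1)} - {0}"
  have finS: "finite S" unfolding S_def using finite_bounded_algebraic_ints by blast
  define M where "M = Min (insert 1 ((\<lambda>x. norm (\<sigma>0 x)) ` S))"
  have M0: "M > 0" unfolding M_def using finS by (subst Min_gr_iff) (auto simp: S_def embedding_eq_0_iff[OF \<sigma>0])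
  have M1: "M \<le> 1" unfolding M_def using finS by (intro Min_le) auto
  have MS: "M \<le> norm (\<sigma>0 x)" if "x \<in> S" for x unfolding M_def using finS that by (intro Min_le) auto
  \<comment> \<open>A nonzero integer with all conjugates at most \<open>t \<le> 1\<close> would lie
    in \<open>S\<close>, hence satisfy \<open>norm (\<sigma>0 x) \<ge> M > t\<close>.\<close>
  define t where "t = M / 2"
  have t: "t > 0" "t \<le> 1" "t < M" using M0 M1 by (auto simp: t_def)
  have small: "b = 0" if "algebraic_int b" "\<And>\<sigma>. \<sigma> \<in> ?emb \<Longrightarrow> norm (\<sigma> b) \<le> t" for b
  proof (rule ccontr)
    assume "b \<noteq> 0"
    then have "b \<in> S" using that t(2) by (fastforce simp: S_def)
    then show False using MS[of b] that(2)[OF \<sigma>0] t(3) by simp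
  qed
  define n where "n = card ?emb"
  have "real (quot_index int_ring (mult_ideal a)) \<le> (C / t ^ n) * abs_norm a" if a: "algebraic_int a" "a \<noteq> 0" for a :: 'a
  proof (rule ccontr)
    assume neg: "\<not> ?thesis"
    obtain R0 where R0: "finite R0" "transversal int_ring (mult_ideal a) R0"
      using fin_index_mult_ideal[OF a(2)] unfolding fin_index_def by blast
    have R0i: "R0 \<subseteq> int_ring" using R0 by (simp add: transversal_def)
    have card0: "quot_index int_ring (mult_ideal a) = card R0"
      by (rule quot_index_transversal[OF add_subgroup_mult_ideal R0(2)])
    define R where "R = (\<lambda>r. r / a) ` R0"
    have cardR: "card R = card R0" unfolding R_def by (rule card_image) (use a in \<open>auto simp: inj_on_def\<close>)
    have R1: "r = s" if rs: "r \<in> R" "s \<in> R" "algebraic_int (r - s)" for r s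
    proof -
      obtain r0 s0 where rs0: "r0 \<in> R0" "s0 \<in> R0" "r = r0 / a" "s = s0 / a" using rs(1,2) unfolding R_def by blast
      have "r0 - s0 = a * (r - s)" using a rs0 by (simp add: field_simps)
      then have "r0 - s0 \<in> mult_ideal a" using rs(3) by blast
      then have "r0 = s0" by (rule transversal_eq[OF add_subgroup_mult_ideal R0(2) rs0(1,2)])
      then show ?thesis using rs0 by simp
    qed
    define T where "T \<sigma> = t / norm (\<sigma> a)" for \<sigma> :: "'a \<Rightarrow> complex"
    have T: "\<forall>\<sigma>\<in>?emb. T \<sigma> > 0 \<and> T (cnj \<circ> \<sigma>) = T \<sigma>"
      using t a by (auto simp: T_def embedding_eq_0_iff)
    have "(\<Prod>\<sigma>\<in>?emb. T \<sigma>) = t ^ n / abs_norm a"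
      by (simp add: T_def n_def abs_norm_def prod_dividef)
    moreover have "C / t ^ n * abs_norm a < real (card R)" using neg card0 cardR by simp
    moreover have "C = C / t ^ n * abs_norm a * (t ^ n / abs_norm a)" using t(1) abs_norm_pos[OF a(2)] by simp
    moreover have "t ^ n / abs_norm a > 0" using t(1) abs_norm_pos[OF a(2)] by simp
    ultimately have "real (card R) * (\<Prod>\<sigma>\<in>?emb. T \<sigma>) > C"
      by (metis mult_strict_right_mono)
    moreover have "finite R" using R0(1) by (simp add: R_def)
    ultimately have "\<exists>r\<in>R. \<exists>s\<in>R. \<exists>\<beta>. algebraic_int \<beta> \<and> r - s + \<beta> \<noteq> 0 \<and> (\<forall>\<sigma>\<in>?emb. norm (\<sigma> (r - s + \<beta>)) \<le> T \<sigma>)"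
      using R1 by (intro C(2)[OF _ _ T]) simp_all
    then obtain r s \<beta> where rs: "r \<in> R" "s \<in> R" "algebraic_int \<beta>" "r - s + \<beta> \<noteq> 0"
      "\<And>\<sigma>. \<sigma> \<in> ?emb \<Longrightarrow> norm (\<sigma> (r - s + \<beta>)) \<le> T \<sigma>"
      by blast
    define b where "b = a * (r - s + \<beta>)"
    obtain r0 s0 where rs0: "r0 \<in> R0" "s0 \<in> R0" "r = r0 / a" "s = s0 / a" using rs(1,2) unfolding R_def by blast
    have "b = r0 - s0 + a * \<beta>" using a rs0 by (simp add: b_def field_simps)
    then have "algebraic_int b" using rs0 R0i rs(3) a by auto
    moreover have "norm (\<sigma> b) \<le> t" if "\<sigma> \<in> ?emb" for \<sigma>
    proof -
      have "norm (\<sigma> b) \<le> norm (\<sigma> a) * T \<sigma>"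
        unfolding b_def embedding_mult[OF that] norm_mult by (intro mult_left_mono rs(5) that) simp
      also have "\<dots> = t" using a(2) embedding_eq_0_iff[OF that] by (simp add: T_def)
      finally show ?thesis .
    qed
    ultimately have "b = 0" by (rule small)
    then show False using rs(4) a by (simp add: b_def)
  qed
  then show ?thesis by blast
qed

section \<open>The index of a principal ideal is its norm\<close>

lemma quot_index_mult_ideal_mult:
  fixes a b :: "'a::number_field"
  assumes "algebraic_int a" "a \<noteq> 0" "algebraic_int b" "b \<noteq> 0"
  shows "quot_index int_ring (mult_ideal (a * b)) = quot_index int_ring (mult_ideal a) * quot_index int_ring (mult_ideal b)"
proof -
  have sub: "mult_ideal (a * b) \<subseteq> mult_ideal a" unfolding mult_ideal_mult by (intro image_mono mult_ideal_subset assms)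
  have e: "mult_ideal a = (\<lambda>x. a * x) ` int_ring" by simp
  have "quot_index (mult_ideal a) (mult_ideal (a * b)) = quot_index int_ring (mult_ideal b)"
    "fin_index (mult_ideal a) (mult_ideal (a * b))"
    using quot_index_inj_image[OF add_subgroup_mult_ideal[of b] additive_mult[of a] inj_mult[OF assms(2)], where M = int_ring]
      fin_index_mult_ideal[OF assms(4)] unfolding mult_ideal_mult by blast+
  then show ?thesis
    using quot_index_tower[OF add_subgroup_mult_ideal add_subgroup_mult_ideal add_subgroup_int_ring sub
        mult_ideal_subset[OF assms(1)] fin_index_mult_ideal[OF assms(2)]] by simp
qed

lemma quot_index_mult_ideal_power:
  assumes "algebraic_int a" "a \<noteq> (0::'a::number_field)"
  shows "quot_index int_ring (mult_ideal (a ^ k)) = quot_index int_ring (mult_ideal a) ^ k"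
proof (induction k)
  case 0
  have "transversal int_ring (mult_ideal (1::'a)) {0}" by (auto simp: transversal_def)
  then have "quot_index int_ring (mult_ideal (1::'a)) = card {0::'a}"
    by (rule quot_index_transversal[OF add_subgroup_mult_ideal])
  then show ?case by simp
next
  case (Suc k)
  then show ?case using quot_index_mult_ideal_mult[OF assms, of "a ^ k"] assms by auto
qed

text \<open>Strips the constant from a bound between multiplicative quantities once it is known for
  all powers.\<close>

lemma le_if_powers_le:
  fixes x y C :: real
  assumes "x > 0" "y > 0" "\<And>k. x ^ k \<le> C * y ^ k"
  shows "x \<le> y"
proof (rule ccontr)
  assume "\<not> x \<le> y"
  then have "1 < x / y" using assms by simp
  then obtain k where "C < (x / y) ^ k" using real_arch_pow by blast
  then show False using assms(2) assms(3)[of k] by (simp add: power_divide divide_simps split: if_splits)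
qed

lemma abs_norm_power: "abs_norm (a ^ k) = abs_norm a ^ k"
  by (induction k) (simp_all add: abs_norm_mult, simp add: abs_norm_def embedding_1)

lemma quot_index_mult_ideal_pos: "a \<noteq> 0 \<Longrightarrow> quot_index int_ring (mult_ideal a) > 0"
  by (rule quot_index_pos[OF add_subgroup_mult_ideal fin_index_mult_ideal]) auto

lemma quot_index_le_abs_norm:
  fixes a :: "'a::number_field"
  assumes "algebraic_int a" "a \<noteq> 0"
  shows "real (quot_index int_ring (mult_ideal a)) \<le> abs_norm a"
proof -
  obtain C where C: "\<And>a::'a. algebraic_int a \<Longrightarrow> a \<noteq> 0 \<Longrightarrow> real (quot_index int_ring (mult_ideal a)) \<le> C * abs_norm a"
    using quot_index_le_abs_norm_const[where 'a = 'a] by blast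
  have "real (quot_index int_ring (mult_ideal a)) ^ k \<le> C * abs_norm a ^ k" for k
    using C[of "a ^ k"] assms by (auto simp: quot_index_mult_ideal_power abs_norm_power)
  from le_if_powers_le[OF _ _ this] show ?thesis
    using quot_index_mult_ideal_pos[OF assms(2)] abs_norm_pos[OF assms(2)] by simp
qed

text \<open>Distribute the combinations of the rational basis with coefficients below
  \<open>k\<close> over the classes modulo \<open>k\<close>. Two in one class differ by
  \<open>k\<close> times an integer with conjugates at most \<open>K\<close>, so no class holds more
  than \<open>card S\<close> of them.\<close>

lemma quot_index_of_nat_ge:
  "\<exists>C. \<forall>k>0. real (k ^ card (field_embeddings :: ('a::number_field \<Rightarrow> complex) set))
     \<le> C * real (quot_index int_ring (mult_ideal (of_nat k :: 'a)))"
proof -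
  let ?emb = "field_embeddings :: ('a \<Rightarrow> complex) set" and ?E = "integral_basis :: 'a set"
  define K where "K = (\<Sum>\<sigma>\<in>?emb. basis_bound \<sigma>)"
  define S where "S = {x :: 'a. algebraic_int x \<and> (\<forall>\<sigma>\<in>?emb. norm (\<sigma> x) \<le> K)}"
  have finS: "finite S" unfolding S_def by (rule finite_bounded_algebraic_ints)
  have "real (k ^ card ?emb) \<le> real (card S) * real (quot_index int_ring (mult_ideal (of_nat k :: 'a)))" if k: "k > 0" for k :: nat
  proof -
    obtain R0 where R0: "finite R0" "transversal int_ring (mult_ideal (of_nat k :: 'a)) R0"
      using fin_index_mult_ideal[of "of_nat k :: 'a"] k unfolding fin_index_def by auto
    define P where "P = ?E \<rightarrow>\<^sub>E {..<k}"
    define pt where "pt c = (\<Sum>e\<in>?E. of_nat (c e) * e)" for c :: "'a \<Rightarrow> nat"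
    have pti: "pt c \<in> int_ring" for c unfolding pt_def using integral_basis_algebraic_int by auto
    have "\<forall>x\<in>int_ring. \<exists>r\<in>R0. x - r \<in> mult_ideal (of_nat k)" using R0(2) unfolding transversal_def by blast
    then obtain f where f: "\<And>x. x \<in> int_ring \<Longrightarrow> f x \<in> R0 \<and> x - f x \<in> mult_ideal (of_nat k)" by metis
    have finP: "finite P" unfolding P_def by (intro finite_PiE finite_integral_basis) simp
    have cardP: "card P = k ^ card ?emb"
      unfolding P_def card_PiE[OF finite_integral_basis] by (simp add: card_integral_basis)
    have fibre: "card {c\<in>P. f (pt c) = r} \<le> card S" for r
    proof (cases "{c\<in>P. f (pt c) = r} = {}")
      case False
      then obtain c0 where c0: "c0 \<in> P" "f (pt c0) = r" by blast
      let ?g = "\<lambda>c. (pt c - pt c0) / of_nat k"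
      have g: "?g c = (\<Sum>e\<in>?E. of_rat (of_int (int (c e) - int (c0 e)) / of_nat k) * e)" for c
        by (simp add: pt_def sum_divide_distrib of_rat_divide of_rat_diff diff_divide_distrib left_diff_distrib sum_subtractf)
      show ?thesis
      proof (rule card_inj_on_le[OF _ _ finS])
        show "inj_on ?g {c\<in>P. f (pt c) = r}"
        proof (rule inj_onI)
          fix c d assume cd: "c \<in> {c\<in>P. f (pt c) = r}" "d \<in> {c\<in>P. f (pt c) = r}" "?g c = ?g d"
          then have "pt c = pt d" using k by simp
          then have "(\<Sum>e\<in>?E. qscale (of_int (int (c e) - int (d e))) e) = 0"
            by (simp add: pt_def qscale_def of_rat_diff left_diff_distrib sum_subtractf)
          from qvec.independentD[OF independent_integral_basis finite_integral_basis subset_refl this]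
          have "of_int (int (c e) - int (d e)) = (0 :: rat)" if "e \<in> ?E" for e using that .
          then have "c e = d e" if "e \<in> ?E" for e using that by fastforce
          then show "c = d" using cd(1,2) unfolding P_def by (intro PiE_ext[of _ ?E "\<lambda>_. {..<k}"]) auto
        qed
        show "?g ` {c\<in>P. f (pt c) = r} \<subseteq> S"
        proof (rule image_subsetI)
          fix c assume c: "c \<in> {c\<in>P. f (pt c) = r}"
          have "pt c - r \<in> mult_ideal (of_nat k)" "pt c0 - r \<in> mult_ideal (of_nat k)"
            using f[OF pti, of c] f[OF pti, of c0] c c0 by auto
          then have "(pt c - r) - (pt c0 - r) \<in> mult_ideal (of_nat k)"
            by (rule add_subgroupD(2)[OF add_subgroup_mult_ideal])
          then obtain z where z: "algebraic_int z" "pt c - pt c0 = of_nat k * z" by auto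
          then have gz: "?g c = z" using k by simp
          have "norm (\<sigma> (?g c)) \<le> K" if \<sigma>: "\<sigma> \<in> ?emb" for \<sigma>
          proof -
            have "norm (\<sigma> (?g c)) \<le> 1 * basis_bound \<sigma>"
              unfolding g
            proof (rule embedding_sum_bound[OF \<sigma>])
              fix e assume e: "e \<in> ?E"
              have ce: "c e < k" "c0 e < k" using c c0 e by (auto simp: P_def)
              have "\<sigma> (of_rat (of_int (int (c e) - int (c0 e)) / of_nat k)) = of_int (int (c e) - int (c0 e)) / of_nat k"
                by (simp only: embedding_of_rat[OF \<sigma>] of_rat_divide of_rat_of_int_eq of_rat_of_nat_eq
                    embedding_divide[OF \<sigma>] embedding_of_int[OF \<sigma>] embedding_of_nat[OF \<sigma>])
              then have "norm (\<sigma> (of_rat (of_int (int (c e) - int (c0 e)) / of_nat k))) = \<bar>real_of_int (int (c e) - int (c0 e))\<bar> / real k"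
                by (simp only: norm_divide norm_of_int norm_of_nat)
              also have "\<dots> \<le> 1" using ce k by simp
              finally show "norm (\<sigma> (of_rat (of_int (int (c e) - int (c0 e)) / of_nat k))) \<le> 1" .
            qed
            also have "\<dots> \<le> K" unfolding K_def
              using member_le_sum[OF \<sigma> _ finite_embeddings, of basis_bound] by (simp add: basis_bound_def sum_nonneg)
            finally show ?thesis .
          qed
          then show "?g c \<in> S" using z(1) gz by (simp add: S_def)
        qed
      qed
    next
      case True
      then show ?thesis by (simp only: True card.empty)
    qed
    have "card P = card (\<Union>r\<in>R0. {c\<in>P. f (pt c) = r})"
      by (rule arg_cong[of _ _ card]) (use f[OF pti] in auto)
    also have "\<dots> \<le> (\<Sum>r\<in>R0. card {c\<in>P. f (pt c) = r})" by (rule card_UN_le[OF R0(1)])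
    also have "\<dots> \<le> (\<Sum>r\<in>R0. card S)" by (intro sum_mono fibre)
    finally have "card P \<le> card R0 * card S" by simp
    then have "real (k ^ card ?emb) \<le> real (card R0 * card S)" unfolding cardP by (simp only: of_nat_le_iff)
    then show ?thesis
      using quot_index_transversal[OF add_subgroup_mult_ideal R0(2)] by (simp add: mult.commute)
  qed
  then show ?thesis by blast
qed

lemma quot_index_of_nat:
  assumes "k > 0"
  shows "real (quot_index int_ring (mult_ideal (of_nat k :: 'a::number_field))) = abs_norm (of_nat k :: 'a)"
proof (rule antisym)
  let ?k = "of_nat k :: 'a" and ?n = "card (field_embeddings :: ('a \<Rightarrow> complex) set)"
  have k: "algebraic_int ?k" "?k \<noteq> 0" using assms by auto
  show "real (quot_index int_ring (mult_ideal ?k)) \<le> abs_norm ?k" by (rule quot_index_le_abs_norm[OF k])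
  obtain C where C: "\<And>k. k > 0 \<Longrightarrow> real (k ^ ?n) \<le> C * real (quot_index int_ring (mult_ideal (of_nat k :: 'a)))"
    using quot_index_of_nat_ge[where 'a = 'a] by blast
  have "abs_norm ?k ^ j \<le> C * real (quot_index int_ring (mult_ideal ?k)) ^ j" for j
  proof -
    have "abs_norm ?k ^ j = real ((k ^ j) ^ ?n)" by (simp add: abs_norm_of_nat power_commutes flip: power_mult) (simp add: mult.commute)
    also have "\<dots> \<le> C * real (quot_index int_ring (mult_ideal (?k ^ j)))" using C[of "k ^ j"] assms by simp
    finally show ?thesis by (simp add: quot_index_mult_ideal_power[OF k])
  qed
  from le_if_powers_le[OF _ _ this] show "abs_norm ?k \<le> real (quot_index int_ring (mult_ideal ?k))"
    using quot_index_mult_ideal_pos[OF k(2)] abs_norm_pos[OF k(2)] by simp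
qed

text \<open>Choose an integer \<open>b\<close> such that \<open>a * b\<close> is a natural number
  \<open>k\<close>. The upper bounds for \<open>a\<close> and for \<open>b\<close> multiply to the
  equality already known for \<open>k\<close>, so neither of them is strict.\<close>

theorem quot_index_eq_abs_norm:
  fixes a :: "'a::number_field"
  assumes a: "algebraic_int a" "a \<noteq> 0"
  shows "real (quot_index int_ring (mult_ideal a)) = abs_norm a"
proof -
  obtain k :: nat where k: "k > 0" "algebraic_int (of_nat k * inverse a)"
    using exists_int_multiple_algebraic_int by metis
  define b where "b = of_nat k * inverse a"
  have b: "algebraic_int b" "b \<noteq> 0" "a * b = of_nat k" using k a by (auto simp: b_def)
  have eq: "real (quot_index int_ring (mult_ideal a)) * real (quot_index int_ring (mult_ideal b)) = abs_norm a * abs_norm b"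
    using quot_index_of_nat[OF k(1), where 'a = 'a] quot_index_mult_ideal_mult[OF a b(1,2)] abs_norm_mult[of a b] b(3) by simp
  show ?thesis
  proof (rule antisym[OF quot_index_le_abs_norm[OF a]], rule ccontr)
    assume "\<not> abs_norm a \<le> real (quot_index int_ring (mult_ideal a))"
    then have "real (quot_index int_ring (mult_ideal a)) * abs_norm b < abs_norm a * abs_norm b"
      using abs_norm_pos[OF b(2)] by simp
    moreover have "real (quot_index int_ring (mult_ideal a)) * real (quot_index int_ring (mult_ideal b))
        \<le> real (quot_index int_ring (mult_ideal a)) * abs_norm b"
      by (intro mult_left_mono quot_index_le_abs_norm b) simp
    ultimately show False using eq by linarith
  qed
qed

text \<open>Here \<open>a\<close> may be a fraction in \<open>J\<close>. The two ways down from
  \<open>J\<close> to \<open>mult_ideal (k * a)\<close>, through the integers and through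
  \<open>mult_ideal a\<close>, compute the same index, and the norm of \<open>k\<close>
  cancels.\<close>

theorem quot_index_fractional:
  fixes J :: "'a::number_field set"
  assumes J: "add_subgroup J" "int_ring \<subseteq> J" "fin_index J int_ring"
    and a: "a \<noteq> 0" "mult_ideal a \<subseteq> J"
  shows "fin_index J (mult_ideal a)"
    and "real (quot_index J (mult_ideal a)) = real (quot_index J int_ring) * abs_norm a"
proof -
  obtain k :: nat where k: "k > 0" "algebraic_int (of_nat k * a)" using exists_int_multiple_algebraic_int by metis
  let ?k = "of_nat k :: 'a"
  have ka: "?k * a \<noteq> 0" and k0: "?k \<noteq> 0" using k a by auto
  have sub1: "mult_ideal (?k * a) \<subseteq> int_ring" using k(2) by (rule mult_ideal_subset)
  have "mult_ideal (a * ?k) \<subseteq> mult_ideal a" unfolding mult_ideal_mult by (intro image_mono mult_ideal_subset) simp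
  then have sub2: "mult_ideal (?k * a) \<subseteq> mult_ideal a" by (simp add: mult.commute)
  have 1: "fin_index J (mult_ideal (?k * a))"
    "quot_index J (mult_ideal (?k * a)) = quot_index J int_ring * quot_index int_ring (mult_ideal (?k * a))"
    using quot_index_tower[OF add_subgroup_mult_ideal add_subgroup_int_ring J(1) sub1 J(2,3) fin_index_mult_ideal[OF ka]] by blast+
  show fi: "fin_index J (mult_ideal a)"
    by (rule fin_index_le(1)[OF add_subgroup_mult_ideal add_subgroup_mult_ideal 1(1)]) (use sub2 in auto)
  have "quot_index (mult_ideal a) (mult_ideal (a * ?k)) = quot_index int_ring (mult_ideal ?k)"
    "fin_index (mult_ideal a) (mult_ideal (a * ?k))"
    using quot_index_inj_image[OF add_subgroup_mult_ideal[of ?k] additive_mult[of a] inj_mult[OF a(1)], where M = int_ring]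
      fin_index_mult_ideal[OF k0] unfolding mult_ideal_mult by blast+
  then have 2: "quot_index (mult_ideal a) (mult_ideal (?k * a)) = quot_index int_ring (mult_ideal ?k)"
    "fin_index (mult_ideal a) (mult_ideal (?k * a))" by (simp_all add: mult.commute)
  have "quot_index J (mult_ideal (?k * a)) = quot_index J (mult_ideal a) * quot_index int_ring (mult_ideal ?k)"
    using quot_index_tower(2)[OF add_subgroup_mult_ideal add_subgroup_mult_ideal J(1) sub2 a(2) fi 2(2)] 2(1) by simp
  then have "real (quot_index J int_ring) * (abs_norm ?k * abs_norm a) = real (quot_index J (mult_ideal a)) * abs_norm ?k"
    using 1(2) quot_index_eq_abs_norm[OF k(2) ka] quot_index_of_nat[OF k(1), where 'a = 'a]
    by (metis abs_norm_mult of_nat_mult)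
  then show "real (quot_index J (mult_ideal a)) = real (quot_index J int_ring) * abs_norm a"
    using abs_norm_pos[OF k0] by simp
qed

section \<open>Finite places from maximal ideals\<close>

text \<open>Two powers of an element that agree up to a fraction lead to a relation of this shape
  once the denominator is cleared.\<close>

lemma algebraic_int_if_monic_trinomial:
  fixes x :: "'a::field_char_0"
  assumes "i < j" "x ^ j = \<alpha> * x ^ i + \<beta>" "algebraic_int \<alpha>" "algebraic_int \<beta>"
  shows "algebraic_int x"
proof -
  obtain G where G: "finite G" "1 \<in> G" "Zstab G \<alpha>" "Zstab G \<beta>"
    using algebraic_int_common[OF assms(3,4)] by metis
  define e where "e = (\<lambda>b. (if b = i then \<alpha> else 0) + (if b = 0 then \<beta> else 0))"
  have "(\<Sum>b<j. e b * x ^ b) = (\<Sum>b<j. (if b = i then \<alpha> * x ^ b else 0) + (if b = 0 then \<beta> else 0))"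
    by (intro sum.cong) (auto simp: e_def distrib_right)
  also have "\<dots> = \<alpha> * x ^ i + \<beta>" using assms(1) by (simp add: sum.distrib)
  finally have eq: "x ^ j = (\<Sum>b<j. e b * x ^ b)" by (simp add: assms(2))
  have e: "Zstab G (e b)" for b
    unfolding e_def using G(3,4) Zstab_of_int[of G 0] by (intro Zstab_add) auto
  have "j > 0" using assms(1) by simp
  then have "\<exists>H. finite H \<and> 1 \<in> H \<and> Zstab H x \<and> (\<forall>z. Zstab G z \<longrightarrow> Zstab H z)"
    by (rule Zstab_extend[OF G(1,2) _ eq e])
  then obtain H where H: "finite H" "1 \<in> H" "Zstab H x" by blast
  then show ?thesis using algebraic_int_if_Zstab[OF H(1-3)] by simp
qed

text \<open>Applied mostly to the powers of one element, where it gives a congruence of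
  \<open>x ^ i\<close> and \<open>x ^ j\<close> modulo \<open>a\<close>.\<close>

lemma pigeonhole_mod_ideal:
  fixes f :: "nat \<Rightarrow> 'a::number_field"
  assumes "a \<noteq> 0" "\<And>n. algebraic_int (f n)"
  obtains i j z where "i < j" "algebraic_int z" "f i - f j = a * z"
proof -
  obtain R where R: "finite R" "transversal int_ring (mult_ideal a) R"
    using fin_index_mult_ideal[OF assms(1)] unfolding fin_index_def by blast
  have "\<forall>x\<in>int_ring. \<exists>r\<in>R. x - r \<in> mult_ideal a" using R(2) unfolding transversal_def by blast
  then obtain g where g: "\<And>x. x \<in> int_ring \<Longrightarrow> g x \<in> R \<and> x - g x \<in> mult_ideal a" by metis
  have "\<not> inj (\<lambda>n. g (f n))"
  proof
    assume "inj (\<lambda>n. g (f n))"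
    moreover have "range (\<lambda>n. g (f n)) \<subseteq> R" using g assms(2) by auto
    ultimately have "finite (UNIV :: nat set)" using R(1) by (metis finite_imageD finite_subset)
    then show False by simp
  qed
  then obtain i j where "i \<noteq> j" "g (f i) = g (f j)" by (auto simp: inj_def)
  then have "\<exists>i j. i < j \<and> g (f i) = g (f j)" by (metis nat_neq_iff)
  then obtain i j where ij: "i < j" "g (f i) = g (f j)" by blast
  have "(f i - g (f i)) - (f j - g (f j)) \<in> mult_ideal a"
    by (rule add_subgroupD(2)[OF add_subgroup_mult_ideal]) (use g assms(2) in auto)
  then have "f i - f j \<in> mult_ideal a" using ij(2) by simp
  then show ?thesis using that ij(1) by blast
qed

section \<open>Localization at a maximal ideal\<close>

locale max_ideal =
  fixes P :: "'a::number_field set"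
  assumes integral: "x \<in> P \<Longrightarrow> algebraic_int x"
    and subgroup: "add_subgroup P"
    and absorb: "algebraic_int a \<Longrightarrow> x \<in> P \<Longrightarrow> a * x \<in> P"
    and one_notin: "1 \<notin> P"
    and inverse_mod: "algebraic_int a \<Longrightarrow> a \<notin> P \<Longrightarrow> \<exists>b. algebraic_int b \<and> 1 - a * b \<in> P"
    and nonzero: "\<exists>k::nat. k > 0 \<and> of_nat k \<in> P"
begin

abbreviation outside :: "'a set" where "outside \<equiv> {s. algebraic_int s \<and> s \<notin> P}"

definition loc :: "'a set" where
  "loc = {y / s | y s. algebraic_int y \<and> s \<in> outside}"

lemma zero_in: "0 \<in> P" using add_subgroupD(1)[OF subgroup] .

lemma outside_nonzero: "s \<in> outside \<Longrightarrow> s \<noteq> 0" using zero_in by auto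

lemma outside_one: "1 \<in> outside" using one_notin by simp

lemma outside_mult: assumes "a \<in> outside" "b \<in> outside" shows "a * b \<in> outside"
proof -
  obtain c where c: "algebraic_int c" "1 - b * c \<in> P" using inverse_mod assms(2) by blast
  have "a * b \<notin> P"
  proof
    assume "a * b \<in> P"
    then have "c * (a * b) \<in> P" using absorb c by blast
    moreover have "a * (1 - b * c) \<in> P" using absorb c assms(1) by blast
    ultimately have "a * (1 - b * c) + c * (a * b) \<in> P" using add_subgroupD(4)[OF subgroup] by blast
    moreover have "a * (1 - b * c) + c * (a * b) = a" by (simp add: algebra_simps)
    ultimately show False using assms(1) by simp
  qed
  then show ?thesis using assms by auto
qed

lemma outside_power: "a \<in> outside \<Longrightarrow> a ^ n \<in> outside"
proof (induction n)
  case 0 then show ?case using outside_one by simp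
next
  case (Suc n) then show ?case using outside_mult[of a "a ^ n"] by simp
qed

lemma power_in: "p \<in> P \<Longrightarrow> n > 0 \<Longrightarrow> p ^ n \<in> P"
proof (induction n)
  case (Suc n)
  have "p ^ n * p \<in> P" by (rule absorb) (use Suc.prems integral in auto)
  then show ?case by (simp add: mult.commute)
qed simp

lemma one_minus_outside: assumes "p \<in> P" shows "1 - p \<in> outside"
proof -
  have "1 - p \<notin> P"
  proof
    assume "1 - p \<in> P"
    then have "1 - p + p \<in> P" using assms add_subgroupD(4)[OF subgroup] by blast
    then show False using one_notin by simp
  qed
  then show ?thesis using integral[OF assms] by auto
qed

lemma locI: "algebraic_int y \<Longrightarrow> s \<in> outside \<Longrightarrow> y / s \<in> loc"
  unfolding loc_def by blast

lemma locE: assumes "x \<in> loc" obtains y s where "x = y / s" "algebraic_int y" "s \<in> outside"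
  using assms unfolding loc_def by blast

lemma loc_integral: "algebraic_int y \<Longrightarrow> y \<in> loc"
  using locI[of y 1] outside_one by simp

lemma loc_mult: assumes "x \<in> loc" "y \<in> loc" shows "x * y \<in> loc"
proof -
  obtain a s where a: "x = a / s" "algebraic_int a" "s \<in> outside" by (rule locE[OF assms(1)])
  obtain b t where b: "y = b / t" "algebraic_int b" "t \<in> outside" by (rule locE[OF assms(2)])
  have "a * b / (s * t) \<in> loc" by (rule locI[OF _ outside_mult]) (use a b in auto)
  then show ?thesis using a b by simp
qed

lemma loc_add: assumes "x \<in> loc" "y \<in> loc" shows "x + y \<in> loc"
proof -
  obtain a s where a: "x = a / s" "algebraic_int a" "s \<in> outside" by (rule locE[OF assms(1)])
  obtain b t where b: "y = b / t" "algebraic_int b" "t \<in> outside" by (rule locE[OF assms(2)])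
  have "(a * t + b * s) / (s * t) \<in> loc" by (rule locI[OF _ outside_mult]) (use a b in auto)
  moreover have "(a * t + b * s) / (s * t) = x + y"
    using a b outside_nonzero[OF a(3)] outside_nonzero[OF b(3)] by (simp add: field_simps)
  ultimately show ?thesis by simp
qed

lemma loc_minus: assumes "x \<in> loc" shows "- x \<in> loc"
  using loc_mult[OF loc_integral[of "- 1"] assms] by simp

lemma loc_diff: assumes "x \<in> loc" "y \<in> loc" shows "x - y \<in> loc"
  using loc_add[OF assms(1) loc_minus[OF assms(2)]] by simp

lemma loc_inverse: "s \<in> outside \<Longrightarrow> 1 / s \<in> loc"
  by (rule locI) auto

text \<open>The residue ring of the localization is covered by the residue ring of the integers: modulo
  \<open>a\<close>, some power \<open>s\<^sup>d\<close> of a unit \<open>s\<close> of the localization is \<open>1\<close>, so \<open>s\<^sup>d\<^sup>-\<^sup>1\<close> inverts \<open>s\<close>.\<close>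

lemma loc_mod:
  assumes "a \<noteq> 0" "x \<in> loc"
  obtains y z where "algebraic_int y" "z \<in> loc" "x = y + a * z"
proof -
  obtain b s where b: "x = b / s" "algebraic_int b" "s \<in> outside" by (rule locE[OF assms(2)])
  have s: "algebraic_int s" "s \<noteq> 0" using b(3) outside_nonzero by auto
  obtain i j w where ij: "i < j" "algebraic_int w" "s ^ i - s ^ j = a * w"
    by (rule pigeonhole_mod_ideal[OF assms(1), of "\<lambda>n. s ^ n", OF algebraic_int_power[OF s(1)]])
  define d where "d = j - i - 1"
  have j: "j = i + Suc d" using ij by (simp add: d_def)
  have si: "s ^ i \<in> outside" using b(3) by (rule outside_power)
  have "s ^ i * (1 - s ^ Suc d) = a * w" using ij(3) unfolding j by (simp add: power_add algebra_simps)
  then have e1: "1 - s ^ Suc d = a * (w / s ^ i)"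
    using s(2) by (metis nonzero_mult_div_cancel_left power_not_zero times_divide_eq_right)
  have "1 / s - s ^ d = (1 - s ^ Suc d) * (1 / s)" using s by (simp add: diff_divide_distrib)
  then have e2: "1 / s = s ^ d + a * (w / s ^ i) * (1 / s)" unfolding e1 by (simp only: diff_eq_eq add.commute)
  have "x = b * (1 / s)" using b(1) by simp
  also have "\<dots> = b * (s ^ d + a * (w / s ^ i) * (1 / s))" by (rule arg_cong[OF e2])
  also have "\<dots> = b * s ^ d + a * (b * (w / s ^ i * (1 / s)))" by (simp only: distrib_left mult_ac)
  finally have "x = b * s ^ d + a * (b * (w / s ^ i * (1 / s)))" .
  moreover have "b * (w / s ^ i * (1 / s)) \<in> loc"
    by (intro loc_mult loc_integral loc_inverse locI) (use b ij si in auto)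
  moreover have "algebraic_int (b * s ^ d)" using b s by auto
  ultimately show ?thesis using that by blast
qed

text \<open>By \<open>loc_mod\<close>, residues of the localization modulo \<open>a\<close> are
  represented by integers, so two of the \<open>a * u ^ k\<close> are congruent modulo
  \<open>a\<close>, which means that \<open>u ^ j - u ^ i\<close> lies in \<open>loc\<close>.
  Clearing its denominator \<open>s\<close> makes \<open>s * u\<close> a root of a monic trinomial
  over the integers.\<close>

lemma loc_integrally_closed:
  assumes a: "algebraic_int a" "a \<noteq> 0" and u: "\<And>k. a * u ^ k \<in> loc"
  shows "u \<in> loc"
proof -
  have "\<forall>k. \<exists>y. algebraic_int y \<and> (\<exists>z\<in>loc. a * u ^ k = y + a * z)"
    using loc_mod[OF a(2) u] by metis
  then obtain y where y: "\<And>k. algebraic_int (y k)" "\<And>k. \<exists>z\<in>loc. a * u ^ k = y k + a * z" by metis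
  obtain i j w where ij: "i < j" "algebraic_int w" "y i - y j = a * w"
    by (rule pigeonhole_mod_ideal[OF a(2) y(1)])
  obtain z z' where z: "z \<in> loc" "a * u ^ i = y i + a * z" "z' \<in> loc" "a * u ^ j = y j + a * z'" using y(2) by metis
  have "a * (u ^ j - u ^ i) = a * (z' - z - w)" using z ij(3) by (simp add: algebra_simps)
  then have c: "u ^ j - u ^ i = z' - z - w" using a by simp
  moreover have "z' - z - w \<in> loc" by (intro loc_diff z loc_integral ij)
  ultimately obtain b s where b: "u ^ j - u ^ i = b / s" "algebraic_int b" "s \<in> outside" using locE by metis
  have s: "algebraic_int s" "s \<noteq> 0" using b(3) outside_nonzero by auto
  have uj: "u ^ j = u ^ i + b / s" using b(1) by (simp add: algebra_simps)
  have "(s * u) ^ j = s ^ j * (u ^ i + b / s)" by (simp add: power_mult_distrib uj)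
  also have "\<dots> = s ^ (j - i) * (s ^ i * u ^ i) + s ^ (j - 1) * b"
  proof -
    have sj: "s ^ j = s ^ (j - i) * s ^ i" "s ^ j = s ^ (j - 1) * s" using ij(1) by (simp_all flip: power_add power_Suc2)
    have "s ^ j * u ^ i = s ^ (j - i) * (s ^ i * u ^ i)" unfolding sj(1) by (rule mult.assoc)
    moreover have "s ^ j * (b / s) = s ^ (j - 1) * (s * (b / s))" unfolding sj(2) by (rule mult.assoc)
    moreover have "s * (b / s) = b" using s by simp
    ultimately show ?thesis by (simp add: distrib_left)
  qed
  finally have "(s * u) ^ j = s ^ (j - i) * (s * u) ^ i + s ^ (j - 1) * b" by (simp add: power_mult_distrib)
  then have "algebraic_int (s * u)"
    by (rule algebraic_int_if_monic_trinomial[OF ij(1)]) (use s b in auto)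
  then have "s * u / s \<in> loc" by (rule locI[OF _ b(3)])
  then show ?thesis using s by simp
qed

text \<open>If \<open>b \<notin> a R\<close> has a maximal annihilator ideal modulo \<open>a R\<close>, that ideal is \<open>P\<close>, so \<open>b P \<subseteq> a R\<close>.\<close>

lemma ex_annihilated:
  assumes a: "a \<in> P" "a \<noteq> 0"
  obtains b where "algebraic_int b" "b / a \<notin> loc" "\<And>p. p \<in> P \<Longrightarrow> b * p / a \<in> loc"
proof -
  have ai: "algebraic_int a" using a integral by blast
  obtain R where R: "finite R" "transversal int_ring (mult_ideal a) R"
    using fin_index_mult_ideal[OF a(2)] unfolding fin_index_def by blast
  define C where "C b = {c. algebraic_int c \<and> c * b / a \<in> loc}" for b
  define good where "good b \<longleftrightarrow> algebraic_int b \<and> b / a \<notin> loc" for b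
  have g1: "good 1"
  proof -
    have "1 / a \<notin> loc"
    proof
      assume "1 / a \<in> loc"
      then obtain y s where ys: "1 / a = y / s" "algebraic_int y" "s \<in> outside" by (rule locE)
      then have "s = y * a" using a outside_nonzero[OF ys(3)] by (simp add: field_simps)
      then show False using ys absorb a by auto
    qed
    then show ?thesis by (simp add: good_def)
  qed
  \<comment> \<open>For integral \<open>b\<close>, the ideal \<open>C b\<close> contains
    \<open>mult_ideal a\<close>, so it is determined by its part in the finite transversal
    \<open>R\<close>, and its size can be measured by a cardinality.\<close>
  have "\<forall>b. good b \<longrightarrow> card (C b \<inter> R) < Suc (card R)" using R by (auto intro: card_mono simp: less_Suc_eq_le)
  from ex_has_greatest_nat[OF g1 this] obtain b where b: "good b" and bmax: "\<And>b'. good b' \<Longrightarrow> card (C b' \<inter> R) \<le> card (C b \<inter> R)"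
    by blast
  have bi: "algebraic_int b" using b by (simp add: good_def)
  have aC: "a * z \<in> C b'" if "algebraic_int z" "algebraic_int b'" for z b'
  proof -
    have "a * z * b' / a = z * b'" using a by simp
    then show ?thesis using that ai by (auto simp: C_def intro!: loc_integral)
  qed
  have Cdiff: "x - y \<in> C b'" if "x \<in> C b'" "y \<in> C b'" for x y b'
    using that loc_diff[of "x * b' / a" "y * b' / a"] by (auto simp: C_def left_diff_distrib diff_divide_distrib)
  have "p \<in> C b" if p: "p \<in> P" for p
  proof (rule ccontr)
    assume np: "p \<notin> C b"
    have pi: "algebraic_int p" using p integral by blast
    have gp: "good (p * b)" using np pi bi by (auto simp: good_def C_def)
    have sub: "C b \<subseteq> C (p * b)"
    proof
      fix c assume c: "c \<in> C b"
      then have "p * (c * b / a) \<in> loc" by (intro loc_mult[OF loc_integral[OF pi]]) (simp add: C_def)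
      then show "c \<in> C (p * b)" using c by (simp add: C_def mult_ac)
    qed
    then have "C b \<inter> R = C (p * b) \<inter> R"
      using bmax[OF gp] R(1) by (intro card_seteq) auto
    have eq: "C (p * b) \<subseteq> C b"
    proof
      fix c assume c: "c \<in> C (p * b)"
      then have ci: "algebraic_int c" by (simp add: C_def)
      then obtain r where r: "r \<in> R" "c - r \<in> mult_ideal a" using R(2) unfolding transversal_def by blast
      then obtain z where z: "algebraic_int z" "c - r = a * z" by blast
      have "c - a * z \<in> C (p * b)" by (rule Cdiff[OF c aC]) (use z pi bi in auto)
      then have "r \<in> C (p * b)" using z by (simp add: algebra_simps)
      then have "r \<in> C b" using \<open>C b \<inter> R = C (p * b) \<inter> R\<close> r(1) by blast
      moreover have "a * (- z) \<in> C b" using aC[of "- z" b] z bi by simp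
      ultimately have "r - a * (- z) \<in> C b" by (rule Cdiff)
      then show "c \<in> C b" using z by (simp add: algebra_simps)
    qed
    \<comment> \<open>As \<open>C (p * b) = C b\<close>, a power of \<open>p\<close> in
      \<open>C b\<close> would drag \<open>1\<close> into it. The congruence of two powers of
      \<open>p\<close> modulo \<open>a\<close> then contradicts this: it puts \<open>p ^ i\<close>
      into \<open>C b\<close>, because \<open>1 - p ^ d\<close> is a unit of the
      localization.\<close>
    have pow: "p ^ n \<notin> C b" for n
    proof (induction n)
      case 0
      then show ?case using b by (simp add: C_def good_def)
    next
      case (Suc n)
      show ?case
      proof
        assume "p ^ Suc n \<in> C b"
        then have "p ^ n \<in> C (p * b)" using pi by (auto simp: C_def mult_ac)
        then show False using eq Suc by blast
      qed
    qed
    obtain i j w where ij: "i < j" "algebraic_int w" "p ^ i - p ^ j = a * w"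
      by (rule pigeonhole_mod_ideal[OF a(2), of "\<lambda>n. p ^ n", OF algebraic_int_power[OF pi]])
    define d where "d = j - i"
    have j: "j = i + d" "d > 0" using ij by (simp_all add: d_def)
    have s: "1 - p ^ d \<in> outside" by (intro one_minus_outside power_in p j)
    have "p ^ i * (1 - p ^ d) = a * w" using ij(3) unfolding j by (simp add: power_add algebra_simps)
    then have "p ^ i = a * w / (1 - p ^ d)" using outside_nonzero[OF s] by (simp add: eq_divide_eq)
    then have "p ^ i * b / a = w * b * (1 / (1 - p ^ d))" using a by simp
    also have "\<dots> \<in> loc" by (intro loc_mult loc_integral loc_inverse s) (use ij bi in auto)
    finally have "p ^ i \<in> C b" using pi by (auto simp: C_def)
    then show False using pow by blast
  qed
  then have "b * p / a \<in> loc" if "p \<in> P" for p using that by (simp add: C_def mult.commute[of b])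
  then show ?thesis using that[of b] b unfolding good_def by blast
qed

text \<open>The element \<open>u = b / a\<close> maps \<open>P\<close> into \<open>loc\<close> but
  does not lie in \<open>loc\<close>. If \<open>u * p\<close> were a non-unit for every
  \<open>p \<in> P\<close>, all \<open>a * u ^ n\<close> would stay in \<open>loc\<close>, against
  \<open>loc_integrally_closed\<close>; so some \<open>u * p\<close> is a unit, and
  \<open>\<pi> = 1 / u\<close> is a uniformizer. For the same reason the products
  \<open>x * u ^ n\<close> of an integer \<open>x \<noteq> 0\<close> reach a unit for some
  \<open>n\<close>.\<close>

theorem ex_uniformizer:
  obtains \<pi> where "\<pi> \<noteq> 0" "\<exists>p\<in>P. \<exists>s\<in>outside. \<pi> = p / s"
    "\<And>x. x \<noteq> 0 \<Longrightarrow> \<exists>n. \<exists>y\<in>outside. \<exists>s\<in>outside. x = \<pi> powi n * (y / s)"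
proof -
  obtain k :: nat where k: "k > 0" "of_nat k \<in> P" using nonzero by blast
  define a where "a = (of_nat k :: 'a)"
  have a: "a \<in> P" "a \<noteq> 0" "algebraic_int a" using k by (auto simp: a_def)
  obtain b where b: "algebraic_int b" "b / a \<notin> loc" "\<And>p. p \<in> P \<Longrightarrow> b * p / a \<in> loc"
    by (rule ex_annihilated[OF a(1,2)]) blast
  define u where "u = b / a"
  have up: "u * p \<in> loc" if "p \<in> P" for p using b(3)[OF that] by (simp add: u_def)
  have unloc: "u \<notin> loc" using b(2) by (simp add: u_def)
  have u0: "u \<noteq> 0" using unloc loc_integral[of 0] by auto
  have "\<exists>p\<in>P. \<exists>y\<in>outside. \<exists>s\<in>outside. u * p = y / s"
  proof (rule ccontr)
    assume no: "\<not> ?thesis"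
    have step: "\<exists>q\<in>P. \<exists>t\<in>outside. u * (p / s) = q / t" if ps: "p \<in> P" "s \<in> outside" for p s
    proof -
      obtain y t where y: "u * p = y / t" "algebraic_int y" "t \<in> outside" using up[OF ps(1)] by (rule locE)
      then have "y \<in> P" using no ps by blast
      moreover have "u * (p / s) = y / (t * s)"
      proof -
        have "u * (p / s) = u * p / s" by simp
        then show ?thesis by (simp add: y(1))
      qed
      ultimately show ?thesis using outside_mult[OF y(3) ps(2)] by blast
    qed
    have "\<exists>q\<in>P. \<exists>t\<in>outside. a * u ^ n = q / t" for n
    proof (induction n)
      case 0
      then show ?case using a outside_one by (intro bexI[of _ a] bexI[of _ 1]) auto
    next
      case (Suc n)
      then obtain q t where q: "q \<in> P" "t \<in> outside" "a * u ^ n = q / t" by blast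
      have "a * u ^ Suc n = u * (a * u ^ n)" by (simp add: mult_ac)
      then have "a * u ^ Suc n = u * (q / t)" by (simp only: q(3))
      then show ?case using step[OF q(1,2)] by simp
    qed
    then have "a * u ^ n \<in> loc" for n using locI integral by metis
    then show False using loc_integrally_closed[OF a(3,2)] unloc by blast
  qed
  then obtain p y s where p: "p \<in> P" "y \<in> outside" "s \<in> outside" "u * p = y / s" by blast
  define \<pi> where "\<pi> = 1 / u"
  have \<pi>: "\<pi> \<noteq> 0" "\<pi> = (s * p) / y"
    using u0 p(4) outside_nonzero[OF p(2)] outside_nonzero[OF p(3)] by (auto simp: \<pi>_def field_simps)
  have sp: "s * p \<in> P" using absorb p by blast
  have main: "\<exists>n::nat. \<exists>y\<in>outside. \<exists>s\<in>outside. x * u ^ n = y / s" if x: "algebraic_int x" "x \<noteq> 0" for x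
  proof (rule ccontr)
    assume no: "\<not> ?thesis"
    have "x * u ^ n \<in> loc" for n
    proof (induction n)
      case 0
      then show ?case using x loc_integral by simp
    next
      case (Suc n)
      then obtain y s where y: "x * u ^ n = y / s" "algebraic_int y" "s \<in> outside" by (rule locE)
      then have "y \<in> P" using no by blast
      then have "(u * y) * (1 / s) \<in> loc" by (intro loc_mult up loc_inverse y)
      moreover have "(u * y) * (1 / s) = x * u ^ Suc n" using y(1) by (simp add: mult_ac)
      ultimately show ?case by simp
    qed
    then show False using loc_integrally_closed[OF x] unloc by blast
  qed
  have "\<exists>n. \<exists>y\<in>outside. \<exists>s\<in>outside. x = \<pi> powi n * (y / s)" if x: "x \<noteq> 0" for x
  proof -
    obtain k :: nat where k: "k > 0" "algebraic_int (of_nat k * x)" using exists_int_multiple_algebraic_int by metis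
    have k0: "(of_nat k :: 'a) \<noteq> 0" using k by simp
    obtain m y s where m: "y \<in> outside" "s \<in> outside" "of_nat k * x * u ^ m = y / s"
      using main[OF k(2)] k0 x by auto
    obtain l y' s' where l: "y' \<in> outside" "s' \<in> outside" "of_nat k * u ^ l = y' / s'"
      using main[of "of_nat k"] k0 by auto
    note nz = outside_nonzero[OF m(1)] outside_nonzero[OF m(2)] outside_nonzero[OF l(1)] outside_nonzero[OF l(2)]
    have "x = u ^ l / u ^ m * ((of_nat k * x * u ^ m) / (of_nat k * u ^ l))" using u0 k0 by (simp add: field_simps)
    also have "(of_nat k * x * u ^ m) / (of_nat k * u ^ l) = (y * s') / (s * y')" unfolding m(3) l(3) using nz by (simp add: field_simps)
    also have "u ^ l / u ^ m = \<pi> powi (int m - int l)"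
      using u0 by (simp add: \<pi>_def power_int_diff power_one_over field_simps)
    finally show ?thesis using outside_mult[OF m(1) l(2)] outside_mult[OF m(2) l(1)] by blast
  qed
  then show ?thesis using that[of \<pi>] \<pi> sp p(2) by blast
qed

end

section \<open>Valuations and algebraic integers\<close>

lemma finite_place_props:
  assumes "v \<in> finite_places"
  shows "x \<noteq> 0 \<Longrightarrow> y \<noteq> 0 \<Longrightarrow> v (x * y) = v x + v y"
    and "x \<noteq> 0 \<Longrightarrow> y \<noteq> 0 \<Longrightarrow> v (x / y) = v x - v y"
    and "x \<noteq> 0 \<Longrightarrow> v (x ^ n) = int n * v x"
    and "x \<noteq> 0 \<Longrightarrow> v (x powi k) = k * v x"
proof -
  have m: "v (x * y) = v x + v y" if "x \<noteq> 0" "y \<noteq> 0" for x y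
    using assms that by (auto simp: finite_places_def)
  show "x \<noteq> 0 \<Longrightarrow> y \<noteq> 0 \<Longrightarrow> v (x * y) = v x + v y" by (rule m)
  have d: "v (x / y) = v x - v y" if "x \<noteq> 0" "y \<noteq> 0" for x y using m[of "x / y" y] that by simp
  show "x \<noteq> 0 \<Longrightarrow> y \<noteq> 0 \<Longrightarrow> v (x / y) = v x - v y" by (rule d)
  have p: "v (x ^ n) = int n * v x" if "x \<noteq> 0" for x n
    using that by (induction n) (auto simp: m val_one[OF assms] algebra_simps)
  show "x \<noteq> 0 \<Longrightarrow> v (x ^ n) = int n * v x" by (rule p)
  show "v (x powi k) = k * v x" if "x \<noteq> 0"
  proof (cases "k \<ge> 0")
    case True
    then show ?thesis using p[OF that, of "nat k"] by (simp add: power_int_def)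
  next
    case False
    have "v (1 / x ^ nat (- k)) = - (int (nat (- k)) * v x)" using d[of 1 "x ^ nat (- k)"] p[OF that] that val_one[OF assms] by simp
    then show ?thesis using False by (simp add: power_int_def inverse_eq_divide power_one_over)
  qed
qed

lemma val_ge_sum: "v \<in> finite_places \<Longrightarrow> (\<And>i. i \<in> I \<Longrightarrow> val_ge v k (f i)) \<Longrightarrow> val_ge v k (sum f I)"
  by (induction I rule: infinite_finite_induct) (auto intro: val_ge_add)

lemma val_ge_of_nat: "v \<in> finite_places \<Longrightarrow> val_ge v 0 (of_nat n)"
proof (induction n)
  case (Suc n)
  have "val_ge v 0 1" using val_one[OF Suc.prems] by (simp add: val_ge_def)
  then show ?case using val_ge_add[OF Suc.prems] Suc by simp
qed simp

lemma val_ge_of_int: "v \<in> finite_places \<Longrightarrow> val_ge v 0 (of_int k)"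
  by (cases k rule: int_cases2) (auto simp: val_ge_of_nat val_ge_minus)

text \<open>If \<open>v x < 0\<close>, all lower terms of a monic relation have valuation at least
  \<open>(k - 1) * v x\<close>, which is more than the valuation \<open>k * v x\<close> of the
  leading term.\<close>

lemma val_ge_algebraic_int:
  assumes v: "v \<in> finite_places" and x: "algebraic_int x"
  shows "val_ge v 0 x"
proof (rule ccontr)
  assume "\<not> val_ge v 0 x"
  then have x0: "x \<noteq> 0" "v x < 0" by (auto simp: val_ge_def)
  obtain k and c :: "nat \<Rightarrow> int" where k: "k > 0" "x ^ k = (\<Sum>b<k. of_int (c b) * x ^ b)"
    using algebraic_int_power_eq[OF x] by blast
  have "val_ge v ((int k - 1) * v x) (of_int (c b) * x ^ b)" if "b < k" for b
  proof -
    have "val_ge v (0 + int b * v x) (of_int (c b) * x ^ b)"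
      by (rule val_ge_mult[OF v val_ge_of_int[OF v]]) (simp add: val_ge_def finite_place_props(3)[OF v x0(1)])
    moreover have "(int k - 1) * v x \<le> int b * v x" using that x0 by (intro mult_right_mono_neg) auto
    ultimately show ?thesis using val_ge_mono by fastforce
  qed
  then have "val_ge v ((int k - 1) * v x) (x ^ k)" unfolding k(2) by (intro val_ge_sum[OF v]) auto
  then have "(int k - 1) * v x \<le> int k * v x" using x0 finite_place_props(3)[OF v x0(1)] by (simp add: val_ge_def)
  then show False using x0 by (simp add: left_diff_distrib)
qed

context max_ideal
begin

text \<open>\<open>v x\<close> is the exponent \<open>n\<close> that makes
  \<open>x / \<pi> powi n\<close> a unit. It is unique because a positive power of
  \<open>\<pi>\<close> has its numerator in \<open>P\<close> and its denominator outside. The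
  ultrametric inequality comes from \<open>1 + y / x \<in> loc\<close> when
  \<open>v x \<le> v y\<close>.\<close>

theorem ex_place:
  obtains v where "v \<in> finite_places" "\<And>x. val_ge v 0 x \<Longrightarrow> x \<in> loc"
proof -
  obtain \<pi> where \<pi>: "\<pi> \<noteq> 0" "\<exists>p\<in>P. \<exists>s\<in>outside. \<pi> = p / s"
    "\<And>x. x \<noteq> 0 \<Longrightarrow> \<exists>n. \<exists>y\<in>outside. \<exists>s\<in>outside. x = \<pi> powi n * (y / s)"
    by (rule ex_uniformizer) blast
  obtain p s0 where ps: "p \<in> P" "s0 \<in> outside" "\<pi> = p / s0" using \<pi>(2) by blast
  define is_unit where "is_unit x \<longleftrightarrow> (\<exists>y\<in>outside. \<exists>s\<in>outside. x = y / s)" for x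
  have unit_mult: "is_unit (x * y)" if xy: "is_unit x" "is_unit y" for x y
  proof -
    obtain a s where "a \<in> outside" "s \<in> outside" "x = a / s" using xy(1) unfolding is_unit_def by (elim bexE)
    moreover obtain b t where "b \<in> outside" "t \<in> outside" "y = b / t" using xy(2) unfolding is_unit_def by (elim bexE)
    ultimately have "x * y = (a * b) / (s * t)" "a * b \<in> outside" "s * t \<in> outside" using outside_mult by auto
    then show ?thesis unfolding is_unit_def by blast
  qed
  have unit_inv: "is_unit (1 / x)" if "is_unit x" for x
    using that unfolding is_unit_def by (metis divide_divide_eq_right mult_1)
  have unit_nz: "x \<noteq> 0" if "is_unit x" for x using that outside_nonzero unfolding is_unit_def by fastforce
  have pos: "\<not> is_unit (\<pi> ^ n)" if "n > 0" for n
  proof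
    assume "is_unit (\<pi> ^ n)"
    then obtain y s where y: "y \<in> outside" "s \<in> outside" "\<pi> ^ n = y / s" unfolding is_unit_def by blast
    have "s * p ^ n = y * s0 ^ n"
      using y(3) outside_nonzero[OF y(2)] outside_nonzero[OF ps(2)] unfolding ps(3) by (simp add: power_divide field_simps)
    moreover have "s * p ^ n \<in> P" using absorb power_in[OF ps(1) that] y by blast
    moreover have "y * s0 ^ n \<in> outside" using outside_mult[OF y(1) outside_power[OF ps(2)]] .
    ultimately show False by auto
  qed
  have pow0: "n = 0" if "is_unit (\<pi> powi n)" for n
  proof (rule ccontr)
    assume "n \<noteq> 0"
    then consider "n > 0" | "n < 0" by linarith
    then show False
    proof cases
      case 1
      then show False using that pos[of "nat n"] by (simp add: power_int_def)
    next
      case 2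
      have "is_unit (1 / \<pi> powi n)" using that by (rule unit_inv)
      then show False using 2 pos[of "nat (- n)"] by (simp add: power_int_def inverse_eq_divide power_one_over)
    qed
  qed
  have uniq: "m = n" if "is_unit (x / \<pi> powi m)" "is_unit (x / \<pi> powi n)" for x m n
  proof -
    have "x \<noteq> 0" using unit_nz[OF that(1)] by auto
    have "is_unit ((x / \<pi> powi n) * (1 / (x / \<pi> powi m)))" by (intro unit_mult unit_inv that)
    also have "(x / \<pi> powi n) * (1 / (x / \<pi> powi m)) = \<pi> powi (m - n)"
      using \<pi>(1) \<open>x \<noteq> 0\<close> by (simp add: power_int_diff)
    finally show ?thesis using pow0 by fastforce
  qed
  have ex: "\<exists>n. is_unit (x / \<pi> powi n)" if x0: "x \<noteq> 0" for x
  proof -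
    obtain n y s where n: "y \<in> outside" "s \<in> outside" "x = \<pi> powi n * (y / s)" using \<pi>(3)[OF x0] by blast
    then have "x / \<pi> powi n = y / s" using \<pi>(1) by simp
    then show ?thesis using n unfolding is_unit_def by blast
  qed
  define v where "v x = (if x = 0 then 0 else THE n. is_unit (x / \<pi> powi n))" for x
  have v: "is_unit (x / \<pi> powi (v x))" if "x \<noteq> 0" for x
  proof -
    obtain n where "is_unit (x / \<pi> powi n)" using ex \<open>x \<noteq> 0\<close> by blast
    then have "(THE n. is_unit (x / \<pi> powi n)) = n" by (intro the_equality uniq)
    then show ?thesis using \<open>is_unit (x / \<pi> powi n)\<close> that by (simp add: v_def)
  qed
  have v_eq: "v x = n" if "x \<noteq> 0" "is_unit (x / \<pi> powi n)" for x n by (rule uniq[OF v[OF that(1)] that(2)])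
  have vmult: "v (x * y) = v x + v y" if "x \<noteq> 0" "y \<noteq> 0" for x y
  proof (rule v_eq)
    have "is_unit ((x / \<pi> powi v x) * (y / \<pi> powi v y))" by (intro unit_mult v that)
    then show "is_unit (x * y / \<pi> powi (v x + v y))" using \<pi>(1) by (simp add: power_int_add)
  qed (use that in simp)
  have unit_loc: "x \<in> loc" if "is_unit x" for x using that locI unfolding is_unit_def by blast
  have \<pi>loc: "\<pi> \<in> loc" unfolding ps(3) by (rule locI[OF integral[OF ps(1)] ps(2)])
  have \<pi>pow: "\<pi> ^ n \<in> loc" for n by (induction n) (auto intro: loc_mult loc_integral \<pi>loc)
  have ge_loc: "x \<in> loc" if "x \<noteq> 0" "v x \<ge> 0" for x
  proof -
    have "\<pi> ^ nat (v x) * (x / \<pi> powi v x) \<in> loc" by (intro loc_mult \<pi>pow unit_loc v that)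
    then show ?thesis using \<pi>(1) that(2) by (simp add: power_int_def)
  qed
  have loc_ge: "v x \<ge> 0" if x: "x \<noteq> 0" "x \<in> loc" for x
  proof (rule ccontr)
    assume "\<not> v x \<ge> 0"
    then have neg: "v x < 0" by simp
    define n where "n = nat (- v x)"
    have n: "n > 0" "v x = - int n" using neg by (simp_all add: n_def)
    have "is_unit (x * \<pi> ^ n)" using v[OF x(1)] by (simp add: n(2) power_int_minus divide_inverse)
    then obtain y s where y: "y \<in> outside" "s \<in> outside" "x * \<pi> ^ n = y / s" unfolding is_unit_def by blast
    obtain z t where z: "x = z / t" "algebraic_int z" "t \<in> outside" by (rule locE[OF x(2)])
    have "s * z * p ^ n = y * (t * s0 ^ n)"
      using y(3) outside_nonzero[OF y(2)] outside_nonzero[OF ps(2)] outside_nonzero[OF z(3)]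
      unfolding ps(3) z(1) by (simp add: power_divide field_simps)
    moreover have "s * z * p ^ n \<in> P" using absorb power_in[OF ps(1) n(1)] y z by blast
    moreover have "y * (t * s0 ^ n) \<in> outside" by (intro outside_mult outside_power y z ps)
    ultimately show False by auto
  qed
  have ultra: "min (v x) (v y) \<le> v (x + y)" if "x \<noteq> 0" "y \<noteq> 0" "x + y \<noteq> 0" "v x \<le> v y" for x y
  proof -
    have q: "v (y / x) = v y - v x" using vmult[of "y / x" x] that by simp
    have "y / x \<in> loc" by (rule ge_loc) (use that q in auto)
    then have l: "1 + y / x \<in> loc" by (rule loc_add[OF loc_integral[OF algebraic_int_1]])
    have e: "x + y = x * (1 + y / x)" using that(1) by (simp add: distrib_left)
    have nz: "1 + y / x \<noteq> 0" using that(3) unfolding e by simp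
    have "v (x + y) = v x + v (1 + y / x)" unfolding e by (rule vmult[OF that(1) nz])
    then show ?thesis using loc_ge[OF nz l] that(4) by simp
  qed
  have "v \<in> finite_places"
    unfolding finite_places_def mem_Collect_eq
  proof (intro conjI allI impI)
    show "v 0 = 0" by (simp add: v_def)
    show "v ` (- {0}) = UNIV"
    proof -
      have "n \<in> v ` (- {0})" for n
      proof -
        have nz: "\<pi> powi n \<noteq> 0" using \<pi>(1) by simp
        have "is_unit (\<pi> powi n / \<pi> powi n)" using nz outside_one unfolding is_unit_def by (intro bexI[of _ 1]) auto
        then have "v (\<pi> powi n) = n" by (rule v_eq[OF nz])
        then show ?thesis using nz by (intro image_eqI[of _ _ "\<pi> powi n"]) auto
      qed
      then show ?thesis by blast
    qed
    fix x y :: 'a assume xy: "x \<noteq> 0" "y \<noteq> 0"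
    show "v (x * y) = v x + v y" by (rule vmult[OF xy])
    assume "x + y \<noteq> 0"
    then show "min (v x) (v y) \<le> v (x + y)"
      using ultra[of x y] ultra[of y x] xy by (cases "v x \<le> v y") (auto simp: add.commute min.commute)
  qed
  moreover have "x \<in> loc" if "val_ge v 0 x" for x
    using that ge_loc loc_integral[of 0] by (cases "x = 0") (auto simp: val_ge_def)
  ultimately show ?thesis using that by blast
qed

text \<open>A place whose valuation ideal on the integers is \<open>P\<close> has value \<open>1\<close> on a uniformizer.\<close>

theorem place_unique:
  assumes v: "v \<in> finite_places" and w: "w \<in> finite_places"
    and Pv: "\<And>x. algebraic_int x \<Longrightarrow> x \<in> P \<longleftrightarrow> val_ge v 1 x"
    and Pw: "\<And>x. algebraic_int x \<Longrightarrow> x \<in> P \<longleftrightarrow> val_ge w 1 x"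
  shows "v = w"
proof -
  obtain \<pi> where \<pi>: "\<pi> \<noteq> 0" "\<exists>p\<in>P. \<exists>s\<in>outside. \<pi> = p / s"
    "\<And>x. x \<noteq> 0 \<Longrightarrow> \<exists>n. \<exists>y\<in>outside. \<exists>s\<in>outside. x = \<pi> powi n * (y / s)"
    by (rule ex_uniformizer) blast
  obtain p s0 where ps: "p \<in> P" "s0 \<in> outside" "\<pi> = p / s0" using \<pi>(2) by blast
  have p0: "p \<noteq> 0" using \<pi>(1) ps(3) by auto
  have *: "u \<pi> = 1 \<and> (\<forall>x\<noteq>0. \<forall>n. (\<exists>y\<in>outside. \<exists>s\<in>outside. x = \<pi> powi n * (y / s)) \<longrightarrow> u x = n)"
    if u: "u \<in> finite_places" and Pu: "\<And>x. algebraic_int x \<Longrightarrow> x \<in> P \<longleftrightarrow> val_ge u 1 x" for u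
  proof -
    have out: "u s = 0" if "s \<in> outside" for s
      using that Pu[of s] val_ge_algebraic_int[OF u, of s] by (auto simp: val_ge_def)
    have eq: "u x = n * u \<pi>" if "y \<in> outside" "s \<in> outside" "x = \<pi> powi n * (y / s)" for x n y s
    proof -
      have nz: "y \<noteq> 0" "s \<noteq> 0" using outside_nonzero that by auto
      have "u x = u (\<pi> powi n) + u (y / s)" unfolding that(3) by (rule finite_place_props(1)[OF u]) (use nz \<pi>(1) in auto)
      then show ?thesis using finite_place_props(2)[OF u nz] finite_place_props(4)[OF u \<pi>(1)] out that by simp
    qed
    have "u \<pi> = u p - u s0" unfolding ps(3) by (rule finite_place_props(2)[OF u p0 outside_nonzero[OF ps(2)]])
    then have pos: "u \<pi> \<ge> 1" using out[OF ps(2)] Pu[of p] integral[OF ps(1)] ps(1) p0 by (simp add: val_ge_def)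
    have "1 \<in> u ` (- {0})" using u by (simp add: finite_places_def)
    then obtain x where x: "x \<noteq> 0" "u x = 1" by force
    obtain n y s where "y \<in> outside" "s \<in> outside" "x = \<pi> powi n * (y / s)" using \<pi>(3)[OF x(1)] by blast
    then have "u x = n * u \<pi>" by (rule eq)
    \<comment> \<open>The value group is all of \<open>int\<close>, so
      \<open>1 = n * u \<pi>\<close> for some \<open>n\<close>, which forces the positive integer
      \<open>u \<pi>\<close> to be \<open>1\<close>.\<close>
    then have one: "u \<pi> = 1" using pos x(2) zmult_eq_1_iff[of n "u \<pi>"] by simp
    have "u x = n" if h: "\<exists>y\<in>outside. \<exists>s\<in>outside. x = \<pi> powi n * (y / s)" for x n
    proof -
      obtain y s where "y \<in> outside" "s \<in> outside" "x = \<pi> powi n * (y / s)" using h by (elim bexE)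
      then have "u x = n * u \<pi>" by (rule eq)
      then show ?thesis using one by simp
    qed
    then show ?thesis using one by blast
  qed
  show ?thesis
  proof
    fix x show "v x = w x"
    proof (cases "x = 0")
      case True
      then show ?thesis using v w by (simp add: finite_places_def)
    next
      case False
      obtain n where "\<exists>y\<in>outside. \<exists>s\<in>outside. x = \<pi> powi n * (y / s)" using \<pi>(3)[OF False] by blast
      then show ?thesis using *[OF v Pv] *[OF w Pw] False by simp
    qed
  qed
qed

end

text \<open>The denominators of \<open>x\<close> form a proper ideal \<open>I\<close> that contains
  a positive integer \<open>k\<close>. A proper ideal \<open>P\<close> above \<open>I\<close> that
  meets a finite transversal \<open>R\<close> modulo \<open>k\<close> in as many elements as
  possible is maximal, since ideals above \<open>I\<close> are determined by their part in
  \<open>R\<close>. At the place of \<open>P\<close> the element \<open>x\<close> is not integral: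
  otherwise it would have a denominator outside \<open>P\<close>.\<close>

theorem ex_place_negative:
  fixes x :: "'a::number_field"
  assumes x: "\<not> algebraic_int x"
  obtains v where "v \<in> finite_places" "\<not> val_ge v 0 x"
proof -
  obtain k :: nat where k: "k > 0" "algebraic_int (of_nat k * x)" using exists_int_multiple_algebraic_int by metis
  have k0: "(of_nat k :: 'a) \<noteq> 0" using k by simp
  obtain R where R: "finite R" "transversal int_ring (mult_ideal (of_nat k :: 'a)) R"
    using fin_index_mult_ideal[OF k0] unfolding fin_index_def by blast
  define I where "I = {d. algebraic_int d \<and> algebraic_int (d * x)}"
  define ideal where "ideal J \<longleftrightarrow> I \<subseteq> J \<and> J \<subseteq> int_ring \<and> add_subgroup J \<and> (\<forall>a j. algebraic_int a \<longrightarrow> j \<in> J \<longrightarrow> a * j \<in> J) \<and> 1 \<notin> J" for J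
  have "ideal I" unfolding ideal_def
  proof (intro conjI allI impI)
    show "add_subgroup I" by (auto simp: add_subgroup_def I_def left_diff_distrib)
    show "1 \<notin> I" using x by (simp add: I_def)
    show "a * j \<in> I" if "algebraic_int a" "j \<in> I" for a j
      using that by (auto simp: I_def mult.assoc)
  qed (auto simp: I_def)
  moreover have "\<forall>J. ideal J \<longrightarrow> card (J \<inter> R) < Suc (card R)" using R by (auto intro: card_mono simp: less_Suc_eq_le)
  ultimately obtain P where P: "ideal P" and Pmax: "\<And>J. ideal J \<Longrightarrow> card (J \<inter> R) \<le> card (P \<inter> R)"
    using ex_has_greatest_nat[of ideal I "\<lambda>J. card (J \<inter> R)" "Suc (card R)"] by blast
  have PD: "I \<subseteq> P" "P \<subseteq> int_ring" "add_subgroup P" "1 \<notin> P" "\<And>a j. algebraic_int a \<Longrightarrow> j \<in> P \<Longrightarrow> a * j \<in> P"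
    using P unfolding ideal_def by blast+
  have kP: "of_nat k \<in> P" using PD(1) k by (auto simp: I_def)
  interpret max_ideal P
  proof
    show "\<exists>k::nat. k > 0 \<and> of_nat k \<in> P" using k kP by blast
    fix a assume a: "algebraic_int a" "a \<notin> P"
    show "\<exists>b. algebraic_int b \<and> 1 - a * b \<in> P"
    proof (rule ccontr)
      assume no: "\<not> ?thesis"
      define J where "J = {p + a * b | p b. p \<in> P \<and> algebraic_int b}"
      have PJ: "P \<subseteq> J" unfolding J_def by (force intro: exI[of _ 0])
      have aJ: "a \<in> J" unfolding J_def using add_subgroupD(1)[OF PD(3)] by (force intro: exI[of _ 1])
      have "ideal J" unfolding ideal_def
      proof (intro conjI allI impI)
        show "I \<subseteq> J" using PD(1) PJ by blast
        show "J \<subseteq> int_ring" unfolding J_def using PD(2) a by auto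
        show "1 \<notin> J"
        proof
          assume "1 \<in> J"
          then obtain p b where "1 = p + a * b" "p \<in> P" "algebraic_int b" unfolding J_def by blast
          moreover from this have "1 - a * b = p" by (simp add: algebra_simps)
          ultimately show False using no by auto
        qed
        show "c * j \<in> J" if c: "algebraic_int c" "j \<in> J" for c j
        proof -
          obtain p b where "j = p + a * b" "p \<in> P" "algebraic_int b" using c(2) unfolding J_def by blast
          then have "c * j = c * p + a * (c * b)" "c * p \<in> P" "algebraic_int (c * b)" using c(1) PD(5) by (auto simp: algebra_simps)
          then show ?thesis unfolding J_def by blast
        qed
        show "add_subgroup J" unfolding add_subgroup_def
        proof (intro conjI ballI)
          show "0 \<in> J" using PJ add_subgroupD(1)[OF PD(3)] by blast
          fix u w assume "u \<in> J" "w \<in> J"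
          then obtain p b q c where "u = p + a * b" "p \<in> P" "algebraic_int b" "w = q + a * c" "q \<in> P" "algebraic_int c"
            unfolding J_def by blast
          then have "u - w = (p - q) + a * (b - c)" "p - q \<in> P" "algebraic_int (b - c)"
            using add_subgroupD(2)[OF PD(3)] by (auto simp: algebra_simps)
          then show "u - w \<in> J" unfolding J_def by blast
        qed
      qed
      then have JD: "J \<subseteq> int_ring" "add_subgroup J" "card (J \<inter> R) \<le> card (P \<inter> R)" using Pmax unfolding ideal_def by blast+
      then have eq: "P \<inter> R = J \<inter> R" using PJ R(1) by (intro card_seteq) auto
      obtain r where r: "r \<in> R" "a - r \<in> mult_ideal (of_nat k)" using R(2) a(1) unfolding transversal_def by blast
      then have "a - r \<in> P" using PD(5)[OF _ kP] by (auto simp: mult.commute)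
      then have "a - (a - r) \<in> J" using add_subgroupD(2)[OF JD(2) aJ] PJ by blast
      then have "r \<in> P" using eq r(1) by auto
      then have "(a - r) + r \<in> P" using \<open>a - r \<in> P\<close> add_subgroupD(4)[OF PD(3)] by blast
      then show False using a by simp
    qed
  qed (use PD in auto)
  obtain v where v: "v \<in> finite_places" "\<And>x. val_ge v 0 x \<Longrightarrow> x \<in> loc" by (rule ex_place) blast
  have "x \<notin> loc"
  proof
    assume "x \<in> loc"
    then obtain y s where ys: "x = y / s" "algebraic_int y" "s \<in> outside" by (rule locE)
    then have "s * x = y" using outside_nonzero by simp
    then have "s \<in> I" using ys by (simp add: I_def)
    then show False using PD(1) ys by blast
  qed
  then show ?thesis using that v by blast
qed

lemma algebraic_int_iff_val_ge:
  "algebraic_int x \<longleftrightarrow> (\<forall>v\<in>finite_places. val_ge v 0 x)"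
  using ex_place_negative val_ge_algebraic_int by metis

text \<open>If \<open>x\<close> has value \<open>-1\<close> and \<open>k * x\<close> is integral,
  then \<open>k\<close> has positive value. For an integer \<open>a\<close> of value
  \<open>0\<close>, a congruence of two powers of \<open>a\<close> modulo \<open>k\<close> shows
  that \<open>1 - a * a ^ d\<close> has positive value, so a power of \<open>a\<close> inverts it
  modulo the ideal.\<close>

lemma place_ideal:
  fixes v :: "'a::number_field \<Rightarrow> int"
  assumes v: "v \<in> finite_places"
  shows "max_ideal {x. algebraic_int x \<and> val_ge v 1 x}" (is "max_ideal ?P")
proof -
  have kex: "\<exists>k::nat. k > 0 \<and> val_ge v 1 (of_nat k)"
  proof -
    have "- 1 \<in> v ` (- {0})" using v by (simp add: finite_places_def)
    then obtain x where x: "x \<noteq> 0" "v x = - 1" by force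
    obtain k :: nat where k: "k > 0" "algebraic_int (of_nat k * x)" using exists_int_multiple_algebraic_int by metis
    have k0: "(of_nat k :: 'a) \<noteq> 0" using k by simp
    have "0 \<le> v (of_nat k * x)" using val_ge_algebraic_int[OF v k(2)] k0 x by (simp add: val_ge_def)
    then have "1 \<le> v (of_nat k)" using finite_place_props(1)[OF v k0 x(1)] x(2) by simp
    then show ?thesis using k by (auto simp: val_ge_def)
  qed
  then obtain k :: nat where k: "k > 0" "val_ge v 1 (of_nat k)" by blast
  show ?thesis
  proof
    show "\<exists>k::nat. k > 0 \<and> of_nat k \<in> ?P" using k by auto
    show "add_subgroup ?P" by (auto simp: add_subgroup_def val_ge_diff[OF v])
    show "1 \<notin> ?P" by (simp add: val_ge_def val_one[OF v])
    show "x \<in> ?P \<Longrightarrow> algebraic_int x" for x by simp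
    show "a * x \<in> ?P" if "algebraic_int a" "x \<in> ?P" for a x
      using that val_ge_mult[OF v val_ge_algebraic_int[OF v that(1)], of 1 x] by auto
    fix a assume a: "algebraic_int a" "a \<notin> ?P"
    then have a0: "a \<noteq> 0" "v a = 0" using val_ge_algebraic_int[OF v a(1)] by (auto simp: val_ge_def)
    have k0: "(of_nat k :: 'a) \<noteq> 0" using k by simp
    obtain i j w where ij: "i < j" "algebraic_int w" "a ^ i - a ^ j = of_nat k * w"
      by (rule pigeonhole_mod_ideal[OF k0, of "\<lambda>n. a ^ n", OF algebraic_int_power[OF a(1)]])
    define d where "d = j - i - 1"
    have j: "j = i + Suc d" using ij by (simp add: d_def)
    have e: "a ^ i * (1 - a * a ^ d) = of_nat k * w" using ij(3) unfolding j by (simp add: power_add algebra_simps)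
    have "val_ge v (1 + 0) (of_nat k * w)" by (rule val_ge_mult[OF v k(2) val_ge_algebraic_int[OF v ij(2)]])
    then have "val_ge v 1 (a ^ i * (1 - a * a ^ d))" unfolding e by simp
    have "val_ge v 1 (1 - a * a ^ d)"
    proof (cases "1 - a * a ^ d = 0")
      case True
      then show ?thesis by (simp only: val_ge_zero)
    next
      case False
      have "a ^ i * (1 - a * a ^ d) \<noteq> 0" using False a0 by simp
      then have "1 \<le> v (a ^ i * (1 - a * a ^ d))"
        using \<open>val_ge v 1 (a ^ i * (1 - a * a ^ d))\<close> unfolding val_ge_def by blast
      also have "\<dots> = v (1 - a * a ^ d)"
        using finite_place_props(1)[OF v _ False, of "a ^ i"] finite_place_props(3)[OF v a0(1), of i] a0 by simp
      finally show ?thesis by (simp add: val_ge_def)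
    qed
    then show "\<exists>b. algebraic_int b \<and> 1 - a * b \<in> ?P" using a(1) by (intro exI[of _ "a ^ d"]) auto
  qed
qed

text \<open>A place is determined by its ideal. For integral \<open>N\<close> with
  \<open>v N > 0\<close> the ideal is determined by the elements of a finite transversal modulo
  \<open>N\<close> that it contains, so there are at most as many such places as subsets of it. A
  general \<open>N\<close> is a quotient of integers.\<close>

theorem finite_places_dividing:
  fixes N :: "'a::number_field"
  assumes N: "N \<noteq> 0"
  shows "finite {v\<in>finite_places. v N \<noteq> 0}"
proof -
  have int: "finite {v\<in>finite_places. v N \<noteq> 0}" if N: "N \<noteq> 0" "algebraic_int N" for N :: 'a
  proof -
    obtain R where R: "finite R" "transversal int_ring (mult_ideal N) R"
      using fin_index_mult_ideal[OF N(1)] unfolding fin_index_def by blast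
    have Ri: "R \<subseteq> int_ring" using R by (simp add: transversal_def)
    let ?f = "\<lambda>v. {x\<in>R. val_ge v 1 x}"
    have "?f ` {v\<in>finite_places. v N \<noteq> 0} \<subseteq> Pow R" by auto
    then have "finite (?f ` {v\<in>finite_places. v N \<noteq> 0})" by (rule finite_subset) (use R in simp)
    moreover have "inj_on ?f {v\<in>finite_places. v N \<noteq> 0}"
    proof (rule inj_onI)
      fix v w assume vw: "v \<in> {v\<in>finite_places. v N \<noteq> 0}" "w \<in> {v\<in>finite_places. v N \<noteq> 0}" "?f v = ?f w"
      have red: "val_ge u 1 x \<longleftrightarrow> r \<in> ?f u" if u: "u \<in> finite_places" "u N \<noteq> 0" and r: "r \<in> R" "x - r \<in> mult_ideal N" for u x r
      proof -
        obtain z where z: "algebraic_int z" "x - r = N * z" using r(2) by blast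
        have "val_ge u 1 N" using val_ge_algebraic_int[OF u(1) N(2)] u(2) by (auto simp: val_ge_def)
        then have "val_ge u (1 + 0) (x - r)" unfolding z(2) by (rule val_ge_mult[OF u(1) _ val_ge_algebraic_int[OF u(1) z(1)]])
        then have d: "val_ge u 1 (x - r)" by simp
        then show ?thesis using val_ge_add[OF u(1) d, of r] val_ge_diff[OF u(1) _ d, of x] r(1) by auto
      qed
      have same: "val_ge v 1 x \<longleftrightarrow> val_ge w 1 x" if "algebraic_int x" for x
      proof -
        obtain r where r: "r \<in> R" "x - r \<in> mult_ideal N" using R(2) \<open>algebraic_int x\<close> unfolding transversal_def by blast
        show ?thesis using red[OF _ _ r, of v] red[OF _ _ r, of w] vw by blast
      qed
      have v: "v \<in> finite_places" and w: "w \<in> finite_places" using vw by auto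
      show "v = w"
        by (rule max_ideal.place_unique[OF place_ideal[OF v] v w]) (use same in auto)
    qed
    ultimately show ?thesis by (rule finite_imageD)
  qed
  obtain k :: nat where k: "k > 0" "algebraic_int (of_nat k * N)" using exists_int_multiple_algebraic_int by metis
  have k0: "(of_nat k :: 'a) \<noteq> 0" "of_nat k * N \<noteq> 0" using k N by auto
  have "v N = v (of_nat k * N) - v (of_nat k)" if "v \<in> finite_places" for v
    using finite_place_props(1)[OF that k0(1) N] by simp
  then have "{v\<in>finite_places. v N \<noteq> 0} \<subseteq> {v\<in>finite_places. v (of_nat k * N) \<noteq> 0} \<union> {v\<in>finite_places. v (of_nat k :: 'a) \<noteq> 0}"
    by force
  then show ?thesis by (rule finite_subset) (use int[OF k0(2) k(2)] int[OF k0(1)] in auto)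
qed

section \<open>Gram determinants\<close>

lemma hermitian_add_left: "hermitian (x + y) z = hermitian x z + hermitian y z"
  by (simp add: hermitian_def algebra_simps sum.distrib)

lemma hermitian_scale_left: "hermitian (c *s x) z = c * hermitian x z"
  by (simp add: hermitian_def sum_distrib_left mult.assoc)

lemma hermitian_sum_left: "hermitian (\<Sum>i\<in>I. f i) z = (\<Sum>i\<in>I. hermitian (f i) z)"
  by (induction I rule: infinite_finite_induct) (auto simp: hermitian_add_left, auto simp: hermitian_def)

lemma hermitian_cnj: "hermitian y x = cnj (hermitian x y)"
  by (simp add: hermitian_def mult.commute)

lemma hermitian_self: "hermitian x x = of_real ((norm x)\<^sup>2)"
proof -
  have "(norm x)\<^sup>2 = (\<Sum>i\<in>UNIV. (norm (x $ i))\<^sup>2)"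
    by (simp add: norm_vec_def L2_set_def sum_nonneg)
  then show ?thesis by (simp only: hermitian_def of_real_sum complex_norm_square)
qed

lemma inner_eq_Re_hermitian: "x \<bullet> y = Re (hermitian x y)"
  by (simp add: hermitian_def inner_vec_def inner_complex_def)

definition gram :: "(complex^'n) list \<Rightarrow> complex" where
  "gram us = Determinant.det (Matrix.mat (length us) (length us) (\<lambda>(i, j). hermitian (us ! i) (us ! j)))"

lemma scaleR_eq_scale: "r *\<^sub>R x = of_real r *s (x :: complex^'n)"
  by (simp add: vec_eq_iff, simp add: scaleR_conv_of_real)

text \<open>The orthogonal decomposition is taken over the reals. Testing against both
  \<open>s\<close> and \<open>\<i> *s s\<close> turns vanishing real parts into hermitian
  orthogonality.\<close>

lemma complex_subspace_decomp:
  fixes w :: "complex^'n"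
  assumes S: "vec.subspace S"
  obtains p z where "p \<in> S" "w = p + z" "\<And>s. s \<in> S \<Longrightarrow> hermitian z s = 0"
proof -
  have rS: "subspace S"
    unfolding subspace_def using S by (auto simp: scaleR_eq_scale vec.subspace_0 vec.subspace_add vec.subspace_scale)
  then have sp: "span S = S" by (simp add: span_eq_iff)
  obtain p z where pz: "p \<in> S" "\<And>s. s \<in> S \<Longrightarrow> orthogonal z s" "w = p + z"
    using orthogonal_subspace_decomp_exists[of S w] unfolding sp by metis
  have "hermitian z s = 0" if s: "s \<in> S" for s
  proof -
    have i: "hermitian z (\<i> *s s) = - \<i> * hermitian z s"
      using hermitian_scale_left[of \<i> s z] hermitian_cnj[of z s] hermitian_cnj[of z "\<i> *s s"] by simp
    have "\<i> *s s \<in> S" using S s by (rule vec.subspace_scale)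
    then have "Re (hermitian z (\<i> *s s)) = 0" "Re (hermitian z s) = 0"
      using pz(2) s by (auto simp: orthogonal_def inner_eq_Re_hermitian)
    then show ?thesis unfolding i by (simp add: complex_eq_iff)
  qed
  then show ?thesis using that pz by blast
qed

lemma infdist_decomp:
  fixes p z :: "complex^'n"
  assumes S: "vec.subspace S" and p: "p \<in> S" and z: "\<And>s. s \<in> S \<Longrightarrow> hermitian z s = 0"
  shows "infdist (p + z) S = norm z"
proof (rule antisym)
  have "infdist (p + z) S \<le> dist (p + z) p" by (rule infdist_le[OF p])
  then show "infdist (p + z) S \<le> norm z" by (simp add: dist_norm)
  have "norm z \<le> dist (p + z) s" if "s \<in> S" for s
  proof -
    have "p - s \<in> S" using S p that by (rule vec.subspace_diff)
    then have "z \<bullet> (p - s) = 0" using z by (simp add: inner_eq_Re_hermitian)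
    then have "(norm (z + (p - s)))\<^sup>2 = (norm z)\<^sup>2 + (norm (p - s))\<^sup>2"
      by (simp add: power2_norm_eq_inner inner_add inner_commute)
    then have "(norm z)\<^sup>2 \<le> (norm (z + (p - s)))\<^sup>2" by simp
    then have "norm z \<le> norm (z + (p - s))" by (rule power2_le_imp_le) simp
    then show ?thesis by (simp add: dist_norm algebra_simps)
  qed
  then show "norm z \<le> infdist (p + z) S"
    using p by (subst infdist_notempty) (auto intro!: cINF_greatest)
qed

text \<open>With it, replacing the last vector of a basis changes its distance from the span of the
  others by the absolute value of one coefficient.\<close>

lemma infdist_scale_add:
  fixes w u :: "complex^'n"
  assumes S: "vec.subspace S" and u: "u \<in> S"
  shows "infdist (a *s w + u) S = norm a * infdist w S"
proof -
  obtain p z where pz: "p \<in> S" "w = p + z" "\<And>s. s \<in> S \<Longrightarrow> hermitian z s = 0"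
    by (rule complex_subspace_decomp[OF S]) blast
  have e: "a *s w + u = (a *s p + u) + a *s z" by (simp add: pz(2) vec.scale_right_distrib)
  have "infdist (a *s w + u) S = norm (a *s z)"
    unfolding e by (rule infdist_decomp[OF S]) (auto intro: vec.subspace_add vec.subspace_scale S pz u simp: hermitian_scale_left pz(3))
  moreover have "norm (a *s z) = norm a * norm z"
    by (simp add: norm_vec_def L2_set_def norm_mult power_mult_distrib sum_distrib_left[symmetric] real_sqrt_mult)
  moreover have "infdist w S = norm z" unfolding pz(2) by (rule infdist_decomp[OF S pz(1,3)])
  ultimately show ?thesis by simp
qed

lemma infdist_zero_imp_mem:
  fixes w :: "complex^'n"
  assumes S: "vec.subspace S" and "infdist w S = 0"
  shows "w \<in> S"
proof -
  obtain p z where pz: "p \<in> S" "w = p + z" "\<And>s. s \<in> S \<Longrightarrow> hermitian z s = 0"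
    by (rule complex_subspace_decomp[OF S]) blast
  have "norm z = 0" using infdist_decomp[OF S pz(1,3)] assms(2) pz(2) by simp
  then show ?thesis using pz by simp
qed

text \<open>Split \<open>w = p + z\<close> with \<open>p\<close> in the span and \<open>z\<close>
  orthogonal to it. Left multiplication by the unipotent block matrix \<open>EE\<close> subtracts
  from the last row the combination belonging to \<open>p\<close> and leaves zeros followed by the
  squared norm of \<open>z\<close>, whose root is the distance of \<open>w\<close> from the
  span.\<close>

theorem gram_snoc:
  fixes us :: "(complex^'n) list"
  shows "gram (us @ [w]) = gram us * of_real ((infdist w (vec.span (set us)))\<^sup>2)"
proof -
  let ?S = "vec.span (set us)"
  define n where "n = length us"
  have S: "vec.subspace ?S" by (rule vec.subspace_span)
  obtain p z where pz: "p \<in> ?S" "w = p + z" "\<And>s. s \<in> ?S \<Longrightarrow> hermitian z s = 0"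
    by (rule complex_subspace_decomp[OF S]) blast
  obtain c0 where "p = (\<Sum>u\<in>set us. c0 u *s u)" using pz(1) unfolding vec.span_finite[OF finite_set] by auto
  \<comment> \<open>\<open>us\<close> may have repetitions, so a combination over
    \<open>set us\<close> is turned into one over the positions of the list.\<close>
  moreover have "\<exists>c. (\<Sum>u\<in>set us. c0 u *s u) = (\<Sum>i<n. c i *s us ! i)"
  proof -
    have "set us = (!) us ` {..<n}" by (auto simp: n_def set_conv_nth)
    then obtain I where I: "I \<subseteq> {..<n}" "inj_on ((!) us) I" "set us = (!) us ` I"
      by (metis subset_image_inj subset_refl)
    have "(\<Sum>u\<in>set us. c0 u *s u) = (\<Sum>i\<in>I. c0 (us ! i) *s us ! i)"
      unfolding I(3) by (rule sum.reindex_cong[OF I(2)]) auto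
    also have "\<dots> = (\<Sum>i<n. (if i \<in> I then c0 (us ! i) else 0) *s us ! i)"
      using I(1) by (intro sum.mono_neutral_cong_left) auto
    finally show ?thesis by (rule exI[of _ "\<lambda>i. if i \<in> I then c0 (us ! i) else 0"])
  qed
  ultimately obtain c where c: "p = (\<Sum>i<n. c i *s us ! i)" by metis
  define h where "h x y = hermitian x y" for x y :: "complex^'n"
  define G0 where "G0 = Matrix.mat n n (\<lambda>(i, j). h (us ! i) (us ! j))"
  define C where "C = Matrix.mat n 1 (\<lambda>(i, j). h (us ! i) w)"
  define R where "R = Matrix.mat 1 n (\<lambda>(i, j). h w (us ! j))"
  define D where "D = Matrix.mat 1 1 (\<lambda>(i :: nat, j :: nat). h w w)"
  define E where "E = Matrix.mat 1 n (\<lambda>(i :: nat, j). - c j)"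
  have car: "G0 \<in> carrier_mat n n" "C \<in> carrier_mat n 1" "R \<in> carrier_mat 1 n" "D \<in> carrier_mat 1 1" "E \<in> carrier_mat 1 n"
    by (simp_all add: G0_def C_def R_def D_def E_def)
  have full: "Matrix.mat (length (us @ [w])) (length (us @ [w])) (\<lambda>(i, j). hermitian ((us @ [w]) ! i) ((us @ [w]) ! j))
      = four_block_mat G0 C R D" (is "?G = _")
  proof (rule eq_matI)
    fix i j assume "i < dim_row (four_block_mat G0 C R D)" "j < dim_col (four_block_mat G0 C R D)"
    then have ij: "i < Suc n" "j < Suc n" using car by auto
    then show "?G $$ (i, j) = four_block_mat G0 C R D $$ (i, j)"
      using car by (auto simp: n_def nth_append G0_def C_def R_def D_def h_def less_Suc_eq)
  qed (use car in \<open>auto simp: n_def\<close>)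
  define EE where "EE = four_block_mat (1\<^sub>m n) (0\<^sub>m n 1) E (1\<^sub>m 1)"
  have "Determinant.det EE = Determinant.det (1\<^sub>m n :: complex mat) * Determinant.det (1\<^sub>m 1 :: complex mat)"
    unfolding EE_def by (rule det_four_block_mat_upper_right_zero[OF one_carrier_mat refl car(5) one_carrier_mat])
  then have EE: "EE \<in> carrier_mat (n + 1) (n + 1)" "Determinant.det EE = 1"
    unfolding EE_def using car(5) by (auto simp: det_one)
  have wp: "h w y = (\<Sum>i<n. c i * h (us ! i) y) + h z y" for y
    unfolding h_def by (simp add: pz(2) c hermitian_add_left hermitian_sum_left hermitian_scale_left)
  have zu: "h z (us ! j) = 0" if "j < n" for j
    unfolding h_def by (rule pz(3)) (use that in \<open>auto simp: n_def intro: vec.span_base\<close>)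
  have ER: "E * G0 + 1\<^sub>m 1 * R = 0\<^sub>m 1 n"
  proof (rule eq_matI)
    fix i j assume "i < dim_row (0\<^sub>m 1 n :: complex mat)" "j < dim_col (0\<^sub>m 1 n :: complex mat)"
    then have ij: "i = 0" "j < n" by auto
    then show "(E * G0 + 1\<^sub>m 1 * R) $$ (i, j) = 0\<^sub>m 1 n $$ (i, j)"
      using car wp[of "us ! j"] zu[OF ij(2)]
      by (simp add: E_def G0_def R_def scalar_prod_def atLeast0LessThan sum_negf)
  qed (use car in auto)
  define Z where "Z = Matrix.mat 1 1 (\<lambda>(i :: nat, j :: nat). h z z)"
  have ED: "E * C + 1\<^sub>m 1 * D = Z"
  proof (rule eq_matI)
    fix i j assume "i < dim_row Z" "j < dim_col Z"
    then have ij: "i = 0" "j = 0" by (auto simp: Z_def)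
    have "hermitian p z = 0" using pz(3)[OF pz(1)] hermitian_cnj[of p z] by simp
    then have "hermitian w z = hermitian z z" by (simp add: pz(2) hermitian_add_left)
    then have "hermitian z w = hermitian z z" using hermitian_cnj[of z w] hermitian_cnj[of z z] by simp
    then have "h z w = h z z" by (simp add: h_def)
    then show "(E * C + 1\<^sub>m 1 * D) $$ (i, j) = Z $$ (i, j)"
      using car wp[of w] ij by (simp add: E_def C_def D_def Z_def scalar_prod_def atLeast0LessThan sum_negf)
  qed (use car in \<open>auto simp: Z_def\<close>)
  have "EE * four_block_mat G0 C R D = four_block_mat (1\<^sub>m n * G0 + 0\<^sub>m n 1 * R) (1\<^sub>m n * C + 0\<^sub>m n 1 * D) (E * G0 + 1\<^sub>m 1 * R) (E * C + 1\<^sub>m 1 * D)"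
    unfolding EE_def by (rule mult_four_block_mat) (use car in auto)
  also have "\<dots> = four_block_mat G0 C (0\<^sub>m 1 n) Z"
    unfolding ER ED using car by simp
  finally have prod: "EE * four_block_mat G0 C R D = four_block_mat G0 C (0\<^sub>m 1 n) Z" .
  have F: "four_block_mat G0 C R D \<in> carrier_mat (n + 1) (n + 1)" by (rule four_block_carrier_mat[OF car(1,4)])
  have "Determinant.det (four_block_mat G0 C R D) = Determinant.det (EE * four_block_mat G0 C R D)"
    using det_mult[OF EE(1) F] EE(2) by simp
  also have "\<dots> = Determinant.det G0 * Determinant.det Z"
    unfolding prod by (rule det_four_block_mat_lower_left_zero[OF car(1,2) refl]) (simp add: Z_def)
  also have "Determinant.det Z = of_real ((norm z)\<^sup>2)"
    by (subst det_single) (auto simp: Z_def h_def hermitian_self)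
  also have "norm z = infdist w ?S" using infdist_decomp[OF S pz(1,3)] pz(2) by simp
  finally show ?thesis unfolding gram_def full by (simp add: G0_def n_def h_def)
qed

lemma gram_Nil: "gram [] = 1"
  by (simp add: gram_def)

text \<open>Rows and columns are permuted together, so the sign enters twice. This lets the wedge
  norm depend on the set of vectors alone.\<close>

lemma gram_permute:
  assumes "distinct us" "distinct vs" "set us = set vs"
  shows "gram us = gram vs"
proof -
  have "mset us = mset vs" using assms by (metis set_eq_iff_mset_eq_distinct)
  then obtain p where p: "p permutes {..<length vs}" "permute_list p vs = us" by (rule mset_eq_permutation)
  define n where "n = length vs"
  have len: "length us = n" using p(2) by (auto simp: n_def)
  have p': "p permutes {0..<n}" using p(1) by (simp add: n_def atLeast0LessThan)
  have us: "us ! i = vs ! p i" if "i < n" for i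
    using that p(2) permute_list_nth[OF p(1), of i] by (auto simp: n_def)
  have pn: "p i < n" if "i < n" for i using permutes_in_image[OF p', of i] that by simp
  define A where "A = Matrix.mat n n (\<lambda>(i, j). hermitian (vs ! i) (vs ! j))"
  have A: "A \<in> carrier_mat n n" by (simp add: A_def)
  define B where "B = Matrix.mat n n (\<lambda>(i, j). A $$ (p i, j))"
  have B: "B \<in> carrier_mat n n" by (simp add: B_def)
  define C where "C = Matrix.mat n n (\<lambda>(i, j). transpose_mat B $$ (p i, j))"
  have "Matrix.mat n n (\<lambda>(i, j). hermitian (us ! i) (us ! j)) = transpose_mat C"
    by (rule eq_matI) (auto simp: C_def B_def A_def us pn)
  moreover have C: "C \<in> carrier_mat n n" by (simp add: C_def)
  ultimately have "gram us = Determinant.det (transpose_mat C)" by (simp add: gram_def len)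
  also have "\<dots> = Determinant.det C" by (rule Determinant.det_transpose[OF C])
  also have "\<dots> = signof p * Determinant.det (transpose_mat B)"
    unfolding C_def by (rule Determinant.det_permute_rows[OF _ p']) (use B in simp)
  also have "\<dots> = signof p * Determinant.det B" by (simp add: Determinant.det_transpose[OF B])
  also have "\<dots> = signof p * (signof p * Determinant.det A)"
    unfolding B_def by (simp add: Determinant.det_permute_rows[OF A p'])
  also have "\<dots> = gram vs" by (simp add: sign_def gram_def A_def n_def)
  finally show ?thesis .
qed

section \<open>Adeles\<close>

lemma cauchy_class_hom:
  assumes v: "v \<in> finite_places"
  shows "cauchy_class v (\<lambda>_. x + y) = cauchy_class v (\<lambda>_. x) \<oplus>\<^bsub>nonarch_completion v\<^esub> cauchy_class v (\<lambda>_. y)"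
    and "cauchy_class v (\<lambda>_. x * y) = cauchy_class v (\<lambda>_. x) \<otimes>\<^bsub>nonarch_completion v\<^esub> cauchy_class v (\<lambda>_. y)"
    and "cauchy_class v (\<lambda>_. 0) = \<zero>\<^bsub>nonarch_completion v\<^esub>" and "cauchy_class v (\<lambda>_. 1) = \<one>\<^bsub>nonarch_completion v\<^esub>"
    and "cauchy_class v (\<lambda>_. x) \<in> carrier (nonarch_completion v)"
proof -
  interpret R: cring "cauchy_ring v" by (rule cring_cauchy_ring[OF v])
  interpret K: cring "nonarch_completion v" by (rule cring_nonarch_completion[OF v])
  interpret h: ring_hom_cring "cauchy_ring v" "nonarch_completion v" "cauchy_class v"
    by unfold_locales (rule cauchy_class_ring_hom[OF v])
  have R0: "\<zero>\<^bsub>cauchy_ring v\<^esub> = (\<lambda>_. 0)" "\<one>\<^bsub>cauchy_ring v\<^esub> = (\<lambda>_. 1)"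
    "\<And>X Y. X \<oplus>\<^bsub>cauchy_ring v\<^esub> Y = (\<lambda>n. X n + Y n)" "\<And>X Y. X \<otimes>\<^bsub>cauchy_ring v\<^esub> Y = (\<lambda>n. X n * Y n)"
    by (simp_all add: cauchy_ring_def)
  show "cauchy_class v (\<lambda>_. x + y) = cauchy_class v (\<lambda>_. x) \<oplus>\<^bsub>nonarch_completion v\<^esub> cauchy_class v (\<lambda>_. y)"
    using h.hom_add[OF cauchy_const[of x v] cauchy_const[of y v]] unfolding R0 .
  show "cauchy_class v (\<lambda>_. x * y) = cauchy_class v (\<lambda>_. x) \<otimes>\<^bsub>nonarch_completion v\<^esub> cauchy_class v (\<lambda>_. y)"
    using h.hom_mult[OF cauchy_const[of x v] cauchy_const[of y v]] unfolding R0 .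
  show "cauchy_class v (\<lambda>_. 0) = \<zero>\<^bsub>nonarch_completion v\<^esub>" using h.hom_zero unfolding R0 .
  show "cauchy_class v (\<lambda>_. 1) = \<one>\<^bsub>nonarch_completion v\<^esub>" using h.hom_one unfolding R0 .
  show "cauchy_class v (\<lambda>_. x) \<in> carrier (nonarch_completion v)" by (rule h.hom_closed[OF cauchy_const])
qed

lemma cauchy_class_eq_iff:
  assumes v: "v \<in> finite_places" and X: "X \<in> carrier (cauchy_ring v)" and Y: "Y \<in> carrier (cauchy_ring v)"
  shows "cauchy_class v X = cauchy_class v Y \<longleftrightarrow> (\<lambda>n. X n - Y n) \<in> null_sequences v"
proof -
  interpret R: cring "cauchy_ring v" by (rule cring_cauchy_ring[OF v])
  interpret I: ideal "null_sequences v" "cauchy_ring v" by (rule ideal_null_sequences[OF v])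
  have mY: "\<ominus>\<^bsub>cauchy_ring v\<^esub> Y = (\<lambda>n. - Y n)"
    by (rule R.minus_equality) (use Y cauchy_minus_closed[OF v] in \<open>auto simp: cauchy_ring_def\<close>)
  have "X \<ominus>\<^bsub>cauchy_ring v\<^esub> Y = (\<lambda>n. X n - Y n)"
    unfolding a_minus_def mY by (simp add: cauchy_ring_def)
  then show ?thesis
    unfolding cauchy_class_def using R.quotient_eq_iff_same_a_r_cos[OF ideal_null_sequences[OF v] X Y] by simp
qed

text \<open>A class in \<open>local_integers\<close> is given by some integral sequence. It is
  eventually close to the constant \<open>x\<close>, and the ultrametric inequality transfers
  integrality.\<close>

lemma const_local_integer_iff:
  assumes v: "v \<in> finite_places"
  shows "cauchy_class v (\<lambda>_. x) \<in> local_integers v \<longleftrightarrow> val_ge v 0 x"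
proof
  assume "val_ge v 0 x"
  then show "cauchy_class v (\<lambda>_. x) \<in> local_integers v"
    unfolding local_integers_def using cauchy_const[of x v] by blast
next
  assume "cauchy_class v (\<lambda>_. x) \<in> local_integers v"
  then obtain X where X: "X \<in> carrier (cauchy_ring v)" "\<And>n. val_ge v 0 (X n)" "cauchy_class v (\<lambda>_. x) = cauchy_class v X"
    unfolding local_integers_def by blast
  then have "(\<lambda>n. x - X n) \<in> null_sequences v" using cauchy_class_eq_iff[OF v cauchy_const X(1)] by simp
  then obtain n where "val_ge v 0 (x - X n)" unfolding null_sequences_def by blast
  then have "val_ge v 0 (x - X n + X n)" using X(2) by (rule val_ge_add[OF v])
  then show "val_ge v 0 x" by simp
qed

lemma arch_embedding_mem:
  assumes "w \<in> arch_places"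
  shows "arch_embedding w \<in> w" "arch_embedding w \<in> field_embeddings" "w = {arch_embedding w, cnj \<circ> arch_embedding w}"
proof -
  obtain \<sigma> where \<sigma>: "w = {\<sigma>, cnj \<circ> \<sigma>}" "\<sigma> \<in> field_embeddings" using assms unfolding arch_places_def by blast
  then show m: "arch_embedding w \<in> w" unfolding arch_embedding_def by (metis insertI1 someI)
  then show "arch_embedding w \<in> field_embeddings" using \<sigma> cnj_embedding by auto
  have "cnj \<circ> (cnj \<circ> \<sigma>) = \<sigma>" by (auto simp: fun_eq_iff)
  then show "w = {arch_embedding w, cnj \<circ> arch_embedding w}" using m \<sigma>(1) by auto
qed

text \<open>\<open>diag_adele\<close> is given through \<open>Abs_adele\<close>, so membership has
  to be shown first. Finiteness of the exceptional set is \<open>finite_places_dividing\<close>; for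
  \<open>x = 0\<close> that set is empty by the convention \<open>v 0 = 0\<close>.\<close>

lemma diag_adele_comp:
  shows fin_comp_diag: "v \<in> finite_places \<Longrightarrow> fin_comp (diag_adele x) v = cauchy_class v (\<lambda>_. x)"
    and arch_comp_diag: "w \<in> arch_places \<Longrightarrow> arch_comp (diag_adele x) w = arch_embedding w x"
proof -
  have fin: "finite {v\<in>finite_places. v x \<noteq> 0}"
  proof (cases "x = 0")
    case True
    have "{v\<in>finite_places. v x \<noteq> 0} = {}" using True by (auto simp: finite_places_def)
    then show ?thesis by (simp only: finite.emptyI)
  qed (rule finite_places_dividing)
  have "(\<lambda>v\<in>finite_places. cauchy_class v (\<lambda>_. x), \<lambda>w\<in>arch_places. arch_embedding w x) \<in>
    {(x, z). x \<in> (\<Pi>\<^sub>E v\<in>finite_places. carrier (nonarch_completion v))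
     \<and> finite {v\<in>finite_places. x v \<notin> local_integers v}
     \<and> z \<in> (\<Pi>\<^sub>E w\<in>arch_places. arch_completion w)}"
    by (rule adele_mem[where S = "{v\<in>finite_places. v x \<noteq> 0}"])
       (auto simp: cauchy_class_hom fin const_local_integer_iff val_ge_def arch_completion_def)
  from Abs_adele_inverse[OF this]
  have R: "Rep_adele (diag_adele x) = (\<lambda>v\<in>finite_places. cauchy_class v (\<lambda>_. x), \<lambda>w\<in>arch_places. arch_embedding w x)"
    unfolding diag_adele_def .
  show "v \<in> finite_places \<Longrightarrow> fin_comp (diag_adele x) v = cauchy_class v (\<lambda>_. x)"
    by (simp add: fin_comp.rep_eq R)
  show "w \<in> arch_places \<Longrightarrow> arch_comp (diag_adele x) w = arch_embedding w x"
    by (simp add: arch_comp.rep_eq R)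
qed

lemma diag_adele_hom:
  shows diag_add: "diag_adele (x + y) = diag_adele x + diag_adele y"
    and diag_mult: "diag_adele (x * y) = diag_adele x * diag_adele y"
    and diag_zero: "diag_adele 0 = 0" and diag_one: "diag_adele 1 = 1"
  by (rule adele_eqI;
      simp add: fin_comp_diag arch_comp_diag fin_comp_simps arch_comp_simps cauchy_class_hom embedding_hom[OF arch_embedding_mem(2)])+

lemma diag_sum: "diag_adele (\<Sum>i\<in>I. f i) = (\<Sum>i\<in>I. diag_adele (f i))"
  by (induction I rule: infinite_finite_induct) (auto simp: diag_add diag_zero)

lemma arch_comp_sum: "w \<in> arch_places \<Longrightarrow> arch_comp (\<Sum>i\<in>I. f i) w = (\<Sum>i\<in>I. arch_comp (f i) w)"
  by (induction I rule: infinite_finite_induct) (auto simp: arch_comp_simps)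

section \<open>Principal adelic vectors and integrality at finite places\<close>

definition diag_vec :: "'a::number_field^'n \<Rightarrow> 'a adele^'n" where
  "diag_vec x = (\<chi> i. diag_adele (x $ i))"

lemma diag_vec_add: "diag_vec (x + y) = diag_vec x + diag_vec y"
  by (simp add: vec_eq_iff diag_vec_def diag_add)

lemma diag_vec_scale: "diag_vec (a *s x) = diag_adele a *s diag_vec x"
  by (simp add: vec_eq_iff diag_vec_def diag_mult)

lemma adelic_matrix_mult_vec: "adelic_matrix A *v diag_vec x = diag_vec (A *v x)"
  by (simp add: vec_eq_iff diag_vec_def adelic_matrix_def matrix_vector_mult_def diag_sum diag_mult)

lemma adelic_matrix_mult: "adelic_matrix A ** adelic_matrix B = adelic_matrix (A ** B)"
  by (simp add: vec_eq_iff adelic_matrix_def matrix_matrix_mult_def diag_sum diag_mult)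

lemma adelic_matrix_one: "adelic_matrix (Finite_Cartesian_Product.mat 1) = Finite_Cartesian_Product.mat 1"
  by (simp add: vec_eq_iff adelic_matrix_def Finite_Cartesian_Product.mat_def diag_one diag_zero)

definition integral_at :: "('a::number_field \<Rightarrow> int) \<Rightarrow> 'a adele \<Rightarrow> bool" where
  "integral_at v a \<longleftrightarrow> fin_comp a v \<in> local_integers v"

lemma integral_at_hom:
  assumes v: "v \<in> finite_places"
  shows "integral_at v a \<Longrightarrow> integral_at v b \<Longrightarrow> integral_at v (a + b)"
    and "integral_at v a \<Longrightarrow> integral_at v b \<Longrightarrow> integral_at v (a * b)"
    and "integral_at v 0" and "integral_at v (diag_adele x) \<longleftrightarrow> val_ge v 0 x"
  using local_integers_closed[OF v] const_local_integer_iff[OF v]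
  by (auto simp: integral_at_def fin_comp_simps[OF v] fin_comp_diag[OF v])

lemma integral_at_sum: "v \<in> finite_places \<Longrightarrow> (\<And>i. i \<in> I \<Longrightarrow> integral_at v (f i)) \<Longrightarrow> integral_at v (\<Sum>i\<in>I. f i)"
  by (induction I rule: infinite_finite_induct) (auto intro: integral_at_hom)

text \<open>At a bad place the values of a Cauchy sequence are bounded below by some
  \<open>k \<le> 0\<close>, and the power \<open>c ^ nat (- k)\<close> of an integer of positive
  value makes up for it. The product of these powers over the finitely many bad places serves at
  every place.\<close>

lemma ex_integral_multiple:
  "\<exists>N::nat. N > 0 \<and> (\<forall>v\<in>finite_places. integral_at v (diag_adele (of_nat N) * a))"
proof -
  define S where "S = {v\<in>finite_places. \<not> integral_at v a}"
  have finS: "finite S"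
    using Rep_adele[of a] unfolding S_def integral_at_def by (auto simp: fin_comp.rep_eq)
  have "\<exists>N::nat. N > 0 \<and> integral_at v (diag_adele (of_nat N) * a)" if vS: "v \<in> S" for v
  proof -
    have v: "v \<in> finite_places" using vS by (simp add: S_def)
    have "fin_comp a v \<in> carrier (nonarch_completion v)" by (rule fin_comp_closed[OF v])
    then obtain X where X: "X \<in> carrier (cauchy_ring v)" "fin_comp a v = cauchy_class v X"
      unfolding nonarch_completion_def FactRing_def A_RCOSETS_def' cauchy_class_def by auto
    obtain k where k: "k \<le> 0" "\<And>n. val_ge v k (X n)" using cauchy_bounded[OF v X(1)] by blast
    obtain c :: nat where c: "c > 0" "val_ge v 1 (of_nat c)"
      using max_ideal.nonzero[OF place_ideal[OF v]] by auto
    define N where "N = c ^ nat (- k)"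
    have "val_ge v (int m) ((of_nat c) ^ m)" for m
    proof (induction m)
      case (Suc m)
      then show ?case using val_ge_mult[OF v c(2) Suc] by (simp add: algebra_simps)
    qed (simp add: val_ge_def val_one[OF v])
    from this[of "nat (- k)"] have N: "val_ge v (- k) (of_nat N)" using k(1) by (simp add: N_def)
    have NX: "val_ge v 0 (of_nat N * X n)" for n using val_ge_mult[OF v N k(2)[of n]] by simp
    have car: "(\<lambda>n. of_nat N * X n) \<in> carrier (cauchy_ring v)" by (rule cauchy_mult_closed[OF v cauchy_const X(1)])
    interpret R: cring "cauchy_ring v" by (rule cring_cauchy_ring[OF v])
    interpret K: cring "nonarch_completion v" by (rule cring_nonarch_completion[OF v])
    interpret h: ring_hom_cring "cauchy_ring v" "nonarch_completion v" "cauchy_class v"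
      by unfold_locales (rule cauchy_class_ring_hom[OF v])
    have "fin_comp (diag_adele (of_nat N) * a) v = cauchy_class v (\<lambda>n. of_nat N * X n)"
      using h.hom_mult[OF cauchy_const[of "of_nat N" v] X(1)]
      by (simp add: fin_comp_simps[OF v] fin_comp_diag[OF v] X(2) cauchy_ring_def)
    then have "integral_at v (diag_adele (of_nat N) * a)"
      unfolding integral_at_def local_integers_def using NX car by blast
    then show ?thesis using c by (intro exI[of _ N]) (simp add: N_def)
  qed
  then obtain N :: "('a \<Rightarrow> int) \<Rightarrow> nat" where N: "\<And>v. v \<in> S \<Longrightarrow> N v > 0 \<and> integral_at v (diag_adele (of_nat (N v)) * a)" by metis
  define M where "M = (\<Prod>v\<in>S. N v)"
  have "integral_at v (diag_adele (of_nat M) * a)" if v: "v \<in> finite_places" for v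
  proof (cases "v \<in> S")
    case True
    have "M = N v * (\<Prod>v\<in>S - {v}. N v)" unfolding M_def using finS True by (simp add: prod.remove)
    then have "diag_adele (of_nat M) * a = diag_adele (of_nat (\<Prod>v\<in>S - {v}. N v)) * (diag_adele (of_nat (N v)) * a)"
      by (simp only: of_nat_mult diag_mult mult_ac)
    then show ?thesis using N[OF True] integral_at_hom(2,4)[OF v] val_ge_of_nat[OF v] by metis
  next
    case False
    then have "integral_at v a" using v by (simp add: S_def)
    then show ?thesis using integral_at_hom(2,4)[OF v] val_ge_of_nat[OF v] by metis
  qed
  moreover have "M > 0" unfolding M_def using N by (auto intro: prod_pos)
  ultimately show ?thesis by blast
qed

lemma ex_integral_multiple_matrix:
  fixes A :: "'a::number_field adele^'n^'n"
  shows "\<exists>N::nat. N > 0 \<and> (\<forall>v\<in>finite_places. \<forall>i j. integral_at v (diag_adele (of_nat N) * A $ i $ j))"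
proof -
  obtain N :: "'n \<Rightarrow> 'n \<Rightarrow> nat" where N: "\<And>i j. N i j > 0"
    "\<And>i j v. v \<in> finite_places \<Longrightarrow> integral_at v (diag_adele (of_nat (N i j)) * A $ i $ j)"
    using ex_integral_multiple[of "A $ _ $ _"] by metis
  define M where "M = (\<Prod>(i, j)\<in>UNIV. N i j)"
  have "integral_at v (diag_adele (of_nat M) * A $ i $ j)" if v: "v \<in> finite_places" for v i j
  proof -
    have "M = N i j * (\<Prod>(i, j)\<in>UNIV - {(i, j)}. N i j)"
      unfolding M_def by (subst prod.remove[of _ "(i, j)"]) auto
    then have "diag_adele (of_nat M) * A $ i $ j
        = diag_adele (of_nat (\<Prod>(i, j)\<in>UNIV - {(i, j)}. N i j)) * (diag_adele (of_nat (N i j)) * A $ i $ j)"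
      by (simp only: of_nat_mult diag_mult mult_ac)
    then show ?thesis using N(2)[OF v] integral_at_hom(2,4)[OF v] val_ge_of_nat[OF v] by metis
  qed
  moreover have "M > 0" unfolding M_def using N(1) by (auto intro: prod_pos)
  ultimately show ?thesis by blast
qed

lemma fin_comp_sum:
  assumes v: "v \<in> finite_places"
  shows "finite I \<Longrightarrow> fin_comp (\<Sum>i\<in>I. f i) v = (\<Oplus>\<^bsub>nonarch_completion v\<^esub>i\<in>I. fin_comp (f i) v)"
proof (induction I rule: finite_induct)
  interpret K: cring "nonarch_completion v" by (rule cring_nonarch_completion[OF v])
  case empty
  then show ?case by (simp add: fin_comp_simps[OF v])
next
  interpret K: cring "nonarch_completion v" by (rule cring_nonarch_completion[OF v])
  case (insert i I)
  then show ?case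
    by (simp add: fin_comp_simps[OF v] fin_comp_closed[OF v] Pi_def)
qed

definition adele_at :: "('a::number_field \<Rightarrow> int) \<Rightarrow> (nat \<Rightarrow> 'a) set \<Rightarrow> 'a adele" where
  "adele_at v y = Abs_adele (\<lambda>u\<in>finite_places. if u = v then y else \<zero>\<^bsub>nonarch_completion u\<^esub>, \<lambda>w\<in>arch_places. 0)"

lemma fin_comp_adele_at:
  fixes v :: "'a::number_field \<Rightarrow> int"
  assumes v: "v \<in> finite_places" and y: "y \<in> carrier (nonarch_completion v)"
  shows "fin_comp (adele_at v y) v = y"
proof -
  have "(\<lambda>u\<in>finite_places. if u = v then y else \<zero>\<^bsub>nonarch_completion u\<^esub>, \<lambda>w\<in>(arch_places :: ('a \<Rightarrow> complex) set set). 0) \<in>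
    {(x, z). x \<in> (\<Pi>\<^sub>E v\<in>finite_places. carrier (nonarch_completion v))
     \<and> finite {v\<in>finite_places. x v \<notin> local_integers v}
     \<and> z \<in> (\<Pi>\<^sub>E w\<in>arch_places. arch_completion w)}"
    by (rule adele_mem[where S = "{v}"])
       (auto simp: y local_integers_closed subsetD[OF local_integers_closed(1) local_integers_closed(2)] arch_completion_closed)
  from Abs_adele_inverse[OF this] show ?thesis using v by (simp add: adele_at_def fin_comp.rep_eq)
qed

text \<open>The local conditions defining the lattice are solved with the inverse matrix \<open>h\<close>; a local solution
  at one place is extended by \<open>0\<close> to an adele, so that matrix algebra takes place in the adele ring.\<close>

theorem lattice_of_iff:
  fixes g h :: "'a::number_field adele^'n^'n"
  assumes gh: "g ** h = Finite_Cartesian_Product.mat 1" "h ** g = Finite_Cartesian_Product.mat 1"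
  shows "x \<in> lattice_of g \<longleftrightarrow> (\<forall>v\<in>finite_places. \<forall>j. integral_at v ((h *v diag_vec x) $ j))"
proof -
  have comp: "fin_comp ((A *v Y) $ i) v = (\<Oplus>\<^bsub>nonarch_completion v\<^esub>j\<in>UNIV. fin_comp (A $ i $ j) v \<otimes>\<^bsub>nonarch_completion v\<^esub> fin_comp (Y $ j) v)"
    if v: "v \<in> finite_places" for A :: "'a adele^'n^'n" and Y i v
    by (simp add: matrix_vector_mult_def fin_comp_sum[OF v] fin_comp_simps[OF v])
  have "(\<exists>y. (\<forall>j. y j \<in> local_integers v) \<and>
     (\<forall>i. cauchy_class v (\<lambda>_. x $ i)
        = (\<Oplus>\<^bsub>nonarch_completion v\<^esub>j\<in>UNIV. fin_comp (g $ i $ j) v \<otimes>\<^bsub>nonarch_completion v\<^esub> y j)))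
     \<longleftrightarrow> (\<forall>j. integral_at v ((h *v diag_vec x) $ j))" (is "?L \<longleftrightarrow> ?R") if v: "v \<in> finite_places" for v
  proof
    assume ?R
    let ?Y = "h *v diag_vec x"
    have "g *v ?Y = diag_vec x" by (simp add: matrix_vector_mul_assoc gh)
    then have "cauchy_class v (\<lambda>_. x $ i) = fin_comp ((g *v ?Y) $ i) v" for i
      by (simp add: diag_vec_def fin_comp_diag[OF v])
    then have "cauchy_class v (\<lambda>_. x $ i) = (\<Oplus>\<^bsub>nonarch_completion v\<^esub>j\<in>UNIV. fin_comp (g $ i $ j) v \<otimes>\<^bsub>nonarch_completion v\<^esub> fin_comp (?Y $ j) v)" for i
      by (simp only: comp[OF v])
    then show ?L using \<open>?R\<close> unfolding integral_at_def by (intro exI[of _ "\<lambda>j. fin_comp (?Y $ j) v"]) blast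
  next
    assume ?L
    then obtain y where y: "\<And>j. y j \<in> local_integers v"
      "\<And>i. cauchy_class v (\<lambda>_. x $ i) = (\<Oplus>\<^bsub>nonarch_completion v\<^esub>j\<in>UNIV. fin_comp (g $ i $ j) v \<otimes>\<^bsub>nonarch_completion v\<^esub> y j)"
      by blast
    define Y where "Y = (\<chi> j. adele_at v (y j))"
    have Y: "fin_comp (Y $ j) v = y j" for j
      using fin_comp_adele_at[OF v subsetD[OF local_integers_closed(1)[OF v] y(1)]] by (simp add: Y_def)
    have gY: "fin_comp ((g *v Y) $ i) v = fin_comp (diag_vec x $ i) v" for i
      using y(2)[of i] by (simp add: comp[OF v] Y diag_vec_def fin_comp_diag[OF v])
    have "fin_comp ((h *v diag_vec x) $ j) v = fin_comp ((h *v (g *v Y)) $ j) v" for j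
      by (simp only: comp[OF v, of h] gY)
    moreover have "h *v (g *v Y) = Y" by (simp add: matrix_vector_mul_assoc gh)
    ultimately show ?R using y(1) by (simp add: integral_at_def Y)
  qed
  then show ?thesis unfolding lattice_of_def by blast
qed


lemma finite_arch_places: "finite (arch_places :: ('a::number_field \<Rightarrow> complex) set set)"
proof (rule finite_subset)
  show "arch_places \<subseteq> (\<lambda>\<sigma>. {\<sigma>, cnj \<circ> \<sigma>}) ` (field_embeddings :: ('a \<Rightarrow> complex) set)"
    by (auto simp: arch_places_def)
qed (intro finite_imageI finite_embeddings)

lemma finite_vec_set: "finite A \<Longrightarrow> finite {x :: 'b^'n. \<forall>i. x $ i \<in> A}"
proof -
  assume A: "finite A"
  have "{x :: 'b^'n. \<forall>i. x $ i \<in> A} \<subseteq> vec_lambda ` (UNIV \<rightarrow>\<^sub>E A)"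
  proof
    fix x :: "'b^'n" assume "x \<in> {x. \<forall>i. x $ i \<in> A}"
    then show "x \<in> vec_lambda ` (UNIV \<rightarrow>\<^sub>E A)" by (intro image_eqI[of _ _ "vec_nth x"]) auto
  qed
  then show ?thesis by (rule finite_subset) (intro finite_imageI finite_PiE A, simp)
qed

section \<open>The lattice and the archimedean vectors\<close>

lemma ex_linear_form:
  fixes U :: "('a::field^'n) set"
  assumes U: "vec.subspace U" and w: "w \<notin> U"
  obtains \<phi> :: "'a^'n \<Rightarrow> 'a" where "\<And>x y. \<phi> (x + y) = \<phi> x + \<phi> y" "\<And>c x. \<phi> (c *s x) = c * \<phi> x"
    "\<And>u. u \<in> U \<Longrightarrow> \<phi> u = 0" "\<phi> w = 1"
proof -
  obtain B where B: "B \<subseteq> U" "vec.independent B" "U \<subseteq> vec.span B"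
    by (rule vec.maximal_independent_subset[of U]) blast
  have spB: "vec.span B = U" using B vec.span_minimal[OF B(1) U] by blast
  have ind: "vec.independent (insert w B)" using vec.independent_insertI[OF _ B(2)] w spB by blast
  define k :: 'n where "k = undefined"
  define f where "f = vec.construct (insert w B) (\<lambda>b. if b = w then axis k 1 else (0 :: 'a^'n))"
  have lin: "Vector_Spaces.linear (*s) (*s) f" unfolding f_def by (rule vec.linear_construct[OF ind])
  have fb: "f b = (if b = w then axis k 1 else 0)" if "b \<in> insert w B" for b
    unfolding f_def by (rule vec.construct_basis[OF ind that])
  have fU: "f u = 0" if u: "u \<in> U" for u
  proof (rule vec.linear_eq_0_on_span[OF lin])
    show "u \<in> vec.span B" using u spB by simp
    show "f b = 0" if b: "b \<in> B" for b using fb[of b] b B(1) w by auto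
  qed
  show ?thesis
  proof (rule that[of "\<lambda>x. f x $ k"])
    show "f w $ k = 1" using fb[of w] by simp
  qed (simp_all add: vec.linear_add[OF lin] vec.linear_scale[OF lin] fU)
qed

locale adelic_lattice =
  fixes g :: "'a::number_field adele^'n^'n"
  assumes invertible_g: "invertible g"
begin

definition h :: "'a adele^'n^'n" where
  "h = matrix_inv g"

lemma gh: "g ** h = Finite_Cartesian_Product.mat 1" "h ** g = Finite_Cartesian_Product.mat 1"
  using invertible_g someI_ex[of "\<lambda>h. g ** h = Finite_Cartesian_Product.mat 1 \<and> h ** g = Finite_Cartesian_Product.mat 1"]
  by (auto simp: h_def matrix_inv_def invertible_def)

abbreviation L :: "('a^'n) set" where "L \<equiv> lattice_of g"

lemma mem_L: "x \<in> L \<longleftrightarrow> (\<forall>v\<in>finite_places. \<forall>j. integral_at v ((h *v diag_vec x) $ j))"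
  by (rule lattice_of_iff[OF gh])

lemma L_zero: "0 \<in> L"
proof -
  have "diag_vec (0 :: 'a^'n) = 0" by (simp add: vec_eq_iff diag_vec_def diag_zero)
  then show ?thesis by (simp add: mem_L integral_at_hom)
qed

lemma L_add: "x \<in> L \<Longrightarrow> y \<in> L \<Longrightarrow> x + y \<in> L"
  by (simp add: mem_L diag_vec_add matrix_vector_right_distrib integral_at_hom)

lemma L_scale: assumes "algebraic_int a" "x \<in> L" shows "a *s x \<in> L"
proof -
  have "h *v (diag_adele a *s diag_vec x) = diag_adele a *s (h *v diag_vec x)"
    by (simp add: vec_eq_iff matrix_vector_mult_def sum_distrib_left mult_ac)
  then show ?thesis
    using assms by (simp add: mem_L diag_vec_scale integral_at_hom val_ge_algebraic_int)
qed

lemma L_minus: "x \<in> L \<Longrightarrow> - x \<in> L"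
  using L_scale[of "- 1" x] by simp

lemma L_diff: "x \<in> L \<Longrightarrow> y \<in> L \<Longrightarrow> x - y \<in> L"
  using L_add[of x "- y"] L_minus[of y] by simp

lemma add_subgroup_L: "add_subgroup L"
  by (simp add: add_subgroup_def L_zero L_diff)

lemma L_sum: "(\<And>i. i \<in> I \<Longrightarrow> f i \<in> L) \<Longrightarrow> sum f I \<in> L"
  by (rule add_subgroup_sum[OF add_subgroup_L])

text \<open>Write \<open>x = g (h x)\<close>, where \<open>h x\<close> is integral at all finite
  places: an integer that clears the denominators of \<open>g\<close> clears those of
  \<open>x\<close>. Elements integral at all finite places are algebraic integers by
  \<open>algebraic_int_iff_val_ge\<close>. \<open>L_lower\<close> is the same argument with
  \<open>h\<close> in place of \<open>g\<close>.\<close>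

lemma L_upper: "\<exists>N::nat. N > 0 \<and> (\<forall>x\<in>L. \<forall>i. algebraic_int (of_nat N * x $ i))"
proof -
  obtain N :: nat where N: "N > 0" "\<And>v i j. v \<in> finite_places \<Longrightarrow> integral_at v (diag_adele (of_nat N) * g $ i $ j)"
    using ex_integral_multiple_matrix[of g] by blast
  have "algebraic_int (of_nat N * x $ i)" if x: "x \<in> L" for x i
  proof -
    have "val_ge v 0 (of_nat N * x $ i)" if v: "v \<in> finite_places" for v
    proof -
      have "diag_vec x = g *v (h *v diag_vec x)" by (simp add: matrix_vector_mul_assoc gh)
      then have "diag_adele (x $ i) = (g *v (h *v diag_vec x)) $ i" by (simp add: diag_vec_def)
      then have "diag_adele (of_nat N * x $ i) = (\<Sum>j\<in>UNIV. (diag_adele (of_nat N) * g $ i $ j) * (h *v diag_vec x) $ j)"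
        by (simp add: diag_mult matrix_vector_mult_def[of g] sum_distrib_left mult.assoc)
      moreover have "integral_at v ((diag_adele (of_nat N) * g $ i $ j) * (h *v diag_vec x) $ j)" for j
        by (rule integral_at_hom(2)[OF v N(2)[OF v]]) (use x v in \<open>simp add: mem_L\<close>)
      then have "integral_at v (\<Sum>j\<in>UNIV. (diag_adele (of_nat N) * g $ i $ j) * (h *v diag_vec x) $ j)"
        by (rule integral_at_sum[OF v])
      ultimately show ?thesis using integral_at_hom(4)[OF v] by metis
    qed
    then show ?thesis using algebraic_int_iff_val_ge by blast
  qed
  then show ?thesis using N(1) by blast
qed

lemma L_lower: "\<exists>N::nat. N > 0 \<and> (\<forall>x. (\<forall>i. algebraic_int (x $ i)) \<longrightarrow> of_nat N *s x \<in> L)"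
proof -
  obtain N :: nat where N: "N > 0" "\<And>v i j. v \<in> finite_places \<Longrightarrow> integral_at v (diag_adele (of_nat N) * h $ i $ j)"
    using ex_integral_multiple_matrix[of h] by blast
  have "of_nat N *s x \<in> L" if x: "\<And>i. algebraic_int (x $ i)" for x
    unfolding mem_L
  proof (intro ballI allI)
    fix v :: "'a \<Rightarrow> int" and j assume v: "v \<in> finite_places"
    have "(h *v diag_vec (of_nat N *s x)) $ j = (\<Sum>k\<in>UNIV. (diag_adele (of_nat N) * h $ j $ k) * diag_adele (x $ k))"
      by (simp add: matrix_vector_mult_def diag_vec_def diag_mult mult_ac)
    moreover have "integral_at v ((diag_adele (of_nat N) * h $ j $ k) * diag_adele (x $ k))" for k
      by (rule integral_at_hom(2)[OF v N(2)[OF v]]) (use x v in \<open>simp add: integral_at_hom(4) val_ge_algebraic_int\<close>)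
    then have "integral_at v (\<Sum>k\<in>UNIV. (diag_adele (of_nat N) * h $ j $ k) * diag_adele (x $ k))"
      by (rule integral_at_sum[OF v])
    ultimately show "integral_at v ((h *v diag_vec (of_nat N *s x)) $ j)" by simp
  qed
  then show ?thesis using N(1) by blast
qed

lemma ex_multiple_in_L: "\<exists>k::nat. k > 0 \<and> of_nat k *s x \<in> L"
proof -
  obtain N :: nat where N: "N > 0" "\<And>x. (\<And>i. algebraic_int (x $ i)) \<Longrightarrow> of_nat N *s x \<in> L" using L_lower by blast
  have "\<forall>i. \<exists>k::nat. k > 0 \<and> algebraic_int (of_nat k * x $ i)" using exists_int_multiple_algebraic_int by metis
  then obtain k :: "'n \<Rightarrow> nat" where k: "\<And>i. k i > 0" "\<And>i. algebraic_int (of_nat (k i) * x $ i)" by metis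
  define M where "M = (\<Prod>i\<in>UNIV. k i)"
  have "algebraic_int ((of_nat M *s x) $ i)" for i
  proof -
    have "M = (\<Prod>i\<in>UNIV - {i}. k i) * k i" unfolding M_def by (subst prod.remove[of _ i]) auto
    then have "(of_nat M *s x) $ i = of_nat (\<Prod>i\<in>UNIV - {i}. k i) * (of_nat (k i) * x $ i)"
      by (simp only: vector_smult_component of_nat_mult mult.assoc)
    then show ?thesis using algebraic_int_mult[OF algebraic_int_of_nat k(2)[of i]] by metis
  qed
  then have "of_nat N *s (of_nat M *s x) \<in> L" by (rule N(2))
  moreover have "N * M > 0" unfolding M_def using N(1) k(1) by (auto intro: prod_pos)
  ultimately show ?thesis by (intro exI[of _ "N * M"]) (simp add: vec.scale_scale)
qed

theorem finite_bounded_L: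
  "finite {x\<in>L. \<forall>i. \<forall>\<sigma>\<in>field_embeddings. norm (\<sigma> (x $ i)) \<le> B}"
proof -
  obtain N :: nat where N: "N > 0" "\<And>x i. x \<in> L \<Longrightarrow> algebraic_int (of_nat N * x $ i)" using L_upper by blast
  define S where "S = {x :: 'a. algebraic_int x \<and> (\<forall>\<sigma>\<in>field_embeddings. norm (\<sigma> x) \<le> real N * B)}"
  have finS: "finite ((\<lambda>x. x / of_nat N) ` S)" unfolding S_def by (intro finite_imageI finite_bounded_algebraic_ints)
  have "x $ i \<in> (\<lambda>x. x / of_nat N) ` S" if "x \<in> L" "\<And>i \<sigma>. \<sigma> \<in> field_embeddings \<Longrightarrow> norm (\<sigma> (x $ i)) \<le> B" for x i
  proof (rule image_eqI)
    show "x $ i = of_nat N * x $ i / of_nat N" using N(1) by simp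
    show "of_nat N * x $ i \<in> S"
      unfolding S_def using N(2)[OF that(1)] that(2)
      by (auto simp: embedding_mult embedding_of_nat norm_mult intro: mult_left_mono)
  qed
  then have "{x\<in>L. \<forall>i. \<forall>\<sigma>\<in>field_embeddings. norm (\<sigma> (x $ i)) \<le> B} \<subseteq> {x. \<forall>i. x $ i \<in> (\<lambda>x. x / of_nat N) ` S}"
    by blast
  then show ?thesis by (rule finite_subset) (rule finite_vec_set[OF finS])
qed

section \<open>Archimedean vectors\<close>

abbreviation av :: "('a \<Rightarrow> complex) set \<Rightarrow> 'a^'n \<Rightarrow> complex^'n" where "av \<equiv> arch_vector g"

definition H :: "('a \<Rightarrow> complex) set \<Rightarrow> complex^'n^'n" where "H w = (\<chi> i j. arch_comp (h $ i $ j) w)"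
definition G :: "('a \<Rightarrow> complex) set \<Rightarrow> complex^'n^'n" where "G w = (\<chi> i j. arch_comp (g $ i $ j) w)"
definition emb_vec :: "('a \<Rightarrow> complex) set \<Rightarrow> 'a^'n \<Rightarrow> complex^'n" where
  "emb_vec w x = (\<chi> i. arch_embedding w (x $ i))"

lemma GH: assumes "w \<in> arch_places"
  shows "G w ** H w = Finite_Cartesian_Product.mat 1" "H w ** G w = Finite_Cartesian_Product.mat 1"
proof -
  have c: "arch_comp ((A ** B) $ i $ j) w = (\<Sum>k\<in>UNIV. arch_comp (A $ i $ k) w * arch_comp (B $ k $ j) w)"
    for A B :: "'a adele^'n^'n" and i j
    by (simp add: matrix_matrix_mult_def arch_comp_sum[OF assms] arch_comp_simps[OF assms])
  have o: "arch_comp ((Finite_Cartesian_Product.mat 1 :: 'a adele^'n^'n) $ i $ j) w = (Finite_Cartesian_Product.mat 1 :: complex^'n^'n) $ i $ j" for i j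
    by (simp add: Finite_Cartesian_Product.mat_def arch_comp_simps[OF assms])
  show "G w ** H w = Finite_Cartesian_Product.mat 1"
    using c[of g h] o unfolding gh by (simp add: vec_eq_iff matrix_matrix_mult_def G_def H_def)
  show "H w ** G w = Finite_Cartesian_Product.mat 1"
    using c[of h g] o unfolding gh by (simp add: vec_eq_iff matrix_matrix_mult_def G_def H_def)
qed

lemma matrix_inv_unique:
  fixes A B :: "'b::field^'n^'n"
  assumes "A ** B = Finite_Cartesian_Product.mat 1" "B ** A = Finite_Cartesian_Product.mat 1"
  shows "matrix_inv A = B"
proof -
  have "A ** matrix_inv A = Finite_Cartesian_Product.mat 1 \<and> matrix_inv A ** A = Finite_Cartesian_Product.mat 1"
    unfolding matrix_inv_def using assms by (intro someI[of "\<lambda>B. A ** B = Finite_Cartesian_Product.mat 1 \<and> B ** A = Finite_Cartesian_Product.mat 1"]) auto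
  then have "matrix_inv A = (B ** A) ** matrix_inv A" "A ** matrix_inv A = Finite_Cartesian_Product.mat 1" using assms by simp_all
  then show ?thesis by (simp add: matrix_mul_assoc[symmetric])
qed

lemma av_eq: "w \<in> arch_places \<Longrightarrow> av w x = H w *v emb_vec w x"
  unfolding arch_vector_def emb_vec_def G_def[symmetric] using matrix_inv_unique[OF GH] by simp

lemma G_av: "w \<in> arch_places \<Longrightarrow> G w *v av w x = emb_vec w x"
  by (simp add: av_eq matrix_vector_mul_assoc GH)

lemma av_add: "w \<in> arch_places \<Longrightarrow> av w (x + y) = av w x + av w y"
proof -
  assume w: "w \<in> arch_places"
  have "emb_vec w (x + y) = emb_vec w x + emb_vec w y"
    by (simp add: vec_eq_iff emb_vec_def embedding_add[OF arch_embedding_mem(2)[OF w]])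
  then show ?thesis by (simp add: av_eq[OF w] matrix_vector_right_distrib)
qed

lemma av_scale: "w \<in> arch_places \<Longrightarrow> av w (a *s x) = arch_embedding w a *s av w x"
proof -
  assume w: "w \<in> arch_places"
  have "emb_vec w (a *s x) = arch_embedding w a *s emb_vec w x"
    by (simp add: vec_eq_iff emb_vec_def embedding_mult[OF arch_embedding_mem(2)[OF w]])
  then show ?thesis by (simp add: av_eq[OF w] vec.scale)
qed

lemma av_zero:
  assumes "w \<in> arch_places" shows "av w 0 = 0"
proof -
  have "av w (0 *s 0) = arch_embedding w 0 *s av w 0" by (rule av_scale[OF assms])
  then show ?thesis unfolding embedding_0[OF arch_embedding_mem(2)[OF assms]] by simp
qed

lemma av_span:
  assumes w: "w \<in> arch_places" and "u \<in> vec.span S"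
  shows "av w u \<in> vec.span (av w ` S)"
  using assms(2)
proof (induction u rule: vec.span_induct_alt)
  case base
  then show ?case by (simp add: av_zero[OF w] vec.span_zero)
next
  case (step c x y)
  have "arch_embedding w c *s av w x + av w y \<in> vec.span (av w ` S)"
    by (rule vec.span_add[OF vec.span_scale[OF vec.span_base[OF imageI[OF step(1)]]] step(2)])
  then show ?case by (simp add: av_add[OF w] av_scale[OF w])
qed

text \<open>A functional \<open>\<phi>\<close> over \<open>F\<close> that separates \<open>x\<close>
  from the span of \<open>S\<close> is carried to the complex functional \<open>\<psi>\<close> by
  embedding its coefficients and undoing \<open>av w\<close> with \<open>G w\<close>. As
  \<open>\<psi> (av w y)\<close> is the embedded \<open>\<phi> y\<close>, it separates the images as
  well.\<close>

lemma av_notin_span: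
  assumes w: "w \<in> arch_places" and x: "x \<notin> vec.span S"
  shows "av w x \<notin> vec.span (av w ` S)"
proof
  assume mem: "av w x \<in> vec.span (av w ` S)"
  obtain \<phi> :: "'a^'n \<Rightarrow> 'a" where \<phi>: "\<And>x y. \<phi> (x + y) = \<phi> x + \<phi> y" "\<And>c x. \<phi> (c *s x) = c * \<phi> x"
    "\<And>u. u \<in> vec.span S \<Longrightarrow> \<phi> u = 0" "\<phi> x = 1"
    by (rule ex_linear_form[OF vec.subspace_span x]) blast
  have \<phi>sum: "\<phi> y = (\<Sum>i\<in>UNIV. \<phi> (axis i 1) * y $ i)" for y
  proof -
    have "\<phi> 0 = 0" using \<phi>(2)[of 0 0] by simp
    then have sum: "\<phi> (\<Sum>i\<in>I. h i) = (\<Sum>i\<in>I. \<phi> (h i))" for h and I :: "'n set"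
      by (induction I rule: infinite_finite_induct) (simp_all add: \<phi>(1))
    have "y = (\<Sum>i\<in>UNIV. y $ i *s axis i 1)" by (simp add: vec_eq_iff axis_def if_distrib cong: if_cong)
    then have "\<phi> y = \<phi> (\<Sum>i\<in>UNIV. y $ i *s axis i 1)" by (rule arg_cong)
    then show ?thesis by (simp add: sum \<phi>(2) mult.commute)
  qed
  have \<phi>S: "\<phi> s = 0" if "s \<in> S" for s using \<phi>(3)[OF vec.span_base[OF that]] .
  define \<psi> where "\<psi> z = (\<Sum>i\<in>UNIV. arch_embedding w (\<phi> (axis i 1)) * (G w *v z) $ i)" for z
  note eh = embedding_hom[OF arch_embedding_mem(2)[OF w]]
  have \<psi>av: "\<psi> (av w y) = arch_embedding w (\<phi> y)" for y
    unfolding \<psi>_def G_av[OF w] \<phi>sum[of y] by (simp add: emb_vec_def eh)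
  have "\<psi> z = 0" if "z \<in> vec.span (av w ` S)" for z
    using that
  proof (induction z rule: vec.span_induct_alt)
    case base
    then show ?case by (simp add: \<psi>_def)
  next
    case (step c y z)
    have lin\<psi>: "\<psi> (c *s y + z) = c * \<psi> y + \<psi> z"
      by (simp add: \<psi>_def matrix_vector_right_distrib vec.scale sum.distrib sum_distrib_left algebra_simps)
    obtain s where "s \<in> S" "y = av w s" using step by blast
    then have "\<psi> y = 0" using \<psi>av \<phi>S eh by simp
    then show ?case using lin\<psi> step by simp
  qed
  then have "arch_embedding w (\<phi> x) = 0" using mem \<psi>av by metis
  then have "\<phi> x = 0" using eh by blast
  then show False using \<phi>(4) by simp
qed

lemma finite_bounded_av:
  "finite {x\<in>L. \<forall>w\<in>arch_places. norm (av w x) \<le> B}"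
proof -
  define K where "K = (\<Sum>w\<in>arch_places. onorm (\<lambda>z. G w *v z) * \<bar>B\<bar>)"
  have on: "onorm (\<lambda>z. G w *v z) \<ge> 0" for w
    by (rule onorm_pos_le) (rule matrix_vector_mul_bounded_linear)
  have "norm (\<sigma> (x $ i)) \<le> K" if x: "\<forall>w\<in>arch_places. norm (av w x) \<le> B" and \<sigma>: "\<sigma> \<in> field_embeddings" for x \<sigma> i
  proof -
    define w where "w = {\<sigma>, cnj \<circ> \<sigma>}"
    have w: "w \<in> arch_places" unfolding w_def arch_places_def using \<sigma> by blast
    have "arch_embedding w = \<sigma> \<or> arch_embedding w = cnj \<circ> \<sigma>" using arch_embedding_mem(1)[OF w] by (simp add: w_def)
    then have "norm (\<sigma> (x $ i)) = norm (emb_vec w x $ i)" by (auto simp: emb_vec_def)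
    also have "\<dots> \<le> norm (emb_vec w x)" by (rule Finite_Cartesian_Product.norm_nth_le)
    also have "\<dots> \<le> onorm (\<lambda>z. G w *v z) * norm (av w x)"
      unfolding G_av[OF w, symmetric] by (rule onorm) (rule matrix_vector_mul_bounded_linear)
    also have "\<dots> \<le> onorm (\<lambda>z. G w *v z) * \<bar>B\<bar>" using x w on by (intro mult_left_mono) force+
    also have "\<dots> \<le> K" unfolding K_def using on by (intro member_le_sum[OF w _ finite_arch_places]) simp
    finally show ?thesis .
  qed
  then have "{x\<in>L. \<forall>w\<in>arch_places. norm (av w x) \<le> B} \<subseteq> {x\<in>L. \<forall>i. \<forall>\<sigma>\<in>field_embeddings. norm (\<sigma> (x $ i)) \<le> K}"
    by blast
  then show ?thesis by (rule finite_subset) (rule finite_bounded_L)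
qed

end

lemma card_arch_place:
  assumes w: "w \<in> arch_places"
  shows "card w = dim (arch_completion w)"
proof (cases "range (arch_embedding w) \<subseteq> \<real>")
  case True
  then have "arch_embedding w x \<in> \<real>" for x by blast
  then have "cnj \<circ> arch_embedding w = arch_embedding w" by (simp add: fun_eq_iff flip: Reals_cnj_iff)
  then have "card w = 1" using arch_embedding_mem(3)[OF w] by (metis card_1_singleton_iff insert_absorb2 One_nat_def)
  moreover have "dim (\<real> :: complex set) = 1"
  proof -
    have "(\<real> :: complex set) = span {1}" by (auto simp: span_singleton Reals_def scaleR_conv_of_real)
    moreover have "dim (span {1 :: complex}) = card {1 :: complex}" by (rule dim_span_eq_card_independent) simp
    ultimately show ?thesis by simp
  qed
  ultimately show ?thesis using True by (simp add: arch_completion_def)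
next
  case False
  then obtain x where "arch_embedding w x \<notin> \<real>" by blast
  then have "cnj \<circ> arch_embedding w \<noteq> arch_embedding w" by (metis Reals_cnj_iff comp_apply)
  then have "card {arch_embedding w, cnj \<circ> arch_embedding w} = 2" by (auto simp: card_insert_if)
  then have "card w = 2" using arch_embedding_mem(3)[OF w] by simp
  then show ?thesis using False by (simp add: arch_completion_def)
qed

text \<open>The weight \<open>dim (arch_completion w)\<close> is the number of embeddings in
  \<open>w\<close>. Weighted sums over places thus become plain sums over embeddings, the form in
  which norms and the pigeonhole theorem are stated.\<close>

theorem sum_arch_places:
  fixes F :: "('a::number_field \<Rightarrow> complex) \<Rightarrow> real"
  assumes F: "\<And>\<sigma>. \<sigma> \<in> field_embeddings \<Longrightarrow> F (cnj \<circ> \<sigma>) = F \<sigma>"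
  shows "(\<Sum>w\<in>arch_places. real (dim (arch_completion w)) * F (arch_embedding w)) = (\<Sum>\<sigma>\<in>field_embeddings. F \<sigma>)"
proof -
  have cc: "cnj \<circ> (cnj \<circ> \<sigma>) = \<sigma>" for \<sigma> :: "'a \<Rightarrow> complex" by (auto simp: fun_eq_iff)
  have U: "\<Union> arch_places = (field_embeddings :: ('a \<Rightarrow> complex) set)"
    using cnj_embedding by (auto simp: arch_places_def)
  have "(\<Sum>\<sigma>\<in>\<Union> arch_places. F \<sigma>) = (\<Sum>w\<in>arch_places. \<Sum>\<sigma>\<in>w. F \<sigma>)"
  proof -
    have eq: "A = {\<rho>, cnj \<circ> \<rho>}" if "A \<in> arch_places" "\<rho> \<in> A" for A :: "('a \<Rightarrow> complex) set" and \<rho>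
      using that by (auto simp: arch_places_def cc)
    have "\<forall>A\<in>arch_places. \<forall>B\<in>arch_places. A \<noteq> B \<longrightarrow> A \<inter> B = ({} :: ('a \<Rightarrow> complex) set)"
      using eq by (metis disjoint_iff)
    moreover have "\<forall>A\<in>arch_places. finite (A :: ('a \<Rightarrow> complex) set)" by (auto simp: arch_places_def)
    ultimately show ?thesis using sum.Union_disjoint[of "arch_places :: ('a \<Rightarrow> complex) set set" F] by simp
  qed
  also have "\<dots> = (\<Sum>w\<in>arch_places. real (dim (arch_completion w)) * F (arch_embedding w))"
  proof (rule sum.cong[OF refl])
    fix w :: "('a \<Rightarrow> complex) set" assume w: "w \<in> arch_places"
    have "F \<sigma> = F (arch_embedding w)" if "\<sigma> \<in> w" for \<sigma>
      using that arch_embedding_mem(3)[OF w] F[OF arch_embedding_mem(2)[OF w]] by (metis insertE singletonD)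
    then have "(\<Sum>\<sigma>\<in>w. F \<sigma>) = (\<Sum>\<sigma>\<in>w. F (arch_embedding w))" by (intro sum.cong) auto
    then show "(\<Sum>\<sigma>\<in>w. F \<sigma>) = real (dim (arch_completion w)) * F (arch_embedding w)"
      by (simp add: card_arch_place[OF w])
  qed
  finally show ?thesis by (simp add: U)
qed

section \<open>The Arakelov degree\<close>

context adelic_lattice
begin

definition iset :: "('a^'n) set \<Rightarrow> ('a^'n) set" where
  "iset S = {\<Sum>x\<in>S. c x *s x | c. \<forall>x\<in>S. algebraic_int (c x)}"

definition WS :: "('a \<Rightarrow> complex) set \<Rightarrow> ('a^'n) set \<Rightarrow> real" where
  "WS w S = wedge_norm g w (SOME xs. distinct xs \<and> set xs = S)"

definition Dist :: "('a \<Rightarrow> complex) set \<Rightarrow> 'a^'n \<Rightarrow> ('a^'n) set \<Rightarrow> real" where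
  "Dist w x S = infdist (av w x) (vec.span (av w ` S))"

abbreviation wt :: "('a \<Rightarrow> complex) set \<Rightarrow> real" where "wt w \<equiv> real (dim (arch_completion w))"

definition logW :: "('a^'n) set \<Rightarrow> real" where
  "logW S = (\<Sum>w\<in>arch_places. wt w * ln (WS w S))"

text \<open>The formula of \<open>arakelov_degree\<close> at the basis \<open>S\<close>, taken as a
  set so that exchange arguments need no order on it.\<close>

definition ldeg :: "('a^'n) set \<Rightarrow> real" where
  "ldeg S = ln (real (quot_index (L \<inter> vec.span S) (iset S))) - logW S"

lemma wedge_norm_gram: "wedge_norm g w xs = sqrt (Re (gram (map (av w) xs)))"
proof -
  have "Matrix.mat (length xs) (length xs) (\<lambda>(i, j). hermitian (av w (xs ! i)) (av w (xs ! j)))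
    = Matrix.mat (length xs) (length xs) (\<lambda>(i, j). hermitian (map (av w) xs ! i) (map (av w) xs ! j))"
    by (rule eq_matI) auto
  then show ?thesis by (simp add: wedge_norm_def gram_def)
qed

lemma inj_av: assumes w: "w \<in> arch_places" shows "inj (av w)"
proof (rule injI)
  fix x y assume "av w x = av w y"
  then have "emb_vec w x = emb_vec w y" using G_av[OF w] by metis
  then have "arch_embedding w (x $ i - y $ i) = 0" for i
    by (simp add: vec_eq_iff emb_vec_def embedding_diff[OF arch_embedding_mem(2)[OF w]])
  then show "x = y" using embedding_eq_0_iff[OF arch_embedding_mem(2)[OF w]] by (simp add: vec_eq_iff)
qed

lemma wedge_norm_WS:
  assumes w: "w \<in> arch_places" and xs: "distinct xs"
  shows "wedge_norm g w xs = WS w (set xs)"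
proof -
  define ys where "ys = (SOME ys. distinct ys \<and> set ys = set xs)"
  have ys: "distinct ys \<and> set ys = set xs"
    unfolding ys_def by (rule someI[of _ xs]) (use xs in simp)
  have inj: "inj_on (av w) A" for A using inj_av[OF w] by (rule inj_on_subset) simp
  have "gram (map (av w) xs) = gram (map (av w) ys)"
    by (rule gram_permute) (use xs ys inj in \<open>simp_all add: distinct_map\<close>)
  then show ?thesis by (simp add: WS_def wedge_norm_gram flip: ys_def)
qed

lemma WS_empty: assumes "w \<in> arch_places" shows "WS w {} = 1"
  using wedge_norm_WS[OF assms, of "[]"] by (simp add: wedge_norm_gram gram_Nil)

text \<open>The volume of a parallelepiped is base times height.\<close>

lemma WS_insert:
  assumes w: "w \<in> arch_places" and S: "finite S" "x \<notin> S"
  shows "WS w (insert x S) = WS w S * Dist w x S"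
proof -
  obtain xs where xs: "distinct xs" "set xs = S" using finite_distinct_list[OF S(1)] by blast
  have "WS w (insert x S) = wedge_norm g w (xs @ [x])"
    using wedge_norm_WS[OF w, of "xs @ [x]"] xs S by simp
  also have "\<dots> = sqrt (Re (gram (map (av w) xs) * of_real ((Dist w x S)\<^sup>2)))"
    by (simp add: wedge_norm_gram gram_snoc Dist_def xs)
  also have "\<dots> = sqrt (Re (gram (map (av w) xs))) * Dist w x S"
    by (simp add: real_sqrt_mult Dist_def infdist_nonneg flip: of_real_power)
  also have "\<dots> = WS w S * Dist w x S" using wedge_norm_WS[OF w xs(1)] xs by (simp add: wedge_norm_gram)
  finally show ?thesis .
qed

lemma Dist_pos:
  assumes w: "w \<in> arch_places" and x: "x \<notin> vec.span S"
  shows "Dist w x S > 0"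
proof -
  have "Dist w x S \<noteq> 0"
    using infdist_zero_imp_mem[OF vec.subspace_span] av_notin_span[OF w x] unfolding Dist_def by blast
  then show ?thesis using infdist_nonneg[of "av w x" "vec.span (av w ` S)"] by (simp add: Dist_def)
qed

lemma independent_insertD:
  assumes "vec.independent (insert x S)" "x \<notin> S"
  shows "x \<notin> vec.span S" "vec.independent S"
  using assms vec.independent_insert[of x S] by auto

lemma WS_pos:
  assumes w: "w \<in> arch_places" and S: "finite S" "vec.independent S"
  shows "WS w S > 0"
  using S
proof (induction S rule: finite_induct)
  case (insert x S)
  then show ?case using independent_insertD[OF insert.prems insert.hyps(2)] Dist_pos[OF w] by (simp add: WS_insert[OF w])
qed (simp add: WS_empty[OF w])

lemma logW_insert:
  assumes S: "finite S" "x \<notin> S" "vec.independent (insert x S)"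
  shows "logW (insert x S) = logW S + (\<Sum>w\<in>arch_places. wt w * ln (Dist w x S))"
proof -
  have "ln (WS w (insert x S)) = ln (WS w S) + ln (Dist w x S)" if w: "w \<in> arch_places" for w
    using WS_pos[OF w S(1) independent_insertD(2)[OF S(3,2)]] Dist_pos[OF w independent_insertD(1)[OF S(3,2)]]
    by (simp add: WS_insert[OF w S(1,2)] ln_mult)
  then show ?thesis by (simp add: logW_def distrib_left sum.distrib)
qed

lemma Dist_mono:
  assumes "S \<subseteq> T" shows "Dist w x T \<le> Dist w x S"
  unfolding Dist_def
proof (rule infdist_mono)
  show "vec.span (av w ` S) \<subseteq> vec.span (av w ` T)" using assms by (intro vec.span_mono image_mono)
  show "vec.span (av w ` S) \<noteq> {}" using vec.span_zero by blast
qed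

lemma sum_ln_abs_norm:
  fixes a :: 'a
  assumes "a \<noteq> 0"
  shows "(\<Sum>w\<in>arch_places. wt w * ln (norm (arch_embedding w a))) = ln (abs_norm a)"
proof -
  have "(\<Sum>w\<in>arch_places. wt w * ln (norm (arch_embedding w a))) = (\<Sum>\<sigma>\<in>field_embeddings. ln (norm (\<sigma> a)))"
    by (rule sum_arch_places) simp
  also have "\<dots> = ln (abs_norm a)"
    unfolding abs_norm_def using assms by (subst ln_prod) (auto simp: finite_embeddings embedding_eq_0_iff)
  finally show ?thesis .
qed

lemma sum_Dist_scale_add:
  assumes a: "a \<noteq> 0" and u: "u \<in> vec.span S" and x: "x \<notin> vec.span S"
  shows "(\<Sum>w\<in>arch_places. wt w * ln (Dist w (a *s x + u) S)) = ln (abs_norm a) + (\<Sum>w\<in>arch_places. wt w * ln (Dist w x S))"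
proof -
  have "ln (Dist w (a *s x + u) S) = ln (norm (arch_embedding w a)) + ln (Dist w x S)" if w: "w \<in> arch_places" for w
  proof -
    have "Dist w (a *s x + u) S = norm (arch_embedding w a) * Dist w x S"
      unfolding Dist_def av_add[OF w] av_scale[OF w]
      by (rule infdist_scale_add[OF vec.subspace_span av_span[OF w u]])
    moreover have "norm (arch_embedding w a) > 0" using a embedding_eq_0_iff[OF arch_embedding_mem(2)[OF w]] by simp
    ultimately show ?thesis using Dist_pos[OF w x] by (simp add: ln_mult)
  qed
  then show ?thesis by (simp add: distrib_left sum.distrib sum_ln_abs_norm[OF a, symmetric])
qed

lemma isetI: "(\<And>x. x \<in> S \<Longrightarrow> algebraic_int (c x)) \<Longrightarrow> (\<Sum>x\<in>S. c x *s x) \<in> iset S"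
  unfolding iset_def by blast

lemma isetE: assumes "y \<in> iset S" obtains c where "y = (\<Sum>x\<in>S. c x *s x)" "\<forall>x\<in>S. algebraic_int (c x)"
  using assms unfolding iset_def by blast

lemma add_subgroup_iset: "add_subgroup (iset S)"
  unfolding add_subgroup_def
proof (intro conjI ballI)
  show "0 \<in> iset S" using isetI[of S "\<lambda>_. 0"] by simp
  fix x y assume x: "x \<in> iset S" and y: "y \<in> iset S"
  obtain c where c: "x = (\<Sum>x\<in>S. c x *s x)" "\<forall>x\<in>S. algebraic_int (c x)" using x by (rule isetE)
  obtain d where d: "y = (\<Sum>x\<in>S. d x *s x)" "\<forall>x\<in>S. algebraic_int (d x)" using y by (rule isetE)
  have "x - y = (\<Sum>x\<in>S. (c x - d x) *s x)" by (simp add: c d vec.scale_left_diff_distrib sum_subtractf)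
  then show "x - y \<in> iset S" using isetI[of S "\<lambda>x. c x - d x"] c(2) d(2) by auto
qed

lemma iset_subset: assumes "S \<subseteq> L" shows "iset S \<subseteq> L \<inter> vec.span S"
proof
  fix y assume "y \<in> iset S"
  then obtain c where c: "y = (\<Sum>x\<in>S. c x *s x)" "\<forall>x\<in>S. algebraic_int (c x)" by (rule isetE)
  have "y \<in> L" unfolding c(1) using assms c(2) by (intro L_sum L_scale) auto
  moreover have "y \<in> vec.span S" unfolding c(1) by (intro vec.span_sum vec.span_scale vec.span_base)
  ultimately show "y \<in> L \<inter> vec.span S" by blast
qed

lemma add_subgroup_L_span: "add_subgroup (L \<inter> vec.span S)"
  by (rule add_subgroup_Int[OF add_subgroup_L]) (simp add: add_subgroup_def vec.span_zero vec.span_diff)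

text \<open>Rounding the coefficients of \<open>y\<close> to integers leaves a remainder in
  \<open>L\<close> with bounded conjugates, and \<open>L\<close> contains finitely many of
  those.\<close>

lemma fin_index_iset:
  assumes S: "finite S" "S \<subseteq> L"
  shows "fin_index (L \<inter> vec.span S) (iset S)"
proof -
  define B where "B = (\<Sum>i\<in>UNIV. \<Sum>\<sigma>\<in>field_embeddings. \<Sum>x\<in>S. basis_bound \<sigma> * norm (\<sigma> (x $ i)))"
  have nn: "0 \<le> basis_bound \<sigma>" for \<sigma> :: "'a \<Rightarrow> complex" by (simp add: basis_bound_def sum_nonneg)
  show ?thesis
  proof (rule fin_indexI[OF add_subgroup_iset finite_bounded_L[of B]])
    fix y assume y: "y \<in> L \<inter> vec.span S"
    then obtain \<alpha> where \<alpha>: "y = (\<Sum>x\<in>S. \<alpha> x *s x)" unfolding vec.span_finite[OF S(1)] by auto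
    have "\<forall>a::'a. \<exists>b. algebraic_int b \<and> (\<forall>\<sigma>\<in>field_embeddings. norm (\<sigma> (a - b)) \<le> basis_bound \<sigma>)"
      using round_to_integral by metis
    then obtain rd :: "'a \<Rightarrow> 'a" where rd: "\<And>a. algebraic_int (rd a)"
      "\<And>a \<sigma>. \<sigma> \<in> field_embeddings \<Longrightarrow> norm (\<sigma> (a - rd a)) \<le> basis_bound \<sigma>" by metis
    define z where "z = (\<Sum>x\<in>S. rd (\<alpha> x) *s x)"
    have z: "z \<in> iset S" unfolding z_def by (rule isetI) (rule rd)
    have yz: "y - z = (\<Sum>x\<in>S. (\<alpha> x - rd (\<alpha> x)) *s x)" by (simp add: \<alpha> z_def vec.scale_left_diff_distrib sum_subtractf)
    have "norm (\<sigma> ((y - z) $ i)) \<le> B" if \<sigma>: "\<sigma> \<in> field_embeddings" for \<sigma> i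
    proof -
      have "norm (\<sigma> ((y - z) $ i)) = norm (\<Sum>x\<in>S. \<sigma> (\<alpha> x - rd (\<alpha> x)) * \<sigma> (x $ i))"
        unfolding yz by (simp only: sum_component vector_smult_component embedding_sum[OF \<sigma>] embedding_mult[OF \<sigma>])
      also have "\<dots> \<le> (\<Sum>x\<in>S. basis_bound \<sigma> * norm (\<sigma> (x $ i)))"
        by (intro sum_norm_le) (auto simp: norm_mult intro!: mult_right_mono rd(2)[OF \<sigma>])
      also have "\<dots> \<le> (\<Sum>\<sigma>\<in>field_embeddings. \<Sum>x\<in>S. basis_bound \<sigma> * norm (\<sigma> (x $ i)))"
        by (rule member_le_sum[OF \<sigma> _ finite_embeddings]) (simp add: sum_nonneg nn)
      also have "\<dots> \<le> B" unfolding B_def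
        by (rule member_le_sum[of i UNIV "\<lambda>i. \<Sum>\<sigma>\<in>field_embeddings. \<Sum>x\<in>S. basis_bound \<sigma> * norm (\<sigma> (x $ i))"]) (simp_all add: sum_nonneg nn)
      finally show ?thesis .
    qed
    moreover have "y - z \<in> L" using y z iset_subset[OF S(2)] L_diff by blast
    ultimately show "\<exists>r\<in>{x\<in>L. \<forall>i. \<forall>\<sigma>\<in>field_embeddings. norm (\<sigma> (x $ i)) \<le> B}. y - r \<in> iset S"
      using z by (intro bexI[of _ "y - z"]) auto
  qed
qed

lemma additiveI: "(\<And>y z. f (y + z) = f y + f z) \<Longrightarrow> Modules.additive f"
  by unfold_locales

text \<open>The index of a basis in the lattice splits along a functional vanishing on all but one basis vector;
  the second factor is the index of a fractional ideal, which depends on the last vector through a norm.\<close>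

lemma quot_index_last:
  assumes S: "finite S" "x \<notin> S" "insert x S \<subseteq> L" "vec.independent (insert x S)"
    and \<phi>: "\<And>y z. \<phi> (y + z) = \<phi> y + \<phi> z" "\<And>c y. \<phi> (c *s y) = c * \<phi> y"
      "\<And>s. s \<in> vec.span S \<Longrightarrow> \<phi> s = 0" and \<phi>x: "\<phi> x \<noteq> 0"
  shows "quot_index (L \<inter> vec.span (insert x S)) (iset (insert x S))
      = quot_index (L \<inter> vec.span S) (iset S) * quot_index (\<phi> ` (L \<inter> vec.span (insert x S))) (mult_ideal (\<phi> x))"
    and "fin_index (\<phi> ` (L \<inter> vec.span (insert x S))) (mult_ideal (\<phi> x))"
    and "mult_ideal (\<phi> x) \<subseteq> \<phi> ` (L \<inter> vec.span (insert x S))"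
proof -
  let ?M = "L \<inter> vec.span (insert x S)" and ?N = "iset (insert x S)" and ?K = "{y. \<phi> y = 0}"
  have fS: "finite (insert x S)" using S by simp
  have iset_ins: "\<exists>a s. algebraic_int a \<and> s \<in> iset S \<and> y = a *s x + s" if y: "y \<in> ?N" for y
  proof -
    obtain c where c: "y = (\<Sum>z\<in>insert x S. c z *s z)" "\<forall>z\<in>insert x S. algebraic_int (c z)" using y by (rule isetE)
    then have "y = c x *s x + (\<Sum>z\<in>S. c z *s z)" using S by simp
    then show ?thesis using c(2) isetI[of S c] by blast
  qed
  have ins_iset: "a *s x + s \<in> ?N" if a: "algebraic_int a" and s: "s \<in> iset S" for a s
  proof -
    obtain c where c: "s = (\<Sum>z\<in>S. c z *s z)" "\<forall>z\<in>S. algebraic_int (c z)" using s by (rule isetE)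
    have "(\<Sum>z\<in>insert x S. (c(x := a)) z *s z) = a *s x + (\<Sum>z\<in>S. (c(x := a)) z *s z)" using S by simp
    also have "(\<Sum>z\<in>S. (c(x := a)) z *s z) = s" unfolding c(1) using S(2) by (intro sum.cong) auto
    finally have e: "(\<Sum>z\<in>insert x S. (c(x := a)) z *s z) = a *s x + s" .
    have "algebraic_int ((c(x := a)) z)" if "z \<in> insert x S" for z using that a c(2) by auto
    then have "(\<Sum>z\<in>insert x S. (c(x := a)) z *s z) \<in> iset (insert x S)" by (rule isetI)
    then show ?thesis unfolding e .
  qed
  have sp: "iset S \<subseteq> L \<inter> vec.span S" by (rule iset_subset) (use S in blast)
  have M_ker: "?M \<inter> ?K = L \<inter> vec.span S"
  proof
    show "L \<inter> vec.span S \<subseteq> ?M \<inter> ?K" using \<phi>(3) vec.span_mono[of S "insert x S"] by blast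
    show "?M \<inter> ?K \<subseteq> L \<inter> vec.span S"
    proof
      fix y assume y: "y \<in> ?M \<inter> ?K"
      then obtain k where k: "y - k *s x \<in> vec.span S" using vec.span_breakdown_eq[of y x S] by blast
      have "\<phi> (y - k *s x + k *s x) = \<phi> (y - k *s x) + \<phi> (k *s x)" by (rule \<phi>(1))
      then have "k * \<phi> x = 0" using y k \<phi>(2,3) by simp
      then have "k = 0" using \<phi>x by simp
      then show "y \<in> L \<inter> vec.span S" using k y by simp
    qed
  qed
  have N_ker: "?N \<inter> ?K = iset S"
  proof
    have "iset S \<subseteq> ?N" using ins_iset[of 0] by auto
    then show "iset S \<subseteq> ?N \<inter> ?K" using sp \<phi>(3) by blast
    show "?N \<inter> ?K \<subseteq> iset S"
    proof
      fix y assume y: "y \<in> ?N \<inter> ?K"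
      then obtain a s where as: "algebraic_int a" "s \<in> iset S" "y = a *s x + s" using iset_ins by blast
      then have "a * \<phi> x = 0" using y \<phi>(1)[of "a *s x" s] \<phi>(2)[of a x] \<phi>(3)[of s] sp by auto
      then show "y \<in> iset S" using as \<phi>x by simp
    qed
  qed
  have N_im: "\<phi> ` ?N = mult_ideal (\<phi> x)"
  proof
    show "\<phi> ` ?N \<subseteq> mult_ideal (\<phi> x)"
    proof
      fix t assume "t \<in> \<phi> ` ?N"
      then obtain y where y: "y \<in> ?N" "t = \<phi> y" by blast
      obtain a s where as: "algebraic_int a" "s \<in> iset S" "y = a *s x + s" using iset_ins[OF y(1)] by blast
      then have "t = \<phi> x * a" using y(2) \<phi>(1)[of "a *s x" s] \<phi>(2)[of a x] \<phi>(3)[of s] sp by (auto simp: mult.commute)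
      then show "t \<in> mult_ideal (\<phi> x)" using as(1) by blast
    qed
    show "mult_ideal (\<phi> x) \<subseteq> \<phi> ` ?N"
    proof
      fix t assume "t \<in> mult_ideal (\<phi> x)"
      then obtain a where a: "algebraic_int a" "t = \<phi> x * a" by blast
      have "0 \<in> iset S" using add_subgroupD(1)[OF add_subgroup_iset] .
      then have "a *s x \<in> ?N" using ins_iset[OF a(1), of 0] by simp
      then show "t \<in> \<phi> ` ?N" using a(2) \<phi>(2)[of a x] by (metis image_eqI mult.commute)
    qed
  qed
  have add: "Modules.additive \<phi>" by (rule additiveI) (rule \<phi>(1))
  have NM: "?N \<subseteq> ?M" by (rule iset_subset[OF S(3)])
  note ex = quot_index_exact[OF add_subgroup_iset add_subgroup_L_span NM fin_index_iset[OF fS S(3)] add, unfolded M_ker N_ker N_im]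
  show "quot_index ?M ?N = quot_index (L \<inter> vec.span S) (iset S) * quot_index (\<phi> ` ?M) (mult_ideal (\<phi> x))"
    by (rule ex(1))
  show "fin_index (\<phi> ` ?M) (mult_ideal (\<phi> x))" by (rule ex(3))
  show "mult_ideal (\<phi> x) \<subseteq> \<phi> ` ?M" unfolding N_im[symmetric] by (rule image_mono[OF NM])
qed

lemma quot_index_iset_pos:
  assumes "finite S" "S \<subseteq> L" shows "quot_index (L \<inter> vec.span S) (iset S) > 0"
proof (rule quot_index_pos[OF add_subgroup_iset fin_index_iset[OF assms]])
  show "L \<inter> vec.span S \<noteq> {}" using L_zero vec.span_zero by blast
qed

text \<open>Let \<open>\<alpha>\<close> be the coefficient of \<open>x\<close> in \<open>y\<close>
  modulo the span of \<open>S\<close>. With \<open>\<phi>\<close> normalized by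
  \<open>\<phi> x = 1\<close>, the index for \<open>x\<close> involves the ideal of all integers and
  that for \<open>y\<close> the ideal of \<open>\<alpha>\<close>, so the index grows by
  \<open>abs_norm \<alpha>\<close>. The distances at the archimedean places grow by the same factor
  in total, and the two changes cancel.\<close>

lemma ldeg_exchange:
  assumes S: "finite S" "x \<notin> S" "y \<notin> S" "insert x S \<subseteq> L" "y \<in> L"
    and ind: "vec.independent (insert x S)" "vec.independent (insert y S)"
    and sp: "vec.span (insert x S) = vec.span (insert y S)"
  shows "ldeg (insert x S) = ldeg (insert y S)"
proof -
  obtain \<phi> :: "'a^'n \<Rightarrow> 'a" where \<phi>: "\<And>y z. \<phi> (y + z) = \<phi> y + \<phi> z" "\<And>c y. \<phi> (c *s y) = c * \<phi> y"
    "\<And>s. s \<in> vec.span S \<Longrightarrow> \<phi> s = 0" "\<phi> x = 1"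
    by (rule ex_linear_form[OF vec.subspace_span independent_insertD(1)[OF ind(1) S(2)]]) blast
  have "y \<in> vec.span (insert x S)" unfolding sp by (rule vec.span_base) simp
  then obtain \<alpha> where \<alpha>: "y - \<alpha> *s x \<in> vec.span S" using vec.span_breakdown_eq by blast
  have y: "y = \<alpha> *s x + (y - \<alpha> *s x)" by simp
  have "\<phi> y = \<phi> (\<alpha> *s x) + \<phi> (y - \<alpha> *s x)" by (subst y) (rule \<phi>(1))
  then have \<phi>y: "\<phi> y = \<alpha>" using \<phi>(2)[of \<alpha> x] \<phi>(3)[OF \<alpha>] \<phi>(4) by simp
  have ysp: "y \<notin> vec.span S" "x \<notin> vec.span S" using independent_insertD ind S by blast+
  have \<alpha>0: "\<alpha> \<noteq> 0" using \<alpha> ysp by auto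
  let ?J = "\<phi> ` (L \<inter> vec.span (insert x S))"
  have \<phi>x0: "\<phi> x \<noteq> 0" using \<phi>(4) by simp
  have \<phi>y0: "\<phi> y \<noteq> 0" using \<phi>y \<alpha>0 by simp
  have yL: "insert y S \<subseteq> L" using S by blast
  note X = quot_index_last[OF S(1,2,4) ind(1) \<phi>(1-3) \<phi>x0] 
  note Y = quot_index_last[OF S(1,3) yL ind(2) \<phi>(1-3) \<phi>y0]
  have mi: "mult_ideal (\<phi> x) = int_ring" by (simp add: \<phi>(4))
  have Y3: "mult_ideal \<alpha> \<subseteq> ?J" using Y(3) unfolding \<phi>y sp[symmetric] .
  have J: "add_subgroup ?J" by (rule add_subgroup_image[OF additiveI add_subgroup_L_span]) (rule \<phi>(1))
  have frac: "real (quot_index ?J (mult_ideal \<alpha>)) = real (quot_index ?J int_ring) * abs_norm \<alpha>"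
    by (rule quot_index_fractional(2)[OF J X(3)[unfolded mi] X(2)[unfolded mi] \<alpha>0 Y3])
  define q where "q = quot_index (L \<inter> vec.span S) (iset S)"
  define r where "r = quot_index ?J int_ring"
  have qx: "quot_index (L \<inter> vec.span (insert x S)) (iset (insert x S)) = q * r"
    using X(1) unfolding mi q_def r_def .
  have "real (quot_index (L \<inter> vec.span (insert y S)) (iset (insert y S))) = real q * real (quot_index ?J (mult_ideal \<alpha>))"
    using Y(1) unfolding q_def \<phi>y sp[symmetric] by simp
  then have qy: "real (quot_index (L \<inter> vec.span (insert y S)) (iset (insert y S))) = real (q * r) * abs_norm \<alpha>"
    unfolding frac r_def by simp
  have qr: "q * r > 0" using quot_index_iset_pos[OF _ S(4)] S(1) unfolding qx by simp
  have "ln (real (quot_index (L \<inter> vec.span (insert y S)) (iset (insert y S)))) = ln (real (q * r)) + ln (abs_norm \<alpha>)"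
    unfolding qy using qr abs_norm_pos[OF \<alpha>0] by (simp add: ln_mult del: of_nat_mult)
  moreover have "logW (insert y S) = logW (insert x S) + ln (abs_norm \<alpha>)"
    using logW_insert[OF S(1,2) ind(1)] logW_insert[OF S(1,3) ind(2)] sum_Dist_scale_add[OF \<alpha>0 \<alpha> ysp(2)] y by simp
  ultimately show ?thesis unfolding ldeg_def qx by simp
qed

text \<open>Steinitz exchange: for \<open>y \<in> T - S\<close> some \<open>x \<in> S - T\<close>
  can be replaced by \<open>y\<close>, as otherwise \<open>y\<close> would be a combination of
  \<open>S \<inter> T\<close>, against the independence of \<open>T\<close>. Each exchange preserves
  \<open>ldeg\<close> and brings \<open>S\<close> closer to \<open>T\<close>.\<close>

theorem ldeg_unique:
  assumes S: "finite S" "vec.independent S" "S \<subseteq> L"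
    and T: "finite T" "vec.independent T" "T \<subseteq> L" and sp: "vec.span S = vec.span T"
  shows "ldeg S = ldeg T"
  using S sp
proof (induction "card (T - S)" arbitrary: S rule: less_induct)
  case less
  have card: "card S = card T"
    using vec.dim_span_eq_card_independent less.prems T(2) by metis
  show ?case
  proof (cases "T \<subseteq> S")
    case True
    then have "T = S" using card less.prems(1) card_subset_eq by metis
    then show ?thesis by simp
  next
    case False
    then obtain y where y: "y \<in> T" "y \<notin> S" by blast
    have yS: "y \<in> vec.span S" unfolding less.prems(4) using y by (simp add: vec.span_base)
    have "\<exists>x\<in>S - T. y \<notin> vec.span (S - {x})"
    proof (rule ccontr)
      assume "\<not> ?thesis"
      then have all: "\<And>x. x \<in> S - T \<Longrightarrow> y \<in> vec.span (S - {x})" by blast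
      have rep0: "vec.representation S y x = 0" if "x \<in> S - T" for x
      proof -
        have "vec.representation (S - {x}) y = vec.representation S y"
          using vec.representation_extend[OF less.prems(2) all[OF that]] by simp
        then show ?thesis using vec.representation_ne_zero[of "S - {x}" y x] by (metis Diff_iff insertI1)
      qed
      have "y = (\<Sum>x\<in>S. vec.representation S y x *s x)"
        using vec.sum_representation_eq[OF less.prems(2) yS less.prems(1)] by simp
      also have "\<dots> = (\<Sum>x\<in>S \<inter> T. vec.representation S y x *s x)"
        using rep0 less.prems(1) by (intro sum.mono_neutral_right) auto
      also have "\<dots> \<in> vec.span (T - {y})"
        using y by (intro vec.span_sum vec.span_scale vec.span_base) auto
      finally show False using T(2) y(1) by (metis vec.dependent_def)
    qed
    then obtain x where x: "x \<in> S" "x \<notin> T" "y \<notin> vec.span (S - {x})" by blast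
    define R where "R = S - {x}"
    have SR: "S = insert x R" "x \<notin> R" "y \<notin> R" using x y by (auto simp: R_def)
    have finR: "finite R" using less.prems(1) by (simp add: R_def)
    have indR: "vec.independent R" using less.prems(2) unfolding R_def by (rule vec.independent_mono) blast
    have indy: "vec.independent (insert y R)" using indR x(3) by (simp add: vec.independent_insert R_def)
    have "x \<in> vec.span (insert y R)"
      using yS x(3) unfolding SR(1) by (metis R_def SR(1) vec.in_span_insert)
    then have "vec.span (insert x R) \<subseteq> vec.span (insert y R)"
      by (intro vec.span_minimal) (auto intro: vec.span_base)
    moreover have "vec.span (insert y R) \<subseteq> vec.span (insert x R)"
      using yS SR(1) by (intro vec.span_minimal) (auto intro: vec.span_base)
    ultimately have sp: "vec.span (insert x R) = vec.span (insert y R)" by blast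
    have yL: "y \<in> L" using y T by blast
    have "ldeg S = ldeg (insert y R)"
      unfolding SR(1) by (rule ldeg_exchange[OF finR SR(2,3) _ yL _ indy sp]) (use less.prems SR in auto)
    moreover have "ldeg (insert y R) = ldeg T"
    proof (rule less.hyps)
      have "T - insert y R \<subset> T - S" using x y SR by auto
      then show "card (T - insert y R) < card (T - S)" using T(1) by (intro psubset_card_mono) auto
      show "finite (insert y R)" using finR by simp
      show "vec.independent (insert y R)" by (rule indy)
      show "insert y R \<subseteq> L" using yL less.prems(3) by (auto simp: R_def)
      show "vec.span (insert y R) = vec.span T" using sp less.prems(4) SR(1) by simp
    qed
    ultimately show ?thesis by simp
  qed
qed

text \<open>Every vector of \<open>V\<close> has a positive integer multiple in \<open>L\<close>, so
  a largest independent set inside both \<open>L\<close> and \<open>V\<close> spans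
  \<open>V\<close>.\<close>

lemma ex_basis_extension:
  assumes V: "vec.subspace V" and S: "S \<subseteq> V" "vec.independent S" "S \<subseteq> L"
  obtains T where "S \<subseteq> T" "finite T" "vec.independent T" "T \<subseteq> L" "vec.span T = V"
proof -
  define P where "P T \<longleftrightarrow> S \<subseteq> T \<and> T \<subseteq> V \<and> vec.independent T \<and> T \<subseteq> L" for T
  have fin: "finite T \<and> card T \<le> CARD('n)" if "vec.independent T" for T :: "('a^'n) set"
  proof -
    have "card T \<le> vec.dim (UNIV :: ('a^'n) set)" by (rule vec.independent_card_le_dim[OF _ that]) simp
    then show ?thesis unfolding vec_dim_card using vec.finiteI_independent[OF that] by blast
  qed
  have "P S" using S by (simp add: P_def)
  moreover have "\<forall>T. P T \<longrightarrow> card T < Suc CARD('n)" using fin by (auto simp: P_def less_Suc_eq_le)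
  ultimately obtain T where T: "P T" and Tmax: "\<And>U. P U \<Longrightarrow> card U \<le> card T"
    using ex_has_greatest_nat[of P S card "Suc CARD('n)"] by blast
  have TD: "S \<subseteq> T" "T \<subseteq> V" "vec.independent T" "T \<subseteq> L" using T by (auto simp: P_def)
  have "V \<subseteq> vec.span T"
  proof
    fix v assume v: "v \<in> V"
    show "v \<in> vec.span T"
    proof (rule ccontr)
      assume nv: "v \<notin> vec.span T"
      obtain k :: nat where k: "k > 0" "of_nat k *s v \<in> L" using ex_multiple_in_L by blast
      define u where "u = of_nat k *s v"
      have "v = inverse (of_nat k) *s u" using k by (simp add: u_def vec.scale_scale)
      then have nu: "u \<notin> vec.span T" using nv vec.span_scale by metis
      have "P (insert u T)"
        unfolding P_def using TD nu k V v
        by (auto simp: vec.independent_insert u_def intro: vec.subspace_scale)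
      then have "card (insert u T) \<le> card T" by (rule Tmax)
      moreover have "u \<notin> T" using nu vec.span_base by blast
      ultimately show False using fin[OF TD(3)] by simp
    qed
  qed
  moreover have "vec.span T \<subseteq> V" using TD V by (intro vec.span_minimal) auto
  ultimately show ?thesis using that TD fin by blast
qed

section \<open>Comparison with the defining formula of the degree\<close>

lemma integral_span_iset:
  assumes "distinct xs" shows "integral_span xs = iset (set xs)"
proof -
  have bij: "bij_betw ((!) xs) {..<length xs} (set xs)" by (rule bij_betw_nth[OF assms]) auto
  have s: "(\<Sum>x\<in>set xs. c x *s x) = (\<Sum>i<length xs. c (xs ! i) *s xs ! i)" for c
    using sum.reindex_bij_betw[OF bij, of "\<lambda>x. c x *s x"] by simp
  show ?thesis
  proof
    show "iset (set xs) \<subseteq> integral_span xs"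
    proof
      fix y assume "y \<in> iset (set xs)"
      then obtain c where "y = (\<Sum>x\<in>set xs. c x *s x)" "\<forall>x\<in>set xs. algebraic_int (c x)" by (rule isetE)
      then show "y \<in> integral_span xs" unfolding integral_span_def s by (auto intro!: exI[of _ "\<lambda>i. c (xs ! i)"])
    qed
    show "integral_span xs \<subseteq> iset (set xs)"
    proof
      fix y assume "y \<in> integral_span xs"
      then obtain c where c: "y = (\<Sum>i<length xs. c i *s xs ! i)" "\<And>i. i < length xs \<Longrightarrow> algebraic_int (c i)"
        unfolding integral_span_def by blast
      define d where "d x = c (the_inv_into {..<length xs} ((!) xs) x)" for x
      have d: "d (xs ! i) = c i" if "i < length xs" for i
        unfolding d_def using the_inv_into_f_f[OF bij_betw_imp_inj_on[OF bij]] that by simp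
      have "y = (\<Sum>x\<in>set xs. d x *s x)" unfolding s c(1) by (intro sum.cong) (auto simp: d)
      moreover have "algebraic_int (d x)" if "x \<in> set xs" for x
        using that c(2) d by (metis in_set_conv_nth)
      ultimately show "y \<in> iset (set xs)" using isetI[of "set xs" d] by simp
    qed
  qed
qed

lemma formula_ldeg:
  assumes "distinct xs" "vec.span (set xs) = V"
  shows "ln (real (lattice_index g V xs)) - (\<Sum>w\<in>arch_places. wt w * ln (wedge_norm g w xs)) = ldeg (set xs)"
proof -
  have "lattice_index g V xs = quot_index (L \<inter> vec.span (set xs)) (iset (set xs))"
    unfolding lattice_index_def quot_index_def integral_span_iset[OF assms(1)] assms(2) by simp
  moreover have "(\<Sum>w\<in>arch_places. wt w * ln (wedge_norm g w xs)) = logW (set xs)"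
    unfolding logW_def by (intro sum.cong) (auto simp: wedge_norm_WS[OF _ assms(1)])
  ultimately show ?thesis by (simp add: ldeg_def)
qed

lemma ldeg_empty: "ldeg {} = 0"
proof -
  have i: "iset {} = {0}" by (simp add: iset_def)
  have "transversal (L \<inter> vec.span {}) (iset {}) {0}"
    unfolding transversal_def i using L_zero by auto
  then have "quot_index (L \<inter> vec.span {}) (iset {}) = card {0 :: 'a^'n}"
    by (rule quot_index_transversal[OF add_subgroup_iset])
  then show ?thesis by (simp add: ldeg_def logW_def WS_empty)
qed

theorem arakelov_degree_eq:
  assumes S: "finite S" "vec.independent S" "S \<subseteq> L" "vec.span S = V"
  shows "arakelov_degree g V = ldeg S"
proof (cases "V = {0}")
  case True
  have "S \<subseteq> {0}" using S(4) True vec.span_superset by blast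
  then have "S = {}" using S(2) vec.dependent_zero by blast
  then show ?thesis using True by (simp add: arakelov_degree_def ldeg_empty)
next
  case False
  obtain xs where xs: "distinct xs" "set xs = S" using finite_distinct_list[OF S(1)] by blast
  have all: "ln (real (lattice_index g V ys)) - (\<Sum>w\<in>arch_places. wt w * ln (wedge_norm g w ys)) = ldeg S"
    if ys: "is_basis ys V" "set ys \<subseteq> L" for ys
  proof -
    have "ldeg (set ys) = ldeg S"
      by (rule ldeg_unique) (use ys S in \<open>auto simp: is_basis_def\<close>)
    then show ?thesis using formula_ldeg[of ys V] ys(1) by (simp add: is_basis_def)
  qed
  have b: "is_basis xs V" "set xs \<subseteq> L" using xs S by (auto simp: is_basis_def)
  have "(THE d. \<forall>xs. is_basis xs V \<and> set xs \<subseteq> L \<longrightarrow> d = ln (real (lattice_index g V xs))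
          - (\<Sum>w\<in>arch_places. wt w * ln (wedge_norm g w xs))) = ldeg S"
  proof (rule the_equality)
    show "\<forall>xs. is_basis xs V \<and> set xs \<subseteq> L \<longrightarrow> ldeg S = ln (real (lattice_index g V xs))
          - (\<Sum>w\<in>arch_places. wt w * ln (wedge_norm g w xs))" using all by simp
    fix d assume "\<forall>xs. is_basis xs V \<and> set xs \<subseteq> L \<longrightarrow> d = ln (real (lattice_index g V xs))
          - (\<Sum>w\<in>arch_places. wt w * ln (wedge_norm g w xs))"
    then have "d = ln (real (lattice_index g V xs)) - (\<Sum>w\<in>arch_places. wt w * ln (wedge_norm g w xs))" using b by blast
    then show "d = ldeg S" using all[OF b] by simp
  qed
  then show ?thesis using False by (simp add: arakelov_degree_def)
qed

end

section \<open>Supermodularity of the degree\<close>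

lemma ex_projection:
  fixes S T :: "('a::field^'n) set"
  assumes "vec.independent (S \<union> T)" "S \<inter> T = {}"
  obtains f :: "'a^'n \<Rightarrow> 'a^'n" where "\<And>x y. f (x + y) = f x + f y"
    "\<And>s. s \<in> vec.span S \<Longrightarrow> f s = 0" "\<And>t. t \<in> vec.span T \<Longrightarrow> f t = t"
proof -
  define f :: "'a^'n \<Rightarrow> 'a^'n" where "f = vec.construct (S \<union> T) (\<lambda>b. if b \<in> T then b else 0)"
  have lin: "Vector_Spaces.linear (*s) (*s) f" unfolding f_def by (rule vec.linear_construct[OF assms(1)])
  interpret f: Vector_Spaces.linear "(*s)" "(*s)" f by (rule lin)
  have fb: "f b = (if b \<in> T then b else 0)" if "b \<in> S \<union> T" for b
    unfolding f_def by (rule vec.construct_basis[OF assms(1) that])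
  have "f s = 0" if "s \<in> vec.span S" for s
  proof (rule f.eq_0_on_span[OF _ that])
    fix b assume "b \<in> S"
    then show "f b = 0" using fb[of b] assms(2) by auto
  qed
  moreover have "f t = t" if "t \<in> vec.span T" for t
    using that
  proof (induction t rule: vec.span_induct_alt)
    case base
    then show ?case by (rule f.zero)
  next
    case (step c b s)
    then show ?case using fb[of b] by (simp add: f.add f.scale)
  qed
  ultimately show ?thesis using that f.add by blast
qed

context adelic_lattice
begin

lemma iset_Un:
  assumes "finite S" "finite T" "S \<inter> T = {}"
  shows "iset (S \<union> T) = {s + t | s t. s \<in> iset S \<and> t \<in> iset T}"
proof
  show "iset (S \<union> T) \<subseteq> {s + t | s t. s \<in> iset S \<and> t \<in> iset T}"
  proof
    fix y assume "y \<in> iset (S \<union> T)"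
    then obtain c where c: "y = (\<Sum>x\<in>S \<union> T. c x *s x)" "\<forall>x\<in>S \<union> T. algebraic_int (c x)" by (rule isetE)
    have "y = (\<Sum>x\<in>S. c x *s x) + (\<Sum>x\<in>T. c x *s x)" unfolding c(1) by (rule sum.union_disjoint[OF assms])
    moreover have "(\<Sum>x\<in>S. c x *s x) \<in> iset S" "(\<Sum>x\<in>T. c x *s x) \<in> iset T"
      by (rule isetI, use c(2) in blast)+
    ultimately show "y \<in> {s + t | s t. s \<in> iset S \<and> t \<in> iset T}" by blast
  qed
  show "{s + t | s t. s \<in> iset S \<and> t \<in> iset T} \<subseteq> iset (S \<union> T)"
  proof
    fix y assume "y \<in> {s + t | s t. s \<in> iset S \<and> t \<in> iset T}"
    then obtain s t where st: "y = s + t" "s \<in> iset S" "t \<in> iset T" by blast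
    obtain c where c: "s = (\<Sum>x\<in>S. c x *s x)" "\<forall>x\<in>S. algebraic_int (c x)" using st(2) by (rule isetE)
    obtain d where d: "t = (\<Sum>x\<in>T. d x *s x)" "\<forall>x\<in>T. algebraic_int (d x)" using st(3) by (rule isetE)
    define e where "e x = (if x \<in> S then c x else d x)" for x
    have "(\<Sum>x\<in>S \<union> T. e x *s x) = (\<Sum>x\<in>S. e x *s x) + (\<Sum>x\<in>T. e x *s x)" by (rule sum.union_disjoint[OF assms])
    also have "(\<Sum>x\<in>S. e x *s x) = s" unfolding c(1) by (rule sum.cong) (auto simp: e_def)
    also have "(\<Sum>x\<in>T. e x *s x) = t" unfolding d(1) using assms(3) by (intro sum.cong) (auto simp: e_def)
    finally have y: "(\<Sum>x\<in>S \<union> T. e x *s x) = y" using st(1) by simp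
    have "(\<Sum>x\<in>S \<union> T. e x *s x) \<in> iset (S \<union> T)" by (rule isetI) (use c(2) d(2) in \<open>auto simp: e_def\<close>)
    then show "y \<in> iset (S \<union> T)" unfolding y .
  qed
qed

text \<open>Analogue of \<open>quot_index_last\<close> for several vectors: \<open>f\<close> is the
  projection onto the span of \<open>T\<close> along that of \<open>S\<close>, and the second factor
  is the index of \<open>iset T\<close> in the projected lattice.\<close>

lemma quot_index_split:
  assumes fin: "finite S" "finite T" and dis: "S \<inter> T = {}" and ST: "S \<union> T \<subseteq> L"
    and f: "\<And>x y. f (x + y) = f x + f y" "\<And>s. s \<in> vec.span S \<Longrightarrow> f s = 0" "\<And>t. t \<in> vec.span T \<Longrightarrow> f t = t"
  shows "quot_index (L \<inter> vec.span (S \<union> T)) (iset (S \<union> T))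
      = quot_index (L \<inter> vec.span S) (iset S) * quot_index (f ` (L \<inter> vec.span (S \<union> T))) (iset T)"
    and "fin_index (f ` (L \<inter> vec.span (S \<union> T))) (iset T)"
proof -
  let ?M = "L \<inter> vec.span (S \<union> T)" and ?N = "iset (S \<union> T)" and ?K = "{y. f y = 0}"
  have SL: "iset S \<subseteq> vec.span S" and TL: "iset T \<subseteq> vec.span T" using iset_subset ST by blast+
  have M_ker: "?M \<inter> ?K = L \<inter> vec.span S"
  proof
    show "L \<inter> vec.span S \<subseteq> ?M \<inter> ?K" using f(2) vec.span_mono[of S "S \<union> T"] by blast
    show "?M \<inter> ?K \<subseteq> L \<inter> vec.span S"
    proof
      fix y assume y: "y \<in> ?M \<inter> ?K"
      then obtain s t where st: "y = s + t" "s \<in> vec.span S" "t \<in> vec.span T" unfolding vec.span_Un by blast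
      have "f y = t" unfolding st(1) f(1) f(2)[OF st(2)] f(3)[OF st(3)] by simp
      then have "t = 0" using y by simp
      then show "y \<in> L \<inter> vec.span S" using y st by simp
    qed
  qed
  have N_ker: "?N \<inter> ?K = iset S"
  proof
    show "iset S \<subseteq> ?N \<inter> ?K"
    proof
      fix s assume s: "s \<in> iset S"
      then have "s + 0 \<in> ?N" unfolding iset_Un[OF fin dis] using add_subgroupD(1)[OF add_subgroup_iset] by blast
      then show "s \<in> ?N \<inter> ?K" using f(2) SL s by auto
    qed
    show "?N \<inter> ?K \<subseteq> iset S"
    proof
      fix y assume y: "y \<in> ?N \<inter> ?K"
      then obtain s t where st: "y = s + t" "s \<in> iset S" "t \<in> iset T" unfolding iset_Un[OF fin dis] by blast
      have "s \<in> vec.span S" "t \<in> vec.span T" using st SL TL by blast+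
      then have "f y = t" by (simp add: st(1) f)
      then show "y \<in> iset S" using y st by simp
    qed
  qed
  have N_im: "f ` ?N = iset T"
  proof
    show "f ` ?N \<subseteq> iset T"
    proof
      fix z assume "z \<in> f ` ?N"
      then obtain s t where st: "z = f (s + t)" "s \<in> iset S" "t \<in> iset T" unfolding iset_Un[OF fin dis] by blast
      have "s \<in> vec.span S" "t \<in> vec.span T" using st SL TL by blast+
      then have "z = t" by (simp add: st(1) f)
      then show "z \<in> iset T" using st by simp
    qed
    show "iset T \<subseteq> f ` ?N"
    proof
      fix t assume t: "t \<in> iset T"
      have "0 + t \<in> ?N" unfolding iset_Un[OF fin dis] using add_subgroupD(1)[OF add_subgroup_iset] t by blast
      moreover have "f (0 + t) = t" using f(3) TL t by auto
      ultimately show "t \<in> f ` ?N" by (metis image_eqI)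
    qed
  qed
  have add: "Modules.additive f" by (rule additiveI) (rule f(1))
  have NM: "?N \<subseteq> ?M" by (rule iset_subset[OF ST])
  have fu: "finite (S \<union> T)" using fin by simp
  note ex = quot_index_exact[OF add_subgroup_iset add_subgroup_L_span NM fin_index_iset[OF fu ST] add, unfolded M_ker N_ker N_im]
  show "quot_index ?M ?N = quot_index (L \<inter> vec.span S) (iset S) * quot_index (f ` ?M) (iset T)" by (rule ex(1))
  show "fin_index (f ` ?M) (iset T)" by (rule ex(3))
qed

text \<open>Add the vectors of \<open>A\<close> one by one: each is at most as far from the span
  over \<open>T\<close> as from the one over \<open>Z\<close>.\<close>

lemma logW_Un_mono:
  assumes fin: "finite A" "finite T" and sub: "Z \<subseteq> T" and dis: "A \<inter> T = {}" and ind: "vec.independent (T \<union> A)"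
  shows "logW (T \<union> A) + logW Z \<le> logW T + logW (Z \<union> A)"
  using fin(1) dis ind
proof (induction A rule: finite_induct)
  case (insert a A)
  have finZ: "finite Z" using sub fin(2) by (rule finite_subset)
  have i1: "vec.independent (insert a (T \<union> A))" using insert.prems by simp
  have i2: "vec.independent (insert a (Z \<union> A))" by (rule vec.independent_mono[OF i1]) (use sub in auto)
  have a1: "a \<notin> T \<union> A" "a \<notin> Z \<union> A" using insert sub by auto
  have IH: "logW (T \<union> A) + logW Z \<le> logW T + logW (Z \<union> A)"
    using insert.IH insert.prems(1) independent_insertD(2)[OF i1 a1(1)] by blast
  have "ln (Dist w a (T \<union> A)) \<le> ln (Dist w a (Z \<union> A))" if w: "w \<in> arch_places" for w
    using Dist_pos[OF w independent_insertD(1)[OF i1 a1(1)]] Dist_mono[of "Z \<union> A" "T \<union> A" w a] sub by (simp add: sup.coboundedI1)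
  then have "(\<Sum>w\<in>arch_places. wt w * ln (Dist w a (T \<union> A))) \<le> (\<Sum>w\<in>arch_places. wt w * ln (Dist w a (Z \<union> A)))"
    by (intro sum_mono mult_left_mono) auto
  moreover have "logW (insert a (T \<union> A)) = logW (T \<union> A) + (\<Sum>w\<in>arch_places. wt w * ln (Dist w a (T \<union> A)))"
    by (rule logW_insert[OF _ a1(1) i1]) (use fin insert in auto)
  moreover have "logW (insert a (Z \<union> A)) = logW (Z \<union> A) + (\<Sum>w\<in>arch_places. wt w * ln (Dist w a (Z \<union> A)))"
    by (rule logW_insert[OF _ a1(2) i2]) (use finZ insert in auto)
  ultimately show ?case using IH by simp
qed simp

text \<open>Extend a basis \<open>Z\<close> of \<open>V \<inter> W\<close> to bases \<open>P\<close>
  of \<open>V\<close> and \<open>Q\<close> of \<open>W\<close>, and let \<open>A = P - Z\<close>.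
  The projection \<open>f\<close> onto the span of \<open>A\<close> kills the spans of both
  \<open>Q\<close> and \<open>Z\<close>, so it splits the contribution of \<open>A\<close> off from
  \<open>P \<union> Q\<close> and from \<open>P\<close> alike. The projected lattice for
  \<open>P\<close> lies in the one for \<open>P \<union> Q\<close>, which compares the indices; the
  distances of \<open>A\<close> shrink as \<open>Z\<close> grows to \<open>Q\<close>.\<close>

theorem arakelov_degree_supermodular:
  assumes V: "vec.subspace V" and W: "vec.subspace W"
  shows "arakelov_degree g V + arakelov_degree g W \<le> arakelov_degree g (vec.span (V \<union> W)) + arakelov_degree g (V \<inter> W)"
proof -
  have VW: "vec.subspace (V \<inter> W)" using V W by (rule vec.subspace_inter)
  have e: "{} \<subseteq> V \<inter> W" "vec.independent ({} :: ('a^'n) set)" "{} \<subseteq> L" using vec.independent_empty by auto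
  obtain Z where Z: "finite Z" "vec.independent Z" "Z \<subseteq> L" "vec.span Z = V \<inter> W"
    by (rule ex_basis_extension[OF VW e]) blast
  have ZV: "Z \<subseteq> V" "Z \<subseteq> W" using Z(4) vec.span_superset[of Z] by auto
  obtain P where P: "Z \<subseteq> P" "finite P" "vec.independent P" "P \<subseteq> L" "vec.span P = V"
    by (rule ex_basis_extension[OF V ZV(1) Z(2,3)]) blast
  obtain Q where Q: "Z \<subseteq> Q" "finite Q" "vec.independent Q" "Q \<subseteq> L" "vec.span Q = W"
    by (rule ex_basis_extension[OF W ZV(2) Z(2,3)]) blast
  have PQ: "P \<inter> Q = Z"
  proof
    show "P \<inter> Q \<subseteq> Z"
    proof
      fix x assume x: "x \<in> P \<inter> Q"
      then have "x \<in> V \<inter> W" using P(5) Q(5) vec.span_base by blast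
      then have xZ: "x \<in> vec.span Z" using Z(4) by simp
      show "x \<in> Z"
      proof (rule ccontr)
        assume "x \<notin> Z"
        then have "Z \<subseteq> P - {x}" using P(1) by blast
        then have "x \<in> vec.span (P - {x})" using xZ vec.span_mono by blast
        then show False using P(3) x unfolding vec.dependent_def by blast
      qed
    qed
  qed (use P(1) Q(1) in blast)
  have spU: "vec.span (P \<union> Q) = vec.span (V \<union> W)"
  proof
    show "vec.span (P \<union> Q) \<subseteq> vec.span (V \<union> W)"
      using P(5) Q(5) vec.span_superset by (intro vec.span_mono) blast
    show "vec.span (V \<union> W) \<subseteq> vec.span (P \<union> Q)"
    proof (rule vec.span_minimal)
      show "V \<union> W \<subseteq> vec.span (P \<union> Q)" using P(5) Q(5) vec.span_mono[of P "P \<union> Q"] vec.span_mono[of Q "P \<union> Q"] by blast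
    qed simp
  qed
  have indU: "vec.independent (P \<union> Q)"
  proof (rule vec.card_le_dim_spanning[of _ "vec.span (V \<union> W)"])
    show "P \<union> Q \<subseteq> vec.span (V \<union> W)" "vec.span (V \<union> W) \<subseteq> vec.span (P \<union> Q)"
      unfolding spU[symmetric] by (auto intro: vec.span_base)
    show "finite (P \<union> Q)" using P Q by simp
    have spW: "vec.span (V \<union> W) = {x + y | x y. x \<in> V \<and> y \<in> W}"
      unfolding vec.span_Un vec.span_eq_iff[THEN iffD2, OF V] vec.span_eq_iff[THEN iffD2, OF W] by blast
    have "vec.dim {x + y | x y. x \<in> V \<and> y \<in> W} + vec.dim (V \<inter> W) = vec.dim V + vec.dim W"
      by (rule vec.dim_sums_Int[OF V W])
    then have "vec.dim (vec.span (V \<union> W)) + card Z = card P + card Q"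
      unfolding spW[symmetric] using vec.dim_eq_card_independent[OF Z(2)] vec.dim_eq_card_independent[OF P(3)] vec.dim_eq_card_independent[OF Q(3)] Z(4) P(5) Q(5)
      by (metis vec.dim_span)
    moreover have "card (P \<union> Q) + card Z = card P + card Q" using card_Un_Int[OF P(2) Q(2)] PQ by simp
    ultimately show "card (P \<union> Q) \<le> vec.dim (vec.span (V \<union> W))" by linarith
  qed
  define A where "A = P - Z"
  have A: "P = Z \<union> A" "Z \<inter> A = {}" "Q \<inter> A = {}" "P \<union> Q = Q \<union> A" "finite A"
    using P(1,2) Q(1) PQ by (auto simp: A_def)
  have indQA: "vec.independent (Q \<union> A)" using indU A(4) by simp
  obtain f :: "'a^'n \<Rightarrow> 'a^'n" where f: "\<And>x y. f (x + y) = f x + f y"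
    "\<And>s. s \<in> vec.span Q \<Longrightarrow> f s = 0" "\<And>t. t \<in> vec.span A \<Longrightarrow> f t = t"
    by (rule ex_projection[OF indQA A(3)]) blast
  have fZ: "f s = 0" if "s \<in> vec.span Z" for s using f(2) vec.span_mono[OF Q(1)] that by blast
  have QAL: "Q \<union> A \<subseteq> L" and ZAL: "Z \<union> A \<subseteq> L" using P(4) Q(4) A Z(3) by auto
  note big = quot_index_split[OF Q(2) A(5) A(3) QAL f]
  note small = quot_index_split[OF Z(1) A(5) A(2) ZAL f(1) fZ f(3)]
  have le: "quot_index (f ` (L \<inter> vec.span (Z \<union> A))) (iset A) \<le> quot_index (f ` (L \<inter> vec.span (Q \<union> A))) (iset A)"
  proof (rule fin_index_le(2)[OF add_subgroup_iset add_subgroup_iset big(2)])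
    have "vec.span (Z \<union> A) \<subseteq> vec.span (Q \<union> A)" using Q(1) by (intro vec.span_mono) blast
    then show "f ` (L \<inter> vec.span (Z \<union> A)) \<subseteq> f ` (L \<inter> vec.span (Q \<union> A))" by (intro image_mono) blast
  qed
  define i where "i S = quot_index (L \<inter> vec.span S) (iset S)" for S
  have "i P * i Q \<le> i (P \<union> Q) * i Z"
  proof -
    have b: "i (Q \<union> A) = i Q * quot_index (f ` (L \<inter> vec.span (Q \<union> A))) (iset A)" unfolding i_def by (rule big(1))
    have s: "i (Z \<union> A) = i Z * quot_index (f ` (L \<inter> vec.span (Z \<union> A))) (iset A)" unfolding i_def by (rule small(1))
    show ?thesis unfolding A(4) unfolding A(1) b s using mult_le_mono1[OF le, of "i Z * i Q"] by (simp only: mult_ac)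
  qed
  then have "real (i P) * real (i Q) \<le> real (i (P \<union> Q)) * real (i Z)" by (metis of_nat_le_iff of_nat_mult)
  moreover have pos: "i P > 0" "i Q > 0" "i (P \<union> Q) > 0" "i Z > 0"
    unfolding i_def using P Q Z by (intro quot_index_iset_pos; simp)+
  ultimately have "ln (real (i P) * real (i Q)) \<le> ln (real (i (P \<union> Q)) * real (i Z))" by (subst ln_le_cancel_iff) auto
  then have idx: "ln (real (i P)) + ln (real (i Q)) \<le> ln (real (i (P \<union> Q))) + ln (real (i Z))"
    using pos by (simp add: ln_mult)
  have AQ: "A \<inter> Q = {}" using A(3) by blast
  have "logW (P \<union> Q) + logW Z \<le> logW Q + logW P"
    unfolding A(4) using logW_Un_mono[OF A(5) Q(2) Q(1) AQ indQA] A(1) by simp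
  then have "ldeg P + ldeg Q \<le> ldeg (P \<union> Q) + ldeg Z"
    using idx unfolding ldeg_def i_def by simp
  moreover have "finite (P \<union> Q)" "P \<union> Q \<subseteq> L" using P Q by auto
  ultimately show ?thesis
    using arakelov_degree_eq[OF P(2-5)] arakelov_degree_eq[OF Q(2-5)] arakelov_degree_eq[OF Z]
      arakelov_degree_eq[OF _ indU _ spU] by simp
qed

section \<open>Finitely many subspaces of bounded degree\<close>

text \<open>For a line through \<open>x \<in> L\<close>, the degree compares the number of
  representatives of the lattice modulo the integral multiples of \<open>x\<close> with the norms of
  \<open>x\<close>. If it is at least \<open>c\<close>, the pigeonhole theorem for the coefficients
  of these representatives gives a nonzero lattice vector on the line with all norms at most
  \<open>t\<close>. Finitely many lattice vectors are that short, and each spans one line.\<close>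

lemma finite_lines_degree_ge:
  "finite {V. (\<exists>x. x \<noteq> 0 \<and> V = vec.span {x}) \<and> c \<le> arakelov_degree g V}"
proof -
  let ?emb = "field_embeddings :: ('a \<Rightarrow> complex) set"
  obtain C where C: "C > 0" "\<And>(R :: 'a set) T. finite R \<Longrightarrow> (\<forall>r\<in>R. \<forall>s\<in>R. algebraic_int (r - s) \<longrightarrow> r = s) \<Longrightarrow>
     (\<forall>\<sigma>\<in>?emb. T \<sigma> > 0 \<and> T (cnj \<circ> \<sigma>) = T \<sigma>) \<Longrightarrow> real (card R) * (\<Prod>\<sigma>\<in>?emb. T \<sigma>) > C \<Longrightarrow>
     (\<exists>r\<in>R. \<exists>s\<in>R. \<exists>\<beta>. algebraic_int \<beta> \<and> r - s + \<beta> \<noteq> 0 \<and> (\<forall>\<sigma>\<in>?emb. norm (\<sigma> (r - s + \<beta>)) \<le> T \<sigma>))"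
    using minkowski_pigeonhole[where 'a = 'a] by (elim exE conjE) simp
  define n where "n = card ?emb"
  have n1: "n \<ge> 1" unfolding n_def using finite_embeddings field_embeddings_nonempty
    by (metis One_nat_def Suc_leI card_gt_0_iff)
  \<comment> \<open>Makes \<open>t ^ n * exp c\<close> exceed the pigeonhole constant
    \<open>C\<close>; the summand \<open>1\<close> ensures \<open>t \<le> t ^ n\<close>.\<close>
  define t where "t = 1 + C / exp c"
  have t1: "t \<ge> 1" "t > 0" using C(1) by (simp_all add: t_def add_pos_pos)
  have tn: "t ^ n * exp c > C"
  proof -
    have "C / exp c < t" by (simp add: t_def)
    also have "t \<le> t ^ n" using power_increasing[OF n1 t1(1)] by simp
    finally show ?thesis by (simp add: pos_divide_less_eq)
  qed
  have "V \<in> (\<lambda>y. vec.span {y}) ` {y\<in>L. \<forall>w\<in>arch_places. norm (av w y) \<le> t}"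
    if V: "x0 \<noteq> 0" "V = vec.span {x0}" and deg: "c \<le> arakelov_degree g V" for V x0
  proof -
    obtain k :: nat where k: "k > 0" "of_nat k *s x0 \<in> L" using ex_multiple_in_L by blast
    define x where "x = of_nat k *s x0"
    have x: "x \<in> L" "x \<noteq> 0" using k V(1) by (simp_all add: x_def)
    have span_scale: "vec.span {a *s y} = vec.span {y}" if "a \<noteq> 0" for a :: 'a and y :: "'a^'n"
    proof
      show "vec.span {a *s y} \<subseteq> vec.span {y}" by (intro vec.span_minimal) (auto intro: vec.span_scale vec.span_base)
      have "inverse a *s (a *s y) \<in> vec.span {a *s y}" by (intro vec.span_scale vec.span_base) simp
      then have "y \<in> vec.span {a *s y}" using that by (simp add: vec.scale_scale)
      then show "vec.span {y} \<subseteq> vec.span {a *s y}" by (intro vec.span_minimal) auto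
    qed
    have Vx: "V = vec.span {x}" using span_scale[of "of_nat k" x0] k V by (simp add: x_def)
    have ind: "vec.independent {x}" using x by simp
    have ld: "arakelov_degree g V = ldeg {x}" by (rule arakelov_degree_eq) (use x ind Vx in auto)
    let ?M = "L \<inter> vec.span {x}"
    have "fin_index ?M (iset {x})" by (rule fin_index_iset) (use x in auto)
    then obtain R0 where R0: "finite R0" "transversal ?M (iset {x}) R0" unfolding fin_index_def by blast
    have idx: "quot_index ?M (iset {x}) = card R0" by (rule quot_index_transversal[OF add_subgroup_iset R0(2)])
    have R0M: "R0 \<subseteq> ?M" using R0 by (simp add: transversal_def)
    define R where "R = {a. a *s x \<in> R0}"
    have injx: "inj_on (\<lambda>a. a *s x) A" for A using x by (auto simp: inj_on_def vec.scale_right_imp_eq)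
    have RR0: "(\<lambda>a. a *s x) ` R = R0"
    proof
      show "R0 \<subseteq> (\<lambda>a. a *s x) ` R"
      proof
        fix y assume y: "y \<in> R0"
        then have "y \<in> vec.span {x}" using R0M by blast
        then obtain a where "y = a *s x" unfolding vec.span_singleton by blast
        then show "y \<in> (\<lambda>a. a *s x) ` R" using y by (intro image_eqI[of _ _ a]) (simp_all add: R_def)
      qed
    qed (auto simp: R_def)
    then have cardR: "card R = card R0" using card_image[OF injx, of R] by simp
    have finR: "finite R" using RR0 R0(1) injx by (metis finite_imageD)
    have iset_x: "a *s x \<in> iset {x}" if "algebraic_int a" for a using isetI[of "{x}" "\<lambda>_. a"] that by simp
    have Rdist: "\<forall>r\<in>R. \<forall>s\<in>R. algebraic_int (r - s) \<longrightarrow> r = s"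
    proof (intro ballI impI)
      fix r s assume rs: "r \<in> R" "s \<in> R" "algebraic_int (r - s)"
      have "r *s x - s *s x \<in> iset {x}" using iset_x[OF rs(3)] by (simp add: vec.scale_left_diff_distrib)
      moreover have "r *s x \<in> R0" "s *s x \<in> R0" using rs by (simp_all add: R_def)
      ultimately have "r *s x = s *s x" using transversal_eq[OF add_subgroup_iset R0(2)] by blast
      then show "r = s" using x by (simp add: vec.scale_cancel_right)
    qed
    define N where "N \<sigma> = norm (av {\<sigma>, cnj \<circ> \<sigma>} x)" for \<sigma>
    have pl: "{\<sigma>, cnj \<circ> \<sigma>} \<in> arch_places" if "\<sigma> \<in> ?emb" for \<sigma> using that unfolding arch_places_def by blast
    have avx: "norm (av w x) > 0" if w: "w \<in> arch_places" for w
      using inj_av[OF w] x(2) av_zero[OF w] by (metis injD zero_less_norm_iff)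
    have Npos: "N \<sigma> > 0" if "\<sigma> \<in> ?emb" for \<sigma> unfolding N_def by (rule avx[OF pl[OF that]])
    have cc: "cnj \<circ> (cnj \<circ> \<sigma>) = \<sigma>" for \<sigma> :: "'a \<Rightarrow> complex" by (auto simp: fun_eq_iff)
    have Ncnj: "N (cnj \<circ> \<sigma>) = N \<sigma>" for \<sigma> unfolding N_def cc by (simp add: insert_commute)
    define T where "T \<sigma> = t / N \<sigma>" for \<sigma>
    have T: "\<forall>\<sigma>\<in>?emb. T \<sigma> > 0 \<and> T (cnj \<circ> \<sigma>) = T \<sigma>" using Npos Ncnj t1 by (simp add: T_def)
    have Dx: "Dist w x {} = norm (av w x)" for w by (simp add: Dist_def)
    have "logW {x} = (\<Sum>w\<in>arch_places. wt w * ln (norm (av w x)))"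
      using logW_insert[of "{}" x] ind by (simp add: Dx) (simp add: logW_def WS_empty)
    also have "\<dots> = (\<Sum>w\<in>arch_places. wt w * ln (N (arch_embedding w)))"
      by (intro sum.cong) (auto simp: N_def simp flip: arch_embedding_mem(3))
    also have "\<dots> = (\<Sum>\<sigma>\<in>?emb. ln (N \<sigma>))" by (rule sum_arch_places) (simp add: Ncnj)
    also have "\<dots> = ln (\<Prod>\<sigma>\<in>?emb. N \<sigma>)" using Npos by (subst ln_prod) (force simp: finite_embeddings)+
    finally have lW: "logW {x} = ln (\<Prod>\<sigma>\<in>?emb. N \<sigma>)" .
    have PN: "(\<Prod>\<sigma>\<in>?emb. N \<sigma>) > 0" using Npos by (intro prod_pos) auto
    have cR0: "card R0 > 0" using quot_index_iset_pos[of "{x}"] x idx by simp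
    have "exp c \<le> exp (ldeg {x})" using deg ld by simp
    also have "\<dots> = real (card R0) / (\<Prod>\<sigma>\<in>?emb. N \<sigma>)"
      using cR0 PN by (simp add: ldeg_def idx lW exp_diff)
    finally have "t ^ n * exp c \<le> t ^ n * (real (card R0) / (\<Prod>\<sigma>\<in>?emb. N \<sigma>))" using t1 by (intro mult_left_mono) auto
    then have "C < t ^ n * (real (card R0) / (\<Prod>\<sigma>\<in>?emb. N \<sigma>))" using tn by linarith
    also have "\<dots> = real (card R) * (\<Prod>\<sigma>\<in>?emb. T \<sigma>)" by (simp add: T_def prod_dividef n_def cardR)
    finally have big: "C < real (card R) * (\<Prod>\<sigma>\<in>?emb. T \<sigma>)" .
    obtain r s \<beta> where rs: "r \<in> R" "s \<in> R" "algebraic_int \<beta>" "r - s + \<beta> \<noteq> 0"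
      "\<And>\<sigma>. \<sigma> \<in> ?emb \<Longrightarrow> norm (\<sigma> (r - s + \<beta>)) \<le> T \<sigma>"
      using C(2)[OF finR Rdist T big] by blast
    define y where "y = (r - s + \<beta>) *s x"
    have "y = r *s x - s *s x + \<beta> *s x" by (simp add: y_def vec.scale_left_distrib vec.scale_left_diff_distrib)
    moreover have "r *s x \<in> L" "s *s x \<in> L" using rs R0M by (auto simp: R_def)
    ultimately have yL: "y \<in> L" using L_add L_diff L_scale rs(3) x(1) by metis
    have "norm (av w y) \<le> t" if w: "w \<in> arch_places" for w
    proof -
      have "norm (av w y) = norm (arch_embedding w (r - s + \<beta>)) * norm (av w x)"
        unfolding y_def av_scale[OF w]
        by (simp add: norm_vec_def L2_set_def norm_mult power_mult_distrib sum_distrib_left[symmetric] real_sqrt_mult)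
      also have "\<dots> \<le> T (arch_embedding w) * norm (av w x)"
        by (intro mult_right_mono rs(5) arch_embedding_mem(2)[OF w]) simp
      also have "\<dots> = t" using avx[OF w] unfolding T_def N_def arch_embedding_mem(3)[OF w, symmetric] by simp
      finally show ?thesis .
    qed
    then have "y \<in> {y\<in>L. \<forall>w\<in>arch_places. norm (av w y) \<le> t}" using yL by simp
    moreover have "V = vec.span {y}" unfolding Vx y_def using span_scale[OF rs(4)] by simp
    ultimately show ?thesis by blast
  qed
  then have "{V. (\<exists>x. x \<noteq> 0 \<and> V = vec.span {x}) \<and> c \<le> arakelov_degree g V}
     \<subseteq> (\<lambda>y. vec.span {y}) ` {y\<in>L. \<forall>w\<in>arch_places. norm (av w y) \<le> t}" by blast
  then show ?thesis by (rule finite_subset) (intro finite_imageI finite_bounded_av)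
qed

text \<open>A subspace \<open>V\<close> with complementary coordinate subspace \<open>F\<^sup>J\<close> is the sum of its lines
  \<open>V \<inter> F\<^sup>J\<^sup>\<union>\<^sup>{\<^sup>i\<^sup>}\<close>, whose degrees supermodularity bounds from below.\<close>

definition coord_space :: "'n set \<Rightarrow> ('a^'n) set" where
  "coord_space J = {x. \<forall>i. i \<notin> J \<longrightarrow> x $ i = 0}"

lemma subspace_coord_space: "vec.subspace (coord_space J)"
  by (auto simp: vec.subspace_def coord_space_def)

theorem finite_degree_ge: "finite {V. vec.subspace V \<and> c \<le> arakelov_degree g V}"
proof -
  define m where "m = Min (range (\<lambda>K. arakelov_degree g (coord_space K)))"
  have m: "m \<le> arakelov_degree g (coord_space K)" for K unfolding m_def by (rule Min_le) auto
  \<comment> \<open>Lower bound for the degree of a line \<open>l i\<close>, from supermodularity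
    for \<open>V\<close> and \<open>coord_space (insert i J)\<close>, which together span
    everything.\<close>
  define c' where "c' = c + m - arakelov_degree g UNIV"
  let ?lines = "{V. (\<exists>x. x \<noteq> 0 \<and> V = vec.span {x}) \<and> c' \<le> arakelov_degree g V}"
  have "V \<in> (\<lambda>M. vec.span (\<Union> M)) ` Pow ?lines" if V: "vec.subspace V" and deg: "c \<le> arakelov_degree g V" for V
  proof -
    define P where "P J \<longleftrightarrow> V \<inter> coord_space J = {0}" for J :: "'n set"
    have P0: "P {}" using V by (auto simp: P_def coord_space_def vec_eq_iff vec.subspace_0)
    have "\<forall>J. P J \<longrightarrow> card J < Suc CARD('n)" by (auto simp: less_Suc_eq_le intro: card_mono)
    \<comment> \<open>By maximality \<open>coord_space J\<close> is a complement of
      \<open>V\<close>, and every further coordinate \<open>i\<close> makes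
      \<open>coord_space (insert i J)\<close> meet \<open>V\<close> in a line.\<close>
    from ex_has_greatest_nat[OF P0 this] obtain J where J: "P J" and Jmax: "\<And>K. P K \<Longrightarrow> card K \<le> card J" by blast
    have J0: "\<And>z. z \<in> V \<Longrightarrow> z \<in> coord_space J \<Longrightarrow> z = 0" using J unfolding P_def by blast
    have ex: "\<exists>v. v \<in> V \<and> v \<in> coord_space (insert i J) \<and> v $ i = 1" if i: "i \<notin> J" for i
    proof -
      have "\<not> P (insert i J)" using Jmax[of "insert i J"] i by auto
      moreover have "0 \<in> V \<inter> coord_space (insert i J)" using V by (simp add: coord_space_def vec.subspace_0)
      ultimately obtain y where y: "y \<in> V" "y \<in> coord_space (insert i J)" "y \<noteq> 0" unfolding P_def by blast
      have "y $ i \<noteq> 0"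
      proof
        assume "y $ i = 0"
        then have "y \<in> V \<inter> coord_space J" using y by (auto simp: coord_space_def)
        then show False using J y(3) by (auto simp: P_def)
      qed
      then show ?thesis
        using y V by (intro exI[of _ "inverse (y $ i) *s y"]) (auto simp: coord_space_def vec.subspace_scale)
    qed
    then have "\<forall>i. \<exists>v. i \<notin> J \<longrightarrow> v \<in> V \<and> v \<in> coord_space (insert i J) \<and> v $ i = 1" by blast
    then obtain v where v: "\<And>i. i \<notin> J \<Longrightarrow> v i \<in> V" "\<And>i. i \<notin> J \<Longrightarrow> v i \<in> coord_space (insert i J)"
      "\<And>i. i \<notin> J \<Longrightarrow> v i $ i = 1" by metis
    have vk: "v i $ k = (if i = k then 1 else 0)" if "i \<notin> J" "k \<notin> J" for i k
      using v(2,3)[OF that(1)] that(2) by (auto simp: coord_space_def)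
    have red: "x - (\<Sum>i\<in>- J. x $ i *s v i) \<in> coord_space J" for x
      unfolding coord_space_def
    proof (intro CollectI allI impI)
      fix k assume k: "k \<notin> J"
      have "(\<Sum>i\<in>- J. x $ i *s v i) $ k = (\<Sum>i\<in>- J. if i = k then x $ i else 0)"
        unfolding sum_component by (intro sum.cong) (use k vk in auto)
      also have "\<dots> = x $ k" using k by simp
      finally show "(x - (\<Sum>i\<in>- J. x $ i *s v i)) $ k = 0" by simp
    qed
    define l where "l i = vec.span {v i}" for i
    have lV: "V \<inter> coord_space (insert i J) = l i" if i: "i \<notin> J" for i
    proof
      show "l i \<subseteq> V \<inter> coord_space (insert i J)" unfolding l_def
        by (rule vec.span_minimal) (use v[OF i] V subspace_coord_space in \<open>auto intro: vec.subspace_inter\<close>)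
      show "V \<inter> coord_space (insert i J) \<subseteq> l i"
      proof
        fix z assume z: "z \<in> V \<inter> coord_space (insert i J)"
        have "z - z $ i *s v i \<in> V" using z v(1)[OF i] by (intro vec.subspace_diff[OF V] vec.subspace_scale[OF V]) simp_all
        moreover have "z - z $ i *s v i \<in> coord_space J"
          unfolding coord_space_def
        proof (intro CollectI allI impI)
          fix k assume "k \<notin> J"
          then show "(z - z $ i *s v i) $ k = 0"
            using z v(2,3)[OF i] by (cases "k = i") (simp_all add: coord_space_def)
        qed
        ultimately have "z - z $ i *s v i = 0" by (rule J0)
        then have e: "z = z $ i *s v i" by (rule eq_iff_diff_eq_0[THEN iffD2])
        have "z $ i *s v i \<in> l i" unfolding l_def by (intro vec.span_scale vec.span_base) simp
        then show "z \<in> l i" unfolding e[symmetric] .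
      qed
    qed
    have "l i \<in> ?lines" if i: "i \<notin> J" for i
    proof -
      have UN: "vec.span (V \<union> coord_space (insert i J)) = UNIV"
      proof -
        have "x \<in> vec.span (V \<union> coord_space (insert i J))" for x
        proof -
          have "x - (\<Sum>i\<in>- J. x $ i *s v i) \<in> V \<union> coord_space (insert i J)" using red[of x] by (auto simp: coord_space_def)
          then have a: "x - (\<Sum>i\<in>- J. x $ i *s v i) \<in> vec.span (V \<union> coord_space (insert i J))" by (rule vec.span_base)
          have b: "(\<Sum>i\<in>- J. x $ i *s v i) \<in> vec.span (V \<union> coord_space (insert i J))"
            by (intro vec.span_sum vec.span_scale vec.span_base) (use v(1) in auto)
          show ?thesis using vec.span_add[OF a b] by simp
        qed
        then show ?thesis by blast
      qed
      have "arakelov_degree g V + arakelov_degree g (coord_space (insert i J)) \<le> arakelov_degree g UNIV + arakelov_degree g (l i)"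
        using arakelov_degree_supermodular[OF V subspace_coord_space[of "insert i J"]] unfolding UN lV[OF i] .
      then have "c' \<le> arakelov_degree g (l i)" using deg m[of "insert i J"] unfolding c'_def by linarith
      moreover have "v i \<noteq> 0" using v(3)[OF i] by auto
      ultimately show ?thesis unfolding l_def by blast
    qed
    then have sub: "l ` (- J) \<in> Pow ?lines" by (intro PowI image_subsetI) (simp only: Compl_iff not_False_eq_True)
    have "V = vec.span (\<Union> (l ` (- J)))"
    proof
      show "vec.span (\<Union> (l ` (- J))) \<subseteq> V" by (rule vec.span_minimal[OF _ V]) (use lV in blast)
      show "V \<subseteq> vec.span (\<Union> (l ` (- J)))"
      proof
        fix x assume x: "x \<in> V"
        have "(\<Sum>i\<in>- J. x $ i *s v i) \<in> V" by (intro vec.subspace_sum vec.subspace_scale V) (use v(1) in auto)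
        then have "x - (\<Sum>i\<in>- J. x $ i *s v i) \<in> V" using x V by (intro vec.subspace_diff)
        then have "x - (\<Sum>i\<in>- J. x $ i *s v i) = 0" by (rule J0[OF _ red])
        then have "x = (\<Sum>i\<in>- J. x $ i *s v i)" by (rule eq_iff_diff_eq_0[THEN iffD2])
        also have "\<dots> \<in> vec.span (\<Union> (l ` (- J)))"
          by (intro vec.span_sum vec.span_scale vec.span_base) (auto simp: l_def intro: vec.span_base)
        finally show "x \<in> vec.span (\<Union> (l ` (- J)))" .
      qed
    qed
    then show ?thesis using sub by (rule image_eqI)
  qed
  then have "{V. vec.subspace V \<and> c \<le> arakelov_degree g V} \<subseteq> (\<lambda>M. vec.span (\<Union> M)) ` Pow ?lines" by blast
  then show ?thesis by (rule finite_subset) (intro finite_imageI, simp add: finite_lines_degree_ge)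
qed

end

section \<open>Equivariance\<close>

text \<open>\<open>\<delta>\<close> carries the lattice of \<open>g\<close> to that of the translate
  and preserves archimedean vectors, because the factor \<open>\<delta>\<close> in the matrix
  cancels the one in the vector. A basis is thus carried to a basis with the same index and the same
  wedge norms.\<close>

theorem arakelov_degree_translate:
  fixes g :: "'a::number_field adele^'n^'n" and \<delta> :: "'a^'n^'n"
  assumes g: "invertible g" and \<delta>: "\<delta> ** \<epsilon> = Finite_Cartesian_Product.mat 1" "\<epsilon> ** \<delta> = Finite_Cartesian_Product.mat 1"
    and V: "vec.subspace V"
  shows "arakelov_degree (adelic_matrix \<delta> ** g) ((*v) \<delta> ` V) = arakelov_degree g V"
    and "invertible (adelic_matrix \<delta> ** g)"
proof -
  interpret A: adelic_lattice g by unfold_locales (rule g)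
  define g' where "g' = adelic_matrix \<delta> ** g"
  define h' where "h' = A.h ** adelic_matrix \<epsilon>"
  have \<delta>\<epsilon>: "adelic_matrix \<delta> ** adelic_matrix \<epsilon> = Finite_Cartesian_Product.mat 1"
    "adelic_matrix \<epsilon> ** adelic_matrix \<delta> = Finite_Cartesian_Product.mat 1"
    by (simp_all add: adelic_matrix_mult \<delta> adelic_matrix_one)
  have gh': "g' ** h' = Finite_Cartesian_Product.mat 1" "h' ** g' = Finite_Cartesian_Product.mat 1"
  proof -
    have "g' ** h' = adelic_matrix \<delta> ** (g ** A.h) ** adelic_matrix \<epsilon>" by (simp add: g'_def h'_def matrix_mul_assoc)
    then show "g' ** h' = Finite_Cartesian_Product.mat 1" by (simp add: A.gh \<delta>\<epsilon>)
    have "h' ** g' = A.h ** (adelic_matrix \<epsilon> ** adelic_matrix \<delta>) ** g" by (simp add: g'_def h'_def matrix_mul_assoc)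
    then show "h' ** g' = Finite_Cartesian_Product.mat 1" by (simp add: A.gh \<delta>\<epsilon>)
  qed
  then show inv: "invertible (adelic_matrix \<delta> ** g)" unfolding invertible_def g'_def by blast
  interpret B: adelic_lattice g' by unfold_locales (use inv in \<open>simp add: g'_def\<close>)
  have \<delta>x: "\<delta> *v (\<epsilon> *v x) = x" "\<epsilon> *v (\<delta> *v x) = x" for x by (simp_all add: matrix_vector_mul_assoc \<delta>)
  have inj: "inj ((*v) \<delta>)" by (rule injI) (metis \<delta>x(2))
  have mem: "x \<in> lattice_of g' \<longleftrightarrow> \<epsilon> *v x \<in> lattice_of g" for x
  proof -
    have "h' *v diag_vec x = A.h *v diag_vec (\<epsilon> *v x)"
      by (simp add: h'_def adelic_matrix_mult_vec flip: matrix_vector_mul_assoc)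
    then show ?thesis using lattice_of_iff[OF gh', of x] A.mem_L[of "\<epsilon> *v x"] by simp
  qed
  have L': "lattice_of g' = (*v) \<delta> ` lattice_of g"
  proof
    show "lattice_of g' \<subseteq> (*v) \<delta> ` lattice_of g" using mem \<delta>x(1) by (metis image_eqI subsetI)
    show "(*v) \<delta> ` lattice_of g \<subseteq> lattice_of g'" using mem \<delta>x(2) by auto
  qed
  have av': "arch_vector g' w (\<delta> *v x) = arch_vector g w x" if w: "w \<in> arch_places" for w x
  proof -
    note eh = embedding_hom[OF arch_embedding_mem(2)[OF w]]
    have G': "B.G w *v z = (\<chi> i j. arch_embedding w (\<delta> $ i $ j)) *v (A.G w *v z)" for z
    proof -
      have "B.G w = (\<chi> i j. arch_embedding w (\<delta> $ i $ j)) ** A.G w"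
        unfolding B.G_def A.G_def by (simp add: vec_eq_iff g'_def matrix_matrix_mult_def arch_comp_sum[OF w]
            arch_comp_simps[OF w] adelic_matrix_def arch_comp_diag[OF w])
      then show ?thesis by (simp add: matrix_vector_mul_assoc)
    qed
    have "B.G w *v arch_vector g w x = (\<chi> i j. arch_embedding w (\<delta> $ i $ j)) *v A.emb_vec w x"
      unfolding G' A.G_av[OF w] ..
    also have "\<dots> = B.emb_vec w (\<delta> *v x)"
      by (simp add: vec_eq_iff A.emb_vec_def B.emb_vec_def matrix_vector_mult_def eh)
    also have "\<dots> = B.G w *v arch_vector g' w (\<delta> *v x)" by (rule B.G_av[OF w, symmetric])
    finally have "B.H w *v (B.G w *v arch_vector g w x) = B.H w *v (B.G w *v arch_vector g' w (\<delta> *v x))" by simp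
    then show ?thesis by (simp add: matrix_vector_mul_assoc B.GH[OF w])
  qed
  have e: "{} \<subseteq> V" "vec.independent ({} :: ('a^'n) set)" "{} \<subseteq> A.L" using vec.independent_empty by auto
  obtain S where S: "finite S" "vec.independent S" "S \<subseteq> A.L" "vec.span S = V"
    by (rule A.ex_basis_extension[OF V e]) blast
  note lin = matrix_vector_mul_linear_gen[of \<delta>]
  have S': "finite ((*v) \<delta> ` S)" "vec.independent ((*v) \<delta> ` S)" "(*v) \<delta> ` S \<subseteq> B.L" "vec.span ((*v) \<delta> ` S) = (*v) \<delta> ` V"
    using S vec.linear_independent_injective_image[OF lin S(2) inj_on_subset[OF inj subset_UNIV]] vec.linear_span_image[OF lin, of S] by (auto simp: L')
  obtain xs where xs: "distinct xs" "set xs = S" using finite_distinct_list[OF S(1)] by blast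
  define ys where "ys = map ((*v) \<delta>) xs"
  have ys: "distinct ys" "set ys = (*v) \<delta> ` S"
    using xs inj by (auto simp: ys_def distinct_map intro: inj_on_subset)
  have add: "Modules.additive ((*v) \<delta>)" by unfold_locales (rule matrix_vector_right_distrib)
  have "integral_span ys = (*v) \<delta> ` integral_span xs"
  proof -
    have "(\<Sum>i<length ys. c i *s ys ! i) = \<delta> *v (\<Sum>i<length xs. c i *s xs ! i)" for c
      by (simp add: ys_def vec.linear_sum[OF lin] vec.linear_scale[OF lin])
    then show ?thesis unfolding integral_span_def by (auto simp: ys_def image_iff)
  qed
  moreover have "lattice_of g' \<inter> (*v) \<delta> ` V = (*v) \<delta> ` (lattice_of g \<inter> V)"
    unfolding L' by (rule image_Int[OF inj, symmetric])
  ultimately have "lattice_index g' ((*v) \<delta> ` V) ys = quot_index ((*v) \<delta> ` (lattice_of g \<inter> V)) ((*v) \<delta> ` integral_span xs)"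
    unfolding lattice_index_def quot_index_def by simp
  also have "\<dots> = quot_index (lattice_of g \<inter> V) (integral_span xs)"
    by (rule quot_index_inj_image(1)[OF _ add inj]) (simp add: A.integral_span_iset[OF xs(1)] A.add_subgroup_iset)
  also have "\<dots> = lattice_index g V xs" unfolding lattice_index_def quot_index_def ..
  finally have idx: "lattice_index g' ((*v) \<delta> ` V) ys = lattice_index g V xs" .
  have W: "wedge_norm g' w ys = wedge_norm g w xs" if w: "w \<in> arch_places" for w
    unfolding B.wedge_norm_gram A.wedge_norm_gram by (simp add: ys_def av'[OF w] o_def cong: map_cong)
  have "arakelov_degree g' ((*v) \<delta> ` V) = B.ldeg (set ys)"
    using B.arakelov_degree_eq[OF S'] ys(2) by simp
  also have "\<dots> = ln (real (lattice_index g' ((*v) \<delta> ` V) ys)) - (\<Sum>w\<in>arch_places. real (dim (arch_completion w)) * ln (wedge_norm g' w ys))"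
    by (rule B.formula_ldeg[OF ys(1), symmetric]) (simp add: ys(2) S'(4))
  also have "\<dots> = ln (real (lattice_index g V xs)) - (\<Sum>w\<in>arch_places. real (dim (arch_completion w)) * ln (wedge_norm g w xs))"
    using W by (simp add: idx)
  also have "\<dots> = A.ldeg (set xs)" by (rule A.formula_ldeg[OF xs(1)]) (simp add: xs(2) S(4))
  also have "\<dots> = arakelov_degree g V" using A.arakelov_degree_eq[OF S] xs(2) by simp
  finally show "arakelov_degree (adelic_matrix \<delta> ** g) ((*v) \<delta> ` V) = arakelov_degree g V" by (simp add: g'_def)
qed

section \<open>Flags and parabolic subgroups\<close>

lemma zero_psubset_UNIV: "{0} \<subset> (UNIV :: ('a::field^'n) set)"
proof -
  have "axis undefined 1 \<noteq> (0 :: 'a^'n)" by (simp add: axis_eq_0_iff)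
  then show ?thesis by blast
qed

lemma sorted_wrt_psubset_set_unique:
  assumes "sorted_wrt (\<subset>) xs" "sorted_wrt (\<subset>) ys" "set xs = set (ys :: 'b set list)"
  shows "xs = ys"
  using assms
proof (induction xs arbitrary: ys)
  case Nil
  then show ?case by simp
next
  case (Cons x xs)
  then obtain y zs where ys: "ys = y # zs" by (cases ys) auto
  have "x = y \<or> y \<subset> x" using Cons.prems(2,3) ys by auto
  moreover have "y = x \<or> x \<subset> y" using Cons.prems(1,3) ys by auto
  ultimately have xy: "x = y" by blast
  have "x \<notin> set xs" "y \<notin> set zs" using Cons.prems(1,2) ys by auto
  then have "set xs = set zs" using Cons.prems(3) ys xy by (simp add: insert_ident)
  then show ?case using Cons.IH[of zs] Cons.prems(1,2) ys xy by simp
qed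

lemma invertible_image_subspace:
  fixes A :: "'a::field^'n^'n"
  assumes A: "invertible A" and V: "vec.subspace V"
  shows "vec.subspace ((*v) A ` V)" "vec.dim ((*v) A ` V) = vec.dim V" "inj ((*v) A)" "surj ((*v) A)"
proof -
  show inj: "inj ((*v) A)" using A by (simp add: invertible_left_inverse matrix_left_invertible_injective)
  show "surj ((*v) A)" using A by (simp add: invertible_right_inverse matrix_right_invertible_surjective)
  show "vec.subspace ((*v) A ` V)" by (rule vec.linear_subspace_image[OF matrix_vector_mul_linear_gen V])
  show "vec.dim ((*v) A ` V) = vec.dim V"
    by (rule vec.dim_image_eq[OF matrix_vector_mul_linear_gen]) (rule inj_on_subset[OF inj subset_UNIV])
qed

lemma subspace_dim_psubset:
  fixes V W :: "('a::field^'n) set"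
  assumes "vec.subspace V" "vec.subspace W" "V \<subset> W"
  shows "vec.dim V < vec.dim W"
  using assms vec.subspace_dim_equal[of V W] vec.dim_subset[of V W] by (metis le_neq_implies_less not_le order.strict_implies_order psubset_eq)

lemma invertible_image_eq:
  fixes A :: "'a::field^'n^'n"
  assumes A: "invertible A" and V: "vec.subspace V" and sub: "(*v) A ` V \<subseteq> V"
  shows "(*v) A ` V = V"
  using vec.subspace_dim_equal[OF invertible_image_subspace(1)[OF A V] V sub] invertible_image_subspace(2)[OF A V] by simp

text \<open>Transvections \<open>1 + \<phi> \<otimes> u\<close>, where \<open>\<phi>\<close> kills the largest step of the flag not containing \<open>V\<close>, stabilize
  the flag and move \<open>V\<close> unless \<open>V\<close> contains the next step.\<close>

lemma flag_stabilizer_stable_subspace: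
  fixes Vs :: "('a::field_char_0^'n) set list"
  assumes flag: "is_flag Vs" and V: "vec.subspace V"
    and stable: "\<And>A. A \<in> flag_stabilizer Vs \<Longrightarrow> (*v) A ` V \<subseteq> V"
  shows "V \<in> set Vs"
proof -
  have ne: "Vs \<noteq> []" and hd: "Vs ! 0 = {0}" and last: "Vs ! (length Vs - 1) = UNIV"
    and sorted: "sorted_wrt (\<subset>) Vs" and sub: "\<And>W. W \<in> set Vs \<Longrightarrow> vec.subspace W"
    using flag unfolding is_flag_def by (auto simp: hd_conv_nth last_conv_nth)
  define i where "i = (LEAST i. V \<subseteq> Vs ! i)"
  have i: "V \<subseteq> Vs ! i" unfolding i_def by (rule LeastI[of _ "length Vs - 1"]) (simp only: last subset_UNIV)
  have il: "i \<le> length Vs - 1" unfolding i_def by (rule Least_le) (simp only: last subset_UNIV)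
  have imin: "\<not> V \<subseteq> Vs ! j" if "j < i" for j using not_less_Least[of j "\<lambda>i. V \<subseteq> Vs ! i"] that unfolding i_def by simp
  have imem: "Vs ! i \<in> set Vs" using il ne by (intro nth_mem) (cases Vs, auto)
  have "Vs ! i \<subseteq> V"
  proof (cases i)
    case 0
    then show ?thesis using hd vec.subspace_0[OF V] by simp
  next
    case (Suc k)
    have kl: "k < length Vs" using Suc il by linarith
    obtain w where w: "w \<in> V" "w \<notin> Vs ! k" using imin[of k] Suc by blast
    obtain \<phi> where \<phi>: "\<And>x y. \<phi> (x + y) = \<phi> x + \<phi> y" "\<And>c x. \<phi> (c *s x) = c * \<phi> x"
      "\<And>u. u \<in> Vs ! k \<Longrightarrow> \<phi> u = 0" "\<phi> w = 1"
      by (rule ex_linear_form[OF sub[OF nth_mem[OF kl]] w(2)]) blast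
    have main: "u \<in> V" if u: "u \<in> Vs ! i" and u1: "1 + \<phi> u \<noteq> 0" for u
    proof -
      define f where "f x = x + \<phi> x *s u" for x
      \<comment> \<open>A right inverse of \<open>f\<close>; this is where
        \<open>1 + \<phi> u \<noteq> 0\<close> enters.\<close>
      define h where "h x = x - (\<phi> x / (1 + \<phi> u)) *s u" for x
      have lin: "Vector_Spaces.linear (*s) (*s) f"
        by unfold_locales (simp_all add: f_def \<phi> vec.scale_left_distrib vec.scale_right_distrib vec.scale_scale)
      define A where "A = matrix f"
      have A: "A *v x = f x" for x unfolding A_def by (rule matrix_works[OF lin])
      have fh: "f (h x) = x" for x
      proof -
        have "\<phi> (h x) = \<phi> x / (1 + \<phi> u)"
        proof -
          have "h x = x + (- (\<phi> x / (1 + \<phi> u))) *s u" by (simp add: h_def vec.scale_minus_left)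
          then have "\<phi> (h x) = \<phi> x + (- (\<phi> x / (1 + \<phi> u))) * \<phi> u" by (simp only: \<phi>)
          also have "\<dots> = \<phi> x / (1 + \<phi> u)" using u1 by (simp add: field_simps)
          finally show ?thesis .
        qed
        then show ?thesis by (simp add: f_def) (simp add: h_def)
      qed
      have "surj ((*v) A)" unfolding surj_def A using fh by metis
      then have inv: "invertible A" by (simp add: invertible_right_inverse matrix_right_invertible_surjective)
      have "(*v) A ` W = W" if W: "W \<in> set Vs" for W
      proof (rule invertible_image_eq[OF inv sub[OF W]])
        obtain j where j: "j < length Vs" "W = Vs ! j" using W by (auto simp: in_set_conv_nth)
        show "(*v) A ` W \<subseteq> W"
        proof (rule image_subsetI)
          fix x assume x: "x \<in> W"
          show "A *v x \<in> W"
          proof (cases "j \<le> k")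
            case True
            have "W \<subseteq> Vs ! k" using sorted_wrt_nth_less[OF sorted, of j k] kl True j by (cases "j = k") auto
            then have "\<phi> x = 0" using x \<phi>(3) by blast
            then show ?thesis using x by (simp add: A f_def)
          next
            case False
            have "Vs ! i \<subseteq> W" using sorted_wrt_nth_less[OF sorted, of i j] j False Suc by (cases "i = j") auto
            then show ?thesis unfolding A f_def
              using x u by (intro vec.subspace_add vec.subspace_scale sub[OF W]) auto
          qed
        qed
      qed
      then have "A \<in> flag_stabilizer Vs" using inv by (simp add: flag_stabilizer_def)
      then have "A *v w \<in> V" using stable w(1) by blast
      then have "w + u \<in> V" by (simp add: A f_def \<phi>(4))
      then show "u \<in> V" using vec.subspace_diff[OF V _ w(1)] by fastforce
    qed
    show ?thesis
    proof
      fix u assume u: "u \<in> Vs ! i"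
      show "u \<in> V"
      proof (cases "1 + \<phi> u = 0")
        \<comment> \<open>The transvection along \<open>u\<close> itself is singular here; along
          half of \<open>u\<close> the critical factor is \<open>1 - 1/2\<close>.\<close>
        case True
        have "\<phi> u = - 1" using True by (simp add: eq_neg_iff_add_eq_0 add.commute)
        then have "\<phi> ((1/2) *s u) = - (1/2)" unfolding \<phi>(2) by simp
        then have "1 + \<phi> ((1/2) *s u) \<noteq> 0" by simp
        moreover have "(1/2) *s u \<in> Vs ! i" by (rule vec.subspace_scale[OF sub[OF imem] u])
        ultimately have "2 *s ((1/2) *s u) \<in> V" by (intro vec.subspace_scale[OF V] main)
        then show ?thesis by simp
      qed (rule main[OF u])
    qed
  qed
  then show ?thesis using i imem by (metis subset_antisym)
qed

text \<open>The steps of a flag are exactly the subspaces stable under its stabilizer, so equal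
  stabilizers come from equal flags. This gives the description in \<open>flag_of\<close> its
  meaning.\<close>

lemma flag_of_stabilizer:
  fixes Vs :: "('a::field_char_0^'n) set list"
  assumes flag: "is_flag Vs"
  shows "flag_of (flag_stabilizer Vs) = Vs"
  unfolding flag_of_def
proof (rule the_equality)
  show "is_flag Vs \<and> flag_stabilizer Vs = flag_stabilizer Vs" using flag by simp
  fix Ws :: "('a^'n) set list"
  assume Ws: "is_flag Ws \<and> flag_stabilizer Vs = flag_stabilizer Ws"
  have "W \<in> set Vs" if W: "W \<in> set Ws" for W
  proof (rule flag_stabilizer_stable_subspace[OF flag])
    show "vec.subspace W" using Ws W by (auto simp: is_flag_def)
    fix A assume "A \<in> flag_stabilizer Vs"
    then have "A \<in> flag_stabilizer Ws" using Ws by simp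
    then show "(*v) A ` W \<subseteq> W" using W by (auto simp: flag_stabilizer_def)
  qed
  moreover have "V \<in> set Ws" if V: "V \<in> set Vs" for V
  proof (rule flag_stabilizer_stable_subspace)
    show "is_flag Ws" using Ws by simp
    show "vec.subspace V" using flag V by (auto simp: is_flag_def)
    fix A assume "A \<in> flag_stabilizer Ws"
    then have "A \<in> flag_stabilizer Vs" using Ws by simp
    then show "(*v) A ` V \<subseteq> V" using V by (auto simp: flag_stabilizer_def)
  qed
  ultimately have "set Ws = set Vs" by blast
  then show "Ws = Vs" using Ws flag by (intro sorted_wrt_psubset_set_unique) (auto simp: is_flag_def)
qed

lemma is_flag_dim_nth:
  fixes Vs :: "('a::field^'n) set list"
  assumes flag: "is_flag Vs"
  shows "2 \<le> length Vs" "Vs ! 0 = {0}" "Vs ! (length Vs - 1) = UNIV"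
    "\<And>i j. i < j \<Longrightarrow> j < length Vs \<Longrightarrow> Vs ! i \<subset> Vs ! j"
    "\<And>i j. i < j \<Longrightarrow> j < length Vs \<Longrightarrow> vec.dim (Vs ! i) < vec.dim (Vs ! j)"
    "distinct Vs"
proof -
  have ne: "Vs \<noteq> []" and sorted: "sorted_wrt (\<subset>) Vs" and sub: "\<And>W. W \<in> set Vs \<Longrightarrow> vec.subspace W"
    using flag unfolding is_flag_def by auto
  show hd: "Vs ! 0 = {0}" and last: "Vs ! (length Vs - 1) = UNIV"
    using flag unfolding is_flag_def by (auto simp: hd_conv_nth last_conv_nth)
  have "{0} \<noteq> (UNIV :: ('a^'n) set)" using zero_psubset_UNIV by blast
  then show "2 \<le> length Vs" using hd last ne by (cases Vs; cases "tl Vs") auto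
  show lt: "Vs ! i \<subset> Vs ! j" if "i < j" "j < length Vs" for i j by (rule sorted_wrt_nth_less[OF sorted that])
  show "vec.dim (Vs ! i) < vec.dim (Vs ! j)" if "i < j" "j < length Vs" for i j
    using subspace_dim_psubset[OF sub sub lt[OF that]] that by simp
  show "distinct Vs" unfolding distinct_conv_nth using lt by (metis nat_neq_iff psubset_eq)
qed

section \<open>Flags and chains of proper subspaces\<close>

definition inner_steps :: "('a::field^'n) set list \<Rightarrow> ('a^'n) set set" where
  "inner_steps Vs = set Vs - {{0}, UNIV}"

lemma inner_steps_nth:
  fixes Vs :: "('a::field^'n) set list"
  assumes flag: "is_flag Vs"
  shows "inner_steps Vs = (!) Vs ` {1..<length Vs - 1}" "card (inner_steps Vs) = length Vs - 2"
proof -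
  note f = is_flag_dim_nth[OF flag]
  have nl: "length Vs - 1 < length Vs" "0 < length Vs" using f(1) by auto
  have neq: "Vs ! i \<noteq> {0} \<and> Vs ! i \<noteq> UNIV \<longleftrightarrow> i \<noteq> 0 \<and> i \<noteq> length Vs - 1" if "i < length Vs" for i
    using nth_eq_iff_index_eq[OF f(6) that nl(1)] nth_eq_iff_index_eq[OF f(6) that nl(2)] f(2,3) by simp
  show eq: "inner_steps Vs = (!) Vs ` {1..<length Vs - 1}"
  proof (rule Set.set_eqI)
    fix V
    have "V \<in> inner_steps Vs \<longleftrightarrow> (\<exists>i<length Vs. V = Vs ! i \<and> Vs ! i \<noteq> {0} \<and> Vs ! i \<noteq> UNIV)"
      unfolding inner_steps_def by (auto simp: in_set_conv_nth)
    also have "\<dots> \<longleftrightarrow> (\<exists>i<length Vs. V = Vs ! i \<and> i \<noteq> 0 \<and> i \<noteq> length Vs - 1)" by (simp only: neq cong: conj_cong)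
    also have "\<dots> \<longleftrightarrow> V \<in> (!) Vs ` {1..<length Vs - 1}" 
    proof
      assume "\<exists>i<length Vs. V = Vs ! i \<and> i \<noteq> 0 \<and> i \<noteq> length Vs - 1"
      then obtain i where "i < length Vs" "V = Vs ! i" "i \<noteq> 0" "i \<noteq> length Vs - 1" by blast
      then show "V \<in> (!) Vs ` {1..<length Vs - 1}" by (intro image_eqI[of _ _ i]) auto
    next
      assume "V \<in> (!) Vs ` {1..<length Vs - 1}"
      then obtain i where "i \<in> {1..<length Vs - 1}" "V = Vs ! i" by blast
      then show "\<exists>i<length Vs. V = Vs ! i \<and> i \<noteq> 0 \<and> i \<noteq> length Vs - 1" by (intro exI[of _ i]) auto
    qed
    finally show "V \<in> inner_steps Vs \<longleftrightarrow> V \<in> (!) Vs ` {1..<length Vs - 1}" .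
  qed
  have "inj_on ((!) Vs) {1..<length Vs - 1}" by (rule inj_on_nth[OF f(6)]) auto
  then show "card (inner_steps Vs) = length Vs - 2" unfolding eq by (subst card_image) auto
qed

text \<open>Within \<open>proper_subspaces\<close> these correspond to flags through
  \<open>inner_steps\<close>; the empty chain is the trivial flag, whose stabilizer is the whole
  group.\<close>

definition subspace_chains :: "('a::field^'n) set set \<Rightarrow> ('a^'n) set set set" where
  "subspace_chains S = {C. C \<subseteq> S \<and> finite C \<and> (\<forall>V\<in>C. \<forall>W\<in>C. V \<subseteq> W \<or> W \<subseteq> V)}"

definition proper_subspaces :: "('a::field^'n) set set" where
  "proper_subspaces = {V. vec.subspace V \<and> V \<noteq> {0} \<and> V \<noteq> UNIV}"

lemma finite_chain_sorted_list:
  assumes "finite C" "\<forall>V\<in>C. \<forall>W\<in>C. V \<subseteq> W \<or> W \<subseteq> (V :: 'b set)"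
  shows "\<exists>xs. set xs = C \<and> sorted_wrt (\<subset>) xs"
  using assms
proof (induction "card C" arbitrary: C)
  case 0
  then show ?case by (intro exI[of _ "[]"]) simp
next
  case (Suc n)
  then have "C \<noteq> {}" by auto
  then obtain M where M: "M \<in> C" "\<forall>V\<in>C. M \<subseteq> V \<longrightarrow> M = V" using finite_has_maximal[OF Suc.prems(1)] by blast
  have lt: "V \<subset> M" if V: "V \<in> C - {M}" for V
  proof -
    have "V \<subseteq> M \<or> M \<subseteq> V" by (rule Suc.prems(2)[rule_format]) (use V M in auto)
    then show ?thesis using M(2) V by auto
  qed
  have "n = card (C - {M})" using Suc M by simp
  then obtain xs where xs: "set xs = C - {M}" "sorted_wrt (\<subset>) xs" using Suc.hyps(1)[of "C - {M}"] Suc.prems by auto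
  then have "set (xs @ [M]) = C \<and> sorted_wrt (\<subset>) (xs @ [M])" using M lt by (auto simp: sorted_wrt_append)
  then show ?case by blast
qed

lemma chain_flag:
  fixes C :: "('a::field^'n) set set"
  assumes C: "C \<in> subspace_chains proper_subspaces"
  obtains Vs where "is_flag Vs" "inner_steps Vs = C"
proof -
  have C': "finite C" "\<forall>V\<in>C. \<forall>W\<in>C. V \<subseteq> W \<or> W \<subseteq> V" "\<And>V. V \<in> C \<Longrightarrow> vec.subspace V \<and> V \<noteq> {0} \<and> V \<noteq> UNIV"
    using C by (auto simp: subspace_chains_def proper_subspaces_def)
  obtain xs where xs: "set xs = C" "sorted_wrt (\<subset>) xs" using finite_chain_sorted_list[OF C'(1,2)] by blast
  have lo: "{0} \<subset> V" if "V \<in> C" for V using C'(3)[OF that] vec.subspace_0[of V] by blast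
  have "is_flag ({0} # xs @ [UNIV])"
    unfolding is_flag_def using xs C'(3) lo zero_psubset_UNIV by (auto simp: sorted_wrt_append vec.subspace_single_0)
  moreover have "inner_steps ({0} # xs @ [UNIV]) = C" unfolding inner_steps_def using xs C'(3) by auto
  ultimately show ?thesis by (rule that)
qed

lemma inner_steps_chain:
  fixes Vs :: "('a::field^'n) set list"
  assumes flag: "is_flag Vs"
  shows "inner_steps Vs \<in> subspace_chains proper_subspaces"
proof -
  have sorted: "sorted_wrt (\<subset>) Vs" using flag by (simp add: is_flag_def)
  have "V \<subseteq> W \<or> W \<subseteq> V" if VW: "V \<in> set Vs" "W \<in> set Vs" for V W
  proof -
    obtain i j where ij: "i < length Vs" "j < length Vs" "V = Vs ! i" "W = Vs ! j" using VW by (auto simp: in_set_conv_nth)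
    consider "i < j" | "i = j" | "j < i" by linarith
    then show ?thesis using is_flag_dim_nth(4)[OF flag, of i j] is_flag_dim_nth(4)[OF flag, of j i] ij
      by cases auto
  qed
  then show ?thesis using flag by (auto simp: subspace_chains_def proper_subspaces_def inner_steps_def is_flag_def)
qed

lemma flag_eqI:
  fixes Vs :: "('a::field^'n) set list"
  assumes "is_flag Vs" "is_flag Ws" "inner_steps Vs = inner_steps Ws"
  shows "Vs = Ws"
proof (rule sorted_wrt_psubset_set_unique)
  have "set Vs = inner_steps Vs \<union> {{0}, UNIV}" if "is_flag Vs" for Vs :: "('a^'n) set list"
  proof -
    have "Vs \<noteq> []" "hd Vs = {0}" "last Vs = UNIV" using that by (auto simp: is_flag_def)
    then have "{0} \<in> set Vs" "UNIV \<in> set Vs" using hd_in_set[of Vs] last_in_set[of Vs] by auto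
    then show ?thesis by (auto simp: inner_steps_def)
  qed
  then show "set Vs = set Ws" using assms by simp
qed (use assms in \<open>auto simp: is_flag_def\<close>)

subsection \<open>Standard flags and transitivity\<close>

definition std_index :: "'n::{finite,linorder} \<Rightarrow> nat" where
  "std_index i = card {j. j < i}"

lemma std_index_less: "i < j \<Longrightarrow> std_index i < std_index j"
  unfolding std_index_def by (rule psubset_card_mono) auto

lemma std_index_bound: "std_index (i :: 'n::{finite,linorder}) < CARD('n)"
  unfolding std_index_def by (rule psubset_card_mono) auto

lemma inj_std_index: "inj std_index"
  by (metis injI less_irrefl linorder_neqE std_index_less)

lemma range_std_index: "range (std_index :: 'n::{finite,linorder} \<Rightarrow> nat) = {..<CARD('n)}"
  by (rule card_subset_eq) (use std_index_bound in \<open>auto simp: card_image[OF inj_std_index]\<close>)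

text \<open>The span of the first \<open>m\<close> standard basis vectors in the order of the index
  type, a step of the full standard flag when \<open>m\<close> is at most the rank.\<close>

definition std_space :: "nat \<Rightarrow> ('a::field^'n::{finite,linorder}) set" where
  "std_space m = {x. \<forall>i. m \<le> std_index i \<longrightarrow> x $ i = 0}"

lemma subspace_std_space: "vec.subspace (std_space m)"
  by (auto simp: vec.subspace_def std_space_def)

lemma std_space_mono: "m \<le> m' \<Longrightarrow> std_space m \<subseteq> std_space m'"
  by (auto simp: std_space_def)

lemma std_space_0: "std_space 0 = {0}"
  by (auto simp: std_space_def vec_eq_iff)

lemma std_space_UNIV: "std_space CARD('n::{finite,linorder}) = (UNIV :: ('a::field^'n::{finite,linorder}) set)"
  using std_index_bound by (fastforce simp: std_space_def not_le[symmetric])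

text \<open>\<open>E\<close> has the vectors of \<open>bs\<close> as columns, in the order of the
  index type.\<close>

lemma ex_frame:
  fixes bs :: "('a::field^'n::{finite,linorder}) list"
  assumes bs: "distinct bs" "vec.independent (set bs)" "length bs = CARD('n)"
  shows "\<exists>E :: 'a^'n::{finite,linorder}^'n::{finite,linorder}. invertible E \<and> (\<forall>m\<le>CARD('n). (*v) E ` std_space m = vec.span (set (take m bs)))"
proof -
  define E :: "(('a, 'n) Finite_Cartesian_Product.vec, 'n) Finite_Cartesian_Product.vec" where "E = (\<chi> i j. bs ! std_index j $ i)"
  have E: "E *v x = (\<Sum>j\<in>UNIV. x $ j *s bs ! std_index j)" for x
    by (simp add: vec_eq_iff E_def matrix_vector_mult_def mult.commute)
  have im: "(*v) E ` std_space m = vec.span (set (take m bs))" if m: "m \<le> CARD('n)" for m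
  proof
    have sub: "vec.subspace ((*v) E ` std_space m)" by (rule vec.linear_subspace_image[OF matrix_vector_mul_linear_gen subspace_std_space])
    show "(*v) E ` std_space m \<subseteq> vec.span (set (take m bs))"
    proof (rule image_subsetI)
      fix x :: "('a, 'n) Finite_Cartesian_Product.vec" assume x: "x \<in> std_space m"
      have "x $ j *s bs ! std_index j \<in> vec.span (set (take m bs))" for j
      proof (cases "std_index j < m")
        case True
        then have "bs ! std_index j \<in> set (take m bs)" using m bs(3) by (auto simp: in_set_conv_nth intro!: exI[of _ "std_index j"])
        then show ?thesis by (intro vec.span_scale vec.span_base)
      next
        case False
        then show ?thesis using x by (simp add: std_space_def vec.span_zero)
      qed
      then show "E *v x \<in> vec.span (set (take m bs))" unfolding E by (intro vec.span_sum)
    qed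
    show "vec.span (set (take m bs)) \<subseteq> (*v) E ` std_space m"
    proof (rule vec.span_minimal[OF _ sub], rule subsetI)
      fix b assume "b \<in> set (take m bs)"
      then obtain k where k: "k < m" "k < length bs" "b = bs ! k" by (auto simp: in_set_conv_nth)
      have "k \<in> range (std_index :: 'n \<Rightarrow> nat)" unfolding range_std_index using k(2) bs(3) by simp
      then obtain j :: 'n where j: "std_index j = k" by blast
      have "E *v axis j 1 = (\<Sum>i\<in>UNIV. if i = j then bs ! std_index i else 0)" unfolding E by (intro sum.cong) (auto simp: axis_def)
      then have "E *v axis j 1 = b" using j k(3) by simp
      moreover have "axis j 1 \<in> std_space m" using j k(1) by (auto simp: std_space_def axis_def)
      ultimately show "b \<in> (*v) E ` std_space m" by (metis image_eqI)
    qed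
  qed
  have "vec.span (set bs) = UNIV"
  proof (rule vec.subspace_dim_equal)
    have "vec.dim (set bs) = CARD('n)" using vec.dim_eq_card_independent[OF bs(2)] distinct_card[OF bs(1)] bs(3) by simp
    then show "vec.dim (UNIV :: (('a, 'n) Finite_Cartesian_Product.vec) set) \<le> vec.dim (vec.span (set bs))" by (simp add: card_cart_basis)
  qed auto
  then have "surj ((*v) E)" using im[of "CARD('n)"] bs(3) unfolding std_space_UNIV by simp
  then have "invertible E" by (simp add: invertible_right_inverse matrix_right_invertible_surjective)
  then show ?thesis using im by blast
qed

lemma dim_std_space:
  assumes m: "m \<le> CARD('n::{finite,linorder})"
  shows "vec.dim (std_space m :: ('a::field^'n::{finite,linorder}) set) = m"
proof -
  obtain bs :: "(('a, 'n) Finite_Cartesian_Product.vec) list" where bs: "distinct bs" "set bs = cart_basis" using finite_distinct_list[OF finite_cart_basis] by blast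
  have l: "length bs = CARD('n)" using distinct_card[OF bs(1)] bs(2) by (simp add: card_cart_basis)
  have ind: "vec.independent (set bs)" unfolding bs(2) by (rule independent_cart_basis)
  obtain E :: "(('a, 'n) Finite_Cartesian_Product.vec, 'n) Finite_Cartesian_Product.vec" where E: "invertible E" "\<forall>m\<le>CARD('n). (*v) E ` std_space m = vec.span (set (take m bs))"
    using ex_frame[OF bs(1) ind l] by blast
  have "vec.dim (std_space m :: (('a, 'n) Finite_Cartesian_Product.vec) set) = vec.dim (set (take m bs))"
    using invertible_image_subspace(2)[OF E(1) subspace_std_space, of m] E(2) m by simp
  also have "\<dots> = card (set (take m bs))"
    by (rule vec.dim_eq_card_independent) (rule vec.independent_mono[OF ind set_take_subset])
  also have "\<dots> = m" using distinct_card[OF distinct_take[OF bs(1)], of m] l m by simp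
  finally show ?thesis .
qed

text \<open>The last clause keeps \<open>bs\<close> inside every subspace above the flag, so that at
  the next step \<open>V\<close> it can be extended within \<open>V\<close> while its old prefixes
  stay the same.\<close>

lemma ex_adapted_basis:
  fixes Vs :: "('a::field^'n) set list"
  assumes "sorted_wrt (\<subset>) Vs" "\<forall>V\<in>set Vs. vec.subspace V"
  shows "\<exists>bs. distinct bs \<and> vec.independent (set bs)
    \<and> (\<forall>V\<in>set Vs. vec.dim V \<le> length bs \<and> vec.span (set (take (vec.dim V) bs)) = V)
    \<and> (\<forall>W. vec.subspace W \<and> (\<forall>V\<in>set Vs. V \<subseteq> W) \<longrightarrow> set bs \<subseteq> W)"
  using assms
proof (induction Vs rule: rev_induct)
  case Nil
  then show ?case by (intro exI[of _ "[]"]) (auto simp: vec.independent_empty)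
next
  case (snoc V Vs)
  have V: "vec.subspace V" using snoc.prems by simp
  have lt: "\<forall>W\<in>set Vs. W \<subseteq> V" using snoc.prems(1) by (auto simp: sorted_wrt_append)
  obtain bs where bs: "distinct bs" "vec.independent (set bs)"
    "\<forall>V\<in>set Vs. vec.dim V \<le> length bs \<and> vec.span (set (take (vec.dim V) bs)) = V"
    "\<forall>W. vec.subspace W \<and> (\<forall>V\<in>set Vs. V \<subseteq> W) \<longrightarrow> set bs \<subseteq> W"
    using snoc by (auto simp: sorted_wrt_append)
  have bsV: "set bs \<subseteq> V" using bs(4) V lt by blast
  obtain B where B: "set bs \<subseteq> B" "B \<subseteq> V" "vec.independent B" "V \<subseteq> vec.span B"
    by (rule vec.maximal_independent_subset_extend[OF bsV bs(2)]) blast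
  have finB: "finite B" by (rule vec.finiteI_independent[OF B(3)])
  obtain es where es: "distinct es" "set es = B - set bs" using finite_distinct_list[of "B - set bs"] finB by blast
  define cs where "cs = bs @ es"
  have cs: "distinct cs" "set cs = B" using bs(1) es B(1) by (auto simp: cs_def)
  have spB: "vec.span B = V" using B(4) vec.span_minimal[OF B(2) V] by blast
  have "vec.dim V = card B" using vec.dim_eq_card_independent[OF B(3)] spB by (metis vec.dim_span)
  then have dV: "vec.dim V = length cs" using distinct_card[OF cs(1)] cs(2) by simp
  have "vec.dim W \<le> length cs \<and> vec.span (set (take (vec.dim W) cs)) = W" if W: "W \<in> set (Vs @ [V])" for W
  proof (cases "W \<in> set Vs")
    case True
    then show ?thesis using bspec[OF bs(3) True] by (simp add: cs_def)
  next
    case False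
    then have "W = V" using W by simp
    then show ?thesis using dV cs(2) spB by simp
  qed
  moreover have "set cs \<subseteq> W" if "vec.subspace W \<and> (\<forall>X\<in>set (Vs @ [V]). X \<subseteq> W)" for W
    using that B(2) cs(2) by auto
  ultimately show ?case using cs B(3) by (intro exI[of _ cs]) simp
qed

lemma ex_flag_frame:
  fixes Vs :: "('a::field^'n::{finite,linorder}) set list"
  assumes flag: "is_flag Vs"
  shows "\<exists>E :: 'a^'n::{finite,linorder}^'n::{finite,linorder}. invertible E \<and> (\<forall>V\<in>set Vs. (*v) E ` std_space (vec.dim V) = V)"
proof -
  have f: "sorted_wrt (\<subset>) Vs" "\<forall>V\<in>set Vs. vec.subspace V" "UNIV \<in> set Vs"
    using flag last_in_set[of Vs] by (auto simp: is_flag_def)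
  obtain bs where bs: "distinct bs" "vec.independent (set bs)"
    "\<forall>V\<in>set Vs. vec.dim V \<le> length bs \<and> vec.span (set (take (vec.dim V) bs)) = V"
    using ex_adapted_basis[OF f(1,2)] by blast
  have "CARD('n) \<le> length bs" using bspec[OF bs(3) f(3)] by (simp add: card_cart_basis)
  moreover have "length bs \<le> CARD('n)"
    using vec.independent_card_le_dim[OF subset_UNIV bs(2)] distinct_card[OF bs(1)] by (simp add: card_cart_basis)
  ultimately have l: "length bs = CARD('n)" by simp
  obtain E :: "(('a, 'n) Finite_Cartesian_Product.vec, 'n) Finite_Cartesian_Product.vec" where E: "invertible E" "\<forall>m\<le>CARD('n). (*v) E ` std_space m = vec.span (set (take m bs))"
    using ex_frame[OF bs(1,2) l] by blast
  have "(*v) E ` std_space (vec.dim V) = V" if V: "V \<in> set Vs" for V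
    using E(2) bs(3) V l by simp
  then show ?thesis using E(1) by blast
qed

lemma parabolic_flag:
  fixes P :: "('a::field_char_0^'n^'n) set"
  assumes "is_parabolic P"
  shows "is_flag (flag_of P)" "P = flag_stabilizer (flag_of P)"
proof -
  obtain Vs where "is_flag Vs" "P = flag_stabilizer Vs" using assms by (auto simp: is_parabolic_def)
  then show "is_flag (flag_of P)" "P = flag_stabilizer (flag_of P)" using flag_of_stabilizer[of Vs] by simp_all
qed

text \<open>The stabilizer of the full standard flag consists of upper triangular matrices and is
  thus contained in \<open>P\<close>. Every step of the flag of \<open>P\<close> is stable under it,
  hence is a step of the full standard flag.\<close>

lemma standard_flag_steps:
  fixes P :: "('a::field_char_0^'n::{finite,linorder}^'n::{finite,linorder}) set"
  assumes P: "P \<in> standard_parabolics" and V: "V \<in> set (flag_of P)"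
  shows "V = std_space (vec.dim V)" "vec.dim V \<le> CARD('n)"
proof -
  note f = parabolic_flag[of P]
  have par: "is_parabolic P" "upper_triangular_group \<subseteq> P" using P by (auto simp: standard_parabolics_def)
  let ?F = "map (std_space :: nat \<Rightarrow> (('a, 'n) Finite_Cartesian_Product.vec) set) [0..<Suc CARD('n)]"
  have F: "is_flag ?F"
    unfolding is_flag_def
  proof (intro conjI)
    show "hd ?F = {0}" by (simp add: hd_map std_space_0 del: upt_Suc)
    show "last ?F = UNIV" by (simp add: std_space_UNIV)
    show "\<forall>V\<in>set ?F. vec.subspace V" by (auto simp: subspace_std_space)
    show "sorted_wrt (\<subset>) ?F"
      unfolding sorted_wrt_map
    proof (rule sorted_wrt_mono_rel[OF _ sorted_wrt_upt])
      fix x y assume xy: "x \<in> set [0..<Suc CARD('n)]" "y \<in> set [0..<Suc CARD('n)]" "x < y"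
      then show "(std_space x :: (('a, 'n) Finite_Cartesian_Product.vec) set) \<subset> std_space y"
        using std_space_mono[of x y] dim_std_space[of x, where 'a='a and 'n='n] dim_std_space[of y, where 'a='a and 'n='n]
        by (auto simp: psubset_eq)
    qed
  qed simp
  have "V \<in> set ?F"
  proof (rule flag_stabilizer_stable_subspace[OF F])
    show "vec.subspace V" using f(1)[OF par(1)] V by (auto simp: is_flag_def)
    fix A assume A: "A \<in> flag_stabilizer ?F"
    have "A $ i $ j = 0" if ij: "j < i" for i j
    proof -
      have l: "Suc (std_index j) \<le> CARD('n)" using std_index_bound[of j] by simp
      then have "std_space (Suc (std_index j)) \<in> set ?F" by (auto simp del: upt_Suc)
      then have st: "(*v) A ` std_space (Suc (std_index j)) = std_space (Suc (std_index j))" using A by (simp add: flag_stabilizer_def del: upt_Suc set_map)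
      have "axis j 1 \<in> std_space (Suc (std_index j))" by (auto simp: std_space_def axis_def)
      then have "A *v axis j 1 \<in> std_space (Suc (std_index j))" using st by blast
      then have "(A *v axis j 1) $ i = 0" using std_index_less[OF ij] by (simp add: std_space_def)
      moreover have "(A *v axis j 1) $ i = (\<Sum>k\<in>UNIV. if k = j then A $ i $ k else 0)"
        unfolding matrix_vector_mult_def by (simp add: axis_def if_distrib cong: if_cong)
      ultimately show ?thesis by simp
    qed
    then have "A \<in> upper_triangular_group" using A by (simp add: upper_triangular_group_def flag_stabilizer_def)
    then have "A \<in> flag_stabilizer (flag_of P)" using par f(2)[OF par(1)] by blast
    then show "(*v) A ` V \<subseteq> V" using V by (simp add: flag_stabilizer_def)
  qed
  then obtain m where m: "V = std_space m" "m \<le> CARD('n)" by (auto simp del: upt_Suc)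
  then show "V = std_space (vec.dim V)" "vec.dim V \<le> CARD('n)" using dim_std_space[OF m(2), where 'a='a] by simp_all
qed

lemma flag_stabilizer_standard:
  fixes Vs :: "('a::field_char_0^'n::{finite,linorder}) set list"
  assumes flag: "is_flag Vs" and std: "\<And>V. V \<in> set Vs \<Longrightarrow> V = std_space (vec.dim V)"
  shows "flag_stabilizer Vs \<in> standard_parabolics"
proof -
  have "upper_triangular_group \<subseteq> flag_stabilizer Vs"
  proof
    fix A :: "(('a, 'n) Finite_Cartesian_Product.vec, 'n) Finite_Cartesian_Product.vec" assume A: "A \<in> upper_triangular_group"
    have inv: "invertible A" using A by (simp add: upper_triangular_group_def)
    have st: "(*v) A ` std_space m = std_space m" for m
    proof (rule invertible_image_eq[OF inv subspace_std_space], rule image_subsetI)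
      fix x :: "('a, 'n) Finite_Cartesian_Product.vec" assume x: "x \<in> std_space m"
      have "(A *v x) $ i = 0" if i: "m \<le> std_index i" for i
      proof -
        have "A $ i $ j * x $ j = 0" for j
        proof (cases "j < i")
          case True
          then show ?thesis using A by (simp add: upper_triangular_group_def)
        next
          case False
          then have "std_index i \<le> std_index j" using std_index_less[of i j] by (metis leI le_less)
          then show ?thesis using x i by (simp add: std_space_def)
        qed
        then have "(\<Sum>j\<in>UNIV. A $ i $ j * x $ j) = 0" by (intro sum.neutral) blast
        then show ?thesis by (simp add: matrix_vector_mult_def)
      qed
      then show "A *v x \<in> std_space m" by (simp add: std_space_def)
    qed
    have "(*v) A ` V = V" if V: "V \<in> set Vs" for V
      using st[of "vec.dim V"] unfolding std[OF V, symmetric] .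
    then show "A \<in> flag_stabilizer Vs" using inv by (simp add: flag_stabilizer_def)
  qed
  then show ?thesis using flag by (auto simp: standard_parabolics_def is_parabolic_def)
qed

lemma standard_parabolics_eqI:
  fixes P Q :: "('a::field_char_0^'n::{finite,linorder}^'n::{finite,linorder}) set"
  assumes P: "P \<in> standard_parabolics" and Q: "Q \<in> standard_parabolics"
    and dims: "vec.dim ` inner_steps (flag_of P) = vec.dim ` inner_steps (flag_of Q)"
  shows "P = Q"
proof -
  have par: "is_parabolic P" "is_parabolic Q" using P Q by (auto simp: standard_parabolics_def)
  have *: "inner_steps (flag_of R) = std_space ` vec.dim ` inner_steps (flag_of R)"
    if R: "R \<in> standard_parabolics" for R :: "((('a, 'n) Finite_Cartesian_Product.vec, 'n) Finite_Cartesian_Product.vec) set"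
  proof -
    have "std_space (vec.dim V) = V" if "V \<in> inner_steps (flag_of R)" for V
      using standard_flag_steps(1)[OF R, of V] that by (simp add: inner_steps_def)
    then show ?thesis by (simp add: image_image)
  qed
  have "flag_of P = flag_of Q"
    by (rule flag_eqI) (use parabolic_flag(1) par *[OF P] *[OF Q] dims in auto)
  then show ?thesis using parabolic_flag(2)[OF par(1)] parabolic_flag(2)[OF par(2)] by simp
qed

lemma finite_standard_parabolics:
  "finite (standard_parabolics :: ('a::field_char_0^'n::{finite,linorder}^'n::{finite,linorder}) set set)"
proof (rule inj_on_finite[where f = "\<lambda>P. vec.dim ` inner_steps (flag_of P)"])
  show "inj_on (\<lambda>P :: ((('a, 'n) Finite_Cartesian_Product.vec, 'n) Finite_Cartesian_Product.vec) set. vec.dim ` inner_steps (flag_of P)) standard_parabolics"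
    by (rule inj_onI) (rule standard_parabolics_eqI)
  show "(\<lambda>P :: ((('a, 'n) Finite_Cartesian_Product.vec, 'n) Finite_Cartesian_Product.vec) set. vec.dim ` inner_steps (flag_of P)) ` standard_parabolics \<subseteq> Pow {..CARD('n)}"
    using standard_flag_steps(2) by (fastforce simp: inner_steps_def)
qed simp

subsection \<open>Cosets of standard parabolics and chains of subspaces\<close>

lemma flag_stabilizer_group:
  fixes Vs :: "('a::field^'n) set list"
  assumes A: "A \<in> flag_stabilizer Vs"
  shows "\<And>B. B \<in> flag_stabilizer Vs \<Longrightarrow> B ** A \<in> flag_stabilizer Vs"
    and "\<exists>B\<in>flag_stabilizer Vs. B ** A = Finite_Cartesian_Product.mat 1"
    and "Finite_Cartesian_Product.mat 1 \<in> flag_stabilizer Vs"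
proof -
  have im: "(*v) (C ** D) ` V = (*v) C ` ((*v) D ` V)" for C D :: "'a^'n^'n" and V
    by (simp add: image_image matrix_vector_mul_assoc)
  show "B ** A \<in> flag_stabilizer Vs" if "B \<in> flag_stabilizer Vs" for B
    using A that by (simp add: flag_stabilizer_def im invertible_mult)
  show one: "Finite_Cartesian_Product.mat 1 \<in> flag_stabilizer Vs"
    unfolding flag_stabilizer_def by (auto simp: invertible_def)
  obtain B where B: "A ** B = Finite_Cartesian_Product.mat 1" "B ** A = Finite_Cartesian_Product.mat 1"
    using A by (auto simp: flag_stabilizer_def invertible_def)
  have "(*v) B ` V = V" if V: "V \<in> set Vs" for V
  proof -
    have "(*v) B ` ((*v) A ` V) = V" unfolding im[symmetric] B(2) by simp
    then show ?thesis using A V by (simp add: flag_stabilizer_def)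
  qed
  moreover have "invertible B" using B by (auto simp: invertible_def)
  ultimately show "\<exists>B\<in>flag_stabilizer Vs. B ** A = Finite_Cartesian_Product.mat 1"
    using B(2) by (auto simp: flag_stabilizer_def)
qed

lemma stabilizer_coset_absorb:
  fixes Vs :: "('a::field^'n) set list"
  assumes A: "A \<in> flag_stabilizer Vs"
  shows "(\<lambda>h. h ** (A ** \<delta>)) ` flag_stabilizer Vs = (\<lambda>h. h ** \<delta>) ` flag_stabilizer Vs"
proof
  show "(\<lambda>h. h ** (A ** \<delta>)) ` flag_stabilizer Vs \<subseteq> (\<lambda>h. h ** \<delta>) ` flag_stabilizer Vs"
    using flag_stabilizer_group(1)[OF A] by (auto simp: matrix_mul_assoc)
  obtain B where B: "B \<in> flag_stabilizer Vs" "B ** A = Finite_Cartesian_Product.mat 1"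
    using flag_stabilizer_group(2)[OF A] by blast
  show "(\<lambda>h. h ** \<delta>) ` flag_stabilizer Vs \<subseteq> (\<lambda>h. h ** (A ** \<delta>)) ` flag_stabilizer Vs"
  proof (rule image_subsetI)
    fix h assume h: "h \<in> flag_stabilizer Vs"
    have "h ** B ** (A ** \<delta>) = h ** (B ** A) ** \<delta>" by (simp only: matrix_mul_assoc)
    then have "h ** \<delta> = h ** B ** (A ** \<delta>)" using B(2) by simp
    then show "h ** \<delta> \<in> (\<lambda>h. h ** (A ** \<delta>)) ` flag_stabilizer Vs"
      by (rule image_eqI) (rule flag_stabilizer_group(1)[OF B(1) h])
  qed
qed

lemma rcosets_GL_group:
  "rcosets\<^bsub>GL_group\<^esub> P = {(\<lambda>h. h ** \<delta>) ` P | \<delta>. invertible \<delta>}"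
  by (auto simp: RCOSETS_def r_coset_def GL_group_def)

text \<open>The representative at which \<open>coset_exceeds\<close> is evaluated.\<close>

definition coset_rep :: "('a::field^'n^'n) set \<Rightarrow> 'a^'n^'n" where
  "coset_rep D = (SOME \<delta>. \<delta> \<in> D)"

lemma coset_rep:
  fixes Vs :: "('a::field^'n) set list"
  assumes \<delta>: "invertible \<delta>"
  shows "\<exists>h\<in>flag_stabilizer Vs. coset_rep ((\<lambda>h. h ** \<delta>) ` flag_stabilizer Vs) = h ** \<delta>"
proof -
  have "Finite_Cartesian_Product.mat 1 ** \<delta> \<in> (\<lambda>h. h ** \<delta>) ` flag_stabilizer Vs"
  proof (rule imageI)
    show "Finite_Cartesian_Product.mat 1 \<in> flag_stabilizer Vs"
      unfolding flag_stabilizer_def by (auto simp: invertible_def)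
  qed
  then have "coset_rep ((\<lambda>h. h ** \<delta>) ` flag_stabilizer Vs) \<in> (\<lambda>h. h ** \<delta>) ` flag_stabilizer Vs"
    unfolding coset_rep_def by (rule someI)
  then show ?thesis by blast
qed

lemma coset_rep_rcosets:
  fixes Vs :: "('a::field^'n) set list"
  assumes D: "D \<in> rcosets\<^bsub>GL_group\<^esub> (flag_stabilizer Vs)"
  shows "invertible (coset_rep D)" "D = (\<lambda>h. h ** coset_rep D) ` flag_stabilizer Vs"
proof -
  obtain \<delta> where \<delta>: "invertible \<delta>" "D = (\<lambda>h. h ** \<delta>) ` flag_stabilizer Vs" using D unfolding rcosets_GL_group by blast
  obtain h where h: "h \<in> flag_stabilizer Vs" "coset_rep D = h ** \<delta>" using coset_rep[OF \<delta>(1), of Vs] \<delta>(2) by blast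
  show "invertible (coset_rep D)" using h \<delta>(1) by (simp add: flag_stabilizer_def invertible_mult)
  show "D = (\<lambda>h. h ** coset_rep D) ` flag_stabilizer Vs" unfolding h(2) stabilizer_coset_absorb[OF h(1)] by (rule \<delta>(2))
qed

lemma vimage_invertible:
  fixes \<delta> :: "'a::field^'n^'n"
  assumes \<delta>: "invertible \<delta>" and V: "vec.subspace V"
  shows "vec.subspace ((*v) \<delta> -` V)" "vec.dim ((*v) \<delta> -` V) = vec.dim V" "(*v) \<delta> ` ((*v) \<delta> -` V) = V"
proof -
  show sub: "vec.subspace ((*v) \<delta> -` V)" by (rule vec.linear_subspace_vimage[OF matrix_vector_mul_linear_gen V])
  show im: "(*v) \<delta> ` ((*v) \<delta> -` V) = V" by (rule surj_image_vimage_eq[OF invertible_image_subspace(4)[OF \<delta> V]])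
  show "vec.dim ((*v) \<delta> -` V) = vec.dim V" using invertible_image_subspace(2)[OF \<delta> sub] im by simp
qed

text \<open>The steps \<open>\<delta>\<^sup>-\<^sup>1 V\<close> for the chosen representative; a
  preimage spares the inverse matrix.\<close>

definition coset_steps :: "('a::field^'n^'n) set \<Rightarrow> ('a^'n^'n) set \<Rightarrow> ('a^'n) set set" where
  "coset_steps P D = (\<lambda>V. (*v) (coset_rep D) -` V) ` inner_steps (flag_of P)"

lemma inner_steps_subspace: "is_flag Vs \<Longrightarrow> V \<in> inner_steps Vs \<Longrightarrow> vec.subspace V \<and> V \<noteq> {0} \<and> V \<noteq> UNIV"
  by (auto simp: inner_steps_def is_flag_def)

lemma vimage_image_invertible:
  fixes E :: "'a::field^'n^'n"
  assumes "F ** E = Finite_Cartesian_Product.mat 1" "E ** F = Finite_Cartesian_Product.mat 1"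
  shows "(*v) F -` V = (*v) E ` V"
proof
  show "(*v) F -` V \<subseteq> (*v) E ` V"
  proof
    fix x assume x: "x \<in> (*v) F -` V"
    have "x = E *v (F *v x)" by (simp add: matrix_vector_mul_assoc assms)
    then show "x \<in> (*v) E ` V" using x by (intro image_eqI[of _ _ "F *v x"]) auto
  qed
  show "(*v) E ` V \<subseteq> (*v) F -` V" using assms by (auto simp: matrix_vector_mul_assoc)
qed

lemma vimage_invertible_inj:
  fixes \<delta> :: "'a::field^'n^'n"
  assumes \<delta>: "invertible \<delta>"
  shows "(*v) \<delta> -` V \<subseteq> (*v) \<delta> -` W \<longleftrightarrow> V \<subseteq> W"
proof -
  have "surj ((*v) \<delta>)" using \<delta> by (simp add: invertible_right_inverse matrix_right_invertible_surjective)
  then have im: "(*v) \<delta> ` ((*v) \<delta> -` X) = X" for X by (rule surj_image_vimage_eq)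
  show ?thesis
  proof
    assume "(*v) \<delta> -` V \<subseteq> (*v) \<delta> -` W"
    then have "(*v) \<delta> ` ((*v) \<delta> -` V) \<subseteq> (*v) \<delta> ` ((*v) \<delta> -` W)" by (rule image_mono)
    then show "V \<subseteq> W" unfolding im .
  qed (rule vimage_mono)
qed

lemma coset_steps_chain:
  fixes P :: "('a::field_char_0^'n::{finite,linorder}^'n::{finite,linorder}) set"
  assumes P: "P \<in> standard_parabolics" and D: "D \<in> rcosets\<^bsub>GL_group\<^esub> P"
  shows "coset_steps P D \<in> subspace_chains proper_subspaces" "card (coset_steps P D) = parabolic_rank P - 1"
    "vec.dim ` coset_steps P D = vec.dim ` inner_steps (flag_of P)"
proof -
  have par: "is_parabolic P" using P by (simp add: standard_parabolics_def)
  note f = parabolic_flag[OF par]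
  let ?\<delta> = "coset_rep D"
  have \<delta>: "invertible ?\<delta>" using coset_rep_rcosets(1)[of D "flag_of P"] D f(2) by simp
  have ch: "inner_steps (flag_of P) \<in> subspace_chains proper_subspaces" by (rule inner_steps_chain[OF f(1)])
  have inv: "vec.subspace ((*v) ?\<delta> -` V)" "vec.dim ((*v) ?\<delta> -` V) = vec.dim V" "(*v) ?\<delta> ` ((*v) ?\<delta> -` V) = V"
    if V: "V \<in> inner_steps (flag_of P)" for V
  proof -
    have s: "vec.subspace V" using inner_steps_subspace[OF f(1) V] by blast
    show "vec.subspace ((*v) ?\<delta> -` V)" "vec.dim ((*v) ?\<delta> -` V) = vec.dim V" "(*v) ?\<delta> ` ((*v) ?\<delta> -` V) = V"
      by (rule vimage_invertible[OF \<delta> s])+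
  qed
  have "(*v) ?\<delta> -` V \<in> proper_subspaces" if V: "V \<in> inner_steps (flag_of P)" for V
  proof -
    have V': "V \<noteq> {0}" "V \<noteq> UNIV" using inner_steps_subspace[OF f(1) V] by auto
    have "(*v) ?\<delta> -` V \<noteq> {0}"
    proof
      assume "(*v) ?\<delta> -` V = {0}"
      from inv(3)[OF V, unfolded this] show False using V'(1) by simp
    qed
    moreover have "(*v) ?\<delta> -` V \<noteq> UNIV"
    proof
      assume "(*v) ?\<delta> -` V = UNIV"
      from inv(3)[OF V, unfolded this] have "V = range ((*v) ?\<delta>)" ..
      also have "\<dots> = UNIV" by (rule invertible_image_subspace(4)[OF \<delta> vec.subspace_UNIV])
      finally show False using V'(2) by simp
    qed
    ultimately show ?thesis using inv(1)[OF V] by (simp add: proper_subspaces_def)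
  qed
  then show "coset_steps P D \<in> subspace_chains proper_subspaces"
    using ch unfolding coset_steps_def subspace_chains_def by (auto simp: vimage_invertible_inj[OF \<delta>])
  have "inj_on (\<lambda>V. (*v) ?\<delta> -` V) (inner_steps (flag_of P))"
    by (rule inj_onI) (metis inv(3))
  then show "card (coset_steps P D) = parabolic_rank P - 1"
    unfolding coset_steps_def using inner_steps_nth(2)[OF f(1)] by (simp add: card_image parabolic_rank_def)
  show "vec.dim ` coset_steps P D = vec.dim ` inner_steps (flag_of P)"
    unfolding coset_steps_def image_image by (rule image_cong[OF refl inv(2)])
qed

text \<open>Dimensions determine a standard parabolic. Within one flag they also match up the steps,
  so both representatives pull each step back to the same subspace, and the quotient
  \<open>h\<close> of the representatives stabilizes the flag.\<close>

lemma coset_steps_inj: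
  fixes P :: "('a::field_char_0^'n::{finite,linorder}^'n::{finite,linorder}) set"
  assumes P: "P \<in> standard_parabolics" "D \<in> rcosets\<^bsub>GL_group\<^esub> P"
    and Q: "Q \<in> standard_parabolics" "E \<in> rcosets\<^bsub>GL_group\<^esub> Q"
    and eq: "coset_steps P D = coset_steps Q E"
  shows "P = Q \<and> D = E"
proof -
  have PQ: "P = Q"
    by (rule standard_parabolics_eqI[OF P(1) Q(1)]) (use coset_steps_chain(3)[OF P] coset_steps_chain(3)[OF Q] eq in simp)
  have par: "is_parabolic P" using P by (simp add: standard_parabolics_def)
  note f = parabolic_flag[OF par]
  let ?\<delta> = "coset_rep D" and ?\<epsilon> = "coset_rep E"
  have \<delta>: "invertible ?\<delta>" "D = (\<lambda>h. h ** ?\<delta>) ` P" using coset_rep_rcosets[of D "flag_of P"] P(2) f(2) by simp_all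
  have \<epsilon>: "invertible ?\<epsilon>" "E = (\<lambda>h. h ** ?\<epsilon>) ` P" using coset_rep_rcosets[of E "flag_of P"] Q(2) f(2) PQ by simp_all
  have same: "(*v) ?\<epsilon> -` V = (*v) ?\<delta> -` V" if V: "V \<in> set (flag_of P)" for V
  proof (cases "V \<in> inner_steps (flag_of P)")
    case True
    have "(*v) ?\<epsilon> -` V \<in> coset_steps P D" unfolding eq unfolding coset_steps_def using True PQ by simp
    then obtain W where W: "W \<in> inner_steps (flag_of P)" "(*v) ?\<epsilon> -` V = (*v) ?\<delta> -` W" unfolding coset_steps_def by blast
    have "vec.dim V = vec.dim W"
      using vimage_invertible(2)[OF \<epsilon>(1), of V] vimage_invertible(2)[OF \<delta>(1), of W] W(2)
        inner_steps_subspace[OF f(1) True] inner_steps_subspace[OF f(1) W(1)] by simp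
    moreover have "V = std_space (vec.dim V)" "W = std_space (vec.dim W)"
      by (rule standard_flag_steps(1)[OF P(1)], use V W(1) in \<open>simp add: inner_steps_def\<close>)+
    ultimately have "V = W" by metis
    then show ?thesis using W(2) by simp
  next
    case False
    then consider "V = {0}" | "V = UNIV" using V by (auto simp: inner_steps_def)
    then show ?thesis
    proof cases
      case 1
      have "(*v) A -` {0} = {0}" if "invertible A" for A :: "(('a, 'n) Finite_Cartesian_Product.vec, 'n) Finite_Cartesian_Product.vec"
        using invertible_image_subspace(3)[OF that vec.subspace_UNIV] by (auto dest: injD[of _ _ 0])
      then show ?thesis using 1 \<delta>(1) \<epsilon>(1) by simp
    qed simp
  qed
  obtain \<delta>' where \<delta>': "?\<delta> ** \<delta>' = Finite_Cartesian_Product.mat 1" "\<delta>' ** ?\<delta> = Finite_Cartesian_Product.mat 1"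
    using \<delta>(1) unfolding invertible_def by blast
  define h where "h = ?\<epsilon> ** \<delta>'"
  have h\<delta>: "h ** ?\<delta> = ?\<epsilon>" unfolding h_def matrix_mul_assoc[symmetric] \<delta>'(2) by simp
  have "invertible \<delta>'" using \<delta>' unfolding invertible_def by blast
  then have inv: "invertible h" unfolding h_def by (rule invertible_mult[OF \<epsilon>(1)])
  have "(*v) h ` V = V" if V: "V \<in> set (flag_of P)" for V
  proof -
    have s: "vec.subspace V" using f(1) V by (simp add: is_flag_def)
    have "(*v) h ` V = (*v) h ` ((*v) ?\<delta> ` ((*v) ?\<delta> -` V))" by (simp only: vimage_invertible(3)[OF \<delta>(1) s])
    also have "\<dots> = (*v) ?\<epsilon> ` ((*v) ?\<epsilon> -` V)"
      unfolding same[OF V] image_image matrix_vector_mul_assoc h\<delta> ..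
    also have "\<dots> = V" by (rule vimage_invertible(3)[OF \<epsilon>(1) s])
    finally show ?thesis .
  qed
  then have "h \<in> flag_stabilizer (flag_of P)" using inv by (simp add: flag_stabilizer_def)
  from stabilizer_coset_absorb[OF this, of ?\<delta>] have "E = D" using \<delta>(2) \<epsilon>(2) f(2) by (simp add: h\<delta>)
  then show ?thesis using PQ by simp
qed

text \<open>A frame \<open>E\<close> carries the standard spaces of the right dimensions to the
  steps of the given flag, and the coset is that of the inverse \<open>F\<close> of
  \<open>E\<close>. The chosen representative may be \<open>h ** F\<close> with \<open>h\<close> in
  the stabilizer, but such an \<open>h\<close> does not change the preimages of the steps.\<close>

lemma coset_steps_surj:
  fixes C :: "('a::field_char_0^'n::{finite,linorder}) set set"
  assumes C: "C \<in> subspace_chains proper_subspaces"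
  shows "\<exists>P\<in>standard_parabolics. \<exists>D\<in>rcosets\<^bsub>GL_group\<^esub> P. coset_steps P D = C"
proof -
  obtain Ws where Ws: "is_flag Ws" "inner_steps Ws = C" by (rule chain_flag[OF C]) blast
  obtain E :: "(('a, 'n) Finite_Cartesian_Product.vec, 'n) Finite_Cartesian_Product.vec"
    where E: "invertible E" "\<forall>V\<in>set Ws. (*v) E ` std_space (vec.dim V) = V" using ex_flag_frame[OF Ws(1)] by blast
  obtain F where F: "E ** F = Finite_Cartesian_Product.mat 1" "F ** E = Finite_Cartesian_Product.mat 1"
    using E(1) unfolding invertible_def by blast
  have F': "invertible F" using F unfolding invertible_def by blast
  define st :: "('a, 'n) Finite_Cartesian_Product.vec set \<Rightarrow> ('a, 'n) Finite_Cartesian_Product.vec set"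
    where "st V = std_space (vec.dim V)" for V
  define Vs where "Vs = map st Ws"
  have pull: "(*v) F -` st V = V" if "V \<in> set Ws" for V
    unfolding vimage_image_invertible[OF F(2,1)] st_def using E(2) that by blast
  have dimst: "vec.dim (st V) = vec.dim V" if "V \<in> set Ws" for V
    using vimage_invertible(2)[OF F', of "st V"] pull[OF that] unfolding st_def by (simp add: subspace_std_space)
  have flag: "is_flag Vs"
    unfolding is_flag_def
  proof (intro conjI)
    have w: "Ws \<noteq> []" "hd Ws = {0}" "last Ws = UNIV" "sorted_wrt (\<subset>) Ws" using Ws(1) by (auto simp: is_flag_def)
    show "Vs \<noteq> []" using w by (simp add: Vs_def)
    show "hd Vs = {0}" using w by (simp add: Vs_def hd_map st_def std_space_0)
    show "last Vs = UNIV" using w by (simp add: Vs_def last_map st_def card_cart_basis std_space_UNIV)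
    show "\<forall>V\<in>set Vs. vec.subspace V" by (auto simp: Vs_def st_def subspace_std_space)
    show "sorted_wrt (\<subset>) Vs"
      unfolding Vs_def sorted_wrt_map
    proof (rule sorted_wrt_mono_rel[OF _ w(4)])
      fix V W assume VW: "V \<in> set Ws" "W \<in> set Ws" "V \<subset> W"
      have "vec.dim V < vec.dim W" using VW Ws(1) by (intro subspace_dim_psubset) (auto simp: is_flag_def)
      then have "st V \<subseteq> st W" unfolding st_def by (intro std_space_mono) simp
      moreover have "st V \<noteq> st W"
      proof
        assume "st V = st W"
        from pull[OF VW(1), unfolded this pull[OF VW(2)]] show False using VW(3) by simp
      qed
      ultimately show "st V \<subset> st W" by blast
    qed
  qed
  define P where "P = flag_stabilizer Vs"
  have std: "V = std_space (vec.dim V)" if "V \<in> set Vs" for V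
  proof -
    obtain W where W: "W \<in> set Ws" "V = st W" using \<open>V \<in> set Vs\<close> by (auto simp: Vs_def)
    show ?thesis unfolding W(2) dimst[OF W(1)] by (rule st_def)
  qed
  have P: "P \<in> standard_parabolics" unfolding P_def by (rule flag_stabilizer_standard[OF flag std])
  have flP: "flag_of P = Vs" unfolding P_def by (rule flag_of_stabilizer[OF flag])
  define D where "D = (\<lambda>h. h ** F) ` P"
  have D: "D \<in> rcosets\<^bsub>GL_group\<^esub> P" unfolding rcosets_GL_group D_def using F' by blast
  obtain h where h: "h \<in> flag_stabilizer Vs" "coset_rep D = h ** F"
    using coset_rep[OF F', of Vs] unfolding D_def P_def by blast
  have hinv: "invertible h" using h(1) by (simp add: flag_stabilizer_def)
  have rep: "(*v) (coset_rep D) -` V = (*v) F -` V" if V: "V \<in> set Vs" for V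
  proof -
    have hV: "(*v) h ` V = V" using h(1) V by (simp add: flag_stabilizer_def)
    have "(*v) h -` ((*v) h ` V) = V" by (rule inj_vimage_image_eq[OF invertible_image_subspace(3)[OF hinv vec.subspace_UNIV]])
    then have hv: "(*v) h -` V = V" unfolding hV .
    have "(*v) (coset_rep D) -` V = (*v) F -` ((*v) h -` V)" unfolding h(2) by (auto simp: matrix_vector_mul_assoc)
    then show ?thesis unfolding hv .
  qed
  have inner: "inner_steps Vs = st ` inner_steps Ws"
  proof -
    have "st V = {0} \<longleftrightarrow> V = {0}" "st V = UNIV \<longleftrightarrow> V = UNIV" if V: "V \<in> set Ws" for V
    proof -
      have F0: "(*v) F -` {0} = {0}" using invertible_image_subspace(3)[OF F' vec.subspace_UNIV] by (auto dest: injD[of _ _ 0])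
      show "st V = {0} \<longleftrightarrow> V = {0}"
      proof
        assume "st V = {0}"
        from pull[OF V, unfolded this F0] show "V = {0}" ..
      qed (simp add: st_def std_space_0)
      show "st V = UNIV \<longleftrightarrow> V = UNIV"
      proof
        assume "st V = UNIV"
        from pull[OF V, unfolded this] show "V = UNIV" by simp
      qed (simp add: st_def card_cart_basis std_space_UNIV)
    qed
    then show ?thesis unfolding inner_steps_def Vs_def by auto
  qed
  have "coset_steps P D = (\<lambda>V. (*v) (coset_rep D) -` st V) ` inner_steps Ws"
    unfolding coset_steps_def flP inner image_image ..
  also have "\<dots> = (\<lambda>V. V) ` inner_steps Ws"
  proof (rule image_cong[OF refl])
    fix V assume "V \<in> inner_steps Ws"
    then have V: "V \<in> set Ws" by (simp add: inner_steps_def)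
    then show "(*v) (coset_rep D) -` st V = V" using rep[of "st V"] pull[OF V] by (simp add: Vs_def)
  qed
  finally have "coset_steps P D = C" using Ws(2) by simp
  then show ?thesis using P D by blast
qed

section \<open>Polygons\<close>

lemma dim_le_CARD: "vec.dim (V :: ('a::field^'n) set) \<le> CARD('n)"
  using vec.dim_subset[of V UNIV] by (simp add: card_cart_basis)

text \<open>As the slopes do not increase, the line through the segment of \<open>p\<close> over
  \<open>t\<close> lies above \<open>p\<close> at all integers of the interval. It is therefore
  above the ends of the chord, hence above the chord, while at \<open>t\<close> it agrees with
  \<open>p\<close>.\<close>

lemma convex_polygon_chord:
  assumes p: "convex_polygon r p" and dd: "d < d'" "d' \<le> r" and t: "real d \<le> t" "t \<le> real d'"
  shows "p (real d) + (t - real d) / (real d' - real d) * (p (real d') - p (real d)) \<le> p t"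
proof -
  define s where "s i = p (real (Suc i)) - p (real i)" for i :: nat
  have step: "s (Suc i) \<le> s i" if "Suc i < r" for i
    using p that unfolding convex_polygon_def s_def by (auto dest!: bspec[of _ _ "Suc i"] simp: add.commute)
  have anti: "s j \<le> s i" if "i \<le> j" "j < r" for i j
    using that
  proof (induction j rule: dec_induct)
    case (step j)
    then show ?case using \<open>\<And>i. Suc i < r \<Longrightarrow> s (Suc i) \<le> s i\<close>[of j] by simp
  qed simp
  have up: "p (real j) \<le> p (real i) + (real j - real i) * s i" if "i \<le> j" "j \<le> r" "i < r" for i j
    using that
  proof (induction j rule: dec_induct)
    case (step j)
    have "p (real (Suc j)) = p (real j) + s j" by (simp add: s_def)
    also have "\<dots> \<le> p (real i) + (real j - real i) * s i + s i" using step anti[of i j] by (intro add_mono) simp_all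
    also have "\<dots> = p (real i) + (real (Suc j) - real i) * s i" by (simp add: algebra_simps)
    finally show ?case .
  qed simp
  have down: "p (real j) \<le> p (real i) + (real j - real i) * s i" if "j \<le> i" "i < r" for i j
    using that(1)
  proof (induction j rule: inc_induct)
    case (step j)
    have "p (real j) = p (real (Suc j)) - s j" by (simp add: s_def)
    also have "\<dots> \<le> p (real i) + (real (Suc j) - real i) * s i - s i" using step anti[of j i] that(2) by (intro diff_mono) simp_all
    also have "\<dots> = p (real i) + (real j - real i) * s i" by (simp add: algebra_simps)
    finally show ?case .
  qed simp
  have line: "p (real j) \<le> p (real i) + (real j - real i) * s i" if "i < r" "j \<le> r" for i j
    using up[of i j] down[of j i] that by (cases "i \<le> j") auto
  obtain i where i: "i < r" "real i \<le> t" "t \<le> real i + 1"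
  proof (cases "t = real r")
    \<comment> \<open>At the right end the floor would be \<open>r\<close>, which numbers no
      segment, so the last segment is taken.\<close>
    case True
    then show ?thesis using that[of "r - 1"] dd by (simp add: of_nat_diff)
  next
    case False
    have t0: "0 \<le> t" using t(1) by simp
    have "real (nat \<lfloor>t\<rfloor>) \<le> t" "t \<le> real (nat \<lfloor>t\<rfloor>) + 1" using t0 by (auto simp: of_nat_nat)
    moreover have "nat \<lfloor>t\<rfloor> < r" using False t(2) dd(2) t0 by (simp add: nat_less_iff floor_less_iff)
    ultimately show ?thesis using that by blast
  qed
  have "\<exists>a b. \<forall>x\<in>{real (Suc i) - 1..real (Suc i)}. p x = a * x + b"
  proof -
    have "\<forall>i\<in>{1..r}. \<exists>a b. \<forall>x\<in>{real i - 1..real i}. p x = a * x + b"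
      using p unfolding convex_polygon_def polygon_def by blast
    then show ?thesis by (rule bspec) (use i(1) in simp)
  qed
  then obtain a b where ab: "\<And>x. real i \<le> x \<Longrightarrow> x \<le> real i + 1 \<Longrightarrow> p x = a * x + b" by (auto simp: add.commute)
  have si: "s i = a" using ab[of "real i"] ab[of "real i + 1"] by (simp add: s_def algebra_simps)
  have pt: "p t = p (real i) + (t - real i) * s i" using ab[of "real i"] ab[of t] i si by (simp add: algebra_simps)
  define l where "l = (t - real d) / (real d' - real d)"
  have l: "0 \<le> l" "l \<le> 1" using t dd by (simp_all add: l_def)
  have tl: "t - real d = l * (real d' - real d)" using dd by (simp add: l_def)
  have "p (real d) + l * (p (real d') - p (real d)) = (1 - l) * p (real d) + l * p (real d')" by (simp add: algebra_simps)
  also have "\<dots> \<le> (1 - l) * (p (real i) + (real d - real i) * s i) + l * (p (real i) + (real d' - real i) * s i)"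
    using l dd i(1) by (intro add_mono mult_left_mono line) auto
  also have "\<dots> = p (real i) + (real d + l * (real d' - real d) - real i) * s i" by (simp add: algebra_simps)
  also have "\<dots> = p t" unfolding pt tl[symmetric] by simp
  finally show ?thesis by (simp add: l_def)
qed

text \<open>Add the chord inequality over \<open>[a, d]\<close> at \<open>b\<close> and at
  \<open>c\<close>: by \<open>b + c = a + d\<close> the two chord values sum to those at the
  ends.\<close>

lemma convex_polygon_submodular:
  assumes p: "convex_polygon r p" and "a \<le> b" "a \<le> c" "b + c = a + d" "d \<le> r"
  shows "p (real a) + p (real d) \<le> p (real b) + p (real c)"
proof (cases "a = d")
  case False
  then have ad: "a < d" using assms by linarith
  define D where "D = (p (real d) - p (real a)) / (real d - real a)"
  have D: "(real d - real a) * D = p (real d) - p (real a)" using ad by (simp add: D_def)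
  have "p (real a) + (real x - real a) * D \<le> p (real x)" if "a \<le> x" "x \<le> d" for x
    using convex_polygon_chord[OF p ad assms(5), of "real x"] that by (simp add: D_def)
  from this[of b] this[of c] have "2 * p (real a) + (real b - real a) * D + (real c - real a) * D \<le> p (real b) + p (real c)"
    using assms by linarith
  moreover have "(real b - real a) * D + (real c - real a) * D = (real d - real a) * D"
  proof -
    have "real b + real c = real a + real d" using assms(4) by (metis of_nat_add)
    then have "real b - real a + (real c - real a) = real d - real a" by simp
    then show ?thesis by (simp only: distrib_right[symmetric])
  qed
  ultimately show ?thesis using D by linarith
next
  case True
  then have "b = d" "c = d" using assms by linarith+
  then show ?thesis using True by simp
qed

section \<open>Polygons of parabolic subgroups\<close>

lemma interpolate_between:
  fixes d :: "nat \<Rightarrow> real"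
  assumes s: "0 < s" and inc: "\<And>i. i < s \<Longrightarrow> d i < d (Suc i)" and t: "d 0 \<le> t" "t \<le> d s"
  shows "\<exists>i<s. d i \<le> t \<and> t \<le> d (Suc i)
    \<and> (\<forall>y. interpolate d y t = y i + (t - d i) / (d (Suc i) - d i) * (y (Suc i) - y i))"
proof -
  define i where "i = (LEAST i. t \<le> d (Suc i))"
  have ex: "t \<le> d (Suc (s - 1))" using t(2) s by simp
  have i: "t \<le> d (Suc i)" "i \<le> s - 1" unfolding i_def using LeastI[of "\<lambda>i. t \<le> d (Suc i)", OF ex] Least_le[of "\<lambda>i. t \<le> d (Suc i)", OF ex] by simp_all
  have "d i \<le> t"
  proof (cases i)
    case (Suc k)
    then have "\<not> t \<le> d (Suc k)" using not_less_Least[of k "\<lambda>i. t \<le> d (Suc i)"] unfolding i_def by simp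
    then show ?thesis using Suc by simp
  qed (use t in simp)
  moreover have "i < s" using i(2) s by linarith
  ultimately show ?thesis using i(1) unfolding interpolate_def i_def[symmetric] Let_def by blast
qed

text \<open>The ordinate at the dimension of \<open>V\<close> of the polygon of any flag through
  \<open>V\<close>; see \<open>parabolic_polygon_node\<close>.\<close>

definition slope_degree :: "'a::number_field adele^'n^'n \<Rightarrow> ('a^'n) set \<Rightarrow> real" where
  "slope_degree g V = arakelov_degree g V - real (vec.dim V) / real CARD('n) * arakelov_degree g UNIV"

lemma parabolic_polygon_between:
  fixes g :: "'a::number_field adele^'n^'n"
  assumes Q: "is_parabolic Q" and t: "0 \<le> t" "t \<le> real CARD('n)"
  shows "\<exists>i. Suc i < length (flag_of Q) \<and> real (vec.dim (flag_of Q ! i)) \<le> t \<and> t \<le> real (vec.dim (flag_of Q ! Suc i))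
    \<and> parabolic_polygon g Q t = slope_degree g (flag_of Q ! i)
        + (t - real (vec.dim (flag_of Q ! i))) / (real (vec.dim (flag_of Q ! Suc i)) - real (vec.dim (flag_of Q ! i)))
          * (slope_degree g (flag_of Q ! Suc i) - slope_degree g (flag_of Q ! i))"
proof -
  note f = is_flag_dim_nth[OF parabolic_flag(1)[OF Q]]
  define s where "s = length (flag_of Q) - 1"
  have s: "0 < s" "s < length (flag_of Q)" using f(1) by (auto simp: s_def)
  have inc: "real (vec.dim (flag_of Q ! i)) < real (vec.dim (flag_of Q ! Suc i))" if "i < s" for i
    using f(5)[of i "Suc i"] that by (simp add: s_def)
  have t': "real (vec.dim (flag_of Q ! 0)) \<le> t" "t \<le> real (vec.dim (flag_of Q ! s))"
    using t f(2,3) by (simp_all add: s_def card_cart_basis)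
  obtain i where i: "i < s" "real (vec.dim (flag_of Q ! i)) \<le> t" "t \<le> real (vec.dim (flag_of Q ! Suc i))"
    "\<forall>y. interpolate (\<lambda>i. real (vec.dim (flag_of Q ! i))) y t
      = y i + (t - real (vec.dim (flag_of Q ! i))) / (real (vec.dim (flag_of Q ! Suc i)) - real (vec.dim (flag_of Q ! i))) * (y (Suc i) - y i)"
    using interpolate_between[OF s(1) inc t'] by blast
  show ?thesis unfolding parabolic_polygon_def slope_degree_def
    using i(1,2,3) by (intro exI[of _ i] conjI i(4)[rule_format]) (simp_all add: s_def)
qed

lemma parabolic_polygon_chord:
  fixes g :: "'a::number_field adele^'n^'n"
  assumes Q: "is_parabolic Q" and t: "0 \<le> t" "t \<le> real CARD('n)"
  shows "\<exists>V W l. vec.subspace V \<and> vec.subspace W \<and> vec.dim V < vec.dim W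
    \<and> real (vec.dim V) \<le> t \<and> t \<le> real (vec.dim W)
    \<and> l = (t - real (vec.dim V)) / (real (vec.dim W) - real (vec.dim V)) \<and> 0 \<le> l \<and> l \<le> 1
    \<and> parabolic_polygon g Q t = slope_degree g V + l * (slope_degree g W - slope_degree g V)"
proof -
  obtain i where i: "Suc i < length (flag_of Q)" "real (vec.dim (flag_of Q ! i)) \<le> t" "t \<le> real (vec.dim (flag_of Q ! Suc i))"
    "parabolic_polygon g Q t = slope_degree g (flag_of Q ! i)
      + (t - real (vec.dim (flag_of Q ! i))) / (real (vec.dim (flag_of Q ! Suc i)) - real (vec.dim (flag_of Q ! i)))
        * (slope_degree g (flag_of Q ! Suc i) - slope_degree g (flag_of Q ! i))"
    using parabolic_polygon_between[OF Q t, of g] by blast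
  have sub: "vec.subspace (flag_of Q ! i)" "vec.subspace (flag_of Q ! Suc i)"
    using parabolic_flag(1)[OF Q] i(1) nth_mem[of i "flag_of Q"] nth_mem[of "Suc i" "flag_of Q"]
    by (auto simp: is_flag_def)
  have lt: "vec.dim (flag_of Q ! i) < vec.dim (flag_of Q ! Suc i)"
    using is_flag_dim_nth(5)[OF parabolic_flag(1)[OF Q], of i "Suc i"] i(1) by simp
  define V W l where "V = flag_of Q ! i" and "W = flag_of Q ! Suc i"
    and "l = (t - real (vec.dim V)) / (real (vec.dim W) - real (vec.dim V))"
  note defs = V_def W_def
  have lt': "real (vec.dim V) < real (vec.dim W)" using lt by (simp add: defs)
  have l: "0 \<le> l" "l \<le> 1" using i(2,3) lt' by (simp_all add: l_def defs)
  show ?thesis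
    by (rule exI[of _ V], rule exI[of _ W], rule exI[of _ l], intro conjI l)
      (use sub lt i(2,3,4) in \<open>simp_all only: l_def defs\<close>)
qed

lemma parabolic_polygon_node:
  fixes g :: "'a::number_field adele^'n^'n"
  assumes Q: "is_parabolic Q" and V: "V \<in> set (flag_of Q)"
  shows "parabolic_polygon g Q (real (vec.dim V)) = slope_degree g V"
proof -
  note f = is_flag_dim_nth[OF parabolic_flag(1)[OF Q]]
  obtain k where k: "k < length (flag_of Q)" "V = flag_of Q ! k" using V by (auto simp: in_set_conv_nth)
  have "vec.dim V \<le> CARD('n)" by (rule dim_le_CARD)
  then obtain i where i: "Suc i < length (flag_of Q)" "real (vec.dim (flag_of Q ! i)) \<le> real (vec.dim V)"
    "real (vec.dim V) \<le> real (vec.dim (flag_of Q ! Suc i))"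
    "parabolic_polygon g Q (real (vec.dim V)) = slope_degree g (flag_of Q ! i)
        + (real (vec.dim V) - real (vec.dim (flag_of Q ! i))) / (real (vec.dim (flag_of Q ! Suc i)) - real (vec.dim (flag_of Q ! i)))
          * (slope_degree g (flag_of Q ! Suc i) - slope_degree g (flag_of Q ! i))"
    using parabolic_polygon_between[OF Q, of "real (vec.dim V)" g] by auto
  have "k = i \<or> k = Suc i"
  proof (rule ccontr)
    assume "\<not> (k = i \<or> k = Suc i)"
    then consider "k < i" | "Suc i < k" by linarith
    then show False
    proof cases
      case 1
      then show False using f(5)[of k i] i(1,2) k(2) by simp
    next
      case 2
      then show False using f(5)[of "Suc i" k] k i(3) by simp
    qed
  qed
  then show ?thesis
  proof
    assume "k = i"
    then show ?thesis using i(4) k(2) by simp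
  next
    assume "k = Suc i"
    then show ?thesis using i(4) k(2) f(5)[of i "Suc i"] i(1) by simp
  qed
qed

text \<open>The values at a fixed abscissa accumulate only at \<open>-\<infinity>\<close>, which is why the pointwise maximum exists.\<close>

lemma finite_above_combination:
  fixes A :: "real set"
  assumes A: "\<And>c. finite {a\<in>A. c \<le> a}" and l: "0 \<le> l" "l \<le> 1"
  shows "finite {y. c \<le> y \<and> (\<exists>a\<in>A. \<exists>b\<in>A. y = a + l * (b - a))}"
proof -
  define M where "M = Max (insert 0 {a\<in>A. 0 \<le> a})"
  have M: "a \<le> M" if "a \<in> A" for a
  proof (cases "0 \<le> a")
    case True
    then show ?thesis unfolding M_def using A[of 0] that by (intro Max_ge) auto
  next
    case False
    have "0 \<le> M" unfolding M_def using A[of 0] by (intro Max_ge) auto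
    then show ?thesis using False by simp
  qed
  \<comment> \<open>The general bounds divide by \<open>l\<close> and by \<open>1 - l\<close>, so
    the two ends are treated apart.\<close>
  consider "l = 0" | "l = 1" | "0 < l" "l < 1" using l by linarith
  then show ?thesis
  proof cases
    case 1
    show ?thesis by (rule finite_subset[OF _ A[of c]]) (use 1 in auto)
  next
    case 2
    show ?thesis by (rule finite_subset[OF _ A[of c]]) (use 2 in auto)
  next
    case 3
    let ?B = "{a\<in>A. (c - l * M) / (1 - l) \<le> a}" and ?C = "{a\<in>A. (c - (1 - l) * M) / l \<le> a}"
    have "{y. c \<le> y \<and> (\<exists>a\<in>A. \<exists>b\<in>A. y = a + l * (b - a))} \<subseteq> (\<lambda>(a, b). a + l * (b - a)) ` (?B \<times> ?C)"
    proof
      fix y assume "y \<in> {y. c \<le> y \<and> (\<exists>a\<in>A. \<exists>b\<in>A. y = a + l * (b - a))}"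
      then obtain a b where y: "c \<le> y" "a \<in> A" "b \<in> A" "y = a + l * (b - a)" by blast
      have y': "y = (1 - l) * a + l * b" using y(4) by (simp add: algebra_simps)
      have "l * b \<le> l * M" "(1 - l) * a \<le> (1 - l) * M" using M y(2,3) 3 by (intro mult_left_mono; simp)+
      then have "c - l * M \<le> (1 - l) * a" "c - (1 - l) * M \<le> l * b" using y(1) y' by linarith+
      then have "(c - l * M) / (1 - l) \<le> a" "(c - (1 - l) * M) / l \<le> b" using 3 by (simp_all add: pos_divide_le_eq mult.commute)
      then show "y \<in> (\<lambda>(a, b). a + l * (b - a)) ` (?B \<times> ?C)"
        using y by (intro image_eqI[of _ _ "(a, b)"]) auto
    qed
    then show ?thesis by (rule finite_subset) (intro finite_imageI finite_cartesian_product A)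
  qed
qed

lemma finite_slope_degree_ge:
  fixes g :: "'a::number_field adele^'n^'n"
  assumes g: "invertible g"
  shows "finite {V. vec.subspace V \<and> c \<le> slope_degree g V}"
proof -
  interpret adelic_lattice g by unfold_locales (rule g)
  have "{V. vec.subspace V \<and> c \<le> slope_degree g V} \<subseteq> {V. vec.subspace V \<and> c - \<bar>arakelov_degree g UNIV\<bar> \<le> arakelov_degree g V}"
  proof (intro Collect_mono impI conjI; elim conjE)
    fix V :: "('a^'n) set" assume V: "vec.subspace V" "c \<le> slope_degree g V"
    have "vec.dim V \<le> CARD('n)" by (rule dim_le_CARD)
    then have "\<bar>real (vec.dim V) / real CARD('n)\<bar> \<le> 1" by simp
    then have "\<bar>real (vec.dim V) / real CARD('n) * arakelov_degree g UNIV\<bar> \<le> 1 * \<bar>arakelov_degree g UNIV\<bar>"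
      unfolding abs_mult by (rule mult_right_mono) simp
    then show "c - \<bar>arakelov_degree g UNIV\<bar> \<le> arakelov_degree g V" using V(2) unfolding slope_degree_def by linarith
  qed
  then show ?thesis by (rule finite_subset) (rule finite_degree_ge)
qed

lemma is_flag_trivial: "is_flag [{0}, UNIV :: ('a::field^'n) set]"
  by (simp add: is_flag_def vec.subspace_single_0 zero_psubset_UNIV)

lemma is_flag_single:
  assumes "V \<in> (proper_subspaces :: ('a::field^'n) set set)"
  shows "is_flag [{0}, V, UNIV]"
  using assms vec.subspace_0[of V] by (auto simp: is_flag_def proper_subspaces_def vec.subspace_single_0)

text \<open>The content is that the \<open>GREATEST\<close> is attained. At abscissa
  \<open>t\<close> every value is a combination of two slope degrees with a weight fixed by two
  dimensions. So there are finitely many weights, collected in \<open>\<Lambda>\<close>, and only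
  finitely many values above a given bound.\<close>

lemma max_polygon_le_iff:
  fixes g :: "'a::number_field adele^'n^'n"
  assumes g: "invertible g" and t: "0 \<le> t" "t \<le> real CARD('n)"
  shows "max_polygon g t \<le> c \<longleftrightarrow> (\<forall>Q. is_parabolic Q \<longrightarrow> parabolic_polygon g Q t \<le> c)"
proof -
  define Y where "Y = {y. \<exists>Q. is_parabolic Q \<and> y = parabolic_polygon g Q t}"
  define A where "A = slope_degree g ` {V. vec.subspace V}"
  have finA: "finite {a\<in>A. b \<le> a}" for b
  proof (rule finite_subset)
    show "{a\<in>A. b \<le> a} \<subseteq> slope_degree g ` {V. vec.subspace V \<and> b \<le> slope_degree g V}" unfolding A_def by blast
  qed (intro finite_imageI finite_slope_degree_ge[OF g])
  define \<Lambda> where "\<Lambda> = (\<lambda>(d, d'). (t - real d) / (real d' - real d)) ` ({..CARD('n)} \<times> {..CARD('n)}) \<inter> {0..1}"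
  have finY: "finite {y\<in>Y. b \<le> y}" for b
  proof (rule finite_subset)
    show "finite (\<Union>l\<in>\<Lambda>. {y. b \<le> y \<and> (\<exists>a\<in>A. \<exists>a'\<in>A. y = a + l * (a' - a))})"
      by (intro finite_UN_I finite_above_combination finA) (auto simp: \<Lambda>_def)
    show "{y\<in>Y. b \<le> y} \<subseteq> (\<Union>l\<in>\<Lambda>. {y. b \<le> y \<and> (\<exists>a\<in>A. \<exists>a'\<in>A. y = a + l * (a' - a))})"
    proof
      fix y assume "y \<in> {y\<in>Y. b \<le> y}"
      then obtain Q :: "('a^'n^'n) set" where Q: "is_parabolic Q" "y = parabolic_polygon g Q t" "b \<le> y" unfolding Y_def by blast
      obtain V W l where VW: "vec.subspace V" "vec.subspace W" "vec.dim V < vec.dim W"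
        and l: "l = (t - real (vec.dim V)) / (real (vec.dim W) - real (vec.dim V))" "0 \<le> l" "l \<le> 1"
        and y: "y = slope_degree g V + l * (slope_degree g W - slope_degree g V)"
        using parabolic_polygon_chord[OF Q(1) t, of g] Q(2) by metis
      have dn: "vec.dim V \<le> CARD('n)" "vec.dim W \<le> CARD('n)" by (rule dim_le_CARD)+
      have "l \<in> (\<lambda>(d, d'). (t - real d) / (real d' - real d)) ` ({..CARD('n)} \<times> {..CARD('n)})"
        by (rule image_eqI[of _ _ "(vec.dim V, vec.dim W)"]) (use dn in \<open>simp_all add: l(1)\<close>)
      then have "l \<in> \<Lambda>" using l(2,3) by (simp add: \<Lambda>_def)
      moreover note y
      moreover have "slope_degree g V \<in> A" "slope_degree g W \<in> A" using VW by (simp_all add: A_def)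
      ultimately show "y \<in> (\<Union>l\<in>\<Lambda>. {y. b \<le> y \<and> (\<exists>a\<in>A. \<exists>a'\<in>A. y = a + l * (a' - a))})" using Q(3) by blast
    qed
  qed
  have "is_parabolic (flag_stabilizer [{0}, UNIV :: ('a^'n) set])" using is_flag_trivial unfolding is_parabolic_def by blast
  then obtain y0 where y0: "y0 \<in> Y" unfolding Y_def by blast
  define m where "m = Max {y\<in>Y. y0 \<le> y}"
  have mY: "m \<in> Y" "y0 \<le> m" using Max_in[OF finY[of y0]] y0 unfolding m_def by auto
  have mle: "y \<le> m" if "y \<in> Y" for y
  proof (cases "y0 \<le> y")
    case True
    then show ?thesis unfolding m_def using finY[of y0] that by (intro Max_ge) auto
  qed (use mY(2) in simp)
  have "max_polygon g t = m" unfolding max_polygon_def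
    by (rule Greatest_equality) (use mY(1) mle in \<open>auto simp: Y_def\<close>)
  then show ?thesis using mY(1) mle unfolding Y_def by (auto intro: order_trans)
qed

section \<open>Excess of subspaces over a convex polygon\<close>

definition excess :: "'a::number_field adele^'n^'n \<Rightarrow> (real \<Rightarrow> real) \<Rightarrow> ('a^'n) set \<Rightarrow> real" where
  "excess g p V = slope_degree g V - p (real (vec.dim V))"

definition exceeding_subspaces :: "'a::number_field adele^'n^'n \<Rightarrow> (real \<Rightarrow> real) \<Rightarrow> ('a^'n) set set" where
  "exceeding_subspaces g p = {V \<in> proper_subspaces. excess g p V > 0}"

lemma excess_trivial:
  fixes g :: "'a::number_field adele^'n^'n"
  assumes "convex_polygon CARD('n) p"
  shows "excess g p {0} = 0" "excess g p UNIV = 0"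
proof -
  have "vec.dim (UNIV :: ('a^'n) set) = CARD('n)" by (simp add: card_cart_basis)
  then show "excess g p {0} = 0" "excess g p UNIV = 0"
    using assms by (simp_all add: excess_def slope_degree_def arakelov_degree_def convex_polygon_def polygon_def)
qed

text \<open>If a proper subspace exceeds \<open>p\<close>, the flag with this single inner step
  detects it. Conversely, every polygon runs along chords between nodes that lie on or below
  \<open>p\<close>, and chords below a concave function stay below it.\<close>

lemma max_polygon_le_polygon_iff:
  fixes g :: "'a::number_field adele^'n^'n"
  assumes g: "invertible g" and p: "convex_polygon CARD('n) p"
  shows "(\<forall>t\<in>{0..real CARD('n)}. max_polygon g t \<le> p t) \<longleftrightarrow> exceeding_subspaces g p = {}"
proof
  assume *: "\<forall>t\<in>{0..real CARD('n)}. max_polygon g t \<le> p t"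
  have "\<not> excess g p V > 0" if V: "V \<in> proper_subspaces" for V
  proof -
    define Q where "Q = flag_stabilizer [{0}, V, UNIV]"
    have Q: "is_parabolic Q" unfolding Q_def is_parabolic_def using is_flag_single[OF V] by blast
    have fl: "flag_of Q = [{0}, V, UNIV]" unfolding Q_def by (rule flag_of_stabilizer[OF is_flag_single[OF V]])
    have "vec.dim V \<le> CARD('n)" by (rule dim_le_CARD)
    then have t: "0 \<le> real (vec.dim V)" "real (vec.dim V) \<le> real CARD('n)" by simp_all
    have "parabolic_polygon g Q (real (vec.dim V)) \<le> p (real (vec.dim V))"
      using *[rule_format, of "real (vec.dim V)"] t Q unfolding max_polygon_le_iff[OF g t] by simp
    then show ?thesis using parabolic_polygon_node[OF Q, of V g] fl by (simp add: excess_def)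
  qed
  then show "exceeding_subspaces g p = {}" by (auto simp: exceeding_subspaces_def)
next
  assume empty: "exceeding_subspaces g p = {}"
  have le: "slope_degree g V \<le> p (real (vec.dim V))" if V: "vec.subspace V" for V
  proof (cases "V = {0} \<or> V = UNIV")
    case True
    then have "excess g p V = 0" using excess_trivial[OF p, of g] by auto
    then show ?thesis by (simp add: excess_def)
  next
    case False
    then have "\<not> excess g p V > 0" using V empty unfolding exceeding_subspaces_def proper_subspaces_def by blast
    then show ?thesis by (simp add: excess_def)
  qed
  show "\<forall>t\<in>{0..real CARD('n)}. max_polygon g t \<le> p t"
  proof
    fix t assume "t \<in> {0..real CARD('n)}"
    then have t: "0 \<le> t" "t \<le> real CARD('n)" by auto
    show "max_polygon g t \<le> p t"
      unfolding max_polygon_le_iff[OF g t]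
    proof (intro allI impI)
      fix Q :: "('a^'n^'n) set" assume Q: "is_parabolic Q"
      obtain V W l where VW: "vec.subspace V" "vec.subspace W" "vec.dim V < vec.dim W"
          "real (vec.dim V) \<le> t" "t \<le> real (vec.dim W)"
        and l: "l = (t - real (vec.dim V)) / (real (vec.dim W) - real (vec.dim V))" "0 \<le> l" "l \<le> 1"
        and y: "parabolic_polygon g Q t = slope_degree g V + l * (slope_degree g W - slope_degree g V)"
        using parabolic_polygon_chord[OF Q t, of g] by metis
      note y
      also have "\<dots> = (1 - l) * slope_degree g V + l * slope_degree g W" by (simp add: algebra_simps)
      also have "\<dots> \<le> (1 - l) * p (real (vec.dim V)) + l * p (real (vec.dim W))"
        using l(2,3) VW(1,2) by (intro add_mono mult_left_mono le) auto
      also have "\<dots> = p (real (vec.dim V)) + l * (p (real (vec.dim W)) - p (real (vec.dim V)))" by (simp add: algebra_simps)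
      also have "\<dots> \<le> p t" unfolding l(1) by (rule convex_polygon_chord[OF p VW(3) dim_le_CARD VW(4,5)])
      finally show "parabolic_polygon g Q t \<le> p t" .
    qed
  qed
qed

lemma finite_exceeding_subspaces:
  fixes g :: "'a::number_field adele^'n^'n"
  assumes g: "invertible g"
  shows "finite (exceeding_subspaces g p)"
proof -
  define m where "m = Min ((\<lambda>d. p (real d)) ` {..CARD('n)})"
  have "exceeding_subspaces g p \<subseteq> {V. vec.subspace V \<and> m \<le> slope_degree g V}"
  proof
    fix V assume V: "V \<in> exceeding_subspaces g p"
    have "vec.dim V \<le> CARD('n)" by (rule dim_le_CARD)
    then have "m \<le> p (real (vec.dim V))" unfolding m_def by (intro Min_le) auto
    then show "V \<in> {V. vec.subspace V \<and> m \<le> slope_degree g V}"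
      using V by (auto simp: exceeding_subspaces_def proper_subspaces_def excess_def)
  qed
  then show ?thesis by (rule finite_subset) (rule finite_slope_degree_ge[OF g])
qed

lemma excess_supermodular:
  fixes g :: "'a::number_field adele^'n^'n"
  assumes g: "invertible g" and p: "convex_polygon CARD('n) p" and V: "vec.subspace V" and W: "vec.subspace W"
  shows "excess g p V + excess g p W \<le> excess g p (vec.span (V \<union> W)) + excess g p (V \<inter> W)"
proof -
  interpret adelic_lattice g by unfold_locales (rule g)
  have sp: "vec.span (V \<union> W) = {x + y | x y. x \<in> V \<and> y \<in> W}"
    unfolding vec.span_Un vec.span_eq_iff[THEN iffD2, OF V] vec.span_eq_iff[THEN iffD2, OF W] by blast
  have dims: "vec.dim V + vec.dim W = vec.dim (V \<inter> W) + vec.dim (vec.span (V \<union> W))"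
    using vec.dim_sums_Int[OF V W] unfolding sp by linarith
  have "p (real (vec.dim (V \<inter> W))) + p (real (vec.dim (vec.span (V \<union> W)))) \<le> p (real (vec.dim V)) + p (real (vec.dim W))"
  proof (rule convex_polygon_submodular[OF p _ _ dims])
    show "vec.dim (V \<inter> W) \<le> vec.dim V" "vec.dim (V \<inter> W) \<le> vec.dim W" by (intro vec.dim_subset; blast)+
    show "vec.dim (vec.span (V \<union> W)) \<le> CARD('n)" by (rule dim_le_CARD)
  qed
  moreover have "real (vec.dim V) / real CARD('n) * c + real (vec.dim W) / real CARD('n) * c
      = real (vec.dim (V \<inter> W)) / real CARD('n) * c + real (vec.dim (vec.span (V \<union> W))) / real CARD('n) * c" for c
  proof -
    have "real (vec.dim V) + real (vec.dim W) = real (vec.dim (V \<inter> W)) + real (vec.dim (vec.span (V \<union> W)))"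
      using dims by (metis of_nat_add)
    then show ?thesis by (simp add: distrib_right[symmetric] add_divide_distrib[symmetric])
  qed
  ultimately show ?thesis
    using arakelov_degree_supermodular[OF V W] unfolding excess_def slope_degree_def
    by (smt (verit, best))
qed

section \<open>The alternating sum over chains\<close>

lemma subspace_chains_mono: "S \<subseteq> T \<Longrightarrow> subspace_chains S \<subseteq> subspace_chains T"
  unfolding subspace_chains_def by (intro Collect_mono impI conjI; elim conjE) (simp_all add: subset_trans)

text \<open>A sign-reversing involution toggles \<open>J W\<close> in a chain, where \<open>W\<close> is its largest element not containing
  \<open>V\<^sub>0\<close> (and toggles \<open>V\<^sub>0\<close> itself if there is none).\<close>

lemma alternating_chain_sum_zero:
  fixes S :: "('a::field^'n) set set"
  assumes fin: "finite S" and V0: "V0 \<in> S"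
    and J: "\<And>W. W \<in> S \<Longrightarrow> J W \<in> S" "\<And>W. W \<in> S \<Longrightarrow> W \<subseteq> J W" "\<And>W. W \<in> S \<Longrightarrow> V0 \<subseteq> J W"
    and Jmin: "\<And>W X. W \<in> S \<Longrightarrow> X \<in> S \<Longrightarrow> W \<subseteq> X \<Longrightarrow> V0 \<subseteq> X \<Longrightarrow> J W \<subseteq> X"
  shows "(\<Sum>C\<in>subspace_chains S. (- 1) ^ card C) = (0 :: real)"
proof -
  define low where "low C = {W\<in>C. \<not> V0 \<subseteq> W}" for C
  define U where "U C = (if low C = {} then V0 else J (\<Union> (low C)))" for C
  define tog where "tog C = (if U C \<in> C then C - {U C} else insert (U C) C)" for C
  have mem: "C \<subseteq> S" "finite C" "\<And>V W. V \<in> C \<Longrightarrow> W \<in> C \<Longrightarrow> V \<subseteq> W \<or> W \<subseteq> V" if "C \<in> subspace_chains S" for C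
    using that by (auto simp: subspace_chains_def)
  have union_low: "\<Union> (low C) \<in> low C" if C: "C \<in> subspace_chains S" and ne: "low C \<noteq> {}" for C
  proof -
    have "finite (low C)" using mem(2)[OF C] by (simp add: low_def)
    then obtain M where M: "M \<in> low C" "\<forall>X\<in>low C. M \<subseteq> X \<longrightarrow> M = X" using finite_has_maximal[OF _ ne] by blast
    have "X \<subseteq> M" if X: "X \<in> low C" for X
    proof -
      have "X \<subseteq> M \<or> M \<subseteq> X" by (rule mem(3)[OF C]) (use X M(1) in \<open>auto simp: low_def\<close>)
      then show ?thesis using M(2) X by auto
    qed
    then have "\<Union> (low C) = M" using M(1) by (intro equalityI Union_least Union_upper)
    then show ?thesis using M(1) by simp
  qed
  have U: "U C \<in> S" "V0 \<subseteq> U C" if C: "C \<in> subspace_chains S" for C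
  proof -
    have "\<Union> (low C) \<in> S" if "low C \<noteq> {}" using union_low[OF C that] mem(1)[OF C] by (auto simp: low_def)
    then show "U C \<in> S" "V0 \<subseteq> U C" using V0 J unfolding U_def by simp_all
  qed
  \<comment> \<open>Elements of the chain without \<open>V0\<close> lie below
    \<open>M = \<Union> (low C)\<close> and hence below \<open>J M\<close>. Elements containing
    \<open>V0\<close> also contain \<open>M\<close>, since the chain is total and \<open>M\<close>
    does not contain \<open>V0\<close>; by \<open>Jmin\<close> they contain
    \<open>J M\<close>.\<close>
  have comp: "X \<subseteq> U C \<or> U C \<subseteq> X" if C: "C \<in> subspace_chains S" and X: "X \<in> C" for C X
  proof (cases "V0 \<subseteq> X")
    case True
    show ?thesis
    proof (cases "low C = {}")
      case False
      define M where "M = \<Union> (low C)"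
      have M: "M \<in> C" "\<not> V0 \<subseteq> M" using union_low[OF C False] by (auto simp: low_def M_def)
      have "M \<subseteq> X" using mem(3)[OF C X M(1)] M(2) True by (metis subset_trans)
      then have "J M \<subseteq> X" using Jmin[of M X] M(1) X mem(1)[OF C] True by blast
      then show ?thesis using False by (simp add: U_def M_def)
    qed (use True in \<open>simp add: U_def\<close>)
  next
    case False
    then have XL: "X \<in> low C" using X by (simp add: low_def)
    then have ne: "low C \<noteq> {}" by blast
    have "\<Union> (low C) \<in> S" using union_low[OF C ne] mem(1)[OF C] by (auto simp: low_def)
    then have "\<Union> (low C) \<subseteq> U C" using J(2) ne by (simp add: U_def)
    then show ?thesis using XL by blast
  qed
  \<comment> \<open>The toggled element contains \<open>V0\<close>, so it never enters
    \<open>low\<close>; the second application therefore toggles the same element.\<close>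
  have low_tog: "low (tog C) = low C" if C: "C \<in> subspace_chains S" for C
    using U(2)[OF C] by (auto simp: low_def tog_def)
  have U_tog: "U (tog C) = U C" if C: "C \<in> subspace_chains S" for C
    unfolding U_def low_tog[OF C] ..
  have tog_mem: "tog C \<in> subspace_chains S" if C: "C \<in> subspace_chains S" for C
  proof -
    have "\<forall>V\<in>insert (U C) C. \<forall>W\<in>insert (U C) C. V \<subseteq> W \<or> W \<subseteq> V"
    proof (intro ballI)
      fix V W assume "V \<in> insert (U C) C" "W \<in> insert (U C) C"
      then show "V \<subseteq> W \<or> W \<subseteq> V" using comp[OF C, of V] comp[OF C, of W] mem(3)[OF C, of V W] by auto
    qed
    then have "insert (U C) C \<in> subspace_chains S" using U(1)[OF C] mem(1,2)[OF C] by (simp add: subspace_chains_def)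
    moreover have "C - {U C} \<in> subspace_chains S" using C by (auto simp: subspace_chains_def)
    ultimately show ?thesis by (simp add: tog_def)
  qed
  have tog_tog: "tog (tog C) = C" if C: "C \<in> subspace_chains S" for C
  proof (cases "U C \<in> C")
    case True
    then have t: "tog C = C - {U C}" by (simp add: tog_def)
    have "tog (tog C) = insert (U C) (tog C)" unfolding tog_def[of "tog C"] U_tog[OF C] by (simp add: t)
    then show ?thesis using True t by (simp add: insert_absorb)
  next
    case False
    then have t: "tog C = insert (U C) C" by (simp add: tog_def)
    have "tog (tog C) = tog C - {U C}" unfolding tog_def[of "tog C"] U_tog[OF C] by (simp add: t)
    then show ?thesis using False t by simp
  qed
  have sign: "- ((- 1) ^ card (tog C)) = ((- 1) ^ card C :: real)" if C: "C \<in> subspace_chains S" for C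
  proof (cases "U C \<in> C")
    case True
    then have "card C = Suc (card (tog C))" using card_Suc_Diff1[OF mem(2)[OF C] True] by (simp add: tog_def)
    then show ?thesis by simp
  next
    case False
    then have "card (tog C) = Suc (card C)" using mem(2)[OF C] by (simp add: tog_def)
    then show ?thesis by simp
  qed
  have "(\<Sum>C\<in>subspace_chains S. (- 1) ^ card C) = (\<Sum>C\<in>subspace_chains S. - ((- 1) ^ card C :: real))"
    by (rule sum.reindex_bij_witness[of _ tog tog]) (simp_all add: tog_tog tog_mem sign)
  then show ?thesis by (simp add: sum_negf)
qed

lemma alternating_sum_exceeding_chains:
  fixes g :: "'a::number_field adele^'n^'n"
  assumes g: "invertible g" and p: "convex_polygon CARD('n) p"
  shows "(\<Sum>C\<in>subspace_chains (exceeding_subspaces g p). (- 1) ^ card C) = (of_bool (exceeding_subspaces g p = {}) :: real)"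
proof (cases "exceeding_subspaces g p = {}")
  case True
  have "subspace_chains ({} :: ('a^'n) set set) = {{}}" by (auto simp: subspace_chains_def)
  then show ?thesis using True by simp
next
  case False
  let ?S = "exceeding_subspaces g p" and ?e = "excess g p"
  have fin: "finite ?S" by (rule finite_exceeding_subspaces[OF g])
  have "Max (?e ` ?S) \<in> ?e ` ?S" using fin False by (intro Max_in) auto
  then obtain V0 where V0: "V0 \<in> ?S" "Max (?e ` ?S) = ?e V0" by blast
  have V0max: "?e W \<le> ?e V0" if "W \<in> ?S" for W unfolding V0(2)[symmetric] using fin that by (intro Max_ge) auto
  have V0': "vec.subspace V0" "V0 \<noteq> {0}" "V0 \<noteq> UNIV" "?e V0 > 0"
    using V0(1) by (auto simp: exceeding_subspaces_def proper_subspaces_def)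
  have "vec.span (W \<union> V0) \<in> ?S" if W: "W \<in> ?S" for W
  proof -
    have W': "vec.subspace W" "?e W > 0" using W by (auto simp: exceeding_subspaces_def proper_subspaces_def)
    have int: "vec.subspace (W \<inter> V0)" by (rule vec.subspace_inter[OF W'(1) V0'(1)])
    have "?e (W \<inter> V0) \<le> ?e V0"
    proof (cases "W \<inter> V0 \<in> ?S")
      \<comment> \<open>The intersection may drop out of \<open>?S\<close>. Its excess is then at
        most \<open>0\<close>, still below the positive maximum.\<close>
      case False
      have "W \<inter> V0 \<noteq> UNIV" using V0'(3) by blast
      then have "W \<inter> V0 = {0} \<or> ?e (W \<inter> V0) \<le> 0" using False int by (auto simp: exceeding_subspaces_def proper_subspaces_def not_less)
      then have "?e (W \<inter> V0) \<le> 0" by (elim disjE) (simp_all only: excess_trivial(1)[OF p] order_refl)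
      then show ?thesis using V0'(4) by simp
    qed (rule V0max)
    then have pos: "?e (vec.span (W \<union> V0)) > 0"
      using excess_supermodular[OF g p W'(1) V0'(1)] W'(2) by linarith
    \<comment> \<open>Both trivial subspaces have excess \<open>0\<close>, so a positive excess
      alone makes the sum a nonzero proper subspace.\<close>
    have "vec.span (W \<union> V0) \<noteq> {0}" "vec.span (W \<union> V0) \<noteq> UNIV"
      using pos excess_trivial[OF p, of g] by (metis less_irrefl)+
    then show ?thesis using pos by (simp add: exceeding_subspaces_def proper_subspaces_def)
  qed
  moreover have "W \<subseteq> vec.span (W \<union> V0)" "V0 \<subseteq> vec.span (W \<union> V0)" for W
    using vec.span_superset[of "W \<union> V0"] by auto
  moreover have "vec.span (W \<union> V0) \<subseteq> X" if "X \<in> ?S" "W \<subseteq> X" "V0 \<subseteq> X" for W X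
    by (rule vec.span_minimal) (use that in \<open>auto simp: exceeding_subspaces_def proper_subspaces_def\<close>)
  ultimately have "(\<Sum>C\<in>subspace_chains ?S. (- 1) ^ card C) = (0 :: real)"
    by (intro alternating_chain_sum_zero[OF fin V0(1), where J = "\<lambda>W. vec.span (W \<union> V0)"])
  then show ?thesis using False by simp
qed

section \<open>The combinatorial formula\<close>

lemma excess_translate:
  fixes g :: "'a::number_field adele^'n^'n"
  assumes g: "invertible g" and \<delta>: "invertible \<delta>" and V: "vec.subspace V"
  shows "excess (adelic_matrix \<delta> ** g) p V = excess g p ((*v) \<delta> -` V)"
proof -
  obtain \<epsilon> where \<epsilon>: "\<delta> ** \<epsilon> = Finite_Cartesian_Product.mat 1" "\<epsilon> ** \<delta> = Finite_Cartesian_Product.mat 1"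
    using \<delta> unfolding invertible_def by blast
  note tr = arakelov_degree_translate(1)[OF g \<epsilon>]
  have "arakelov_degree (adelic_matrix \<delta> ** g) V = arakelov_degree g ((*v) \<delta> -` V)"
    using tr[OF vimage_invertible(1)[OF \<delta> V]] unfolding vimage_invertible(3)[OF \<delta> V] .
  moreover have "arakelov_degree (adelic_matrix \<delta> ** g) UNIV = arakelov_degree g UNIV"
    using tr[OF vec.subspace_UNIV] unfolding invertible_image_subspace(4)[OF \<delta> vec.subspace_UNIV] .
  ultimately show ?thesis
    using vimage_invertible(2)[OF \<delta> V] by (simp add: excess_def slope_degree_def)
qed

lemma coset_exceeds_iff:
  fixes g :: "'a::number_field adele^'n::{finite,linorder}^'n::{finite,linorder}"
  assumes g: "invertible g" and P: "P \<in> standard_parabolics" and D: "D \<in> rcosets\<^bsub>GL_group\<^esub> P"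
  shows "coset_exceeds g p P D \<longleftrightarrow> coset_steps P D \<in> subspace_chains (exceeding_subspaces g p)"
proof -
  have par: "is_parabolic P" using P by (simp add: standard_parabolics_def)
  note f = parabolic_flag[OF par]
  let ?\<delta> = "coset_rep D"
  let ?g = "adelic_matrix ?\<delta> ** g"
  have \<delta>: "invertible ?\<delta>" using coset_rep_rcosets(1)[of D "flag_of P"] D f(2) by simp
  have ch: "coset_steps P D \<in> subspace_chains proper_subspaces" by (rule coset_steps_chain(1)[OF P D])
  have node: "parabolic_polygon ?g P (real (vec.dim V)) > p (real (vec.dim V)) \<longleftrightarrow> excess g p ((*v) ?\<delta> -` V) > 0"
    if V: "V \<in> inner_steps (flag_of P)" for V
  proof -
    have "V \<in> set (flag_of P)" "vec.subspace V" using V inner_steps_subspace[OF f(1) V] by (simp_all add: inner_steps_def)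
    then show ?thesis
      unfolding excess_translate[OF g \<delta> \<open>vec.subspace V\<close>, symmetric] parabolic_polygon_node[OF par \<open>V \<in> set (flag_of P)\<close>]
      by (simp add: excess_def)
  qed
  have "coset_exceeds g p P D \<longleftrightarrow> polygon_exceeds P (parabolic_polygon ?g P) p"
    unfolding coset_exceeds_def coset_rep_def Let_def ..
  also have "\<dots> \<longleftrightarrow> (\<forall>V\<in>inner_steps (flag_of P). parabolic_polygon ?g P (real (vec.dim V)) > p (real (vec.dim V)))"
    unfolding polygon_exceeds_def parabolic_rank_def inner_steps_nth(1)[OF f(1)] ball_simps ..
  also have "\<dots> \<longleftrightarrow> (\<forall>V\<in>inner_steps (flag_of P). excess g p ((*v) ?\<delta> -` V) > 0)"
    by (rule ball_cong[OF refl node])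
  also have "\<dots> \<longleftrightarrow> (\<forall>W\<in>coset_steps P D. excess g p W > 0)" unfolding coset_steps_def ball_simps ..
  also have "\<dots> \<longleftrightarrow> coset_steps P D \<in> subspace_chains (exceeding_subspaces g p)"
  proof -
    note C' = ch[unfolded subspace_chains_def mem_Collect_eq]
    note C = C'[THEN conjunct1] C'[THEN conjunct2, THEN conjunct1] C'[THEN conjunct2, THEN conjunct2]
    have "(\<forall>W\<in>coset_steps P D. excess g p W > 0) \<longleftrightarrow> coset_steps P D \<subseteq> exceeding_subspaces g p"
      unfolding exceeding_subspaces_def
    proof
      assume "\<forall>W\<in>coset_steps P D. excess g p W > 0"
      then show "coset_steps P D \<subseteq> {V \<in> proper_subspaces. excess g p V > 0}"
        by (intro subsetI CollectI conjI subsetD[OF C(1)]) simp_all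
    next
      assume "coset_steps P D \<subseteq> {V \<in> proper_subspaces. excess g p V > 0}"
      then show "\<forall>W\<in>coset_steps P D. excess g p W > 0" by (intro ballI) (drule subsetD, assumption, simp)
    qed
    also have "\<dots> \<longleftrightarrow> coset_steps P D \<in> subspace_chains (exceeding_subspaces g p)"
      unfolding subspace_chains_def mem_Collect_eq by (rule iffI, intro conjI C(2,3), assumption, erule conjunct1)
    finally show ?thesis .
  qed
  finally show ?thesis .
qed

lemma bij_betw_coset_steps:
  fixes g :: "'a::number_field adele^'n::{finite,linorder}^'n::{finite,linorder}"
  assumes g: "invertible g"
  shows "bij_betw (\<lambda>(P, D). coset_steps P D)
    (SIGMA P:standard_parabolics. {D \<in> rcosets\<^bsub>GL_group\<^esub> P. coset_exceeds g p P D}) (subspace_chains (exceeding_subspaces g p))"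
    (is "bij_betw ?f ?X ?Y")
  unfolding bij_betw_def
proof
  show "inj_on ?f ?X"
  proof (rule inj_onI)
    fix x y assume xy: "x \<in> ?X" "y \<in> ?X" "?f x = ?f y"
    then show "x = y" using coset_steps_inj[of "fst x" "snd x" "fst y" "snd y"] by (auto simp: split_beta)
  qed
  show "?f ` ?X = ?Y"
  proof
    show "?f ` ?X \<subseteq> ?Y" using coset_exceeds_iff[OF g] by auto
    show "?Y \<subseteq> ?f ` ?X"
    proof
      fix C assume C: "C \<in> ?Y"
      moreover have "subspace_chains (exceeding_subspaces g p) \<subseteq> subspace_chains proper_subspaces"
        by (rule subspace_chains_mono) (simp add: exceeding_subspaces_def)
      ultimately have "C \<in> subspace_chains proper_subspaces" by (rule rev_subsetD)
      then obtain P D where PD: "P \<in> standard_parabolics" "D \<in> rcosets\<^bsub>GL_group\<^esub> P" "coset_steps P D = C"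
        using coset_steps_surj by blast
      then have "coset_exceeds g p P D" using coset_exceeds_iff[OF g PD(1,2), of p] C by simp
      then show "C \<in> ?f ` ?X" using PD by (intro image_eqI[of _ _ "(P, D)"]) auto
    qed
  qed
qed

theorem mainTheorem7:
  fixes p :: "real \<Rightarrow> real"
    and g :: "('a::number_field) adele^'n::{finite,linorder}^'n::{finite,linorder}"
  assumes "convex_polygon CARD('n) p"
    and "invertible g"
  shows "(\<forall>P\<in>standard_parabolics.
            finite {D \<in> rcosets\<^bsub>GL_group\<^esub> P. coset_exceeds g p P D})
    \<and> (of_bool (\<forall>t\<in>{0..real CARD('n)}. max_polygon g t \<le> p t) :: real)
      = (\<Sum>P\<in>standard_parabolics.
           (- 1) ^ (parabolic_rank P - 1)
           * (\<Sum>\<^sub>\<infinity>D\<in>rcosets\<^bsub>GL_group\<^esub> P. of_bool (coset_exceeds g p P D)))"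
proof -
  let ?X = "\<lambda>P. {D \<in> rcosets\<^bsub>GL_group\<^esub> P. coset_exceeds g p P D}"
  let ?S = "exceeding_subspaces g p"
  have finS: "finite ?S" by (rule finite_exceeding_subspaces[OF assms(2)])
  have finC: "finite (subspace_chains ?S)"
    by (rule finite_subset[OF _ finite_Pow_iff[THEN iffD2, OF finS]]) (auto simp: subspace_chains_def)
  note bij = bij_betw_coset_steps[OF assms(2), of p]
  \<comment> \<open>The bijection with the finite set of chains also yields the finiteness claim of
    the theorem.\<close>
  have "finite (SIGMA P:standard_parabolics. ?X P)" using bij_betw_finite[OF bij] finC by simp
  then have finX: "finite (?X P)" if P: "P \<in> standard_parabolics" for P
    by (rule finite_subset[OF _ finite_imageI[of _ snd], rotated]) (use P in force)
  have "(\<Sum>P\<in>standard_parabolics. (- 1) ^ (parabolic_rank P - 1)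
           * (\<Sum>\<^sub>\<infinity>D\<in>rcosets\<^bsub>GL_group\<^esub> P. of_bool (coset_exceeds g p P D)))
    = (\<Sum>P\<in>standard_parabolics. \<Sum>D\<in>?X P. (- 1) ^ card (coset_steps P D) :: real)"
  proof (rule sum.cong[OF refl])
    fix P :: "(('a, 'n) Finite_Cartesian_Product.vec, 'n) Finite_Cartesian_Product.vec set"
    assume P: "P \<in> standard_parabolics"
    have "(\<Sum>\<^sub>\<infinity>D\<in>rcosets\<^bsub>GL_group\<^esub> P. of_bool (coset_exceeds g p P D)) = (\<Sum>\<^sub>\<infinity>D\<in>?X P. 1 :: real)"
      by (rule infsum_cong_neutral) auto
    also have "\<dots> = (\<Sum>D\<in>?X P. 1)" by (rule infsum_finite[OF finX[OF P]])
    finally have "(- 1) ^ (parabolic_rank P - 1) * (\<Sum>\<^sub>\<infinity>D\<in>rcosets\<^bsub>GL_group\<^esub> P. of_bool (coset_exceeds g p P D))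
      = (\<Sum>D\<in>?X P. (- 1) ^ (parabolic_rank P - 1) :: real)" by (simp add: mult.commute)
    also have "\<dots> = (\<Sum>D\<in>?X P. (- 1) ^ card (coset_steps P D))"
      using coset_steps_chain(2)[OF P] by (intro sum.cong) auto
    finally show "(- 1) ^ (parabolic_rank P - 1) * (\<Sum>\<^sub>\<infinity>D\<in>rcosets\<^bsub>GL_group\<^esub> P. of_bool (coset_exceeds g p P D))
      = (\<Sum>D\<in>?X P. (- 1) ^ card (coset_steps P D) :: real)" .
  qed
  also have "\<dots> = (\<Sum>(P, D)\<in>(SIGMA P:standard_parabolics. ?X P). (- 1) ^ card (coset_steps P D))"
    by (rule sum.Sigma) (use finite_standard_parabolics finX in auto)
  also have "\<dots> = (\<Sum>C\<in>subspace_chains ?S. (- 1) ^ card C)"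
    using sum.reindex_bij_betw[OF bij, of "\<lambda>C. (- 1) ^ card C :: real"] by (simp add: split_beta)
  also have "\<dots> = of_bool (?S = {})" by (rule alternating_sum_exceeding_chains[OF assms(2,1)])
  also have "\<dots> = of_bool (\<forall>t\<in>{0..real CARD('n)}. max_polygon g t \<le> p t)"
    unfolding max_polygon_le_polygon_iff[OF assms(2,1)] ..
  finally show ?thesis using finX by simp
qed

end
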